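(* Let $4 < p < q \leq 6$. Let $V : \mathbb{R}^3 \to (0,\infty)$ be such that $$\|u\|_V = \left( \int_{\mathbb{R}^3} (|\nabla u|^2 + V u^2)\,dx \right)^{1/2}$$ is a norm equivalent to the standard norm of $H^1(\mathbb{R}^3)$. Let $g \in L^{6/(6-p)}(\mathbb{R}^3)$ be such that $g \geq 0$ and $\Omega := \{x \in \mathbb{R}^3 : g(x) > 0\}$ is a nonempty open subset of $\mathbb{R}^3$. Then for every $m \in \mathbb{N}$ there is $\lambda_m > 0$ such that for all $\lambda \geq \lambda_m$ the equation $$- \Delta u + V(x) u + \left( \frac{1}{4\pi |x|} \ast u^2 \right) u = \lambda g(x) |u|^{p-2} u + |u|^{q-2} u, \qquad u \in H^1(\mathbb{R}^3),$$ has $m$ pairs of solutions $\pm u_1, \dots, \pm u_m$ (distinct pairs) with positive energy, i.e. $\Phi(u_j) > 0$ for $j=1,\dots,m$.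
   Context: Let $X$ be the completion of $C_0^\infty(\mathbb{R}^3)$ with respect to the norm $$\|u\| = \left[ \int_{\mathbb{R}^3} (|\nabla u|^2 + V u^2)\,dx + \left( \iint_{\mathbb{R}^3\times\mathbb{R}^3} \frac{u^2(x)u^2(y)}{|x-y|}\,dx\,dy \right)^{1/2} \right]^{1/2};$$ it embeds continuously into $H^1(\mathbb{R}^3)$. The energy functional $\Phi : X \to \mathbb{R}$ is $$\Phi(u) = \frac12 \int_{\mathbb{R}^3} (|\nabla u|^2 + Vu^2)\,dx + \frac{1}{16\pi} \iint \frac{u^2(x)u^2(y)}{|x-y|}\,dx\,dy - \frac{\lambda}{p} \int_{\mathbb{R}^3} g|u|^p\,dx - \frac1q \int_{\mathbb{R}^3} |u|^q\,dx,$$ which is of class $C^1$ on $X$. A solution of the equation means a (weak) solution $u \in X$, i.e. a critical point of $\Phi$: for all $v \in X$, $$\int (\nabla u\cdot\nabla v + Vuv) + \frac{1}{4\pi}\iint \frac{u^2(x)u(y)v(y)}{|x-y|}\,dx\,dy - \lambda \int g|u|^{p-2}uv - \int |u|^{q-2}uv = 0.$$ The energy of a solution $u$ is $\Phi(u)$. Since $\Phi$ is even, solutions come in pairs $\pm u$. *)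

theory Defs
  imports "HOL-Analysis.Analysis"
begin

type_synonym R3 = "real ^ 3"

text \<open>
  Functions on \<open>R3\<close> are genuine functions, measurable for \<^const>\<open>lebesgue\<close>; elements of the
  function spaces below are representatives, to be identified when they agree almost everywhere.
\<close>

definition Lp :: "real \<Rightarrow> (R3 \<Rightarrow> 'b::euclidean_space) set" where
  "Lp r = {f \<in> borel_measurable lebesgue. integrable lebesgue (\<lambda>x. norm (f x) powr r)}"

definition partial_deriv :: "3 \<Rightarrow> (R3 \<Rightarrow> real) \<Rightarrow> R3 \<Rightarrow> real" where
  "partial_deriv i f x = frechet_derivative f (at x) (axis i 1)"

primrec C_k :: "nat \<Rightarrow> (R3 \<Rightarrow> real) \<Rightarrow> bool" where
  "C_k 0 f \<longleftrightarrow> continuous_on UNIV f"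
| "C_k (Suc k) f \<longleftrightarrow> (\<forall>x. f differentiable (at x)) \<and> (\<forall>i. C_k k (partial_deriv i f))"

definition test_functions :: "(R3 \<Rightarrow> real) set" where
  "test_functions = {\<phi>. (\<forall>k. C_k k \<phi>) \<and> compact (closure {x. \<phi> x \<noteq> 0})}"

definition locally_integrable :: "(R3 \<Rightarrow> 'b::euclidean_space) \<Rightarrow> bool" where
  "locally_integrable f \<longleftrightarrow> (\<forall>K. compact K \<longrightarrow> set_integrable lebesgue K f)"

definition has_weak_gradient :: "(R3 \<Rightarrow> real) \<Rightarrow> (R3 \<Rightarrow> R3) \<Rightarrow> bool" where
  "has_weak_gradient u G \<longleftrightarrow>
     locally_integrable u \<and> locally_integrable G \<and>
     (\<forall>\<phi>\<in>test_functions. \<forall>i.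
        (LINT x|lebesgue. u x * partial_deriv i \<phi> x) = - (LINT x|lebesgue. G x $ i * \<phi> x))"

text \<open>A weak gradient is unique only up to null sets; \<open>weak_grad\<close> picks a representative.\<close>

definition weak_grad :: "(R3 \<Rightarrow> real) \<Rightarrow> R3 \<Rightarrow> R3" where
  "weak_grad u = (SOME G. has_weak_gradient u G)"

definition H1 :: "(R3 \<Rightarrow> real) set" where
  "H1 = {u \<in> Lp 2. \<exists>G \<in> Lp 2. has_weak_gradient u G}"

definition H1_norm :: "(R3 \<Rightarrow> real) \<Rightarrow> real" where
  "H1_norm u = sqrt (LINT x|lebesgue. (norm (weak_grad u x))\<^sup>2 + (u x)\<^sup>2)"

definition V_norm :: "(R3 \<Rightarrow> real) \<Rightarrow> (R3 \<Rightarrow> real) \<Rightarrow> real" where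
  "V_norm V u = sqrt (LINT x|lebesgue. (norm (weak_grad u x))\<^sup>2 + V x * (u x)\<^sup>2)"

text \<open>Integrability of \<open>V u\<^sup>2\<close> expresses that \<open>V_norm V u\<close> is finite; the Bochner integral of a
  non-integrable function would be \<open>0\<close>.\<close>

definition V_norm_equivalent :: "(R3 \<Rightarrow> real) \<Rightarrow> bool" where
  "V_norm_equivalent V \<longleftrightarrow>
     (\<forall>u\<in>H1. integrable lebesgue (\<lambda>x. V x * (u x)\<^sup>2)) \<and>
     (\<exists>c>0. \<exists>C>0. \<forall>u\<in>H1. c * H1_norm u \<le> V_norm V u \<and> V_norm V u \<le> C * H1_norm u)"

text \<open>On the diagonal, a null set, division by zero gives the integrand the value \<open>0\<close>.\<close>

definition coulomb :: "(R3 \<Rightarrow> real) \<Rightarrow> real" where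
  "coulomb u = (LINT (x, y)|(lebesgue \<Otimes>\<^sub>M lebesgue). (u x)\<^sup>2 * (u y)\<^sup>2 / norm (x - y))"

definition X_norm :: "(R3 \<Rightarrow> real) \<Rightarrow> (R3 \<Rightarrow> real) \<Rightarrow> real" where
  "X_norm V u =
     sqrt ((LINT x|lebesgue. (norm (weak_grad u x))\<^sup>2 + V x * (u x)\<^sup>2) + sqrt (coulomb u))"

text \<open>
  The completion of the test functions for \<open>X_norm V\<close>, realised inside \<open>H1\<close> through its continuous
  embedding: the class of a Cauchy sequence is represented by the limit of the sequence in \<open>H1\<close>.
\<close>

definition X_space :: "(R3 \<Rightarrow> real) \<Rightarrow> (R3 \<Rightarrow> real) set" where
  "X_space V = {u \<in> H1. \<exists>\<phi>. (\<forall>n::nat. \<phi> n \<in> test_functions) \<and>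
     (\<forall>e>0. \<exists>N. \<forall>m\<ge>N. \<forall>n\<ge>N. X_norm V (\<lambda>x. \<phi> m x - \<phi> n x) < e) \<and>
     (\<lambda>n. H1_norm (\<lambda>x. \<phi> n x - u x)) \<longlonglongrightarrow> 0}"

definition energy ::
  "(R3 \<Rightarrow> real) \<Rightarrow> (R3 \<Rightarrow> real) \<Rightarrow> real \<Rightarrow> real \<Rightarrow> real \<Rightarrow> (R3 \<Rightarrow> real) \<Rightarrow> real" where
  "energy V g p q lam u =
     1/2 * (LINT x|lebesgue. (norm (weak_grad u x))\<^sup>2 + V x * (u x)\<^sup>2)
     + 1 / (16 * pi) * coulomb u
     - lam / p * (LINT x|lebesgue. g x * \<bar>u x\<bar> powr p)
     - 1 / q * (LINT x|lebesgue. \<bar>u x\<bar> powr q)"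

text \<open>
  A weak solution of
  \<open>- \<Delta>u + V u + (1/(4\<pi>|x|) * u\<^sup>2) u = \<lambda> g |u|\<^sup>p\<^sup>-\<^sup>2 u + |u|\<^sup>q\<^sup>-\<^sup>2 u\<close>, i.e. a critical point of \<open>energy\<close>
  on \<open>X_space V\<close>. When \<open>V_norm_equivalent V\<close>, \<open>4 < p < q \<le> 6\<close> and \<open>g \<in> Lp (6 / (6 - p))\<close>, all
  integrals here and in \<open>energy\<close> converge absolutely for \<open>u\<close>, \<open>v\<close> in \<open>X_space V\<close>.
\<close>

definition weak_solution ::
  "(R3 \<Rightarrow> real) \<Rightarrow> (R3 \<Rightarrow> real) \<Rightarrow> real \<Rightarrow> real \<Rightarrow> real \<Rightarrow> (R3 \<Rightarrow> real) \<Rightarrow> bool" where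
  "weak_solution V g p q lam u \<longleftrightarrow> u \<in> X_space V \<and>
     (\<forall>v\<in>X_space V.
        (LINT x|lebesgue. weak_grad u x \<bullet> weak_grad v x + V x * u x * v x)
        + 1 / (4 * pi) *
            (LINT (x, y)|(lebesgue \<Otimes>\<^sub>M lebesgue). (u x)\<^sup>2 * u y * v y / norm (x - y))
        - lam * (LINT x|lebesgue. g x * \<bar>u x\<bar> powr (p - 2) * u x * v x)
        - (LINT x|lebesgue. \<bar>u x\<bar> powr (q - 2) * u x * v x) = 0)"

end

theory Submission
  imports Defs "HOL-Library.Z2"
begin

text \<open>
  Along every ray the energy has a single critical point, its maximum, so the energy of the point
  of the Nehari manifold on that ray is an even function on the sphere of directions. A mod 2 cup
  product argument on octahedral spheres replaces the genus: if the sphere spanned by \<open>k + 1\<close>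
  directions lies in a sublevel set, a descent along the gradient yields more than \<open>k\<close> critical
  points there. Bumps with disjoint supports in \<open>\<Omega> = {g > 0}\<close> span such spheres at an arbitrarily
  small level, provided that \<open>\<lambda>\<close> is large. At small energy the Nehari manifold lies in a small ball of
  \<open>H\<^sup>1\<close> whose radius does not depend on \<open>\<lambda>\<close>; there the gradient is a strongly monotone map minus
  \<open>\<lambda>\<close> times the compact map induced by \<open>g\<close>, and this gives the Palais--Smale condition even
  for \<open>q = 6\<close>.
\<close>

section \<open>A Lusternik--Schnirelmann covering theorem\<close>

text \<open>The Coulomb integral is at most a constant times the fourth power of the
  \<open>H1\<close> norm, so completing the test functions for \<open>X_norm\<close> gives the same
  space as completing them for \<open>H1_norm\<close>, and everything takes place in the one Hilbert
  space \<open>h1\<close>. That term is quartic, and this is where p, q > 4 enters: the derivative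
  along a ray, divided by t^3, is strictly decreasing. The Nehari manifold is never treated as a
  differentiable manifold; the projection onto it is only continuous and odd, and the descent uses a
  Lipschitz gradient together with a one-sided quadratic bound. In that bound the power terms cost
  nothing, because they are convex and enter with a minus sign. The delicate point is the order of
  the choices. The radius comes from the quadratic form, the Coulomb term and the q-power, it fixes
  the energy level, and only then is \<lambda> raised until the sphere of bumps lies below that
  level; the weighted term may thus be large without harm, since it is compact. The covering
  argument counts critical points, not pairs, so 2m + 1 bumps are used for m pairs.\<close>

declare add_bit_eq_xor [simp del] mult_bit_eq_and [simp del]

section \<open>Mod 2 simplicial chains and cup products\<close>

lemma bit_add_self [simp]: "(a::bit) + a = 0"
  by (cases a) simp_all

lemma bit_add_self_left [simp]: "(a::bit) + (a + b) = b"
  by (simp flip: add.assoc)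

text \<open>A simplex is its list of vertices and a chain is a list of simplices whose
  multiplicities count mod 2, so faces carry no sign. A single vertex has the empty list as its
  face, which makes this the augmented boundary.\<close>

primrec faces :: "'a list \<Rightarrow> 'a list list" where
  "faces [] = []"
| "faces (a # vs) = vs # map ((#) a) (faces vs)"

lemma faces_map: "faces (map f vs) = map (map f) (faces vs)"
  by (induction vs) auto

text \<open>The Alexander--Whitney product of the coboundaries of the 0-cochains \<open>es\<close>,
  evaluated on an ordered simplex: the i-th factor is the difference of the i-th cochain along the
  i-th edge.\<close>

fun cup :: "('a \<Rightarrow> bit) list \<Rightarrow> 'a list \<Rightarrow> bit" where
  "cup [] vs = 1"
| "cup (e # es) (a # b # vs) = (e a + e b) * cup es (b # vs)"
| "cup (e # es) vs = 0"

text \<open>A product of coboundaries is a cocycle: its sum over all faces of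
  \<open>a # b # us\<close> vanishes, and mod 2 the value on the face omitting \<open>a\<close>
  equals the sum over the other faces.\<close>

lemma sum_faces_cup:
  "length us = length es \<Longrightarrow> (\<Sum>s\<leftarrow>faces (b # us). cup es (a # s)) = cup es (b # us)"
proof (induction es arbitrary: us a b)
  case Nil
  then show ?case by simp
next
  case (Cons f fs)
  then obtain c ts where us: "us = c # ts" "length ts = length fs"
    by (cases us) auto
  have "(\<Sum>s\<leftarrow>faces (b # us). cup (f # fs) (a # s))
      = (f a + f c) * cup fs (c # ts) + (f a + f b) * (\<Sum>s\<leftarrow>faces (c # ts). cup fs (b # s))"
    by (simp add: us comp_def distrib_left flip: sum_list_const_mult)
  also have "\<dots> = cup (f # fs) (b # us)"
    using Cons.IH [OF us(2), of b c]
    by (cases "f a"; cases "f b"; cases "f c") (auto simp: us simp del: faces.simps)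
  finally show ?case .
qed

text \<open>The cochain \<open>cup (e # es)\<close> is the coboundary of \<open>e \<union> cup es\<close>.\<close>

lemma sum_faces_coboundary:
  assumes "length vs = length es + 2"
  shows "(\<Sum>s\<leftarrow>faces vs. e (hd s) * cup es s) = cup (e # es) vs"
proof -
  obtain a b us where vs: "vs = a # b # us" "length us = length es"
    using assms by (cases vs; cases "tl vs") auto
  have "(\<Sum>s\<leftarrow>faces vs. e (hd s) * cup es s)
      = e b * cup es (b # us) + e a * (\<Sum>s\<leftarrow>faces (b # us). cup es (a # s))"
    by (simp add: vs comp_def distrib_left flip: sum_list_const_mult)
  then show ?thesis
    unfolding sum_faces_cup [OF vs(2)] by (simp add: vs distrib_right add.commute)
qed

text \<open>The usual triangulation of simplex times interval, with \<open>h\<close> at the bottom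
  and \<open>h'\<close> at the top: each simplex runs along the bottom up to some vertex and
  continues along the top from that same vertex.\<close>

primrec prism :: "('a \<Rightarrow> 'b) \<Rightarrow> ('a \<Rightarrow> 'b) \<Rightarrow> 'a list \<Rightarrow> 'b list list" where
  "prism h h' [] = []"
| "prism h h' (a # vs) = (h a # h' a # map h' vs) # map ((#) (h a)) (prism h h' vs)"

text \<open>The chain homotopy formula: boundary of the prism plus prism of the boundary equals top
  plus bottom. Chains are compared by testing them with an arbitrary mod 2 cochain
  \<open>R\<close>.\<close>

lemma sum_faces_prism:
  fixes R :: "'b list \<Rightarrow> bit"
  shows "(\<Sum>t\<leftarrow>prism h h' vs. \<Sum>s\<leftarrow>faces t. R s) + (\<Sum>s\<leftarrow>faces vs. \<Sum>t\<leftarrow>prism h h' s. R t)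
    = R (map h' vs) + R (map h vs)"
proof (induction vs arbitrary: R)
  case Nil
  then show ?case by simp
next
  case (Cons a vs)
  show ?case
    using Cons [of "\<lambda>s. R (h a # s)"]
    by (simp add: comp_def faces_map sum_list_addf algebra_simps)
qed

lemma prism_props:
  assumes "t \<in> set (prism h h' vs)"
  shows "length t = Suc (length vs)" "set t \<subseteq> h ` set vs \<union> h' ` set vs"
  using assms by (induction vs arbitrary: t) (auto, blast)

section \<open>Octahedral spheres, as linear images of l1 unit spheres\<close>

definition octa :: "(nat \<Rightarrow> 'a::real_vector) \<Rightarrow> nat \<Rightarrow> 'a set" where
  "octa \<phi> j = {\<Sum>i\<le>j. s i *\<^sub>R \<phi> i | s. (\<Sum>i\<le>j. \<bar>s i\<bar>) = 1}"

lemma octa_uminus: "x \<in> octa \<phi> j \<Longrightarrow> - x \<in> octa \<phi> j"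
proof -
  assume "x \<in> octa \<phi> j"
  then obtain s where "x = (\<Sum>i\<le>j. s i *\<^sub>R \<phi> i)" "(\<Sum>i\<le>j. \<bar>s i\<bar>) = 1"
    by (auto simp: octa_def)
  then have "- x = (\<Sum>i\<le>j. (- s i) *\<^sub>R \<phi> i) \<and> (\<Sum>i\<le>j. \<bar>- s i\<bar>) = 1"
    by (simp add: sum_negf)
  then show ?thesis unfolding octa_def
    by (auto intro!: exI [of _ "\<lambda>i. - s i"])
qed

lemma octa_0: "octa \<phi> 0 = {\<phi> 0, - \<phi> 0}"
proof -
  have "\<phi> 0 \<in> octa \<phi> 0"
    unfolding octa_def by (auto intro!: exI [of _ "\<lambda>_. 1"])
  moreover have "octa \<phi> 0 \<subseteq> {\<phi> 0, - \<phi> 0}"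
    by (auto simp: octa_def abs_if split: if_splits)
  ultimately show ?thesis using octa_uminus [of "\<phi> 0" \<phi> 0] by auto
qed

lemma octa_join:
  assumes "x \<in> octa \<phi> j" "0 \<le> t" "t \<le> 1"
  shows "(1 - t) *\<^sub>R x + t *\<^sub>R \<phi> (Suc j) \<in> octa \<phi> (Suc j)"
proof -
  obtain s where s: "x = (\<Sum>i\<le>j. s i *\<^sub>R \<phi> i)" "(\<Sum>i\<le>j. \<bar>s i\<bar>) = 1"
    using assms by (auto simp: octa_def)
  define s' where "s' i = (if i \<le> j then (1 - t) * s i else t)" for i
  have "(\<Sum>i\<le>Suc j. s' i *\<^sub>R \<phi> i) = (1 - t) *\<^sub>R x + t *\<^sub>R \<phi> (Suc j)"
    by (simp add: s'_def s scaleR_sum_right)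
  moreover have "(\<Sum>i\<le>Suc j. \<bar>s' i\<bar>) = 1"
    using assms s(2) by (simp add: s'_def abs_mult flip: sum_distrib_left)
  ultimately show ?thesis unfolding octa_def by (auto intro!: exI [of _ s'])
qed

lemma octa_norm:
  fixes \<phi> :: "nat \<Rightarrow> 'a::real_normed_vector"
  assumes "x \<in> octa \<phi> j"
  shows "norm x \<le> (\<Sum>i\<le>j. norm (\<phi> i))"
proof -
  obtain s where s: "x = (\<Sum>i\<le>j. s i *\<^sub>R \<phi> i)" "(\<Sum>i\<le>j. \<bar>s i\<bar>) = 1"
    using assms by (auto simp: octa_def)
  have "\<bar>s i\<bar> \<le> 1" if "i \<le> j" for i
    using member_le_sum [of i "{..j}" "\<lambda>i. \<bar>s i\<bar>"] s(2) that by auto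
  then have "norm x \<le> (\<Sum>i\<le>j. 1 * norm (\<phi> i))"
    unfolding s(1) by (intro order.trans [OF norm_sum] sum_mono) (simp add: mult_left_le_one_le)
  then show ?thesis by simp
qed

text \<open>Each sphere is the suspension of the previous one: with t the last coefficient, it is
  the image of [-1, 1] times the smaller sphere under (t, x) \<mapsto> (1 - |t|) x + t \<phi>(j +
  1), so compactness passes on by induction.\<close>

lemma compact_octa:
  fixes \<phi> :: "nat \<Rightarrow> 'a::real_normed_vector"
  shows "compact (octa \<phi> j)"
proof (induction j)
  case 0
  then show ?case by (simp add: octa_0)
next
  case (Suc j)
  define J where "J = (\<lambda>(t, x). (1 - \<bar>t\<bar>) *\<^sub>R x + t *\<^sub>R \<phi> (Suc j)) ` ({-1..1::real} \<times> octa \<phi> j)"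
  have "compact J"
    unfolding J_def split_def
    by (intro compact_continuous_image compact_Times Suc continuous_intros) auto
  moreover have "octa \<phi> (Suc j) = J"
  proof (intro equalityI subsetI)
    fix y assume "y \<in> octa \<phi> (Suc j)"
    then obtain s where s: "y = (\<Sum>i\<le>Suc j. s i *\<^sub>R \<phi> i)" "(\<Sum>i\<le>Suc j. \<bar>s i\<bar>) = 1"
      by (auto simp: octa_def)
    define t where "t = s (Suc j)"
    have t1: "(\<Sum>i\<le>j. \<bar>s i\<bar>) = 1 - \<bar>t\<bar>" using s(2) by (simp add: t_def)
    have t: "\<bar>t\<bar> \<le> 1" using sum_nonneg [of "{..j}" "\<lambda>i. \<bar>s i\<bar>"] t1 by auto
    show "y \<in> J"
    \<comment> \<open>At the poles the point of the smaller sphere cannot be recovered by dividing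
      by 1 - |t|; any point of it serves.\<close>
    proof (cases "\<bar>t\<bar> = 1")
      case True
      then have "\<forall>i\<le>j. s i = 0"
        using t1 by (simp add: sum_nonneg_eq_0_iff)
      then have y: "y = t *\<^sub>R \<phi> (Suc j)" by (simp add: s t_def)
      have "octa \<phi> j \<noteq> {}"
        unfolding octa_def by (auto intro!: exI [of _ "\<lambda>i. if i = 0 then 1 else 0"] simp: if_distrib cong: if_cong)
      then obtain x where "x \<in> octa \<phi> j" by auto
      then show ?thesis unfolding J_def
        using True t by (intro image_eqI [of _ _ "(t, x)"]) (auto simp: y)
    next
      case False
      define x where "x = (\<Sum>i\<le>j. (s i / (1 - \<bar>t\<bar>)) *\<^sub>R \<phi> i)"
      have pos: "1 - \<bar>t\<bar> > 0" using False t by auto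
      have "(\<Sum>i\<le>j. \<bar>s i / (1 - \<bar>t\<bar>)\<bar>) = 1"
        using t1 pos by (simp add: flip: sum_divide_distrib)
      then have "x \<in> octa \<phi> j" unfolding octa_def x_def by (auto intro!: exI [of _ "\<lambda>i. s i / (1 - \<bar>t\<bar>)"])
      moreover have "y = (1 - \<bar>t\<bar>) *\<^sub>R x + t *\<^sub>R \<phi> (Suc j)"
        using pos by (simp add: s x_def t_def scaleR_sum_right)
      ultimately show ?thesis unfolding J_def
        using t by (intro image_eqI [of _ _ "(t, x)"]) auto
    qed
  next
    fix y assume "y \<in> J"
    then obtain t x where tx: "\<bar>t\<bar> \<le> 1" "x \<in> octa \<phi> j"
      and y: "y = (1 - \<bar>t\<bar>) *\<^sub>R x + t *\<^sub>R \<phi> (Suc j)"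
      unfolding J_def by force
    show "y \<in> octa \<phi> (Suc j)"
    proof (cases "t \<ge> 0")
      case True
      then show ?thesis using octa_join [of x \<phi> j t] tx y by auto
    next
      case False
      have "- ((1 - (- t)) *\<^sub>R (- x) + (- t) *\<^sub>R \<phi> (Suc j)) \<in> octa \<phi> (Suc j)"
        using False tx by (intro octa_uminus octa_join) auto
      then show ?thesis using False y by (simp add: add.commute)
    qed
  qed
  ultimately show ?case by simp
qed

text \<open>Modulo 2 the chain \<open>C\<close> is a fine triangulation of a hemisphere of the octahedral
  \<open>j\<close>-sphere; the next hemisphere is obtained by contracting the sphere
  \<open>C \<union> - C\<close> along straight lines to the new vertex \<open>\<phi> (j + 1)\<close>.\<close>

lemma fine_hemisphere:
  fixes \<phi> :: "nat \<Rightarrow> 'a::real_normed_vector"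
  assumes "\<delta> > 0"
  shows "\<exists>C. (\<forall>t\<in>set C. length t = Suc j \<and> set t \<subseteq> octa \<phi> j \<and> (\<forall>x\<in>set t. \<forall>y\<in>set t. dist x y < \<delta>)) \<and>
    (\<forall>R::'a list \<Rightarrow> bit. (\<Sum>t\<leftarrow>C @ map (map uminus) C. \<Sum>s\<leftarrow>faces t. R s) = 0) \<and>
    (\<forall>es. length es = j \<longrightarrow> (\<forall>e\<in>set es. \<forall>x\<in>octa \<phi> j. e (- x) = e x + 1) \<longrightarrow> (\<Sum>t\<leftarrow>C. cup es t) = 1)"
  using assms
proof (induction j arbitrary: \<delta>)
  case 0
  \<comment> \<open>One of the two points of the 0-sphere. The augmented boundary of either point is
    the empty simplex, so the two cancel mod 2.\<close>
  then show ?case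
    by (intro exI [of _ "[[\<phi> 0]]"]) (auto simp: octa_0)
next
  case (Suc j)
  obtain C where C: "\<And>t. t \<in> set C \<Longrightarrow> length t = Suc j \<and> set t \<subseteq> octa \<phi> j \<and> (\<forall>x\<in>set t. \<forall>y\<in>set t. dist x y < \<delta> / 2)"
    and cyc: "\<And>R::'a list \<Rightarrow> bit. (\<Sum>t\<leftarrow>C @ map (map uminus) C. \<Sum>s\<leftarrow>faces t. R s) = 0"
    and one: "\<And>es. length es = j \<Longrightarrow> (\<forall>e\<in>set es. \<forall>x\<in>octa \<phi> j. e (- x) = e x + 1) \<Longrightarrow> (\<Sum>t\<leftarrow>C. cup es t) = 1"
    using Suc.IH [OF half_gt_zero [OF Suc.prems]] by blast
  \<comment> \<open>The whole octahedral j-sphere, a mod 2 cycle by \<open>cyc\<close>.\<close>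
  define Z where "Z = C @ map (map uminus) C"
  have Z: "length t = Suc j" "set t \<subseteq> octa \<phi> j" "\<And>x y. x \<in> set t \<Longrightarrow> y \<in> set t \<Longrightarrow> dist x y < \<delta> / 2"
    if "t \<in> set Z" for t
  proof -
    from that consider "t \<in> set C" | s where "s \<in> set C" "t = map uminus s"
      by (auto simp: Z_def)
    then have "length t = Suc j \<and> set t \<subseteq> octa \<phi> j \<and> (\<forall>x\<in>set t. \<forall>y\<in>set t. dist x y < \<delta> / 2)"
    proof cases
      case 1
      then show ?thesis by (rule C)
    next
      case 2
      have "dist (- x) (- y) < \<delta> / 2" if "x \<in> set s" "y \<in> set s" for x y
        using C [OF 2(1)] that unfolding dist_minus by blast
      moreover have "length s = Suc j" "set s \<subseteq> octa \<phi> j"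
        using C [OF 2(1)] by auto
      ultimately show ?thesis
        by (auto simp: 2(2) intro!: octa_uminus)
    qed
    then show "length t = Suc j" "set t \<subseteq> octa \<phi> j" "\<And>x y. x \<in> set t \<Longrightarrow> y \<in> set t \<Longrightarrow> dist x y < \<delta> / 2"
      by blast+
  qed
  define B where "B = (\<Sum>i\<le>j. norm (\<phi> i)) + norm (\<phi> (Suc j))"
  have B: "norm (x - \<phi> (Suc j)) \<le> B" if "x \<in> octa \<phi> j" for x
    using octa_norm [OF that] norm_triangle_ineq4 [of x "\<phi> (Suc j)"] by (simp add: B_def)
  \<comment> \<open>The contraction to the new vertex is cut into M stages, each moving a point by
    at most \<open>B / M\<close>; the other half of \<delta> is used up by the diameter of the
    simplices of \<open>Z\<close>.\<close>
  obtain M :: nat where M: "M > 0" "B / M < \<delta> / 2"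
  proof -
    obtain M :: nat where M: "real M > max 1 (B / (\<delta> / 2))"
      using reals_Archimedean2 by blast
    then have "M > 0" by (simp add: max_def split: if_splits)
    moreover from M have "B / M < \<delta> / 2"
      using Suc.prems by (simp add: divide_simps mult.commute)
    ultimately show ?thesis using that by blast
  qed
  define h where "h i v = (1 - real i / M) *\<^sub>R v + (real i / M) *\<^sub>R \<phi> (Suc j)" for i v
  have h0: "h 0 = id" and hM: "h M = (\<lambda>_. \<phi> (Suc j))"
    using M by (auto simp: h_def)
  have h_octa: "h i v \<in> octa \<phi> (Suc j)" if "v \<in> octa \<phi> j" "i \<le> M" for i v
    unfolding h_def using that M by (intro octa_join) auto
  have h_dist: "dist (h i x) (h i' y) < \<delta>"
    if "x \<in> octa \<phi> j" "y \<in> octa \<phi> j" "dist x y < \<delta> / 2" "i \<le> M" "i' \<le> i + 1" "i \<le> i' + 1" for i i' x y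
  proof -
    have "h i x - h i' y = (1 - real i / M) *\<^sub>R (x - y) + (real i' / M - real i / M) *\<^sub>R (y - \<phi> (Suc j))"
      by (simp add: h_def algebra_simps)
    then have "norm (h i x - h i' y) \<le> \<bar>1 - real i / M\<bar> * norm (x - y) + \<bar>real i' / M - real i / M\<bar> * norm (y - \<phi> (Suc j))"
      by (metis norm_scaleR norm_triangle_ineq)
    also have "\<bar>1 - real i / M\<bar> * norm (x - y) \<le> 1 * norm (x - y)"
      using that M by (intro mult_right_mono) auto
    also have "\<bar>real i' / M - real i / M\<bar> * norm (y - \<phi> (Suc j)) \<le> (1 / M) * B"
    proof (intro mult_mono B that)
      have "\<bar>real i' - real i\<bar> \<le> 1" using that by linarith
      then show "\<bar>real i' / real M - real i / real M\<bar> \<le> 1 / real M"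
        using M by (simp add: divide_right_mono flip: diff_divide_distrib)
    qed auto
    finally have "norm (h i x - h i' y) \<le> norm (x - y) + 1 / M * B" by simp
    moreover have "1 / M * B < \<delta> / 2" using M(2) by simp
    ultimately show ?thesis using that(3) unfolding dist_norm by linarith
  qed
  \<comment> \<open>The i-th layer of the cone, between two successive copies of the sphere.\<close>
  define D where "D i = concat (map (prism (h i) (h (Suc i))) Z)" for i
  define C' where "C' = concat (map D [0..<M])"
  have C'_mem: "length t = Suc (Suc j) \<and> set t \<subseteq> octa \<phi> (Suc j) \<and> (\<forall>x\<in>set t. \<forall>y\<in>set t. dist x y < \<delta>)"
    if t: "t \<in> set C'" for t
  proof -
    obtain i z where iz: "i < M" "z \<in> set Z" "t \<in> set (prism (h i) (h (Suc i)) z)"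
      using t by (auto simp: C'_def D_def)
    have *: "\<exists>x'\<in>set z. \<exists>i'\<in>{i, Suc i}. x = h i' x'" if "x \<in> set t" for x
      using prism_props(2) [OF iz(3)] that by auto
    have "x \<in> octa \<phi> (Suc j)" if "x \<in> set t" for x
      using * [OF that] h_octa Z(2) [OF iz(2)] iz(1) by auto
    moreover have "dist x y < \<delta>" if xy: "x \<in> set t" "y \<in> set t" for x y
    proof -
      obtain x' i1 where x: "x' \<in> set z" "i1 \<in> {i, Suc i}" "x = h i1 x'"
        using * [OF xy(1)] by blast
      obtain y' i2 where y: "y' \<in> set z" "i2 \<in> {i, Suc i}" "y = h i2 y'"
        using * [OF xy(2)] by blast
      show ?thesis unfolding x(3) y(3)
        by (rule h_dist) (use x y Z [OF iz(2)] iz(1) in auto)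
    qed
    ultimately show ?thesis using prism_props(1) [OF iz(3)] Z(1) [OF iz(2)] by auto
  qed
  \<comment> \<open>The boundary of the cone is the old sphere. The layers telescope by the prism
    formula, whose term with the boundary of \<open>Z\<close> vanishes. The last copy sits at the
    new vertex, where \<open>C\<close> and its antipode give the same simplices and cancel.\<close>
  have bd: "(\<Sum>t\<leftarrow>C'. \<Sum>s\<leftarrow>faces t. R s) = (\<Sum>t\<leftarrow>Z. R t)" for R :: "'a list \<Rightarrow> bit"
  proof -
    have D: "(\<Sum>t\<leftarrow>D i. \<Sum>s\<leftarrow>faces t. R s) = (\<Sum>t\<leftarrow>Z. R (map (h (Suc i)) t)) + (\<Sum>t\<leftarrow>Z. R (map (h i) t))" for i
    proof -
      have "(\<Sum>t\<leftarrow>D i. \<Sum>s\<leftarrow>faces t. R s)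
          = (\<Sum>z\<leftarrow>Z. \<Sum>t\<leftarrow>prism (h i) (h (Suc i)) z. \<Sum>s\<leftarrow>faces t. R s)"
        unfolding D_def by (induction Z) auto
      also have "\<dots> = (\<Sum>z\<leftarrow>Z. \<Sum>t\<leftarrow>prism (h i) (h (Suc i)) z. \<Sum>s\<leftarrow>faces t. R s)
          + (\<Sum>z\<leftarrow>Z. \<Sum>s\<leftarrow>faces z. \<Sum>t\<leftarrow>prism (h i) (h (Suc i)) s. R t)"
        using cyc [of "\<lambda>s. \<Sum>t\<leftarrow>prism (h i) (h (Suc i)) s. R t"] by (simp add: Z_def)
      also have "\<dots> = (\<Sum>z\<leftarrow>Z. R (map (h (Suc i)) z) + R (map (h i) z))"
        by (simp add: sum_faces_prism flip: sum_list_addf)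
      finally show ?thesis by (simp add: sum_list_addf)
    qed
    have "(\<Sum>t\<leftarrow>concat (map D [0..<n]). \<Sum>s\<leftarrow>faces t. R s) = (\<Sum>t\<leftarrow>Z. R (map (h n) t)) + (\<Sum>t\<leftarrow>Z. R t)" for n
    proof (induction n)
      case 0
      then show ?case by (simp add: h0)
    next
      case (Suc n)
      then show ?case by (simp add: D algebra_simps)
    qed
    moreover have "(\<Sum>t\<leftarrow>Z. R (map (h M) t)) = 0"
    proof -
      have "map (h M) t = replicate (Suc j) (\<phi> (Suc j))" if "t \<in> set Z" for t
        using Z(1) [OF that] by (simp add: hM map_replicate_const)
      then have "(\<Sum>t\<leftarrow>Z. R (map (h M) t)) = (\<Sum>t\<leftarrow>Z. R (replicate (Suc j) (\<phi> (Suc j))))"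
        by (metis (mono_tags, lifting) map_cong)
      then show ?thesis by (simp add: Z_def comp_def)
    qed
    ultimately show ?thesis unfolding C'_def by simp
  qed
  show ?case
  proof (intro exI [of _ C'] conjI ballI allI impI)
    show "length t = Suc (Suc j)" "set t \<subseteq> octa \<phi> (Suc j)" if "t \<in> set C'" for t
      using C'_mem [OF that] by auto
    show "dist x y < \<delta>" if "t \<in> set C'" "x \<in> set t" "y \<in> set t" for t x y
      using C'_mem [OF that(1)] that by auto
  next
    fix R :: "'a list \<Rightarrow> bit"
    have "(\<Sum>t\<leftarrow>map (map uminus) C'. \<Sum>s\<leftarrow>faces t. R s) = (\<Sum>t\<leftarrow>Z. R (map uminus t))"
      using bd [of "\<lambda>s. R (map uminus s)"] by (simp add: comp_def faces_map)
    also have "\<dots> = (\<Sum>t\<leftarrow>Z. R t)"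
      by (simp add: Z_def comp_def add.commute)
    finally show "(\<Sum>t\<leftarrow>C' @ map (map uminus) C'. \<Sum>s\<leftarrow>faces t. R s) = 0"
      using bd [of R] by simp
  next
    fix es :: "('a \<Rightarrow> bit) list"
    assume len: "length es = Suc j" and odd: "\<forall>e\<in>set es. \<forall>x\<in>octa \<phi> (Suc j). e (- x) = e x + 1"
    have mono: "octa \<phi> j \<subseteq> octa \<phi> (Suc j)"
      using octa_join [of _ \<phi> j 0] by auto
    obtain e fs where es: "es = e # fs" "length fs = j" using len by (cases es) auto
    have e: "e (- x) = e x + 1" if "x \<in> octa \<phi> j" for x
      using odd es mono that by auto
    have fs: "f (- x) = f x + 1" if "f \<in> set fs" "x \<in> octa \<phi> j" for f x
      using odd es mono that by auto
    \<comment> \<open>Adding 1 at both ends of an edge does not change a coboundary, so the product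
      is invariant under the antipodal map although the cochains are odd.\<close>
    have sym: "cup gs (map uminus s) = cup gs s"
      if "set s \<subseteq> octa \<phi> j" "set gs \<subseteq> set fs" for gs s
      using that
    proof (induction gs s rule: cup.induct)
      case (2 g gs a b vs)
      then have "g (- a) + g (- b) = g a + g b"
        using fs [of g] by (simp add: algebra_simps)
      with 2 show ?case by simp
    qed auto
    \<comment> \<open>Stokes: \<open>cup es\<close> is the coboundary of \<open>e\<close> times
      \<open>cup fs\<close>, so its sum over \<open>C'\<close> becomes a sum over the boundary
      \<open>Z\<close>. A simplex and its antipode contribute e and e + 1 times the same factor,
      which leaves the sum of \<open>cup fs\<close> over \<open>C\<close>, one dimension
      lower.\<close>
    have "(\<Sum>t\<leftarrow>C'. cup es t) = (\<Sum>t\<leftarrow>C'. \<Sum>s\<leftarrow>faces t. e (hd s) * cup fs s)"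
    proof (rule arg_cong [of _ _ sum_list], rule map_cong)
      fix t assume "t \<in> set C'"
      then have "length t = length fs + 2" using C'_mem es by auto
      then show "cup es t = (\<Sum>s\<leftarrow>faces t. e (hd s) * cup fs s)"
        by (simp add: sum_faces_coboundary es)
    qed simp
    also have "\<dots> = (\<Sum>t\<leftarrow>C. e (hd t) * cup fs t + e (hd (map uminus t)) * cup fs (map uminus t))"
      unfolding bd by (simp add: Z_def comp_def sum_list_addf)
    also have "\<dots> = (\<Sum>t\<leftarrow>C. cup fs t)"
    proof (rule arg_cong [of _ _ sum_list], rule map_cong)
      fix t assume "t \<in> set C"
      then have t: "t \<noteq> []" "set t \<subseteq> octa \<phi> j" using C [of t] by auto
      then have "hd t \<in> octa \<phi> j" by (meson hd_in_set subsetD)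
      then have "e (hd (map uminus t)) = e (hd t) + 1"
        using t by (simp add: hd_map e)
      then show "e (hd t) * cup fs t + e (hd (map uminus t)) * cup fs (map uminus t) = cup fs t"
        using sym [of t fs] t by (simp add: distrib_right)
    qed simp
    also have "\<dots> = 1"
      using one [of fs] es fs by auto
    finally show "(\<Sum>t\<leftarrow>C'. cup es t) = 1" .
  qed
qed

text \<open>A cochain that is constant on the simplex has zero coboundary on each edge, and one zero
  factor is enough.\<close>

lemma cup_eq_0:
  assumes "length t = Suc (length es)" "i < length es" "\<And>x. x \<in> set t \<Longrightarrow> (es ! i) x = c"
  shows "cup es t = 0"
  using assms
proof (induction es t arbitrary: i rule: cup.induct)
  case (2 e es a b vs)
  then show ?case
    by (cases i) auto
qed auto

lemma infdist_uminus:
  fixes x :: "'a::real_normed_vector"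
  shows "infdist (- x) (uminus ` A) = infdist x A"
  by (simp add: infdist_def image_comp comp_def dist_minus)

text \<open>The Lusternik--Schnirelmann form of the Borsuk--Ulam theorem. Each pair of the cover
  yields an odd 0/1 label. The product of the k coboundaries sums to 1 over a hemisphere; but on a
  fine enough triangulation every simplex has some label that is constant on it, so every summand is
  0.\<close>

theorem octa_antipodal_cover:
  fixes \<phi> :: "nat \<Rightarrow> 'a::real_normed_vector"
  assumes F: "\<And>i. i < k \<Longrightarrow> closed (F i)" "\<And>i. i < k \<Longrightarrow> F i \<inter> uminus ` F i = {}"
    and cov: "octa \<phi> k \<subseteq> (\<Union>i<k. F i \<union> uminus ` F i)"
  shows False
proof -
  let ?K = "octa \<phi> k"
  \<comment> \<open>Odd and continuous, positive on \<open>F i\<close> and negative on its antipode;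
    an empty \<open>F i\<close> gives the zero function, since \<open>infdist\<close> to the empty
    set is 0.\<close>
  define f where "f i x = infdist x (uminus ` F i) - infdist x (F i)" for i x
  have f_odd: "f i (- x) = - f i x" for i x
    using infdist_uminus [of x "uminus ` F i"] infdist_uminus [of x "F i"]
    by (simp add: f_def image_comp comp_def)
  have f_cont: "continuous_on UNIV (f i)" for i
    unfolding f_def by (intro continuous_intros)
  have f_pos: "f i x > 0" if "x \<in> F i" "i < k" for i x
  proof -
    have "closed (uminus ` F i)" using F(1) [OF that(2)] by (rule closed_negations)
    moreover have "x \<notin> uminus ` F i" using F(2) [OF that(2)] that by blast
    ultimately have "infdist x (uminus ` F i) > 0"
      using that by (intro infdist_pos_not_in_closed) auto
    then show ?thesis using that by (simp add: f_def)
  qed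
  have f_nz: "\<exists>i<k. f i x \<noteq> 0" if x: "x \<in> ?K" for x
  proof -
    from cov x have "\<exists>i<k. x \<in> F i \<or> - x \<in> F i" by force
    then show ?thesis using f_pos f_odd by force
  qed
  define \<C> where "\<C> = (\<Union>i<k. {{x. f i x > 0}, {x. f i x < 0}})"
  have "?K \<subseteq> \<Union>\<C>"
    using f_nz by (force simp: \<C>_def neq_iff)
  moreover have "open G" if "G \<in> \<C>" for G
    using that f_cont by (auto simp: \<C>_def intro!: open_Collect_less continuous_intros)
  \<comment> \<open>A Lebesgue number for the cover by the sets on which some \<open>f i\<close> has
    a fixed sign.\<close>
  ultimately have "\<exists>\<delta>>0. \<forall>x\<in>?K. \<exists>G\<in>\<C>. ball x \<delta> \<subseteq> G"
    by (rule Heine_Borel_lemma [OF compact_octa]) (assumption, intro exI conjI ballI)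
  then obtain \<delta> where \<delta>: "\<delta> > 0" "\<And>x. x \<in> ?K \<Longrightarrow> \<exists>G\<in>\<C>. ball x \<delta> \<subseteq> G"
    by blast
  \<comment> \<open>Where \<open>f i\<close> vanishes, its own sign gives no odd label; the sign of
    the first nonvanishing \<open>f\<close> at that point stands in.\<close>
  define \<eta> where "\<eta> x = (if f (LEAST i. f i x \<noteq> 0) x > 0 then 0 else 1 :: bit)" for x
  define \<epsilon> where "\<epsilon> i x = (if f i x > 0 then 0 else if f i x < 0 then 1 else \<eta> x)" for i x
  have \<eta>_odd: "\<eta> (- x) = \<eta> x + 1" if "x \<in> ?K" for x
  proof -
    have "f (LEAST i. f i x \<noteq> 0) x \<noteq> 0"
      using f_nz [OF that] by (metis (mono_tags, lifting) LeastI)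
    then show ?thesis by (auto simp: \<eta>_def f_odd)
  qed
  obtain C where C: "\<And>t. t \<in> set C \<Longrightarrow> length t = Suc k \<and> set t \<subseteq> octa \<phi> k \<and> (\<forall>x\<in>set t. \<forall>y\<in>set t. dist x y < \<delta>)"
    and one: "\<And>es. length es = k \<Longrightarrow> (\<forall>e\<in>set es. \<forall>x\<in>octa \<phi> k. e (- x) = e x + 1) \<Longrightarrow> (\<Sum>t\<leftarrow>C. cup es t) = 1"
    using fine_hemisphere [OF \<delta>(1), of k \<phi>] by blast
  define es where "es = map \<epsilon> [0..<k]"
  have "(\<Sum>t\<leftarrow>C. cup es t) = 1"
    by (rule one) (auto simp: es_def \<epsilon>_def f_odd \<eta>_odd)
  moreover have "cup es t = 0" if t: "t \<in> set C" for t
  proof -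
    have "hd t \<in> set t" using C [OF t] by (cases t) auto
    then obtain G where G: "G \<in> \<C>" "ball (hd t) \<delta> \<subseteq> G"
      using \<delta>(2) [of "hd t"] C [OF t] by blast
    have "set t \<subseteq> G"
      using C [OF t] \<open>hd t \<in> set t\<close> G(2) by (meson mem_ball subset_iff)
    then obtain i where i: "i < k" "(\<forall>x\<in>set t. f i x > 0) \<or> (\<forall>x\<in>set t. f i x < 0)"
      using G(1) unfolding \<C>_def by blast
    then have "\<exists>c. \<forall>x\<in>set t. \<epsilon> i x = c"
      by (force simp: \<epsilon>_def)
    then obtain c where "\<forall>x\<in>set t. \<epsilon> i x = c" ..
    then show ?thesis
      using i(1) C [OF t] by (intro cup_eq_0 [of t es i c]) (auto simp: es_def)
  qed
  then have "map (cup es) C = map (\<lambda>_. 0) C"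
    by (intro map_cong) auto
  then have "(\<Sum>t\<leftarrow>C. cup es t) = 0"
    by (metis sum_list_0)
  ultimately show False by simp
qed

section \<open>Critical points of fibered functionals\<close>

text \<open>The convex function y \<mapsto> y^(p/4) lies above its tangent at y = 1; this is read
  off at y = t^4. Young's inequality with weights 4/p and 1 - 4/p is that tangent
  inequality.\<close>

lemma powr_ge_tangent_quartic:
  fixes t p :: real
  assumes "t > 0" "p > 4"
  shows "(t ^ 4 - 1) / 4 \<le> (t powr p - 1) / p"
proof -
  have "(t powr p) powr (4 / p) * 1 powr (1 - 4 / p) \<le> 4 / p * (t powr p) + (1 - 4 / p) * 1"
    using assms by (intro Youngs_inequality_0) auto
  then have "t powr 4 \<le> 4 / p * (t powr p) + (1 - 4 / p)"
    using assms by (simp add: powr_powr)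
  moreover have "t powr p \<ge> 0" by simp
  ultimately have "t ^ 4 - 1 \<le> 4 / p * (t powr p - 1)"
    using assms by (simp add: right_diff_distrib)
  then show ?thesis by (simp add: mult.commute)
qed

text \<open>Bounds the genus of \<open>S\<close> by n in the language of coverings. Closedness is
  relative to \<open>S\<close>, because the sublevel sets of directions omit the origin and need not
  be closed in the space.\<close>

definition antipodal_cover :: "nat \<Rightarrow> 'a::real_normed_vector set \<Rightarrow> bool" where
  "antipodal_cover n S \<longleftrightarrow> (\<exists>F. (\<forall>i<n. closedin (top_of_set S) (F i) \<and> F i \<inter> uminus ` F i = {}) \<and>
     S \<subseteq> (\<Union>i<n. F i \<union> uminus ` F i))"

lemma antipodal_cover_mono:
  assumes "antipodal_cover n S" "n \<le> m"
  shows "antipodal_cover m S"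
proof -
  obtain F where F: "\<forall>i<n. closedin (top_of_set S) (F i) \<and> F i \<inter> uminus ` F i = {}"
      "S \<subseteq> (\<Union>i<n. F i \<union> uminus ` F i)"
    using assms by (auto simp: antipodal_cover_def)
  show ?thesis unfolding antipodal_cover_def
  proof (intro exI [of _ "\<lambda>i. if i < n then F i else {}"] conjI)
    show "S \<subseteq> (\<Union>i<m. (if i < n then F i else {}) \<union> uminus ` (if i < n then F i else {}))"
    proof
      fix x assume "x \<in> S"
      then obtain i where "i < n" "x \<in> F i \<union> uminus ` F i" using F(2) by auto
      then show "x \<in> (\<Union>i<m. (if i < n then F i else {}) \<union> uminus ` (if i < n then F i else {}))"
        using assms(2) by (intro UN_I [of i]) auto
    qed
  qed (use F(1) in auto)
qed

text \<open>Relatively closed subsets of \<open>S\<close> become closed when cut with the compact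
  sphere, so the covering theorem applies; a cover by n \<le> k pairs is padded by empty sets to k
  pairs.\<close>

lemma antipodal_cover_octa:
  fixes \<phi> :: "nat \<Rightarrow> 'a::real_normed_vector"
  assumes "antipodal_cover n S" "octa \<phi> k \<subseteq> S"
  shows "k < n"
proof (rule ccontr)
  assume "\<not> k < n"
  then obtain F where F: "\<And>i. i < k \<Longrightarrow> closedin (top_of_set S) (F i)" "\<And>i. i < k \<Longrightarrow> F i \<inter> uminus ` F i = {}"
      "S \<subseteq> (\<Union>i<k. F i \<union> uminus ` F i)"
    using antipodal_cover_mono [OF assms(1), of k] by (auto simp: antipodal_cover_def)
  show False
  proof (rule octa_antipodal_cover [of k "\<lambda>i. F i \<inter> octa \<phi> k" \<phi>])
    show "closed (F i \<inter> octa \<phi> k)" if i: "i < k" for i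
    proof -
      obtain T where "closed T" "F i = S \<inter> T"
        using F(1) [OF i] by (auto simp: closedin_closed)
      then have "F i \<inter> octa \<phi> k = T \<inter> octa \<phi> k" using assms(2) by auto
      then show ?thesis
        using \<open>closed T\<close> compact_imp_closed [OF compact_octa [of \<phi> k]] closed_Int [of T "octa \<phi> k"] by simp
    qed
    show "F i \<inter> octa \<phi> k \<inter> uminus ` (F i \<inter> octa \<phi> k) = {}" if "i < k" for i
      using F(2) [OF that] by blast
    show "octa \<phi> k \<subseteq> (\<Union>i<k. F i \<inter> octa \<phi> k \<union> uminus ` (F i \<inter> octa \<phi> k))"
    proof
      fix x assume x: "x \<in> octa \<phi> k"
      then obtain i where i: "i < k" "x \<in> F i \<or> - x \<in> F i" using F(3) assms(2) by force
      have "x \<in> F i \<inter> octa \<phi> k \<union> uminus ` (F i \<inter> octa \<phi> k)"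
        using i(2)
      proof
        assume "- x \<in> F i"
        then have "x \<in> uminus ` (F i \<inter> octa \<phi> k)"
          using octa_uminus [OF x] by (intro image_eqI [of _ _ "- x"]) auto
        then show ?thesis ..
      qed (use x in simp)
      then show "x \<in> (\<Union>i<k. F i \<inter> octa \<phi> k \<union> uminus ` (F i \<inter> octa \<phi> k))"
        using i(1) by (intro UN_I [of i]) auto
    qed
  qed
qed

text \<open>\<alpha>, \<beta>, \<gamma>, \<delta> stand for the quadratic form, the Coulomb energy,
  the weighted power and the q-power; \<lambda> is absorbed in \<gamma>. \<open>D_ray\<close>
  carries the factor t so that the same four powers appear as in \<open>Phi_ray\<close>. The bound
  \<open>descent\<close> has no absolute value, but used with u and v exchanged and with the
  Lipschitz bound it makes D the gradient of \<Phi>.\<close>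

locale fibered_functional =
  fixes \<Phi> :: "'a::{real_inner,complete_space} \<Rightarrow> real" and D :: "'a \<Rightarrow> 'a"
    and \<alpha> \<beta> \<gamma> \<delta> :: "'a \<Rightarrow> real" and p q a\<^sub>0 \<Gamma> :: real
  assumes p: "p > 4" and q: "q > 4" and a0: "a\<^sub>0 > 0" and Gamma_pos: "\<Gamma> > 0"
    and Phi_ray: "\<And>t u. t > 0 \<Longrightarrow>
      \<Phi> (t *\<^sub>R u) = \<alpha> u * t ^ 2 / 2 + \<beta> u * t ^ 4 / 4 - \<gamma> u * t powr p / p - \<delta> u * t powr q / q"
    and D_ray: "\<And>t u. t > 0 \<Longrightarrow>
      (D (t *\<^sub>R u) \<bullet> u) * t = \<alpha> u * t ^ 2 + \<beta> u * t ^ 4 - \<gamma> u * t powr p - \<delta> u * t powr q"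
    and Phi_minus: "\<And>u. \<Phi> (- u) = \<Phi> u"
    and D_minus: "\<And>u. D (- u) = - D u"
    and \<alpha>_ge: "\<And>u. \<alpha> u \<ge> a\<^sub>0 * norm u ^ 2"
    and \<beta>_nonneg: "\<And>u. \<beta> u \<ge> 0" and \<gamma>_nonneg: "\<And>u. \<gamma> u \<ge> 0"
    and \<delta>_pos: "\<And>u. u \<noteq> 0 \<Longrightarrow> \<delta> u > 0"
    and \<gamma>_le: "\<And>u. \<gamma> u \<le> \<Gamma> * norm u powr p" and \<delta>_le: "\<And>u. \<delta> u \<le> \<Gamma> * norm u powr q"
    and D_lipschitz: "\<And>R. \<exists>L. \<forall>u v. norm u \<le> R \<longrightarrow> norm v \<le> R \<longrightarrow> norm (D u - D v) \<le> L * norm (u - v)"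
    and descent: "\<And>R. \<exists>L. \<forall>u v. norm u \<le> R \<longrightarrow> norm v \<le> R \<longrightarrow> \<Phi> v \<le> \<Phi> u + D u \<bullet> (v - u) + L * norm (v - u) ^ 2"
begin

section \<open>Continuity of the gradient and of the functional\<close>

lemma D_0 [simp]: "D 0 = 0"
  using D_minus [of 0] by (simp add: eq_neg_iff_add_eq_0 flip: scaleR_2)

lemma lipschitz_descent:
  obtains L where "L > 0"
    "\<And>u v. norm u \<le> R \<Longrightarrow> norm v \<le> R \<Longrightarrow> norm (D u - D v) \<le> L * norm (u - v)"
    "\<And>u v. norm u \<le> R \<Longrightarrow> norm v \<le> R \<Longrightarrow> \<Phi> v \<le> \<Phi> u + D u \<bullet> (v - u) + L * norm (v - u) ^ 2"
proof -
  obtain L1 where L1: "\<And>u v. norm u \<le> R \<Longrightarrow> norm v \<le> R \<Longrightarrow> norm (D u - D v) \<le> L1 * norm (u - v)"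
    using D_lipschitz by meson
  obtain L2 where L2: "\<And>u v. norm u \<le> R \<Longrightarrow> norm v \<le> R \<Longrightarrow> \<Phi> v \<le> \<Phi> u + D u \<bullet> (v - u) + L2 * norm (v - u) ^ 2"
    using descent by meson
  define L where "L = max 1 (max L1 L2)"
  have "L1 * norm (u - v) \<le> L * norm (u - v)" "L2 * norm (v - u) ^ 2 \<le> L * norm (v - u) ^ 2" for u v :: 'a
    by (intro mult_right_mono; simp add: L_def)+
  note le = this
  show ?thesis
  proof (rule that [of L])
    show "L > 0" by (simp add: L_def)
    show "norm (D u - D v) \<le> L * norm (u - v)" if "norm u \<le> R" "norm v \<le> R" for u v
      using L1 [OF that] le(1) [of u v] by linarith
    show "\<Phi> v \<le> \<Phi> u + D u \<bullet> (v - u) + L * norm (v - u) ^ 2" if "norm u \<le> R" "norm v \<le> R" for u v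
      using L2 [OF that] le(2) [of v u] by linarith
  qed
qed

lemma continuous_D: "continuous_on UNIV D"
proof -
  have "isCont D u" for u
  proof -
    obtain L where L: "L > 0" "\<And>x y. norm x \<le> norm u + 1 \<Longrightarrow> norm y \<le> norm u + 1 \<Longrightarrow> norm (D x - D y) \<le> L * norm (x - y)"
      by (rule lipschitz_descent [of "norm u + 1"], rule that)
    have "((\<lambda>v. D v - D u) \<longlongrightarrow> 0) (at u)"
    proof (rule Lim_null_comparison)
      show "\<forall>\<^sub>F v in at u. norm (D v - D u) \<le> L * norm (v - u)"
        unfolding eventually_at
      proof (intro exI [of _ 1] conjI ballI impI)
        fix v assume "v \<noteq> u \<and> dist v u < 1"
        then have "norm v \<le> norm u + 1"
          using norm_triangle_sub [of v u] by (simp add: dist_norm)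
        then show "norm (D v - D u) \<le> L * norm (v - u)"
          by (intro L) auto
      qed simp
      show "((\<lambda>v. L * norm (v - u)) \<longlongrightarrow> 0) (at u)"
        by (auto intro!: tendsto_eq_intros)
    qed
    then show ?thesis unfolding isCont_def by (simp add: LIM_zero_iff)
  qed
  then show ?thesis by (simp add: continuous_at_imp_continuous_on)
qed

text \<open>The one-sided bound \<open>descent\<close>, used in both directions, squeezes \<Phi> v -
  \<Phi> u between terms that tend to 0.\<close>

lemma continuous_Phi: "continuous_on UNIV \<Phi>"
proof -
  have "isCont \<Phi> u" for u
  proof -
    obtain L where L: "L > 0" "\<And>x y. norm x \<le> norm u + 1 \<Longrightarrow> norm y \<le> norm u + 1 \<Longrightarrow> \<Phi> y \<le> \<Phi> x + D x \<bullet> (y - x) + L * norm (y - x) ^ 2"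
      by (rule lipschitz_descent [of "norm u + 1"], rule that)
    have "((\<lambda>v. \<Phi> v - \<Phi> u) \<longlongrightarrow> 0) (at u)"
    proof (rule Lim_null_comparison)
      show "\<forall>\<^sub>F v in at u. norm (\<Phi> v - \<Phi> u) \<le> \<bar>D u \<bullet> (v - u)\<bar> + \<bar>D v \<bullet> (u - v)\<bar> + L * norm (v - u) ^ 2"
        unfolding eventually_at
      proof (intro exI [of _ 1] conjI ballI impI)
        fix v assume "v \<noteq> u \<and> dist v u < 1"
        then have "norm v \<le> norm u + 1"
          using norm_triangle_sub [of v u] by (simp add: dist_norm)
        then show "norm (\<Phi> v - \<Phi> u) \<le> \<bar>D u \<bullet> (v - u)\<bar> + \<bar>D v \<bullet> (u - v)\<bar> + L * norm (v - u) ^ 2"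
          using L(2) [of u v] L(2) [of v u] by (simp add: norm_minus_commute)
      qed simp
      have "isCont D u" using continuous_D by (simp add: continuous_on_eq_continuous_at)
      then have "isCont (\<lambda>v. \<bar>D u \<bullet> (v - u)\<bar> + \<bar>D v \<bullet> (u - v)\<bar> + L * norm (v - u) ^ 2) u"
        by (intro continuous_intros)
      then show "((\<lambda>v. \<bar>D u \<bullet> (v - u)\<bar> + \<bar>D v \<bullet> (u - v)\<bar> + L * norm (v - u) ^ 2) \<longlongrightarrow> 0) (at u)"
        by (simp add: isCont_def)
    qed
    then show ?thesis unfolding isCont_def by (simp add: LIM_zero_iff)
  qed
  then show ?thesis by (simp add: continuous_at_imp_continuous_on)
qed

subsection \<open>Projection onto the Nehari manifold\<close>

text \<open>The derivative of t \<mapsto> \<Phi>(t u) divided by t^3. This normalisation turns the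
  quartic coefficient into a constant and, since p, q > 4, leaves no increasing term.\<close>

definition fib :: "'a \<Rightarrow> real \<Rightarrow> real" where
  "fib u t = \<alpha> u / t ^ 2 + \<beta> u - \<gamma> u * t powr (p - 4) - \<delta> u * t powr (q - 4)"

lemma D_fib:
  assumes "t > 0"
  shows "D (t *\<^sub>R u) \<bullet> u = t ^ 3 * fib u t"
proof -
  have *: "t powr s = t powr (s - 4) * t ^ 4" for s
    using assms by (simp add: powr_diff)
  have "(D (t *\<^sub>R u) \<bullet> u) * t = t ^ 3 * fib u t * t"
    unfolding D_ray [OF assms] * [of p] * [of q] fib_def
    using assms by (simp add: field_simps power2_eq_square eval_nat_numeral)
  then show ?thesis using assms by simp
qed

lemma \<alpha>_pos: "u \<noteq> 0 \<Longrightarrow> \<alpha> u > 0"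
  using \<alpha>_ge [of u] a0 by (meson less_le_trans mult_pos_pos zero_less_norm_iff zero_less_power)

lemma fib_strict_antimono:
  assumes "u \<noteq> 0" "0 < s" "s < t"
  shows "fib u t < fib u s"
proof -
  have "\<alpha> u / t ^ 2 < \<alpha> u / s ^ 2"
    using \<alpha>_pos [OF assms(1)] assms by (intro divide_strict_left_mono power_strict_mono) auto
  moreover have "\<gamma> u * s powr (p - 4) \<le> \<gamma> u * t powr (p - 4)"
    using assms p by (intro mult_left_mono \<gamma>_nonneg powr_mono2) auto
  moreover have "\<delta> u * s powr (q - 4) \<le> \<delta> u * t powr (q - 4)"
    using assms q \<delta>_pos [OF assms(1)] by (intro mult_left_mono powr_mono2) auto
  ultimately show ?thesis by (simp add: fib_def)
qed

text \<open>Uniqueness is strict monotonicity. For existence, \<open>fib u\<close> is positive at a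
  small s, where \<alpha>/s^2 outweighs \<gamma> + \<delta>, and negative at a large t, where the
  q-power outweighs \<alpha> + \<beta>.\<close>

lemma fib_zero_ex:
  assumes "u \<noteq> 0"
  shows "\<exists>!t. t > 0 \<and> fib u t = 0"
proof -
  have pos: "\<alpha> u > 0" "\<beta> u \<ge> 0" "\<gamma> u \<ge> 0" "\<delta> u > 0"
    using \<alpha>_pos \<beta>_nonneg \<gamma>_nonneg \<delta>_pos assms by auto
  define s where "s = min 1 (sqrt (\<alpha> u / (\<gamma> u + \<delta> u + 1)))"
  have s: "0 < s" "s \<le> 1" using pos by (auto simp: s_def)
  have "s ^ 2 \<le> (sqrt (\<alpha> u / (\<gamma> u + \<delta> u + 1))) ^ 2"
    using s pos by (intro power_mono) (auto simp: s_def)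
  also have "\<dots> = \<alpha> u / (\<gamma> u + \<delta> u + 1)" using pos by simp
  finally have "\<gamma> u + \<delta> u + 1 \<le> \<alpha> u / s ^ 2"
    using s pos by (simp add: field_simps)
  moreover have "s powr (p - 4) \<le> 1" "s powr (q - 4) \<le> 1"
    using s p q by (auto intro!: powr_le1)
  then have "\<gamma> u * s powr (p - 4) \<le> \<gamma> u" "\<delta> u * s powr (q - 4) \<le> \<delta> u"
    using pos mult_left_le [of "s powr (p - 4)" "\<gamma> u"] mult_left_le [of "s powr (q - 4)" "\<delta> u"] by auto
  ultimately have fs: "fib u s > 0" using pos unfolding fib_def by linarith
  \<comment> \<open>Chosen so that \<delta> t^(q-4) equals \<alpha> + \<beta> + \<delta>.\<close>
  define t where "t = ((\<alpha> u + \<beta> u) / \<delta> u + 1) powr (1 / (q - 4))"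
  have ge1: "(\<alpha> u + \<beta> u) / \<delta> u + 1 \<ge> 1" using pos by simp
  have t1: "t \<ge> 1" unfolding t_def using ge1 q by (intro ge_one_powr_ge_zero) auto
  have "t powr (q - 4) = (\<alpha> u + \<beta> u) / \<delta> u + 1"
    using ge1 q by (simp add: t_def powr_powr)
  then have "\<delta> u * t powr (q - 4) = \<alpha> u + \<beta> u + \<delta> u"
    using pos by (simp add: field_simps)
  moreover have "\<alpha> u / t ^ 2 \<le> \<alpha> u"
    using t1 pos by (simp add: divide_le_eq_1 pos_divide_le_eq mult_le_cancel_left1)
  moreover have "\<gamma> u * t powr (p - 4) \<ge> 0" using pos by simp
  ultimately have ft: "fib u t < 0" using pos unfolding fib_def by linarith
  have "s \<le> t" using s t1 by simp
  moreover have "continuous_on {s..t} (fib u)"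
    unfolding fib_def using s by (intro continuous_intros) auto
  ultimately obtain x where "s \<le> x" "x \<le> t" "fib u x = 0"
    using IVT2' [of "fib u" t 0 s] fs ft by auto
  then have x: "x > 0 \<and> fib u x = 0" using s by simp
  moreover have "y = x" if "y > 0 \<and> fib u y = 0" for y
    using that x fib_strict_antimono [OF assms, of x y] fib_strict_antimono [OF assms, of y x]
    by (cases x y rule: linorder_cases) auto
  ultimately show ?thesis by blast
qed

definition scale :: "'a \<Rightarrow> real" where
  "scale u = (THE t. t > 0 \<and> fib u t = 0)"

lemma scale:
  assumes "u \<noteq> 0"
  shows "scale u > 0" "fib u (scale u) = 0"
  using theI' [OF fib_zero_ex [OF assms]] by (auto simp: scale_def)

lemma less_scale_iff:
  assumes "u \<noteq> 0" "t > 0"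
  shows "t < scale u \<longleftrightarrow> fib u t > 0" "scale u < t \<longleftrightarrow> fib u t < 0"
  using scale [OF assms(1)] assms(2)
    fib_strict_antimono [OF assms(1), of t "scale u"] fib_strict_antimono [OF assms(1), of "scale u" t]
  by (cases t "scale u" rule: linorder_cases; simp)+

text \<open>The locale does not make the four coefficients continuous one by one; their combination
  is continuous because D is, through \<open>D_fib\<close>.\<close>

lemma continuous_fib:
  assumes "t > 0"
  shows "continuous_on UNIV (\<lambda>u. fib u t)"
proof -
  have "continuous_on UNIV (\<lambda>u. D (t *\<^sub>R u))"
    by (rule continuous_on_compose2 [OF continuous_D]) (auto intro!: continuous_intros)
  then have "continuous_on UNIV (\<lambda>u. D (t *\<^sub>R u) \<bullet> u / t ^ 3)"
    using assms by (intro continuous_intros) auto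
  then show ?thesis using D_fib [OF assms] assms by simp
qed

text \<open>Two values of t slightly below and above \<open>scale u\<close> give \<open>fib\<close>
  opposite signs. Both signs persist for v near u, and by monotonicity the zero for v stays between
  these two values.\<close>

lemma continuous_scale: "continuous_on (- {0}) scale"
proof -
  have "isCont scale u" if u: "u \<noteq> 0" for u
    unfolding isCont_def
  proof (rule tendstoI)
    fix e :: real assume e: "e > 0"
    define e' where "e' = min e (scale u / 2)"
    have e': "0 < e'" "e' < scale u" "e' \<le> e"
      using e scale [OF u] by (auto simp: e'_def)
    define t1 t2 where t: "t1 = scale u - e'" "t2 = scale u + e'"
    have "fib u t1 > 0" "fib u t2 < 0"
      using less_scale_iff [OF u, of t1] less_scale_iff [OF u, of t2] e' scale [OF u] t by auto
    moreover have "((\<lambda>v. fib v t1) \<longlongrightarrow> fib u t1) (at u)" "((\<lambda>v. fib v t2) \<longlongrightarrow> fib u t2) (at u)"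
      using continuous_fib [of t1] continuous_fib [of t2] e' t scale [OF u]
      by (auto simp: continuous_on_eq_continuous_at isCont_def)
    ultimately have "\<forall>\<^sub>F v in at u. fib v t1 > 0" "\<forall>\<^sub>F v in at u. fib v t2 < 0"
      by (auto dest: order_tendstoD)
    moreover have "\<forall>\<^sub>F v in at u. v \<noteq> 0"
      using u by (auto intro!: tendsto_imp_eventually_ne tendsto_ident_at)
    ultimately show "\<forall>\<^sub>F v in at u. dist (scale v) (scale u) < e"
    proof eventually_elim
      case (elim v)
      then have "t1 < scale v" "scale v < t2"
        using less_scale_iff [of v t1] less_scale_iff [of v t2] e' t by auto
      then show ?case using t e' by (auto simp: dist_real_def)
    qed
  qed
  then show ?thesis by (simp add: continuous_at_imp_continuous_on)
qed

text \<open>Evenness of \<open>fib\<close> is read off from \<open>D_fib\<close>, where the minus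
  signs of D and of u cancel.\<close>

lemma scale_minus:
  assumes "u \<noteq> 0"
  shows "scale (- u) = scale u"
proof -
  have "fib (- u) t = fib u t" if "t > 0" for t
    using D_fib [OF that, of u] D_fib [OF that, of "- u"] that by (simp add: D_minus)
  then have "(\<lambda>t. t > 0 \<and> fib (- u) t = 0) = (\<lambda>t. t > 0 \<and> fib u t = 0)" by auto
  then show ?thesis
    unfolding scale_def by simp
qed

section \<open>The Nehari manifold\<close>

definition nehari :: "'a \<Rightarrow> bool" where
  "nehari w \<longleftrightarrow> w \<noteq> 0 \<and> D w \<bullet> w = 0"

definition proj :: "'a \<Rightarrow> 'a" where
  "proj u = scale u *\<^sub>R u"

lemma nehari_proj: "u \<noteq> 0 \<Longrightarrow> nehari (proj u)"
  using scale [of u] D_fib [of "scale u" u] by (auto simp: nehari_def proj_def)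

lemma proj_minus: "u \<noteq> 0 \<Longrightarrow> proj (- u) = - proj u"
  by (simp add: proj_def scale_minus)

lemma continuous_proj: "continuous_on (- {0}) proj"
  unfolding proj_def by (intro continuous_intros continuous_scale)

lemma nehari_eq:
  assumes "nehari w"
  shows "\<alpha> w + \<beta> w = \<gamma> w + \<delta> w"
  using D_ray [of 1 w] assms by (simp add: nehari_def)

text \<open>Both powers are replaced by their quartic minorants. With \<open>nehari_eq\<close> the
  \<beta> terms cancel and a square remains, which quantifies how much the energy drops when one
  moves along the ray away from its maximum at t = 1.\<close>

lemma nehari_Phi_le:
  assumes "nehari w" "t > 0"
  shows "\<Phi> (t *\<^sub>R w) \<le> \<Phi> w - \<alpha> w / 4 * (1 - t ^ 2) ^ 2"
proof -
  have w: "w \<noteq> 0" using assms by (simp add: nehari_def)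
  have "\<gamma> w * ((t ^ 4 - 1) / 4) \<le> \<gamma> w * ((t powr p - 1) / p)"
    using assms p by (intro mult_left_mono powr_ge_tangent_quartic \<gamma>_nonneg)
  moreover have "\<delta> w * ((t ^ 4 - 1) / 4) \<le> \<delta> w * ((t powr q - 1) / q)"
    using assms q \<delta>_pos [OF w] by (intro mult_left_mono powr_ge_tangent_quartic) auto
  moreover have "\<Phi> w - \<Phi> (t *\<^sub>R w) = \<alpha> w * (1 - t ^ 2) / 2 + \<beta> w * (1 - t ^ 4) / 4
      + \<gamma> w * ((t powr p - 1) / p) + \<delta> w * ((t powr q - 1) / q)"
    using Phi_ray [of 1 w] Phi_ray [OF assms(2), of w] p q
    by (simp add: field_simps)
  ultimately have "\<Phi> w - \<Phi> (t *\<^sub>R w) \<ge> \<alpha> w * (1 - t ^ 2) / 2 + \<beta> w * (1 - t ^ 4) / 4 + (\<gamma> w + \<delta> w) * ((t ^ 4 - 1) / 4)"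
    by (simp add: distrib_right)
  also have "\<alpha> w * (1 - t ^ 2) / 2 + \<beta> w * (1 - t ^ 4) / 4 + (\<gamma> w + \<delta> w) * ((t ^ 4 - 1) / 4)
     = \<alpha> w / 4 * (1 - t ^ 2) ^ 2"
    unfolding nehari_eq [OF assms(1), symmetric] by (simp add: field_simps power2_eq_square eval_nat_numeral)
  finally show ?thesis by simp
qed

text \<open>Replacing 1/p and 1/q by 1/4 cancels everything but \<alpha>/4. Hence a bound on the
  energy is a bound on the norm of Nehari points.\<close>

lemma nehari_Phi_ge:
  assumes "nehari w"
  shows "\<Phi> w \<ge> a\<^sub>0 / 4 * norm w ^ 2"
proof -
  have w: "w \<noteq> 0" using assms by (simp add: nehari_def)
  have "\<gamma> w / p \<le> \<gamma> w / 4"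
    using p \<gamma>_nonneg [of w] by (intro divide_left_mono) auto
  moreover have "\<delta> w / q \<le> \<delta> w / 4"
    using q \<delta>_pos [OF w] by (intro divide_left_mono) auto
  moreover have "\<Phi> w = \<alpha> w / 2 + \<beta> w / 4 - \<gamma> w / p - \<delta> w / q"
    using Phi_ray [of 1 w] by simp
  ultimately have "\<Phi> w \<ge> \<alpha> w / 4"
    using nehari_eq [OF assms] by linarith
  then show ?thesis using \<alpha>_ge [of w] by simp
qed

lemma nehari_Phi_pos:
  assumes "nehari w"
  shows "\<Phi> w > 0"
proof -
  have "a\<^sub>0 / 4 * norm w ^ 2 > 0" using a0 assms by (simp add: nehari_def)
  then show ?thesis using nehari_Phi_ge [OF assms] by linarith
qed

text \<open>In the unit ball both powers are at most the fourth, so the Nehari identity gives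
  \<open>a\<^sub>0 * norm w ^ 2 \<le> 2 * \<Gamma> * norm w ^ 4\<close>, which keeps the manifold
  away from the origin.\<close>

lemma nehari_norm_ge:
  assumes "nehari w"
  shows "norm w ^ 2 \<ge> min 1 (a\<^sub>0 / (2 * \<Gamma>))"
proof (cases "norm w \<le> 1")
  case True
  have w: "norm w > 0" using assms by (simp add: nehari_def)
  have "norm w powr p \<le> norm w powr 4" "norm w powr q \<le> norm w powr 4"
    using True p q by (intro powr_mono'; simp)+
  then have "\<Gamma> * norm w powr p + \<Gamma> * norm w powr q \<le> \<Gamma> * norm w ^ 4 + \<Gamma> * norm w ^ 4"
    using w Gamma_pos by (intro add_mono mult_left_mono) auto
  then have "a\<^sub>0 * norm w ^ 2 \<le> 2 * \<Gamma> * norm w ^ 4"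
    using \<alpha>_ge [of w] nehari_eq [OF assms] \<beta>_nonneg [of w] \<gamma>_le [of w] \<delta>_le [of w] by linarith
  also have "\<dots> = (2 * \<Gamma> * norm w ^ 2) * norm w ^ 2" by (simp add: eval_nat_numeral)
  finally have "a\<^sub>0 \<le> 2 * \<Gamma> * norm w ^ 2" using w by simp
  then show ?thesis using Gamma_pos by (simp add: field_simps min_le_iff_disj)
next
  case False
  then show ?thesis by (simp add: min_le_iff_disj one_le_power)
qed

text \<open>A set of directions, invariant under positive scaling. By \<open>sublevel_iff\<close> it
  is the preimage of an energy sublevel under the projection; the definition avoids the projection,
  so membership can be checked by bounding \<Phi> on whole rays.\<close>

definition sublevel :: "real \<Rightarrow> 'a set" where
  "sublevel c = {u. u \<noteq> 0 \<and> (\<forall>t>0. \<Phi> (t *\<^sub>R u) \<le> c)}"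

lemma sublevel_iff: "u \<in> sublevel c \<longleftrightarrow> u \<noteq> 0 \<and> \<Phi> (proj u) \<le> c"
proof (cases "u = 0")
  case False
  have s: "scale u > 0" using scale [OF False] by auto
  have "\<Phi> (t *\<^sub>R u) \<le> \<Phi> (proj u)" if t: "t > 0" for t
  proof -
    have "\<Phi> ((t / scale u) *\<^sub>R proj u) \<le> \<Phi> (proj u) - \<alpha> (proj u) / 4 * (1 - (t / scale u) ^ 2) ^ 2"
      using t s by (intro nehari_Phi_le nehari_proj False) auto
    moreover have "\<alpha> (proj u) / 4 * (1 - (t / scale u) ^ 2) ^ 2 \<ge> 0"
      using \<alpha>_pos [of "proj u"] nehari_proj [OF False] by (simp add: nehari_def)
    ultimately show ?thesis using s by (simp add: proj_def)
  qed
  then show ?thesis using False s by (auto simp: sublevel_def proj_def intro: order.trans)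
qed (simp add: sublevel_def)

lemma sublevel_minus: "u \<in> sublevel c \<Longrightarrow> - u \<in> sublevel c"
  by (auto simp: sublevel_iff proj_minus Phi_minus)

subsection \<open>Descent along the gradient\<close>

text \<open>At a Nehari point D w is orthogonal to w, so the step is tangential and cannot lead to
  0. The new point v leaves the manifold, and what has to be bounded is the maximum of \<Phi> over
  its ray, attained at a parameter T close to 1. The energy at T v is compared with that at T w; the
  drop of \<Phi> along the ray of w pays for the error made by using the gradient at T w in place of
  the one at w.\<close>

lemma descent_step:
  assumes r: "r > 0"
  obtains s where "s > 0"
    "\<And>w t. nehari w \<Longrightarrow> norm w \<le> r \<Longrightarrow> w - s *\<^sub>R D w \<noteq> 0"
    "\<And>w t. nehari w \<Longrightarrow> norm w \<le> r \<Longrightarrow> t > 0 \<Longrightarrow>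
       \<Phi> (t *\<^sub>R (w - s *\<^sub>R D w)) \<le> \<Phi> w - s / 4 * norm (D w) ^ 2"
proof -
  define R where "R = 2 * r + 2"
  obtain L where L: "L > 0"
    "\<And>u v. norm u \<le> R \<Longrightarrow> norm v \<le> R \<Longrightarrow> norm (D u - D v) \<le> L * norm (u - v)"
    "\<And>u v. norm u \<le> R \<Longrightarrow> norm v \<le> R \<Longrightarrow> \<Phi> v \<le> \<Phi> u + D u \<bullet> (v - u) + L * norm (v - u) ^ 2"
    by (rule lipschitz_descent [of R], rule that)
  \<comment> \<open>A lower bound for \<alpha> on the whole Nehari manifold.\<close>
  define m where "m = a\<^sub>0 * min 1 (a\<^sub>0 / (2 * \<Gamma>))"
  have m: "m > 0" using a0 Gamma_pos by (simp add: m_def)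
  have m_le: "m \<le> \<alpha> w" if "nehari w" for w
  proof -
    have "m \<le> a\<^sub>0 * norm w ^ 2"
      unfolding m_def using nehari_norm_ge [OF that] a0 by (intro mult_left_mono) auto
    then show ?thesis using \<alpha>_ge [of w] by simp
  qed
  define Y where "Y = L * r"
  have Y: "Y > 0" using L r by (simp add: Y_def)
  have D_le: "norm (D w) \<le> Y" if "norm w \<le> r" for w
  proof -
    have "norm (D w - D 0) \<le> L * norm (w - 0)" using that r by (intro L) (auto simp: R_def)
    also have "\<dots> \<le> Y" using that L by (simp add: Y_def)
    finally show ?thesis by simp
  qed
  \<comment> \<open>\<open>s * C1\<close> bounds the change of the radial derivative between w and
    the new point for t \<le> 2; \<open>C2\<close> collects the second order terms of the energy
    estimate.\<close>
  define C1 where "C1 = 2 * L * r * Y + 2 * L * (r + 1) * Y"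
  define C2 where "C2 = 4 * (L * r)\<^sup>2 / m + 4 * L"
  have C: "C1 > 0" "C2 > 0" using L r Y m by (auto simp: C1_def C2_def add_pos_pos)
  define s where "s = Min {1 / Y, m / (4 * C1), 1 / (4 * C2)}"
  have s: "s > 0" "s * Y \<le> 1" "s * C1 \<le> m / 4" "s * C2 \<le> 1 / 4"
  proof -
    have "s \<le> 1 / Y" "s \<le> m / (4 * C1)" "s \<le> 1 / (4 * C2)" by (auto simp: s_def)
    then show "s * Y \<le> 1" "s * C1 \<le> m / 4" "s * C2 \<le> 1 / 4"
      using Y C by (auto simp: field_simps)
    show "s > 0" unfolding s_def using Y C m by (subst Min_gr_iff) auto
  qed
  have key: "w - s *\<^sub>R D w \<noteq> 0 \<and> (\<forall>t>0. \<Phi> (t *\<^sub>R (w - s *\<^sub>R D w)) \<le> \<Phi> w - s / 4 * norm (D w) ^ 2)"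
    if w: "nehari w" "norm w \<le> r" for w
  proof -
    define y where "y = D w"
    define v where "v = w - s *\<^sub>R y"
    have w0: "w \<noteq> 0" and wy: "y \<bullet> w = 0" using w by (auto simp: nehari_def y_def)
    have yY: "norm y \<le> Y" using D_le w by (simp add: y_def)
    have sy: "norm (s *\<^sub>R y) \<le> s * Y" "norm (s *\<^sub>R y) \<le> 1"
      using yY s by (auto intro: order.trans [OF mult_left_mono])
    have "v \<bullet> w = w \<bullet> w" by (simp add: v_def inner_diff_left wy)
    then have v0: "v \<noteq> 0" using w0 by auto
    have vn: "norm v \<le> r + 1"
      unfolding v_def using norm_triangle_ineq4 [of w "s *\<^sub>R y"] sy w by linarith
    have pert: "\<bar>D (t *\<^sub>R v) \<bullet> v - D (t *\<^sub>R w) \<bullet> w\<bar> \<le> m / 4" if t: "0 < t" "t \<le> 2" for t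
    proof -
      have nt: "norm (t *\<^sub>R v) \<le> R" "norm (t *\<^sub>R w) \<le> R"
        using t vn w r mult_mono [of t 2 "norm v" "r + 1"] mult_mono [of t 2 "norm w" r] by (auto simp: R_def)
      have "D (t *\<^sub>R v) \<bullet> v - D (t *\<^sub>R w) \<bullet> w = (D (t *\<^sub>R v) - D (t *\<^sub>R w)) \<bullet> w + D (t *\<^sub>R v) \<bullet> (v - w)"
        by (simp add: inner_diff_left inner_diff_right)
      also have "\<bar>\<dots>\<bar> \<le> norm (D (t *\<^sub>R v) - D (t *\<^sub>R w)) * norm w + norm (D (t *\<^sub>R v)) * norm (v - w)"
        by (intro order.trans [OF abs_triangle_ineq] add_mono Cauchy_Schwarz_ineq2)
      also have "\<dots> \<le> (L * (2 * (s * Y))) * r + (L * (2 * (r + 1))) * (s * Y)"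
      proof (intro add_mono mult_mono)
        have "norm (D (t *\<^sub>R v) - D (t *\<^sub>R w)) \<le> L * norm (t *\<^sub>R v - t *\<^sub>R w)"
          by (intro L nt)
        also have "norm (t *\<^sub>R v - t *\<^sub>R w) = t * norm (s *\<^sub>R y)"
          using t by (simp add: v_def abs_mult flip: scaleR_diff_right)
        also have "L * (t * norm (s *\<^sub>R y)) \<le> L * (2 * (s * Y))"
          using t sy L by (intro mult_left_mono mult_mono) auto
        finally show "norm (D (t *\<^sub>R v) - D (t *\<^sub>R w)) \<le> L * (2 * (s * Y))" .
        have "norm (D (t *\<^sub>R v) - D 0) \<le> L * norm (t *\<^sub>R v - 0)"
          using nt(1) r by (intro L) (auto simp: R_def)
        also have "\<dots> \<le> L * (2 * (r + 1))"
          using nt(1) L by (intro mult_left_mono) (auto simp: R_def)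
        finally show "norm (D (t *\<^sub>R v)) \<le> L * (2 * (r + 1))" by simp
        show "norm (v - w) \<le> s * Y" using sy(1) by (simp add: v_def)
      qed (use L s Y r w in auto)
      also have "\<dots> = s * C1" by (simp add: C1_def algebra_simps)
      finally show ?thesis using s by simp
    qed
    \<comment> \<open>T lies in (1/2, 2). At 2 the powers are at least 16, and the Nehari identity
      leaves 4\<alpha> + 16\<beta> - 16(\<alpha> + \<beta>) = -12\<alpha>; at 1/2 it leaves at least
      (1/4 - 1/16)\<alpha>. Passing from w to v is too small a perturbation to change these
      signs.\<close>
    define T where "T = scale v"
    have "D (2 *\<^sub>R w) \<bullet> w * 2 \<le> - 12 * \<alpha> w"
    proof -
      have "2 powr 4 \<le> (2::real) powr p" "2 powr 4 \<le> (2::real) powr q"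
        using p q by (intro powr_mono; simp)+
      then have "\<gamma> w * 16 \<le> \<gamma> w * 2 powr p" "\<delta> w * 16 \<le> \<delta> w * 2 powr q"
        using \<gamma>_nonneg [of w] \<delta>_pos [OF w0] by (auto intro!: mult_left_mono)
      then show ?thesis
        using D_ray [of 2 w] nehari_eq [OF w(1)] by simp
    qed
    then have "D (2 *\<^sub>R v) \<bullet> v < 0"
      using pert [of 2] m_le [OF w(1)] m by (simp only: abs_le_iff) linarith
    then have "fib v 2 < 0" using D_fib [of 2 v] by (simp add: mult_less_0_iff)
    then have T2: "T < 2" using less_scale_iff [OF v0, of 2] by (simp add: T_def)
    have "D ((1/2) *\<^sub>R w) \<bullet> w * (1/2) \<ge> 3/16 * \<alpha> w"
    proof -
      have "(1/2) powr p \<le> (1/2::real) powr 4" "(1/2) powr q \<le> (1/2::real) powr 4"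
        using p q by (intro powr_mono'; simp)+
      then have "(1/2) powr p \<le> (1/16::real)" "(1/2) powr q \<le> (1/16::real)"
        by (simp_all add: power_divide)
      then have "\<gamma> w * (1/2) powr p \<le> \<gamma> w * (1/16)" "\<delta> w * (1/2) powr q \<le> \<delta> w * (1/16)"
        using \<gamma>_nonneg [of w] \<delta>_pos [OF w0] by (intro mult_left_mono; simp)+
      then show ?thesis
        using D_ray [of "1/2" w] nehari_eq [OF w(1)] by (simp add: power_divide)
    qed
    then have "D ((1/2) *\<^sub>R v) \<bullet> v > 0"
      using pert [of "1/2"] m_le [OF w(1)] m by (simp only: abs_le_iff) linarith
    then have "fib v (1/2) > 0" using D_fib [of "1/2" v] by (simp add: zero_less_mult_iff)
    then have T1: "1/2 < T" using less_scale_iff [OF v0, of "1/2"] by (simp add: T_def)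
    define x where "x = \<bar>T - 1\<bar>"
    have nT: "norm (T *\<^sub>R v) \<le> R" "norm (T *\<^sub>R w) \<le> R"
      using T1 T2 vn w r mult_mono [of T 2 "norm v" "r + 1"] mult_mono [of T 2 "norm w" r] by (auto simp: R_def)
    have "\<Phi> (T *\<^sub>R v) \<le> \<Phi> (T *\<^sub>R w) + D (T *\<^sub>R w) \<bullet> (T *\<^sub>R v - T *\<^sub>R w) + L * norm (T *\<^sub>R v - T *\<^sub>R w) ^ 2"
      by (intro L nT)
    also have "T *\<^sub>R v - T *\<^sub>R w = - (T * s) *\<^sub>R y"
      by (simp add: v_def algebra_simps)
    also have "D (T *\<^sub>R w) \<bullet> (- (T * s) *\<^sub>R y) \<le> - (T * s) * norm y ^ 2 + T * s * (L * x * r * norm y)"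
    proof -
      have "norm (D (T *\<^sub>R w) - D w) \<le> L * norm (T *\<^sub>R w - w)"
        using w r by (intro L nT) (auto simp: R_def)
      also have "T *\<^sub>R w - w = (T - 1) *\<^sub>R w" by (simp add: algebra_simps)
      also have "L * norm ((T - 1) *\<^sub>R w) \<le> L * (x * r)"
        using w L by (simp add: x_def mult_left_mono)
      finally have "norm (D (T *\<^sub>R w) - D w) * norm y \<le> (L * (x * r)) * norm y"
        by (intro mult_right_mono) auto
      then have "(D (T *\<^sub>R w) - D w) \<bullet> y \<ge> - (L * x * r * norm y)"
        using Cauchy_Schwarz_ineq2 [of "D (T *\<^sub>R w) - D w" y] by (simp add: mult.assoc)
      then have "D (T *\<^sub>R w) \<bullet> y \<ge> norm y ^ 2 - L * x * r * norm y"
        by (simp add: inner_diff_left y_def power2_norm_eq_inner)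
      then have "(T * s) * (D (T *\<^sub>R w) \<bullet> y) \<ge> (T * s) * (norm y ^ 2 - L * x * r * norm y)"
        using T1 s by (intro mult_left_mono) auto
      then show ?thesis by (simp add: right_diff_distrib)
    qed
    also have "\<Phi> (T *\<^sub>R w) \<le> \<Phi> w - m / 4 * x\<^sup>2"
    proof -
      have "m / 4 * x\<^sup>2 \<le> \<alpha> w / 4 * (1 - T\<^sup>2)\<^sup>2"
      proof (intro mult_mono divide_right_mono m_le [OF w(1)])
        have "(1 - T\<^sup>2)\<^sup>2 = x\<^sup>2 * (1 + T)\<^sup>2" by (simp add: x_def power2_eq_square algebra_simps)
        moreover have "(1 + T)\<^sup>2 \<ge> 1" using T1 by (intro one_le_power) auto
        ultimately show "x\<^sup>2 \<le> (1 - T\<^sup>2)\<^sup>2"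
          using mult_left_mono [of 1 "(1 + T)\<^sup>2" "x\<^sup>2"] by simp
      qed (use m m_le [OF w(1)] in auto)
      then show ?thesis using nehari_Phi_le [OF w(1), of T] T1 by simp
    qed
    also have "L * (norm (- (T * s) *\<^sub>R y))\<^sup>2 \<le> 4 * L * s\<^sup>2 * (norm y)\<^sup>2"
    proof -
      have "T\<^sup>2 \<le> 2\<^sup>2" using T1 T2 by (intro power_mono) auto
      then have "T\<^sup>2 * (L * s\<^sup>2 * (norm y)\<^sup>2) \<le> 4 * (L * s\<^sup>2 * (norm y)\<^sup>2)"
        using L by (intro mult_right_mono) auto
      then show ?thesis by (simp add: power_mult_distrib mult_ac)
    qed
    also have "- (T * s) * (norm y)\<^sup>2 \<le> - (s / 2) * (norm y)\<^sup>2"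
      using T1 s by (intro mult_right_mono) auto
    \<comment> \<open>The weights of the two squares are chosen so that the part in x cancels the
      drop \<open>m / 4 * x\<^sup>2\<close> gained along the ray of w.\<close>
    also have "T * s * (L * x * r * norm y) \<le> m / 4 * x\<^sup>2 + 4 * (L * r)\<^sup>2 / m * s\<^sup>2 * (norm y)\<^sup>2"
    proof -
      have "T * s * (L * x * r * norm y) \<le> 2 * s * (L * x * r * norm y)"
        using T2 s L r by (intro mult_right_mono) (auto simp: x_def)
      also have "\<dots> = 2 * (sqrt m / 2 * x) * (2 * L * r * s * norm y / sqrt m)"
        using m by (simp add: field_simps)
      also have "\<dots> \<le> (sqrt m / 2 * x)\<^sup>2 + (2 * L * r * s * norm y / sqrt m)\<^sup>2"
        by (rule sum_squares_bound)
      also have "\<dots> = m / 4 * x\<^sup>2 + 4 * (L * r)\<^sup>2 / m * s\<^sup>2 * (norm y)\<^sup>2"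
        using m by (simp add: power_mult_distrib power_divide)
      finally show ?thesis .
    qed
    finally have "\<Phi> (T *\<^sub>R v) \<le> \<Phi> w - s / 2 * (norm y)\<^sup>2 + s * (norm y)\<^sup>2 * (s * C2)"
      by (simp add: C2_def algebra_simps power2_eq_square)
    also have "s * (norm y)\<^sup>2 * (s * C2) \<le> s * (norm y)\<^sup>2 * (1 / 4)"
      using s by (intro mult_left_mono) auto
    finally have "\<Phi> (T *\<^sub>R v) \<le> \<Phi> w - s / 4 * (norm y)\<^sup>2"
      by simp
    then have "v \<in> sublevel (\<Phi> w - s / 4 * (norm y)\<^sup>2)"
      by (simp add: sublevel_iff v0 proj_def T_def)
    then show ?thesis by (simp add: sublevel_def v_def y_def)
  qed
  then show ?thesis using that [of s] s(1) by blast
qed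

text \<open>The deformation lemma in terms of covers. Away from a neighbourhood \<open>N\<close> of
  the critical points at level c, the odd map \<open>h\<close> lowers the energy to c - \<epsilon>,
  and a cover of the lower set is pulled back along \<open>h\<close>; directions that project into
  \<open>N\<close> are covered by one ball per critical point. The level b is kept apart from c +
  \<epsilon> because compactness is only available up to \<open>cmax\<close>.\<close>

lemma sublevel_step:
  assumes r: "r > 0" and cmax: "4 * cmax \<le> a\<^sub>0 * r\<^sup>2"
    and ps: "\<And>X. (\<And>n. norm (X n) \<le> r) \<Longrightarrow> (\<lambda>n. D (X n)) \<longlonglongrightarrow> 0 \<Longrightarrow>
      \<exists>l k. strict_mono (k::nat\<Rightarrow>nat) \<and> (X \<circ> k) \<longlonglongrightarrow> l"
    and K_def: "K = {w. w \<noteq> 0 \<and> D w = 0 \<and> \<Phi> w = c}" and fin: "finite K"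
  obtains \<epsilon> where "\<epsilon> > 0"
    "\<And>b n. b \<le> c + \<epsilon> \<Longrightarrow> b \<le> cmax \<Longrightarrow> antipodal_cover n (sublevel (c - \<epsilon>)) \<Longrightarrow>
      antipodal_cover (n + card K) (sublevel b)"
proof -
  have norm_le: "norm w \<le> r" if "nehari w" "\<Phi> w \<le> cmax" for w
  proof -
    have "a\<^sub>0 * (norm w)\<^sup>2 \<le> a\<^sub>0 * r\<^sup>2" using nehari_Phi_ge [OF that(1)] that(2) cmax by simp
    then show ?thesis using a0 r by (simp add: power2_le_iff_abs_le)
  qed
  obtain s where s: "s > 0"
    "\<And>w. nehari w \<Longrightarrow> norm w \<le> r \<Longrightarrow> w - s *\<^sub>R D w \<noteq> 0"
    "\<And>w t. nehari w \<Longrightarrow> norm w \<le> r \<Longrightarrow> t > 0 \<Longrightarrow>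
       \<Phi> (t *\<^sub>R (w - s *\<^sub>R D w)) \<le> \<Phi> w - s / 4 * norm (D w) ^ 2"
    by (rule descent_step [OF r], rule that)
  \<comment> \<open>At most half the norm of every critical point in K, so a closed ball of radius d
    around one of them is disjoint from its antipode. The 1 covers the case of empty K.\<close>
  define d where "d = Min (insert 1 ((\<lambda>\<kappa>. norm \<kappa> / 2) ` K))"
  have d: "d > 0" "\<And>\<kappa>. \<kappa> \<in> K \<Longrightarrow> d < norm \<kappa>"
  proof -
    show "d > 0" unfolding d_def using fin by (subst Min_gr_iff) (auto simp: K_def)
    fix \<kappa> assume \<kappa>: "\<kappa> \<in> K"
    then have "\<kappa> \<noteq> 0" by (simp add: K_def)
    have "d \<le> norm \<kappa> / 2" unfolding d_def using fin \<kappa> by (intro Min_le) auto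
    also have "\<dots> < norm \<kappa>" using \<open>\<kappa> \<noteq> 0\<close> by simp
    finally show "d < norm \<kappa>" .
  qed
  define N where "N = (\<Union>\<kappa>\<in>K. ball \<kappa> d)"
  \<comment> \<open>Outside \<open>N\<close> there are no almost critical points near level c:
    otherwise the Palais--Smale property would produce a limit in K. The lower bound for norms of
    Nehari points excludes 0 as the limit.\<close>
  have "\<exists>\<epsilon>0>0. \<forall>w. nehari w \<longrightarrow> \<bar>\<Phi> w - c\<bar> \<le> \<epsilon>0 \<longrightarrow> \<Phi> w \<le> cmax \<longrightarrow> w \<notin> N \<longrightarrow> norm (D w) \<ge> \<epsilon>0"
  proof (rule ccontr)
    assume "\<not> ?thesis"
    then have "\<exists>w. nehari w \<and> \<bar>\<Phi> w - c\<bar> \<le> 1 / real (Suc n) \<and> \<Phi> w \<le> cmax \<and> w \<notin> N \<and> norm (D w) < 1 / real (Suc n)" for n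
      by (metis not_le of_nat_0_less_iff zero_less_Suc zero_less_divide_1_iff)
    then obtain X where X: "\<And>n. nehari (X n)" "\<And>n. \<bar>\<Phi> (X n) - c\<bar> \<le> 1 / real (Suc n)"
      "\<And>n. \<Phi> (X n) \<le> cmax" "\<And>n. X n \<notin> N" "\<And>n. norm (D (X n)) < 1 / real (Suc n)"
      by metis
    have lim: "(\<lambda>n. 1 / real (Suc n)) \<longlonglongrightarrow> 0"
      by (rule lim_inverse_n' [THEN LIMSEQ_Suc])
    have D0: "(\<lambda>n. D (X n)) \<longlonglongrightarrow> 0"
      by (rule Lim_null_comparison [OF _ lim]) (use X(5) in \<open>auto intro!: always_eventually less_imp_le\<close>)
    have Pc: "(\<lambda>n. \<Phi> (X n)) \<longlonglongrightarrow> c"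
      by (rule LIM_zero_cancel, rule Lim_null_comparison [OF _ lim]) (use X(2) in \<open>auto intro!: always_eventually\<close>)
    obtain l k where lk: "strict_mono k" "(X \<circ> k) \<longlonglongrightarrow> l"
      using ps [of X] norm_le X D0 by blast
    have "(\<lambda>n. D ((X \<circ> k) n)) \<longlonglongrightarrow> D l" "(\<lambda>n. \<Phi> ((X \<circ> k) n)) \<longlonglongrightarrow> \<Phi> l"
      using continuous_on_tendsto_compose [OF continuous_D lk(2)] continuous_on_tendsto_compose [OF continuous_Phi lk(2)] by auto
    then have Dl: "D l = 0" and Pl: "\<Phi> l = c"
      using LIMSEQ_subseq_LIMSEQ [OF D0 lk(1)] LIMSEQ_subseq_LIMSEQ [OF Pc lk(1)]
      by (auto simp: comp_def dest: LIMSEQ_unique)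
    have "(norm l)\<^sup>2 \<ge> min 1 (a\<^sub>0 / (2 * \<Gamma>))"
    proof (rule tendsto_lowerbound)
      show "(\<lambda>n. (norm ((X \<circ> k) n))\<^sup>2) \<longlonglongrightarrow> (norm l)\<^sup>2" by (intro tendsto_intros lk)
      show "\<forall>\<^sub>F n in sequentially. min 1 (a\<^sub>0 / (2 * \<Gamma>)) \<le> (norm ((X \<circ> k) n))\<^sup>2"
        using nehari_norm_ge X(1) by (intro always_eventually) auto
    qed simp
    then have "l \<noteq> 0" using a0 Gamma_pos by (auto simp: min_le_iff_disj divide_le_0_iff)
    then have "l \<in> K" using Dl Pl by (auto simp: K_def)
    moreover obtain n where "dist l ((X \<circ> k) n) < d"
      using lk(2) d(1) by (metis LIMSEQ_iff_nz dist_commute lim_sequentially order_refl)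
    ultimately have "X (k n) \<in> N" by (auto simp: N_def)
    then show False using X(4) by blast
  qed
  then obtain \<epsilon>0 where \<epsilon>0: "\<epsilon>0 > 0"
    "\<And>w. nehari w \<Longrightarrow> \<bar>\<Phi> w - c\<bar> \<le> \<epsilon>0 \<Longrightarrow> \<Phi> w \<le> cmax \<Longrightarrow> w \<notin> N \<Longrightarrow> norm (D w) \<ge> \<epsilon>0"
    by blast
  \<comment> \<open>With a gradient of norm at least \<open>\<epsilon>0\<close> one step gains at
    least \<open>2 * \<epsilon>\<close>, enough to pass from c + \<epsilon> to c -
    \<epsilon>.\<close>
  define \<epsilon> where "\<epsilon> = min \<epsilon>0 (s * \<epsilon>0\<^sup>2 / 8)"
  have \<epsilon>: "\<epsilon> > 0" "\<epsilon> \<le> \<epsilon>0" "2 * \<epsilon> \<le> s / 4 * \<epsilon>0\<^sup>2" using \<epsilon>0 s by (auto simp: \<epsilon>_def)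
  define h where "h u = proj u - s *\<^sub>R D (proj u)" for u
  show ?thesis
  proof (rule that [OF \<epsilon>(1)])
    fix b n assume b: "b \<le> c + \<epsilon>" "b \<le> cmax" and cov: "antipodal_cover n (sublevel (c - \<epsilon>))"
    let ?S = "sublevel b" and ?T = "sublevel (c - \<epsilon>)"
    have S: "u \<noteq> 0" "nehari (proj u)" "\<Phi> (proj u) \<le> b" "norm (proj u) \<le> r" if "u \<in> ?S" for u
      using that b nehari_proj [of u] norm_le [of "proj u"] by (auto simp: sublevel_iff)
    have Ssub: "?S \<subseteq> - {0}" using S by auto
    have cproj: "continuous_on ?S proj"
      using continuous_proj Ssub by (rule continuous_on_subset)
    have ch: "continuous_on ?S h"
      unfolding h_def by (intro continuous_intros cproj continuous_on_compose2 [OF continuous_D cproj]) auto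
    define S1 where "S1 = {u\<in>?S. proj u \<notin> N}"
    have S1: "closedin (top_of_set ?S) S1"
    proof -
      have "closed (- N)" unfolding N_def by (intro closed_Compl open_UN) auto
      then have "closedin (top_of_set ?S) (?S \<inter> proj -` (- N))"
        by (rule continuous_closedin_preimage [OF cproj])
      moreover have "?S \<inter> proj -` (- N) = S1" by (auto simp: S1_def)
      ultimately show ?thesis by simp
    qed
    have hT: "h u \<in> ?T" if u: "u \<in> S1" for u
    proof -
      have u': "u \<in> ?S" "proj u \<notin> N" using u by (auto simp: S1_def)
      have "\<Phi> (proj u) - s / 4 * norm (D (proj u)) ^ 2 \<le> c - \<epsilon>"
      \<comment> \<open>Below c - \<epsilon> the gradient may be small, but there the step only has
        to keep the energy from rising.\<close>
      proof (cases "\<Phi> (proj u) \<le> c - \<epsilon>")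
        case True
        then show ?thesis using s(1) by (smt (verit) divide_nonneg_pos mult_nonneg_nonneg zero_le_power2)
      next
        case False
        then have "norm (D (proj u)) \<ge> \<epsilon>0"
          using S [OF u'(1)] b \<epsilon> u'(2) by (intro \<epsilon>0) auto
        then have "\<epsilon>0\<^sup>2 \<le> (norm (D (proj u)))\<^sup>2" using \<epsilon>0 by (intro power_mono) auto
        then have "s / 4 * \<epsilon>0\<^sup>2 \<le> s / 4 * (norm (D (proj u)))\<^sup>2" using s by (intro mult_left_mono) auto
        then show ?thesis using \<epsilon>(3) S(3) [OF u'(1)] b by linarith
      qed
      then show ?thesis unfolding sublevel_def h_def
        using s(2,3) S [OF u'(1)] by (auto intro: order.trans)
    qed
    have h_minus: "h (- u) = - h u" if "u \<in> ?S" for u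
      using S(1) [OF that] by (simp add: h_def proj_minus D_minus)
    obtain F where F: "\<And>i. i < n \<Longrightarrow> closedin (top_of_set ?T) (F i)" "\<And>i. i < n \<Longrightarrow> F i \<inter> uminus ` F i = {}"
        "?T \<subseteq> (\<Union>i<n. F i \<union> uminus ` F i)"
      using cov by (auto simp: antipodal_cover_def)
    obtain \<kappa> where \<kappa>: "bij_betw \<kappa> {..<card K} K"
      using ex_bij_betw_nat_finite [OF fin] by (auto simp: atLeast0LessThan)
    define G where "G i = (if i < n then {u\<in>S1. h u \<in> F i} else {u\<in>?S. proj u \<in> cball (\<kappa> (i - n)) d})" for i
    show "antipodal_cover (n + card K) ?S"
      unfolding antipodal_cover_def
    proof (intro exI [of _ G] conjI allI impI)
      fix i assume i: "i < n + card K"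
      show "closedin (top_of_set ?S) (G i)"
      proof (cases "i < n")
        case True
        have "h ` S1 \<subseteq> ?T" using hT by auto
        moreover have "continuous_on S1 h" using ch by (rule continuous_on_subset) (auto simp: S1_def)
        ultimately have "closedin (top_of_set S1) (S1 \<inter> h -` F i)"
          using F(1) [OF True] by (intro continuous_closedin_preimage_gen) auto
        moreover have "S1 \<inter> h -` F i = G i" using True by (auto simp: G_def)
        ultimately show ?thesis using S1 by (metis closedin_trans)
      next
        case False
        have "closedin (top_of_set ?S) (?S \<inter> proj -` cball (\<kappa> (i - n)) d)"
          by (rule continuous_closedin_preimage [OF cproj]) simp
        moreover have "?S \<inter> proj -` cball (\<kappa> (i - n)) d = G i" using False by (auto simp: G_def)
        ultimately show ?thesis by simp
      qed
      show "G i \<inter> uminus ` G i = {}"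
      proof (cases "i < n")
        case True
        have False if u: "u \<in> G i" "- u \<in> G i" for u
        proof -
          have "u \<in> ?S" using u True by (auto simp: G_def S1_def)
          then have "h u \<in> F i" "- h u \<in> F i" using u True h_minus by (auto simp: G_def)
          then have "h u \<in> F i \<inter> uminus ` F i" by (auto intro: image_eqI [of _ _ "- h u"])
          then show False using F(2) [OF True] by auto
        qed
        then show ?thesis by force
      next
        case False
        then have "\<kappa> (i - n) \<in> K" using bij_betwE [OF \<kappa>] i by auto
        then have d': "d < norm (\<kappa> (i - n))" by (rule d(2))
        have False if u: "u \<in> G i" "- u \<in> G i" for u
        proof -
          have "norm (\<kappa> (i - n) - proj u) \<le> d" "norm (\<kappa> (i - n) + proj u) \<le> d"
            using u False S(1) [of u] by (auto simp: G_def dist_norm proj_minus)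
          then have "norm ((\<kappa> (i - n) - proj u) + (\<kappa> (i - n) + proj u)) \<le> 2 * d"
            using norm_triangle_ineq [of "\<kappa> (i - n) - proj u" "\<kappa> (i - n) + proj u"] by linarith
          then have "norm (2 *\<^sub>R \<kappa> (i - n)) \<le> 2 * d" by (simp add: scaleR_2)
          then show False using d' by simp
        qed
        then show ?thesis by force
      qed
    next
      show "?S \<subseteq> (\<Union>i<n + card K. G i \<union> uminus ` G i)"
      proof
        fix u assume u: "u \<in> ?S"
        have mem: "u \<in> G i \<union> uminus ` G i" if "u \<in> G i \<or> - u \<in> G i" for i
          using that by (auto intro: image_eqI [of _ _ "- u"])
        show "u \<in> (\<Union>i<n + card K. G i \<union> uminus ` G i)"
        proof (cases "proj u \<in> N")
          case True
          then obtain k where k: "k \<in> K" "dist k (proj u) < d" by (auto simp: N_def)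
          then obtain j where j: "j < card K" "\<kappa> j = k" using \<kappa> by (metis bij_betw_iff_bijections lessThan_iff)
          then have "u \<in> G (n + j)" using u k by (simp add: G_def)
          then show ?thesis using j mem by (intro UN_I [of "n + j"]) auto
        next
          case False
          have m: "- u \<in> ?S" using u by (rule sublevel_minus)
          have uS1: "u \<in> S1" using u False by (simp add: S1_def)
          obtain i where i: "i < n" "h u \<in> F i \<or> - h u \<in> F i"
            using F(3) hT [OF uS1] by force
          show ?thesis
          proof (cases "h u \<in> F i")
            case True
            then have "u \<in> G i" using uS1 i by (simp add: G_def)
            then show ?thesis using i mem by (intro UN_I [of i]) auto
          next
            case h: False
            have "- proj u \<notin> N"
            proof
              assume "- proj u \<in> N"
              then obtain k where k: "k \<in> K" "dist k (- proj u) < d" by (auto simp: N_def)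
              moreover have "dist (- k) (proj u) = dist k (- proj u)"
                using dist_minus [of k "- proj u"] by simp
              ultimately have "- k \<in> K" "dist (- k) (proj u) < d"
                by (auto simp: K_def D_minus Phi_minus)
              then show False using False by (auto simp: N_def)
            qed
            then have "- u \<in> G i"
              using h i m h_minus [OF u] S(1) [OF u] by (simp add: G_def S1_def proj_minus)
            then show ?thesis using i mem by (intro UN_I [of i]) auto
          qed
        qed
      qed
    qed
  qed
qed

text \<open>Instead of minimax values, a level c is called good if the sublevel has an antipodal
  cover by as many pairs as there are critical points up to c. Levels c \<le> 0 are good because
  their sublevel is empty, and \<open>sublevel_step\<close> at the infimum of the bad levels shows
  that a bad level just above it is good.\<close>

theorem octa_le_card_critical:
  assumes r: "r > 0" and cmax: "4 * cmax \<le> a\<^sub>0 * r\<^sup>2"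
    and ps: "\<And>X. (\<And>n. norm (X n) \<le> r) \<Longrightarrow> (\<lambda>n. D (X n)) \<longlonglongrightarrow> 0 \<Longrightarrow>
      \<exists>l k. strict_mono (k::nat\<Rightarrow>nat) \<and> (X \<circ> k) \<longlonglongrightarrow> l"
    and fin: "finite {w. w \<noteq> 0 \<and> D w = 0 \<and> \<Phi> w \<le> cmax}"
    and octa: "octa \<phi> k \<subseteq> sublevel cmax"
  shows "k < card {w. w \<noteq> 0 \<and> D w = 0 \<and> \<Phi> w \<le> cmax}"
proof -
  define N where "N c = {w. w \<noteq> 0 \<and> D w = 0 \<and> \<Phi> w \<le> c}" for c
  have N_fin: "finite (N c)" if "c \<le> cmax" for c
    using fin by (rule rev_finite_subset) (use that in \<open>auto simp: N_def\<close>)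
  define good where "good c \<longleftrightarrow> antipodal_cover (card (N c)) (sublevel c)" for c
  have good0: "good c" if "c \<le> 0" for c
  proof -
    have "sublevel c = {}"
      using that nehari_Phi_pos [OF nehari_proj] by (force simp: sublevel_iff)
    then show ?thesis unfolding good_def antipodal_cover_def
      by (intro exI [of _ "\<lambda>_. {}"]) auto
  qed
  have "good cmax"
  proof (rule ccontr)
    assume bad: "\<not> good cmax"
    define B where "B = {c. c \<le> cmax \<and> \<not> good c}"
    have B: "cmax \<in> B" "bdd_below B"
      using bad good0 by (auto simp: B_def intro!: bdd_belowI [of _ 0] linear less_imp_le not_le_imp_less)
    define \<sigma> where "\<sigma> = Inf B"
    have \<sigma>: "\<sigma> \<le> cmax" unfolding \<sigma>_def using B by (intro cInf_lower)
    have below: "good c" if "c < \<sigma>" for c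
      using that \<sigma> cInf_lower [OF _ B(2), of c] by (force simp: B_def \<sigma>_def)
    have Kfin: "finite {w. w \<noteq> 0 \<and> D w = 0 \<and> \<Phi> w = \<sigma>}"
      using N_fin [OF \<sigma>] by (rule rev_finite_subset) (auto simp: N_def)
    obtain \<epsilon> where \<epsilon>: "\<epsilon> > 0"
      "\<And>b n. b \<le> \<sigma> + \<epsilon> \<Longrightarrow> b \<le> cmax \<Longrightarrow> antipodal_cover n (sublevel (\<sigma> - \<epsilon>)) \<Longrightarrow>
        antipodal_cover (n + card {w. w \<noteq> 0 \<and> D w = 0 \<and> \<Phi> w = \<sigma>}) (sublevel b)"
      by (rule sublevel_step [OF r cmax ps refl Kfin]) (assumption | rule that)+
    obtain b where b: "b \<in> B" "b < \<sigma> + \<epsilon>"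
      using cInf_lessD [of B "\<sigma> + \<epsilon>"] B(1) \<epsilon>(1) by (auto simp: \<sigma>_def)
    have "\<sigma> \<le> b" unfolding \<sigma>_def using b B by (intro cInf_lower)
    have "antipodal_cover (card (N (\<sigma> - \<epsilon>))) (sublevel (\<sigma> - \<epsilon>))"
      using below [of "\<sigma> - \<epsilon>"] \<epsilon>(1) by (simp add: good_def)
    then have "antipodal_cover (card (N (\<sigma> - \<epsilon>)) + card {w. w \<noteq> 0 \<and> D w = 0 \<and> \<Phi> w = \<sigma>}) (sublevel b)"
      using b by (intro \<epsilon>) (auto simp: B_def)
    moreover have "card (N (\<sigma> - \<epsilon>)) + card {w. w \<noteq> 0 \<and> D w = 0 \<and> \<Phi> w = \<sigma>} \<le> card (N b)"
    proof -
      have "card (N (\<sigma> - \<epsilon>)) + card {w. w \<noteq> 0 \<and> D w = 0 \<and> \<Phi> w = \<sigma>}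
          = card (N (\<sigma> - \<epsilon>) \<union> {w. w \<noteq> 0 \<and> D w = 0 \<and> \<Phi> w = \<sigma>})"
        using \<epsilon>(1) \<sigma> by (intro card_Un_disjoint [symmetric] N_fin Kfin) (auto simp: N_def)
      also have "\<dots> \<le> card (N b)"
        using b \<open>\<sigma> \<le> b\<close> \<epsilon>(1) by (intro card_mono N_fin) (auto simp: N_def B_def)
      finally show ?thesis .
    qed
    ultimately have "good b" unfolding good_def by (rule antipodal_cover_mono)
    then show False using b by (simp add: B_def)
  qed
  then show ?thesis
    using antipodal_cover_octa octa by (auto simp: good_def N_def)
qed

end

section \<open>Test functions\<close>

lemma partial_deriv_eq: "(f has_derivative f') (at x) \<Longrightarrow> partial_deriv i f x = f' (axis i 1)"
  unfolding partial_deriv_def by (metis frechet_derivative_at)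

lemma has_derivative_partial:
  "f differentiable at x \<Longrightarrow> (f has_derivative (\<lambda>h. \<Sum>i\<in>UNIV. h $ i * partial_deriv i f x)) (at x)"
proof -
  assume "f differentiable at x"
  then obtain f' where f': "(f has_derivative f') (at x)" by (auto simp: differentiable_def)
  then have "linear f'" by (rule has_derivative_linear)
  have "f' h = (\<Sum>i\<in>UNIV. h $ i * partial_deriv i f x)" for h
  proof -
    have "f' h = f' (\<Sum>i\<in>UNIV. (h $ i) *\<^sub>R axis i 1)"
      by (simp add: basis_expansion flip: scalar_mult_eq_scaleR)
    also have "\<dots> = (\<Sum>i\<in>UNIV. h $ i * f' (axis i 1))"
      by (simp add: linear_sum [OF \<open>linear f'\<close>] linear_scale [OF \<open>linear f'\<close>])
    finally show ?thesis by (simp add: partial_deriv_eq [OF f'])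
  qed
  then show ?thesis using f' by (simp add: has_derivative_eq_rhs fun_eq_iff)
qed

lemma partial_deriv_add:
  assumes "f differentiable at x" "g differentiable at x"
  shows "partial_deriv i (\<lambda>x. f x + g x) x = partial_deriv i f x + partial_deriv i g x"
proof -
  obtain f' g' where *: "(f has_derivative f') (at x)" "(g has_derivative g') (at x)"
    using assms by (auto simp: differentiable_def)
  show ?thesis
    using partial_deriv_eq [OF has_derivative_add [OF *]] * by (simp add: partial_deriv_eq)
qed

lemma partial_deriv_cmult:
  assumes "f differentiable at x"
  shows "partial_deriv i (\<lambda>x. c * f x) x = c * partial_deriv i f x"
proof -
  obtain f' where f': "(f has_derivative f') (at x)" using assms by (auto simp: differentiable_def)
  then have "((\<lambda>x. c * f x) has_derivative (\<lambda>h. c * f' h)) (at x)"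
    by (rule has_derivative_mult_right)
  then show ?thesis using f' by (simp add: partial_deriv_eq)
qed

lemma partial_deriv_mult:
  assumes "f differentiable at x" "g differentiable at x"
  shows "partial_deriv i (\<lambda>x. f x * g x) x = f x * partial_deriv i g x + partial_deriv i f x * g x"
proof -
  obtain f' g' where *: "(f has_derivative f') (at x)" "(g has_derivative g') (at x)"
    using assms by (auto simp: differentiable_def)
  show ?thesis
    using partial_deriv_eq [OF has_derivative_mult [OF *]] * by (simp add: partial_deriv_eq)
qed

lemma C_k_add: "C_k k f \<Longrightarrow> C_k k g \<Longrightarrow> C_k k (\<lambda>x. f x + g x)"
proof (induction k arbitrary: f g)
  case 0
  then show ?case by (simp add: continuous_on_add)
next
  case (Suc k)
  then have "partial_deriv i (\<lambda>x. f x + g x) = (\<lambda>x. partial_deriv i f x + partial_deriv i g x)" for i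
    by (auto simp: partial_deriv_add)
  with Suc show ?case by (auto intro!: differentiable_add)
qed

lemma C_k_cmult: "C_k k f \<Longrightarrow> C_k k (\<lambda>x. c * f x)"
proof (induction k arbitrary: f)
  case 0
  then show ?case by (simp add: continuous_on_mult)
next
  case (Suc k)
  then have "partial_deriv i (\<lambda>x. c * f x) = (\<lambda>x. c * partial_deriv i f x)" for i
    by (auto simp: partial_deriv_cmult)
  with Suc show ?case by (auto intro!: differentiable_mult)
qed

lemma test_functions_add:
  assumes "f \<in> test_functions" "g \<in> test_functions"
  shows "(\<lambda>x. f x + g x) \<in> test_functions"
proof -
  have "{x. f x + g x \<noteq> 0} \<subseteq> {x. f x \<noteq> 0} \<union> {x. g x \<noteq> 0}" by auto
  moreover have "bounded ({x. f x \<noteq> 0} \<union> {x. g x \<noteq> 0})"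
    using assms by (simp add: test_functions_def)
  ultimately have "bounded {x. f x + g x \<noteq> 0}" by (rule bounded_subset [rotated])
  then show ?thesis using assms by (auto simp: test_functions_def intro!: C_k_add)
qed

lemma test_functions_cmult:
  assumes "f \<in> test_functions"
  shows "(\<lambda>x. c * f x) \<in> test_functions"
proof -
  have "bounded {x. f x \<noteq> 0}" using assms by (simp add: test_functions_def)
  then have "bounded {x. c * f x \<noteq> 0}" by (rule bounded_subset) auto
  then show ?thesis using assms by (auto simp: test_functions_def intro!: C_k_cmult)
qed

lemma test_functions_0: "(\<lambda>x. 0) \<in> test_functions"
proof -
  have "C_k k (\<lambda>x. 0)" for k
  proof (induction k)
    case (Suc k)
    have "partial_deriv i (\<lambda>x. 0) = (\<lambda>x. 0)" for i
      by (rule ext, rule partial_deriv_eq [OF has_derivative_const])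
    with Suc show ?case by simp
  qed simp
  then show ?thesis by (simp add: test_functions_def)
qed

lemma test_functions_continuous: "\<phi> \<in> test_functions \<Longrightarrow> continuous_on UNIV \<phi>"
  using C_k.simps(1) [of \<phi>] by (auto simp: test_functions_def)

lemma partial_deriv_0_outside:
  assumes "x \<notin> closure {x. \<phi> x \<noteq> 0}"
  shows "partial_deriv i \<phi> x = 0"
proof -
  have "((\<lambda>_. 0) has_derivative (\<lambda>_. 0)) (at x)" by simp
  then have "(\<phi> has_derivative (\<lambda>_. 0)) (at x)"
  proof (rule has_derivative_transform_within_open [of _ _ x UNIV "- closure {x. \<phi> x \<noteq> 0}"])
    show "0 = \<phi> y" if "y \<in> - closure {x. \<phi> x \<noteq> 0}" for y
      using that closure_subset [of "{x. \<phi> x \<noteq> 0}"] by auto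
  qed (use assms in auto)
  then show ?thesis by (simp add: partial_deriv_eq)
qed

lemma test_functions_partial_deriv:
  assumes "\<phi> \<in> test_functions"
  shows "partial_deriv i \<phi> \<in> test_functions"
proof -
  have C: "C_k k (partial_deriv i \<phi>)" for k
    using assms C_k.simps(2) [of k \<phi>] by (auto simp: test_functions_def)
  have "{x. partial_deriv i \<phi> x \<noteq> 0} \<subseteq> closure {x. \<phi> x \<noteq> 0}"
    using partial_deriv_0_outside by blast
  moreover have "bounded (closure {x. \<phi> x \<noteq> 0})" using assms by (simp add: test_functions_def bounded_closure)
  ultimately have "bounded {x. partial_deriv i \<phi> x \<noteq> 0}" by (blast intro: bounded_subset)
  with C show ?thesis by (simp add: test_functions_def)
qed

subsection \<open>Smooth bumps on boxes\<close>

text \<open>Only the existence of derivatives is recorded. Continuity of the k-th derivative follows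
  from the existence of the next one, which is why \<open>C_k_prod\<close> asks for
  \<open>Suc k\<close>.\<close>

primrec diff_k :: "nat \<Rightarrow> (real \<Rightarrow> real) \<Rightarrow> bool" where
  "diff_k 0 f \<longleftrightarrow> True"
| "diff_k (Suc k) f \<longleftrightarrow> (\<exists>f'. (\<forall>x. (f has_real_derivative f' x) (at x)) \<and> diff_k k f')"

lemma diff_k_lower: "diff_k (Suc k) f \<Longrightarrow> diff_k k f"
  by (induction k arbitrary: f) auto

lemma diff_k_add: "diff_k k f \<Longrightarrow> diff_k k g \<Longrightarrow> diff_k k (\<lambda>x. f x + g x)"
proof (induction k arbitrary: f g)
  case (Suc k)
  then obtain f' g' where "\<And>x. (f has_real_derivative f' x) (at x)" "diff_k k f'"
    "\<And>x. (g has_real_derivative g' x) (at x)" "diff_k k g'" by auto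
  then show ?case
    using Suc.IH by (auto intro!: exI [of _ "\<lambda>x. f' x + g' x"] derivative_intros)
qed simp

lemma diff_k_mult: "diff_k k f \<Longrightarrow> diff_k k g \<Longrightarrow> diff_k k (\<lambda>x. f x * g x)"
proof (induction k arbitrary: f g)
  case (Suc k)
  then obtain f' g' where *: "\<And>x. (f has_real_derivative f' x) (at x)" "diff_k k f'"
    "\<And>x. (g has_real_derivative g' x) (at x)" "diff_k k g'" by auto
  have "diff_k k (\<lambda>x. f' x * g x + g' x * f x)"
    using Suc * diff_k_lower by (intro diff_k_add Suc.IH) blast+
  then show ?case
    using * by (auto intro!: exI [of _ "\<lambda>x. f' x * g x + g' x * f x"] derivative_eq_intros)
qed simp

lemma diff_k_const: "diff_k k (\<lambda>x. c)"
  by (induction k arbitrary: c) (auto intro!: exI [of _ "\<lambda>_. 0"])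

lemma diff_k_affine: "diff_k k f \<Longrightarrow> diff_k k (\<lambda>x. f (a * x + b))"
proof (induction k arbitrary: f)
  case (Suc k)
  then obtain f' where *: "\<And>x. (f has_real_derivative f' x) (at x)" "diff_k k f'" by auto
  have "((\<lambda>x. f (a * x + b)) has_real_derivative f' (a * x + b) * a) (at x)" for x
    by (rule DERIV_chain2 [OF *(1)]) (auto intro!: derivative_eq_intros)
  then show ?case
    using Suc.IH [OF *(2)] by (auto intro!: exI [of _ "\<lambda>x. f' (a * x + b) * a"] diff_k_mult diff_k_const)
qed simp

text \<open>The flat function exp(-1/y) divided by powers of y; the derivative of each member is a
  linear combination of two others.\<close>

definition expm :: "nat \<Rightarrow> real \<Rightarrow> real" where
  "expm j y = (if y \<le> 0 then 0 else exp (- 1 / y) / y ^ j)"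

text \<open>The exponential series bounds exp(1/y) from below by its term of order j + 2. Quadratic
  decay at 0 is what makes the difference quotient there tend to 0.\<close>

lemma expm_le_square: "\<bar>expm j y\<bar> \<le> fact (j + 2) * y\<^sup>2"
proof (cases "y > 0")
  case True
  define c :: real where "c = fact (j + 2)"
  have c: "c > 0" unfolding c_def by (rule fact_gt_zero)
  have "(1 / y) ^ (j + 2) / c \<le> exp (1 / y)"
    unfolding exp_def c_def using True summable_exp_generic [of "1 / y"]
      sum_le_suminf [of "\<lambda>n. (1 / y) ^ n /\<^sub>R fact n" "{j + 2}"]
    by (simp del: fact_Suc power_Suc add: divide_inverse mult.commute)
  then have "1 \<le> c * exp (1 / y) * y ^ (j + 2)"
    using True c by (simp add: power_divide pos_divide_le_eq mult.commute mult.left_commute del: power_Suc)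
  then have "exp (- 1 / y) \<le> c * y ^ (j + 2)"
    using True by (simp add: exp_minus divide_simps mult_ac del: power_Suc)
  then have "exp (- 1 / y) / y ^ j \<le> c * y\<^sup>2"
    using True by (simp add: pos_divide_le_eq power_add power2_eq_square mult_ac)
  then show ?thesis using True by (simp add: expm_def c_def del: fact_Suc)
qed (simp add: expm_def)

lemma expm_deriv:
  "(expm j has_real_derivative (expm (j + 2) y - j * expm (j + 1) y)) (at y)"
proof -
  consider "y > 0" | "y < 0" | "y = 0" by linarith
  then show ?thesis
  proof cases
    case 1
    have "((\<lambda>y. exp (- 1 / y)) has_real_derivative exp (- 1 / y) / y\<^sup>2) (at y)"
      using 1 by (auto intro!: derivative_eq_intros simp: field_simps power2_eq_square)
    from DERIV_divide [OF this DERIV_pow [of j y]]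
    have "((\<lambda>y. exp (- 1 / y) / y ^ j) has_real_derivative
        (exp (- 1 / y) / y\<^sup>2 * y ^ j - exp (- 1 / y) * (real j * y ^ (j - Suc 0))) / (y ^ j * y ^ j)) (at y)"
      using 1 by simp
    also have "(exp (- 1 / y) / y\<^sup>2 * y ^ j - exp (- 1 / y) * (real j * y ^ (j - Suc 0))) / (y ^ j * y ^ j)
        = expm (j + 2) y - j * expm (j + 1) y"
    proof (cases j)
      case (Suc n)
      have aux: "(E / y\<^sup>2 * (y * z) - E * (k * z)) / ((y * z) * (y * z)) = E / (y * (y * (y * z))) - k * (E / (y * (y * z)))"
        if "z \<noteq> 0" for E z k :: real
        using that 1 by (simp add: field_simps power2_eq_square)
      have e: "expm (Suc n + 2) y = exp (- 1 / y) / (y * (y * (y * y ^ n)))"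
        "expm (Suc n + 1) y = exp (- 1 / y) / (y * (y * y ^ n))"
        using 1 by (auto simp: expm_def)
      show ?thesis
        unfolding Suc e using aux [of "y ^ n" "exp (- 1 / y)" "real (Suc n)"] 1 by simp
    qed (use 1 in \<open>simp add: expm_def power2_eq_square\<close>)
    finally have "((\<lambda>y. exp (- 1 / y) / y ^ j) has_real_derivative (expm (j + 2) y - j * expm (j + 1) y)) (at y)" .
    then show ?thesis
      by (rule has_field_derivative_transform_within_open [of _ _ _ "{0<..}"]) (use 1 in \<open>auto simp: expm_def\<close>)
  next
    case 2
    have "((\<lambda>y. 0) has_real_derivative (expm (j + 2) y - j * expm (j + 1) y)) (at y)"
      using 2 by (simp add: expm_def)
    then show ?thesis
      by (rule has_field_derivative_transform_within_open [of _ _ _ "{..<0}"]) (use 2 in \<open>auto simp: expm_def\<close>)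
  next
    case 3
    have "((\<lambda>h. expm j h / h) \<longlongrightarrow> 0) (at 0)"
    proof (rule Lim_null_comparison)
      show "\<forall>\<^sub>F h in at 0. norm (expm j h / h) \<le> fact (j + 2) * \<bar>h\<bar>"
      proof (rule always_eventually, rule allI)
        fix h :: real
        have "\<bar>expm j h\<bar> \<le> fact (j + 2) * \<bar>h\<bar> * \<bar>h\<bar>"
          using expm_le_square [of j h] by (simp add: power2_eq_square mult.assoc del: fact_Suc)
        then show "norm (expm j h / h) \<le> fact (j + 2) * \<bar>h\<bar>"
          by (cases "h = 0") (simp_all add: pos_divide_le_eq del: fact_Suc)
      qed
      show "((\<lambda>h. fact (j + 2) * \<bar>h\<bar>) \<longlongrightarrow> 0) (at (0::real))"
        by (auto intro!: tendsto_eq_intros)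
    qed
    then show ?thesis using 3 by (simp add: DERIV_def expm_def)
  qed
qed

lemma diff_k_expm: "diff_k k (expm j)"
proof (induction k arbitrary: j)
  case (Suc k)
  have "diff_k k (\<lambda>y. expm (j + 2) y + (- real j) * expm (j + 1) y)"
    by (intro diff_k_add diff_k_mult diff_k_const Suc)
  then show ?case
    using expm_deriv [of j] by (auto intro!: exI [of _ "\<lambda>y. expm (j + 2) y - j * expm (j + 1) y"])
qed simp

text \<open>A partial derivative of a product of functions of single coordinates is again such a
  product, with one factor replaced by its derivative, so the class is closed under
  differentiation.\<close>

lemma C_k_prod:
  assumes "\<And>i. diff_k (Suc k) (h i)"
  shows "C_k k (\<lambda>x. \<Prod>i\<in>UNIV. h i (x $ i))"
  using assms
proof (induction k arbitrary: h)
  case 0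
  have "continuous_on UNIV (h i)" for i
  proof -
    obtain f' where "\<And>x. (h i has_real_derivative f' x) (at x)" using 0 [of i] by auto
    then show ?thesis by (rule DERIV_continuous_on)
  qed
  note c = this
  have "continuous_on UNIV (\<lambda>x::R3. h i (x $ i))" for i
    by (rule continuous_on_compose2 [OF c]) (auto intro: continuous_intros)
  then show ?case
    by (auto intro!: continuous_on_prod)
next
  case (Suc k)
  obtain h' where h': "\<And>i x. (h i has_real_derivative h' i x) (at x)" "\<And>i. diff_k (Suc k) (h' i)"
    using Suc.prems unfolding diff_k.simps(2) [of "Suc k"] by metis
  have d: "((\<lambda>x. \<Prod>i\<in>UNIV. h i (x $ i)) has_derivative
     (\<lambda>y. \<Sum>i\<in>UNIV. (y $ i * h' i (x $ i)) * (\<Prod>j\<in>UNIV - {i}. h j (x $ j)))) (at x)" for x :: R3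
  proof (rule has_derivative_prod)
    fix i :: 3
    have "(h i has_derivative (\<lambda>t. t * h' i (x $ i))) (at (x $ i))"
      using h'(1) [of i "x $ i"] by (simp add: has_field_derivative_def mult_commute_abs)
    moreover have "((\<lambda>x. x $ i) has_derivative (\<lambda>y. y $ i)) (at x)"
      by (intro bounded_linear_imp_has_derivative bounded_linear_vec_nth)
    ultimately show "((\<lambda>x. h i (x $ i)) has_derivative (\<lambda>y. y $ i * h' i (x $ i))) (at x)"
      using has_derivative_compose by blast
  qed
  have pd: "partial_deriv m (\<lambda>x. \<Prod>i\<in>UNIV. h i (x $ i)) = (\<lambda>x. \<Prod>i\<in>UNIV. (h(m := h' m)) i (x $ i))" for m
  proof
    fix x :: R3
    have "partial_deriv m (\<lambda>x. \<Prod>i\<in>UNIV. h i (x $ i)) x = h' m (x $ m) * (\<Prod>j\<in>UNIV - {m}. h j (x $ j))"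
      unfolding partial_deriv_eq [OF d] by (subst sum.remove [of _ m]) (auto simp: axis_def intro!: sum.neutral)
    also have "\<dots> = (\<Prod>i\<in>UNIV. (h(m := h' m)) i (x $ i))"
      by (subst (2) prod.remove [of _ m]) (auto intro!: prod.cong)
    finally show "partial_deriv m (\<lambda>x. \<Prod>i\<in>UNIV. h i (x $ i)) x = \<dots>" .
  qed
  have "C_k k (\<lambda>x. \<Prod>i\<in>UNIV. (h(m := h' m)) i (x $ i))" for m
  proof (rule Suc.IH)
    show "diff_k (Suc k) ((h(m := h' m)) i)" for i
      using h'(2) Suc.prems [of i] diff_k_lower [of "Suc k" "h i"] by (cases "i = m") auto
  qed
  then show ?case using d pd by (auto simp: differentiable_def)
qed

text \<open>The scale n sharpens the bump: as n grows it tends to the indicator of the open box,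
  which drives the uniqueness of weak gradients. The value n = 1 supplies the directions with
  disjoint supports.\<close>

definition bump :: "real \<Rightarrow> R3 \<Rightarrow> R3 \<Rightarrow> R3 \<Rightarrow> real" where
  "bump n a b x = (\<Prod>i\<in>UNIV. expm 0 (n * (x $ i - a $ i)) * expm 0 (n * (b $ i - x $ i)))"

lemma expm_0: "expm 0 y \<ge> 0" "expm 0 y \<le> 1" "expm 0 y > 0 \<longleftrightarrow> y > 0" "y \<le> 0 \<Longrightarrow> expm 0 y = 0"
  by (auto simp: expm_def)

lemma bump_bounds: "0 \<le> bump n a b x" "bump n a b x \<le> 1"
  unfolding bump_def by (auto intro!: prod_nonneg prod_le_1 mult_le_one mult_nonneg_nonneg expm_0)

lemma bump_pos:
  assumes "n > 0" "x \<in> box a b"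
  shows "bump n a b x > 0"
proof -
  have "a $ i < x $ i" "x $ i < b $ i" for i using assms by (auto simp: mem_box_cart)
  then show ?thesis
    unfolding bump_def using assms(1) by (intro prod_pos mult_pos_pos) (simp_all add: expm_0(3))
qed

lemma bump_outside:
  assumes "n > 0" "x \<notin> box a b"
  shows "bump n a b x = 0"
proof -
  obtain i where "x $ i \<le> a $ i \<or> b $ i \<le> x $ i" using assms by (auto simp: mem_box_cart not_less)
  then have "expm 0 (n * (x $ i - a $ i)) * expm 0 (n * (b $ i - x $ i)) = 0"
    using assms(1) by (auto intro!: expm_0(4) mult_nonneg_nonpos)
  then show ?thesis unfolding bump_def by (intro prod_zero) auto
qed

lemma bump_test_function:
  assumes "n > 0"
  shows "bump n a b \<in> test_functions"
proof -
  have "C_k k (bump n a b)" for k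
  proof -
    have "diff_k (Suc k) (\<lambda>t. expm 0 (n * (t - a $ i)) * expm 0 (n * (b $ i - t)))" for i
    proof -
      have "(\<lambda>t. expm 0 (n * (t - a $ i))) = (\<lambda>t. expm 0 (n * t + (- n * a $ i)))"
        "(\<lambda>t. expm 0 (n * (b $ i - t))) = (\<lambda>t. expm 0 ((- n) * t + n * b $ i))"
        by (simp_all add: algebra_simps)
      moreover have "diff_k (Suc k) (\<lambda>t. expm 0 (c * t + d))" for c d
        by (intro diff_k_affine diff_k_expm)
      ultimately show ?thesis by (intro diff_k_mult) (simp_all only:)
    qed
    then show ?thesis unfolding bump_def by (rule C_k_prod)
  qed
  moreover have "bounded {x. bump n a b x \<noteq> 0}"
    by (rule bounded_subset [of "box a b"]) (use bump_outside [OF assms] in auto)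
  ultimately show ?thesis by (simp add: test_functions_def)
qed

lemma bump_tendsto: "(\<lambda>n. bump (real (Suc n)) a b x) \<longlonglongrightarrow> indicator (box a b) x"
proof (cases "x \<in> box a b")
  case True
  have *: "(\<lambda>n. expm 0 (real (Suc n) * d)) \<longlonglongrightarrow> 1" if "d > 0" for d
  proof -
    have "(\<lambda>n. exp (- (1 / d) * (1 / real (Suc n)))) \<longlonglongrightarrow> exp (- (1 / d) * 0)"
      by (intro tendsto_intros LIMSEQ_Suc [OF lim_1_over_n])
    moreover have "expm 0 (real (Suc n) * d) = exp (- (1 / d) * (1 / real (Suc n)))" for n
      using that by (auto simp: expm_def mult.commute mult_le_0_iff)
    ultimately show ?thesis by simp
  qed
  have "a $ i < x $ i" "x $ i < b $ i" for i using True by (auto simp: mem_box_cart)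
  then have "(\<lambda>n. bump (real (Suc n)) a b x) \<longlonglongrightarrow> (\<Prod>i\<in>(UNIV::3 set). 1 * 1)"
    unfolding bump_def by (intro tendsto_prod tendsto_mult *) auto
  then show ?thesis using True by simp
next
  case False
  then show ?thesis using bump_outside [of "real (Suc n)" x a b for n] by simp
qed

section \<open>Weak gradients\<close>

definition grad :: "(R3 \<Rightarrow> real) \<Rightarrow> R3 \<Rightarrow> R3" where
  "grad f x = (\<chi> i. partial_deriv i f x)"

definition C1c :: "(R3 \<Rightarrow> real) \<Rightarrow> bool" where
  "C1c f \<longleftrightarrow> C_k 1 f \<and> bounded {x. f x \<noteq> 0}"

lemma C1c_test: "\<phi> \<in> test_functions \<Longrightarrow> C1c \<phi>"
  by (auto simp: C1c_def test_functions_def)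

lemma C1c_differentiable: "C1c f \<Longrightarrow> f differentiable at x"
  and C1c_partial: "C1c f \<Longrightarrow> continuous_on UNIV (partial_deriv i f)"
  by (simp_all add: C1c_def)

lemma C1c_continuous: "C1c f \<Longrightarrow> continuous_on UNIV f"
  using C1c_differentiable differentiable_imp_continuous_within
  by (metis continuous_at_imp_continuous_on)

lemma continuous_grad: "C1c f \<Longrightarrow> continuous_on UNIV (grad f)"
  unfolding grad_def by (intro continuous_on_vec_lambda C1c_partial)

lemma test_functions_measurable:
  assumes "\<phi> \<in> test_functions"
  shows "\<phi> \<in> borel_measurable borel" "\<phi> \<in> borel_measurable lebesgue"
proof -
  show *: "\<phi> \<in> borel_measurable borel"
    by (intro borel_measurable_continuous_onI test_functions_continuous assms)
  then show "\<phi> \<in> borel_measurable lebesgue" by (simp add: measurable_completion)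
qed

lemma has_derivative_grad: "C1c f \<Longrightarrow> (f has_derivative (\<lambda>h. grad f x \<bullet> h)) (at x)"
  using has_derivative_partial [OF C1c_differentiable, of f x]
  by (simp add: inner_vec_def grad_def mult.commute)

lemma line_derivative:
  assumes "C1c f"
  shows "((\<lambda>t. f (x + t *\<^sub>R v)) has_real_derivative grad f (x + t *\<^sub>R v) \<bullet> v) (at t)"
proof -
  have "((\<lambda>t. x + t *\<^sub>R v) has_derivative (\<lambda>t. t *\<^sub>R v)) (at t)"
    by (auto intro!: derivative_eq_intros)
  from has_derivative_compose [OF this has_derivative_grad [OF assms]]
  show ?thesis by (simp add: has_field_derivative_def mult_commute_abs)
qed

lemma support_grad: "{x. grad f x \<noteq> 0} \<subseteq> closure {x. f x \<noteq> 0}"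
  using partial_deriv_0_outside by (fastforce simp: grad_def vec_eq_iff)

lemma bounded_support_grad: "C1c f \<Longrightarrow> bounded {x. grad f x \<noteq> 0}"
  by (rule bounded_subset [OF _ support_grad]) (simp add: C1c_def bounded_closure)

lemma integrable_bounded_support:
  fixes f :: "R3 \<Rightarrow> 'b::euclidean_space"
  assumes "continuous_on UNIV f" "bounded {x. f x \<noteq> 0}"
  shows "integrable lborel f" "integrable lebesgue f"
proof -
  let ?K = "closure {x. f x \<noteq> 0}"
  have "integrable lborel (\<lambda>x. indicator ?K x *\<^sub>R f x)"
    using assms by (intro borel_integrable_compact) (auto intro: continuous_on_subset)
  moreover have "(\<lambda>x. indicator ?K x *\<^sub>R f x) = f"
    using closure_subset [of "{x. f x \<noteq> 0}"] by (auto simp: indicator_def fun_eq_iff)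
  ultimately show "integrable lborel f" by simp
  then show "integrable lebesgue f" by (simp add: integrable_completion)
qed

lemma bounded_range_bounded_support:
  fixes f :: "R3 \<Rightarrow> 'b::euclidean_space"
  assumes "continuous_on UNIV f" "bounded {x. f x \<noteq> 0}"
  obtains M where "M > 0" "\<And>x. norm (f x) \<le> M"
proof -
  let ?K = "closure {x. f x \<noteq> 0}"
  have "compact (f ` ?K)"
    using assms by (intro compact_continuous_image) (auto intro: continuous_on_subset)
  then obtain M where M: "M > 0" "\<And>x. x \<in> ?K \<Longrightarrow> norm (f x) \<le> M"
    using compact_imp_bounded bounded_pos by (metis imageI)
  have "norm (f x) \<le> M" for x
    using M closure_subset [of "{x. f x \<noteq> 0}"] by (cases "f x = 0") auto
  then show ?thesis using that M by blast
qed

lemma C1c_lipschitz: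
  assumes "C1c f"
  obtains M where "M > 0" "\<And>x y. \<bar>f x - f y\<bar> \<le> M * norm (x - y)"
proof -
  obtain M where M: "M > 0" "\<And>x. norm (grad f x) \<le> M"
    using bounded_range_bounded_support [OF continuous_grad bounded_support_grad] assms by metis
  have "norm (f x - f y) \<le> M * norm (x - y)" for x y
  proof (rule differentiable_bound [of UNIV f "\<lambda>x h. grad f x \<bullet> h"])
    show "onorm ((\<bullet>) (grad f z)) \<le> M" for z
    proof (rule onorm_le)
      fix h show "norm (grad f z \<bullet> h) \<le> M * norm h"
        using Cauchy_Schwarz_ineq2 [of "grad f z" h] mult_right_mono [OF M(2) [of z], of "norm h"] by simp
    qed
  qed (use assms has_derivative_grad in auto)
  then show ?thesis using that M by simp
qed

lemma lborel_integral_translation: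
  fixes f :: "'a::euclidean_space \<Rightarrow> 'b::{banach, second_countable_topology}"
  assumes "f \<in> borel_measurable borel"
  shows "(LINT x|lborel. f (c + x)) = (LINT x|lborel. f x)"
  using integral_distr [of "(+) c" lborel borel f] assms lborel_distr_plus [of c] by simp

text \<open>By translation invariance every difference quotient has integral 0. The quotients are
  bounded by the Lipschitz constant and vanish outside a ball enlarged by 1, so dominated
  convergence passes to the derivative.\<close>

lemma integral_partial_deriv_0:
  assumes f: "C1c f"
  shows "(LINT x|lebesgue. partial_deriv i f x) = 0"
proof -
  let ?e = "axis i (1::real) :: R3"
  have [measurable]: "f \<in> borel_measurable borel" "partial_deriv i f \<in> borel_measurable borel"
    using C1c_continuous C1c_partial f by (auto intro: borel_measurable_continuous_onI)
  obtain M where M: "M > 0" "\<And>x y. \<bar>f x - f y\<bar> \<le> M * norm (x - y)"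
    using C1c_lipschitz [OF f] by metis
  obtain R where R: "\<And>x. f x \<noteq> 0 \<Longrightarrow> norm x \<le> R"
    using f by (auto simp: C1c_def bounded_iff)
  define s where "s n x = (f (x + (1 / real (Suc n)) *\<^sub>R ?e) - f x) * real (Suc n)" for n x
  have int_f: "integrable lborel f"
    using f C1c_continuous by (intro integrable_bounded_support) (auto simp: C1c_def)
  have "(\<lambda>n. LINT x|lborel. s n x) \<longlonglongrightarrow> (LINT x|lborel. partial_deriv i f x)"
  proof (rule integral_dominated_convergence)
    show "integrable lborel (\<lambda>x. M * indicator (cball (0::R3) (R + 1)) x)"
      by (intro integrable_mult_right integrable_real_indicator)
      (use emeasure_lborel_cball_finite [of "0::R3" "R + 1"] in auto)
    show "AE x in lborel. (\<lambda>n. s n x) \<longlonglongrightarrow> partial_deriv i f x"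
    proof (rule AE_I2)
      fix x
      have "((\<lambda>t. f (x + t *\<^sub>R ?e)) has_real_derivative partial_deriv i f x) (at 0)"
        using line_derivative [OF f, of x ?e 0] by (simp add: grad_def inner_axis)
      then have "(\<lambda>t. (f (x + t *\<^sub>R ?e) - f x) / t) \<midarrow>0\<rightarrow> partial_deriv i f x"
        by (simp add: DERIV_def)
      moreover have "filterlim (\<lambda>n. 1 / real (Suc n)) (at 0) sequentially"
        using LIMSEQ_Suc [OF lim_inverse_n'] by (auto simp: filterlim_at)
      ultimately have "(\<lambda>n. (f (x + (1 / real (Suc n)) *\<^sub>R ?e) - f x) / (1 / real (Suc n))) \<longlonglongrightarrow> partial_deriv i f x"
        by (rule filterlim_compose)
      then show "(\<lambda>n. s n x) \<longlonglongrightarrow> partial_deriv i f x"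
        by (simp add: s_def)
    qed
    show "AE x in lborel. norm (s n x) \<le> M * indicator (cball 0 (R + 1)) x" for n
    proof (rule AE_I2)
      fix x :: R3
      have ne: "norm ((1 / real (Suc n)) *\<^sub>R ?e) = 1 / real (Suc n)" by (simp add: norm_axis_1)
      show "norm (s n x) \<le> M * indicator (cball 0 (R + 1)) x"
      proof (cases "norm x \<le> R + 1")
        case True
        have "\<bar>s n x\<bar> = \<bar>f (x + (1 / real (Suc n)) *\<^sub>R ?e) - f x\<bar> * real (Suc n)"
          by (simp add: s_def abs_mult)
        also have "\<dots> \<le> (M * norm (x + (1 / real (Suc n)) *\<^sub>R ?e - x)) * real (Suc n)"
          by (intro mult_right_mono M) auto
        also have "\<dots> = M" using ne by simp
        finally show ?thesis using True by (simp add: indicator_def)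
      next
        case False
        then have "f x = 0" using R by force
        moreover have "norm (x + (1 / real (Suc n)) *\<^sub>R ?e) > R"
        proof -
          have "norm x \<le> norm (x + (1 / real (Suc n)) *\<^sub>R ?e) + norm ((1 / real (Suc n)) *\<^sub>R ?e)"
            using norm_triangle_ineq4 [of "x + (1 / real (Suc n)) *\<^sub>R ?e" "(1 / real (Suc n)) *\<^sub>R ?e"] by simp
          moreover have "norm ((1 / real (Suc n)) *\<^sub>R ?e) \<le> 1" unfolding ne by simp
          ultimately show ?thesis using False by linarith
        qed
        then have "f (x + (1 / real (Suc n)) *\<^sub>R ?e) = 0" using R by force
        ultimately show ?thesis using False by (simp add: s_def indicator_def)
      qed
    qed
    show "s n \<in> borel_measurable lborel" for n
      unfolding s_def by measurable
  qed measurable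
  moreover have "(LINT x|lborel. s n x) = 0" for n
  proof -
    let ?c = "(1 / real (Suc n)) *\<^sub>R ?e"
    have "integrable lborel (\<lambda>x. f (?c + x))"
      using integrable_distr [of "(+) ?c" lborel borel f] int_f by (simp add: lborel_distr_plus)
    then have "(LINT x|lborel. s n x) = ((LINT x|lborel. f (?c + x)) - (LINT x|lborel. f x)) * real (Suc n)"
      using int_f by (simp add: s_def add.commute)
    then show ?thesis by (simp add: lborel_integral_translation)
  qed
  ultimately have "(LINT x|lborel. partial_deriv i f x) = 0"
    by (simp add: LIMSEQ_const_iff)
  then show ?thesis by (simp add: integral_completion)
qed

lemma C1c_mult:
  assumes "C1c f" "C1c g"
  shows "C1c (\<lambda>x. f x * g x)"
proof -
  have "partial_deriv i (\<lambda>x. f x * g x) = (\<lambda>x. f x * partial_deriv i g x + partial_deriv i f x * g x)" for i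
    using assms by (auto simp: partial_deriv_mult C1c_differentiable)
  moreover have "bounded {x. f x * g x \<noteq> 0}"
    using assms by (auto simp: C1c_def intro!: bounded_subset [of "{x. f x \<noteq> 0}"])
  ultimately show ?thesis using assms C1c_continuous [of f] C1c_continuous [of g]
    by (auto simp: C1c_def intro!: continuous_intros differentiable_mult)
qed

lemma integration_by_parts:
  assumes "C1c f" "C1c g"
  shows "(LINT x|lebesgue. f x * partial_deriv i g x) = - (LINT x|lebesgue. partial_deriv i f x * g x)"
proof -
  have c: "continuous_on UNIV f" "continuous_on UNIV g" "continuous_on UNIV (partial_deriv i f)"
    "continuous_on UNIV (partial_deriv i g)" "bounded {x. f x \<noteq> 0}" "bounded {x. g x \<noteq> 0}"
    using assms [THEN C1c_continuous] assms [THEN C1c_partial] assms by (simp_all add: C1c_def)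
  have "integrable lebesgue (\<lambda>x. f x * partial_deriv i g x)"
    using c by (intro integrable_bounded_support continuous_intros bounded_subset [OF c(5)]) auto
  moreover have "integrable lebesgue (\<lambda>x. partial_deriv i f x * g x)"
    using c by (intro integrable_bounded_support continuous_intros bounded_subset [OF c(6)]) auto
  moreover have "(LINT x|lebesgue. f x * partial_deriv i g x + partial_deriv i f x * g x) = 0"
    using integral_partial_deriv_0 [OF C1c_mult [OF assms], of i] assms
    by (simp add: partial_deriv_mult C1c_differentiable)
  ultimately show ?thesis by simp
qed

lemma locally_integrable_integrable:
  fixes f :: "R3 \<Rightarrow> 'b::euclidean_space"
  assumes "integrable lebesgue f"
  shows "locally_integrable f"
  unfolding locally_integrable_def set_integrable_def
  using assms by (auto intro!: integrable_mult_indicator simp: compact_imp_closed)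

lemma has_weak_gradient_test:
  assumes "\<phi> \<in> test_functions"
  shows "has_weak_gradient \<phi> (grad \<phi>)"
proof -
  have \<phi>: "C1c \<phi>" by (rule C1c_test [OF assms])
  have "bounded {x. \<phi> x \<noteq> 0}" using \<phi> by (simp add: C1c_def)
  then have "locally_integrable \<phi>" "locally_integrable (grad \<phi>)"
    by (intro locally_integrable_integrable integrable_bounded_support C1c_continuous continuous_grad
        bounded_support_grad \<phi>; assumption)+
  then show ?thesis
    using integration_by_parts [OF \<phi> C1c_test] by (simp add: has_weak_gradient_def grad_def)
qed

subsection \<open>Uniqueness\<close>

lemma in_some_box: "\<exists>n::nat. (x::'a::euclidean_space) \<in> box (- real n *\<^sub>R One) (real n *\<^sub>R One)"
proof -
  have "x \<in> (\<Union>i::nat. box (- (real i *\<^sub>R One)) (real i *\<^sub>R One))"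
    unfolding UN_box_eq_UNIV by simp
  then show ?thesis by auto
qed

text \<open>Boxes generate the Borel sets and are stable under intersection; the \<pi>-\<lambda>
  theorem extends the vanishing of the integral to all Borel sets.\<close>

lemma AE_0_if_box_integrals_0:
  fixes f :: "R3 \<Rightarrow> real"
  assumes f: "integrable lborel f" and box: "\<And>a b. (LINT x|lborel. indicator (box a b) x * f x) = 0"
  shows "AE x in lborel. f x = 0"
proof (rule sigma_finite_measure.density_zero [OF lborel.sigma_finite_measure_axioms f])
  have int: "integrable lborel (\<lambda>x. indicator A x * f x)" if "A \<in> sets borel" for A
    using integrable_mult_indicator [of A lborel f] f that by simp
  \<comment> \<open>Complements in the induction need the integral over the whole space, obtained
    from an exhaustion by boxes.\<close>
  have f0: "(LINT x|lborel. f x) = 0"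
  proof (rule LIMSEQ_unique)
    have "(\<lambda>n. LINT x|lborel. indicator (box (- real n *\<^sub>R One) (real n *\<^sub>R One)) x * f x) \<longlonglongrightarrow> (LINT x|lborel. f x)"
    proof (rule integral_dominated_convergence)
      show "integrable lborel (\<lambda>x. \<bar>f x\<bar>)" using f by simp
      show "AE x in lborel. (\<lambda>n. indicator (box (- real n *\<^sub>R One) (real n *\<^sub>R One)) x * f x) \<longlonglongrightarrow> f x"
      proof (rule AE_I2)
        fix x :: R3
        obtain n where n: "x \<in> box (- real n *\<^sub>R One) (real n *\<^sub>R One)"
          using in_some_box by blast
        have "\<forall>\<^sub>F m in sequentially. indicator (box (- real m *\<^sub>R One) (real m *\<^sub>R One)) x * f x = f x"
          using eventually_ge_at_top [of n]
        proof eventually_elim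
          case (elim m)
          then have "x \<in> box (- real m *\<^sub>R One) (real m *\<^sub>R One)"
            using n by (force simp: mem_box)
          then show ?case by simp
        qed
        then show "(\<lambda>n. indicator (box (- real n *\<^sub>R One) (real n *\<^sub>R One)) x * f x) \<longlonglongrightarrow> f x"
          by (rule tendsto_eventually)
      qed
      show "AE x in lborel. norm (indicator (box (- real n *\<^sub>R One) (real n *\<^sub>R One)) x * f x) \<le> \<bar>f x\<bar>" for n
        by (auto simp: indicator_def)
    qed (use f in measurable)
    then show "(\<lambda>n::nat. 0) \<longlonglongrightarrow> (LINT x|lborel. f x)" by (simp add: box)
  qed simp
  fix A :: "R3 set" assume "A \<in> sets lborel"
  then have A: "A \<in> sigma_sets UNIV (range (\<lambda>(a, b). box a b))"
    by (simp add: borel_eq_box)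
  have "Int_stable (range (\<lambda>(a, b). box a b) :: R3 set set)"
    by (auto simp: Int_stable_def box_Int_box)
  moreover have "range (\<lambda>(a, b). box a b) \<subseteq> Pow (UNIV :: R3 set)" by simp
  moreover note A
  ultimately show "set_lebesgue_integral lborel A f = 0"
  proof (induction rule: sigma_sets_induct_disjoint)
    case (basic A)
    then show ?case using box by (auto simp: set_lebesgue_integral_def)
  next
    case (compl A)
    then have A: "A \<in> sets borel" by (simp add: borel_eq_box)
    have "set_lebesgue_integral lborel (UNIV - A) f = (LINT x|lborel. f x - indicator A x * f x)"
      unfolding set_lebesgue_integral_def by (intro Bochner_Integration.integral_cong) (auto simp: indicator_def)
    also have "\<dots> = 0" using compl int [OF A] f f0 by (simp add: set_lebesgue_integral_def)
    finally show ?case .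
  next
    case (union F)
    then have F: "F i \<in> sets borel" for i by (simp add: borel_eq_box subset_eq)
    have "set_integrable lborel (\<Union>i. F i) f"
      unfolding set_integrable_def using f F by (intro integrable_mult_indicator) auto
    then show ?case
      using union F lebesgue_integral_countable_add [of F lborel f]
      by (simp add: disjoint_family_on_def)
  qed (auto simp: set_lebesgue_integral_def)
qed

text \<open>The fundamental lemma of the calculus of variations: bumps tend to the indicator of a
  box, so all box integrals of h vanish. As h is only Lebesgue measurable, on each large box it is
  replaced by a Borel function equal to it almost everywhere.\<close>

lemma AE_0_if_test_integrals_0:
  fixes h :: "R3 \<Rightarrow> real"
  assumes h: "locally_integrable h"
    and test: "\<And>\<phi>. \<phi> \<in> test_functions \<Longrightarrow> (LINT x|lebesgue. h x * \<phi> x) = 0"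
  shows "AE x in lebesgue. h x = 0"
proof -
  have box0: "(LINT x|lebesgue. indicator (box a b) x * h x) = 0" for a b
  proof -
    have int: "integrable lebesgue (\<lambda>x. indicator (cbox a b) x * h x)"
      using h by (auto simp: locally_integrable_def set_integrable_def)
    have eq: "h x * bump (real (Suc n)) a b x = (indicator (cbox a b) x * h x) * bump (real (Suc n)) a b x" for n x
      using bump_outside [of "real (Suc n)" x a b] box_subset_cbox [of a b] by (auto simp: indicator_def)
    have "(\<lambda>n. LINT x|lebesgue. h x * bump (real (Suc n)) a b x) \<longlonglongrightarrow> (LINT x|lebesgue. indicator (box a b) x * h x)"
    proof (rule integral_dominated_convergence)
      show "integrable lebesgue (\<lambda>x. \<bar>indicator (cbox a b) x * h x\<bar>)" using int by simp
      show "(\<lambda>x. indicator (box a b) x * h x) \<in> borel_measurable lebesgue"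
      proof -
        have "(\<lambda>x. indicator (box a b) x * h x) = (\<lambda>x. indicator (box a b) x * (indicator (cbox a b) x * h x))"
          using box_subset_cbox [of a b] by (auto simp: indicator_def fun_eq_iff)
        moreover have "\<dots> \<in> borel_measurable lebesgue"
          by (rule borel_measurable_times [OF borel_measurable_indicator borel_measurable_integrable [OF int]]) auto
        ultimately show ?thesis by simp
      qed
      show "(\<lambda>x. h x * bump (real (Suc n)) a b x) \<in> borel_measurable lebesgue" for n
        unfolding eq
        by (rule borel_measurable_times [OF borel_measurable_integrable [OF int]])
          (simp add: test_functions_measurable bump_test_function)
      show "AE x in lebesgue. (\<lambda>n. h x * bump (real (Suc n)) a b x) \<longlonglongrightarrow> indicator (box a b) x * h x"
        using tendsto_mult [OF tendsto_const bump_tendsto] by (intro AE_I2) (simp add: mult.commute)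
      show "AE x in lebesgue. norm (h x * bump (real (Suc n)) a b x) \<le> \<bar>indicator (cbox a b) x * h x\<bar>" for n
        unfolding eq using bump_bounds [of "real (Suc n)" a b]
        by (intro AE_I2) (simp add: abs_mult mult_left_le)
    qed
    moreover have "(LINT x|lebesgue. h x * bump (real (Suc n)) a b x) = 0" for n
      by (intro test bump_test_function) simp
    ultimately show ?thesis by (simp add: LIMSEQ_const_iff)
  qed
  have "AE x in lebesgue. indicator (box (- real n *\<^sub>R One) (real n *\<^sub>R One)) x * h x = 0" for n
  proof -
    let ?B = "box (- real n *\<^sub>R One) (real n *\<^sub>R One) :: R3 set"
    let ?f = "\<lambda>x. indicator ?B x * h x"
    have "integrable lebesgue (\<lambda>x. indicator ?B x * (indicator (cbox (- real n *\<^sub>R One) (real n *\<^sub>R One)) x * h x))"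
      using h integrable_mult_indicator [of ?B lebesgue "\<lambda>x. indicator (cbox (- real n *\<^sub>R One) (real n *\<^sub>R One)) x * h x"]
      by (auto simp: locally_integrable_def set_integrable_def)
    moreover have "(\<lambda>x. indicator ?B x * (indicator (cbox (- real n *\<^sub>R One) (real n *\<^sub>R One)) x * h x)) = ?f"
      using box_subset_cbox [of "- real n *\<^sub>R One" "real n *\<^sub>R One :: R3"] by (auto simp: indicator_def fun_eq_iff)
    ultimately have int: "integrable lebesgue ?f" by simp
    obtain f' where f': "f' \<in> borel_measurable lborel" "AE x in lborel. ?f x = f' x"
      using completion_ex_borel_measurable_real [of ?f lborel] int by auto
    have ae: "AE x in lebesgue. ?f x = f' x" using f'(2) by (rule AE_completion)
    have "integrable lebesgue f'"
      using int ae f'(1) by (subst integrable_cong_AE [of f' lebesgue ?f]) (auto simp: measurable_completion)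
    then have intf': "integrable lborel f'" using f'(1) by (simp add: integrable_completion)
    have "AE x in lborel. f' x = 0"
    proof (rule AE_0_if_box_integrals_0 [OF intf'])
      fix a b :: R3
      have "(LINT x|lborel. indicator (box a b) x * f' x) = (LINT x|lebesgue. indicator (box a b) x * f' x)"
        using f'(1) by (intro integral_completion [symmetric]) auto
      also have "\<dots> = (LINT x|lebesgue. indicator (box a b) x * ?f x)"
      proof (rule integral_cong_AE)
        show "(\<lambda>x. indicator (box a b) x * ?f x) \<in> borel_measurable lebesgue"
          by (rule borel_measurable_times [OF borel_measurable_indicator borel_measurable_integrable [OF int]]) auto
        show "(\<lambda>x. indicator (box a b) x * f' x) \<in> borel_measurable lebesgue"
          using f'(1) by (intro borel_measurable_times borel_measurable_indicator) (auto simp: measurable_completion)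
        show "AE x in lebesgue. indicator (box a b) x * f' x = indicator (box a b) x * ?f x"
          using ae by eventually_elim simp
      qed
      also have "\<dots> = (LINT x|lebesgue. indicator (box a b \<inter> ?B) x * h x)"
        by (intro Bochner_Integration.integral_cong) (auto simp: indicator_def)
      also have "\<dots> = 0"
        unfolding box_Int_box by (rule box0)
      finally show "(LINT x|lborel. indicator (box a b) x * f' x) = 0" .
    qed
    then have "AE x in lebesgue. f' x = 0" by (rule AE_completion)
    with ae show ?thesis by eventually_elim simp
  qed
  then have "AE x in lebesgue. \<forall>n. indicator (box (- real n *\<^sub>R One) (real n *\<^sub>R One)) x * h x = 0"
    by (intro AE_all_countable [THEN iffD2] allI)
  then show ?thesis
  proof eventually_elim
    case (elim x)
    obtain n :: nat where "x \<in> box (- real n *\<^sub>R One) (real n *\<^sub>R One)"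
      using in_some_box by blast
    moreover have "indicator (box (- real n *\<^sub>R One) (real n *\<^sub>R One)) x * h x = 0"
      using elim by blast
    ultimately show ?case by simp
  qed
qed

lemma locally_integrable_diff:
  fixes f g :: "R3 \<Rightarrow> 'b::euclidean_space"
  shows "locally_integrable f \<Longrightarrow> locally_integrable g \<Longrightarrow> locally_integrable (\<lambda>x. f x - g x)"
  by (auto simp: locally_integrable_def set_integral_diff)

lemma locally_integrable_times_test:
  fixes f :: "R3 \<Rightarrow> real"
  assumes "locally_integrable f" "\<phi> \<in> test_functions"
  shows "integrable lebesgue (\<lambda>x. f x * \<phi> x)"
proof -
  let ?K = "closure {x. \<phi> x \<noteq> 0}"
  have "compact ?K" using assms by (simp add: test_functions_def)
  then have int: "integrable lebesgue (\<lambda>x. indicator ?K x * f x)"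
    using assms by (auto simp: locally_integrable_def set_integrable_def)
  have b: "bounded {x. \<phi> x \<noteq> 0}" using assms by (simp add: test_functions_def)
  obtain M where M: "\<And>x. norm (\<phi> x) \<le> M"
    by (rule bounded_range_bounded_support [OF test_functions_continuous [OF assms(2)] b], rule that)
  have eq: "f x * \<phi> x = (indicator ?K x * f x) * \<phi> x" for x
    using closure_subset [of "{x. \<phi> x \<noteq> 0}"] by (auto simp: indicator_def)
  show ?thesis
  proof (rule Bochner_Integration.integrable_bound [of _ "\<lambda>x. M * (indicator ?K x * f x)"])
    show "(\<lambda>x. f x * \<phi> x) \<in> borel_measurable lebesgue"
      unfolding eq
      by (rule borel_measurable_times [OF borel_measurable_integrable [OF int]])
        (simp add: test_functions_measurable assms)
    show "AE x in lebesgue. norm (f x * \<phi> x) \<le> norm (M * (indicator ?K x * f x))"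
    proof (rule AE_I2)
      fix x
      have "\<bar>\<phi> x\<bar> \<le> \<bar>M\<bar>" using M [of x] by simp
      then have "\<bar>indicator ?K x * f x\<bar> * \<bar>\<phi> x\<bar> \<le> \<bar>indicator ?K x * f x\<bar> * \<bar>M\<bar>"
        by (intro mult_left_mono) auto
      then show "norm (f x * \<phi> x) \<le> norm (M * (indicator ?K x * f x))"
        unfolding eq by (simp add: abs_mult mult_ac)
    qed
  qed (use int in simp)
qed

lemma locally_integrable_nth:
  fixes G :: "R3 \<Rightarrow> R3"
  assumes "locally_integrable G"
  shows "locally_integrable (\<lambda>x. G x $ i)"
  unfolding locally_integrable_def set_integrable_def
proof (intro allI impI)
  fix K :: "R3 set" assume "compact K"
  then have "integrable lebesgue (\<lambda>x. indicator K x *\<^sub>R G x)"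
    using assms by (simp add: locally_integrable_def set_integrable_def)
  from integrable_bounded_linear [OF bounded_linear_vec_nth this, of i]
  show "integrable lebesgue (\<lambda>x. indicator K x *\<^sub>R G x $ i)" by simp
qed

lemma has_weak_gradient_unique:
  assumes "has_weak_gradient u G" "has_weak_gradient v H" "AE x in lebesgue. u x = v x"
  shows "AE x in lebesgue. G x = H x"
proof -
  have "AE x in lebesgue. G x $ i - H x $ i = 0" for i
  proof (rule AE_0_if_test_integrals_0)
    have GH: "locally_integrable (\<lambda>x. G x $ i)" "locally_integrable (\<lambda>x. H x $ i)"
      using assms by (auto simp: has_weak_gradient_def intro: locally_integrable_nth)
    then show "locally_integrable (\<lambda>x. G x $ i - H x $ i)" by (rule locally_integrable_diff)
    fix \<phi> :: "R3 \<Rightarrow> real" assume \<phi>: "\<phi> \<in> test_functions"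
    have int: "integrable lebesgue (\<lambda>x. u x * partial_deriv i \<phi> x)" "integrable lebesgue (\<lambda>x. v x * partial_deriv i \<phi> x)"
      using assms \<phi> by (auto simp: has_weak_gradient_def intro!: locally_integrable_times_test test_functions_partial_deriv)
    then have "(LINT x|lebesgue. u x * partial_deriv i \<phi> x) = (LINT x|lebesgue. v x * partial_deriv i \<phi> x)"
      using assms(3) by (intro integral_cong_AE) auto
    then have "(LINT x|lebesgue. G x $ i * \<phi> x) = (LINT x|lebesgue. H x $ i * \<phi> x)"
      using assms \<phi> by (simp add: has_weak_gradient_def)
    then show "(LINT x|lebesgue. (G x $ i - H x $ i) * \<phi> x) = 0"
      using locally_integrable_times_test [OF GH(1) \<phi>] locally_integrable_times_test [OF GH(2) \<phi>]
      by (simp add: left_diff_distrib)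
  qed
  then have "AE x in lebesgue. \<forall>i\<in>UNIV. G x $ i - H x $ i = 0"
    by (intro AE_finite_allI) auto
  then show ?thesis by eventually_elim (simp add: vec_eq_iff)
qed

lemma weak_grad_AE:
  assumes "has_weak_gradient u G"
  shows "has_weak_gradient u (weak_grad u)" "AE x in lebesgue. weak_grad u x = G x"
proof -
  show 1: "has_weak_gradient u (weak_grad u)"
    unfolding weak_grad_def by (rule someI [of "has_weak_gradient u", OF assms])
  show "AE x in lebesgue. weak_grad u x = G x"
    by (rule has_weak_gradient_unique [OF 1 assms]) simp
qed

section \<open>The Sobolev inequality and translations\<close>

abbreviation vec3 :: "real \<Rightarrow> real \<Rightarrow> real \<Rightarrow> R3" where
  "vec3 a b c \<equiv> vector [a, b, c]"

lemma continuous_vec3: "continuous_on UNIV (\<lambda>(a, b, c). vec3 a b c)"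
proof -
  have "(\<lambda>(a, b, c). vec3 a b c) = (\<lambda>(a, b, c). a *\<^sub>R axis 1 1 + b *\<^sub>R axis 2 1 + c *\<^sub>R axis 3 1)"
    by (auto simp: vec_eq_iff forall_3 vector_3 axis_def fun_eq_iff)
  then show ?thesis by (simp add: split_def) (intro continuous_intros)
qed

lemma vec3_measurable [measurable]: "(\<lambda>(a, b, c). vec3 a b c) \<in> borel_measurable borel"
  by (rule borel_measurable_continuous_onI [OF continuous_vec3])

text \<open>Carries iterated integrals over three real variables to integrals over
  \<open>real ^ 3\<close>; a measure that gives boxes their volume is Lebesgue measure.\<close>

lemma distr_vec3: "distr lborel borel (\<lambda>(a, b, c). vec3 a b c) = lborel"
proof (rule lborel_eqI [symmetric])
  fix l u :: R3 assume lu: "\<And>b. b \<in> Basis \<Longrightarrow> l \<bullet> b \<le> u \<bullet> b"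
  have le: "l $ i \<le> u $ i" for i
    using lu [of "axis i 1"] by (auto simp: inner_axis axis_in_Basis_iff)
  let ?f = "\<lambda>(a, b, c). vec3 a b c"
  have "emeasure (distr lborel borel ?f) (box l u) = emeasure lborel (?f -` box l u \<inter> space lborel)"
    by (rule emeasure_distr) auto
  also have "?f -` box l u \<inter> space lborel = {l $ 1<..<u $ 1} \<times> {l $ 2<..<u $ 2} \<times> {l $ 3<..<u $ 3}"
    by (auto simp: mem_box_cart forall_3 vector_3)
  also have "emeasure lborel \<dots> = emeasure (lborel \<Otimes>\<^sub>M (lborel \<Otimes>\<^sub>M lborel)) ({l $ 1<..<u $ 1} \<times> {l $ 2<..<u $ 2} \<times> {l $ 3<..<u $ 3})"
    by (simp add: lborel_prod)
  also have "\<dots> = ennreal (u $ 1 - l $ 1) * (ennreal (u $ 2 - l $ 2) * ennreal (u $ 3 - l $ 3))"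
  proof -
    have "emeasure (lborel \<Otimes>\<^sub>M lborel) ({l $ 2<..<u $ 2} \<times> {l $ 3<..<u $ 3}) = ennreal (u $ 2 - l $ 2) * ennreal (u $ 3 - l $ 3)"
      using le by (subst lborel.emeasure_pair_measure_Times) auto
    moreover have "sigma_finite_measure (lborel \<Otimes>\<^sub>M lborel :: (real \<times> real) measure)"
      by (simp add: lborel_prod lborel.sigma_finite_measure_axioms)
    ultimately show ?thesis
      using le by (subst sigma_finite_measure.emeasure_pair_measure_Times) auto
  qed
  also have "\<dots> = ennreal (\<Prod>b\<in>Basis. (u - l) \<bullet> b)"
  proof -
    have "(\<Prod>b\<in>Basis. (u - l) \<bullet> b) = (\<Prod>i\<in>UNIV. (u - l) $ i)"
      unfolding Basis_vec_def by (subst prod.UNION_disjoint) (auto simp: inner_axis axis_eq_axis prod.reindex inj_on_def)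
    also have "\<dots> = (u $ 1 - l $ 1) * ((u $ 2 - l $ 2) * (u $ 3 - l $ 3))"
      unfolding UNIV_3 by simp
    finally have eq: "(\<Prod>b\<in>Basis. (u - l) \<bullet> b) = (u $ 1 - l $ 1) * ((u $ 2 - l $ 2) * (u $ 3 - l $ 3))" .
    have "0 \<le> u $ i - l $ i" for i using le by simp
    then show ?thesis unfolding eq by (simp only: ennreal_mult mult_nonneg_nonneg)
  qed
  finally show "emeasure (distr lborel borel ?f) (box l u) = ennreal (\<Prod>b\<in>Basis. (u - l) \<bullet> b)" .
qed simp

lemma nn_integral_R3:
  fixes f :: "R3 \<Rightarrow> ennreal"
  assumes [measurable]: "f \<in> borel_measurable borel"
  shows "(\<integral>\<^sup>+x. f x \<partial>lborel) = (\<integral>\<^sup>+a. \<integral>\<^sup>+b. \<integral>\<^sup>+c. f (vec3 a b c) \<partial>lborel \<partial>lborel \<partial>lborel)"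
proof -
  have m: "(\<lambda>p. f (vec3 (fst p) (fst (snd p)) (snd (snd p)))) \<in> borel_measurable (lborel \<Otimes>\<^sub>M (lborel \<Otimes>\<^sub>M lborel))"
    using measurable_compose [OF vec3_measurable assms] by (simp add: lborel_prod split_def)
  have "(\<integral>\<^sup>+x. f x \<partial>lborel) = (\<integral>\<^sup>+x. f x \<partial>distr lborel borel (\<lambda>(a, b, c). vec3 a b c))"
    by (simp add: distr_vec3)
  also have "\<dots> = (\<integral>\<^sup>+p. f (vec3 (fst p) (fst (snd p)) (snd (snd p))) \<partial>(lborel \<Otimes>\<^sub>M (lborel \<Otimes>\<^sub>M lborel)))"
    using vec3_measurable by (subst nn_integral_distr) (auto simp: lborel_prod split_def)
  also have "\<dots> = (\<integral>\<^sup>+a. \<integral>\<^sup>+q. f (vec3 a (fst q) (snd q)) \<partial>(lborel \<Otimes>\<^sub>M lborel) \<partial>lborel)"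
  proof -
    have "sigma_finite_measure (lborel \<Otimes>\<^sub>M lborel :: (real \<times> real) measure)"
      by (simp add: lborel_prod lborel.sigma_finite_measure_axioms)
    from sigma_finite_measure.nn_integral_fst [OF this m] show ?thesis by simp
  qed
  also have "\<dots> = (\<integral>\<^sup>+a. \<integral>\<^sup>+b. \<integral>\<^sup>+c. f (vec3 a b c) \<partial>lborel \<partial>lborel \<partial>lborel)"
  proof (rule nn_integral_cong)
    fix a :: real
    have "(\<lambda>q. f (vec3 a (fst q) (snd q))) \<in> borel_measurable (lborel \<Otimes>\<^sub>M lborel)"
      using measurable_compose [OF measurable_Pair1' [of a lborel "lborel \<Otimes>\<^sub>M lborel"] m] by simp
    from lborel.nn_integral_fst [OF this]
    show "(\<integral>\<^sup>+q. f (vec3 a (fst q) (snd q)) \<partial>(lborel \<Otimes>\<^sub>M lborel)) = (\<integral>\<^sup>+b. \<integral>\<^sup>+c. f (vec3 a b c) \<partial>lborel \<partial>lborel)"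
      by simp
  qed
  finally show ?thesis .
qed

text \<open>Cauchy--Schwarz in the variable c for the two factors that contain it, then once more in
  (a, b) against the third factor. The squared form keeps roots out of the statement.\<close>

lemma Loomis_Whitney:
  fixes f g h :: "real \<times> real \<Rightarrow> ennreal"
  assumes [measurable]: "f \<in> borel_measurable (lborel \<Otimes>\<^sub>M lborel)" "g \<in> borel_measurable (lborel \<Otimes>\<^sub>M lborel)"
    "h \<in> borel_measurable (lborel \<Otimes>\<^sub>M lborel)"
  shows "(\<integral>\<^sup>+a. \<integral>\<^sup>+b. \<integral>\<^sup>+c. f (b, c) * g (a, c) * h (a, b) \<partial>lborel \<partial>lborel \<partial>lborel)\<^sup>2
    \<le> (\<integral>\<^sup>+b. \<integral>\<^sup>+c. (f (b, c))\<^sup>2 \<partial>lborel \<partial>lborel) * (\<integral>\<^sup>+a. \<integral>\<^sup>+c. (g (a, c))\<^sup>2 \<partial>lborel \<partial>lborel)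
      * (\<integral>\<^sup>+a. \<integral>\<^sup>+b. (h (a, b))\<^sup>2 \<partial>lborel \<partial>lborel)"
proof -
  define J where "J a b = (\<integral>\<^sup>+c. f (b, c) * g (a, c) \<partial>lborel)" for a b
  define A where "A b = (\<integral>\<^sup>+c. (f (b, c))\<^sup>2 \<partial>lborel)" for b
  define B where "B a = (\<integral>\<^sup>+c. (g (a, c))\<^sup>2 \<partial>lborel)" for a
  have [measurable]: "(\<lambda>p. J (fst p) (snd p)) \<in> borel_measurable (lborel \<Otimes>\<^sub>M lborel)"
    unfolding J_def by measurable
  have [measurable]: "A \<in> borel_measurable lborel" "B \<in> borel_measurable lborel"
    unfolding A_def B_def by measurable
  have J: "(J a b)\<^sup>2 \<le> A b * B a" for a b
    unfolding J_def A_def B_def by (rule Cauchy_Schwarz_nn_integral) measurable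
  have "(\<integral>\<^sup>+a. \<integral>\<^sup>+b. \<integral>\<^sup>+c. f (b, c) * g (a, c) * h (a, b) \<partial>lborel \<partial>lborel \<partial>lborel)
      = (\<integral>\<^sup>+a. \<integral>\<^sup>+b. J a b * h (a, b) \<partial>lborel \<partial>lborel)"
    unfolding J_def by (intro nn_integral_cong nn_integral_multc) measurable
  also have "\<dots> = (\<integral>\<^sup>+p. J (fst p) (snd p) * h p \<partial>(lborel \<Otimes>\<^sub>M lborel))"
    by (subst lborel.nn_integral_fst [symmetric]) auto
  finally have "(\<integral>\<^sup>+a. \<integral>\<^sup>+b. \<integral>\<^sup>+c. f (b, c) * g (a, c) * h (a, b) \<partial>lborel \<partial>lborel \<partial>lborel)\<^sup>2
      = (\<integral>\<^sup>+p. J (fst p) (snd p) * h p \<partial>(lborel \<Otimes>\<^sub>M lborel))\<^sup>2" by simp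
  also have "\<dots> \<le> (\<integral>\<^sup>+p. (J (fst p) (snd p))\<^sup>2 \<partial>(lborel \<Otimes>\<^sub>M lborel)) * (\<integral>\<^sup>+p. (h p)\<^sup>2 \<partial>(lborel \<Otimes>\<^sub>M lborel))"
    by (rule Cauchy_Schwarz_nn_integral) measurable
  also have "\<dots> \<le> (\<integral>\<^sup>+p. A (snd p) * B (fst p) \<partial>(lborel \<Otimes>\<^sub>M lborel)) * (\<integral>\<^sup>+p. (h p)\<^sup>2 \<partial>(lborel \<Otimes>\<^sub>M lborel))"
    by (intro mult_right_mono nn_integral_mono J) auto
  also have "(\<integral>\<^sup>+p. A (snd p) * B (fst p) \<partial>(lborel \<Otimes>\<^sub>M lborel)) = (\<integral>\<^sup>+a. \<integral>\<^sup>+b. A b * B a \<partial>lborel \<partial>lborel)"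
    by (subst lborel.nn_integral_fst [symmetric]) auto
  also have "\<dots> = (\<integral>\<^sup>+a. (\<integral>\<^sup>+b. A b \<partial>lborel) * B a \<partial>lborel)"
    by (intro nn_integral_cong nn_integral_multc) measurable
  also have "\<dots> = (\<integral>\<^sup>+b. A b \<partial>lborel) * (\<integral>\<^sup>+a. B a \<partial>lborel)"
    by (intro nn_integral_cmult) measurable
  also have "(\<integral>\<^sup>+p. (h p)\<^sup>2 \<partial>(lborel \<Otimes>\<^sub>M lborel)) = (\<integral>\<^sup>+a. \<integral>\<^sup>+b. (h (a, b))\<^sup>2 \<partial>lborel \<partial>lborel)"
    by (subst lborel.nn_integral_fst [symmetric]) auto
  finally show ?thesis by (simp add: A_def B_def)
qed

lemma line_increment_le:
  fixes f f' :: "real \<Rightarrow> real"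
  assumes "\<And>t. (f has_real_derivative f' t) (at t)" "continuous_on UNIV f'" "a \<le> b"
  shows "ennreal \<bar>f b - f a\<bar> \<le> (\<integral>\<^sup>+t. indicator {a..b} t * ennreal \<bar>f' t\<bar> \<partial>lborel)"
proof -
  have "has_bochner_integral lborel (\<lambda>t. indicator {a..b} t *\<^sub>R f' t) (f b - f a)"
    using assms by (intro has_bochner_integral_FTC_Icc)
      (auto simp: has_real_derivative_iff_has_vector_derivative [symmetric]
        intro: has_field_derivative_at_within continuous_on_subset)
  then have I: "integrable lborel (\<lambda>t. indicator {a..b} t *\<^sub>R f' t)" "(LINT t|lborel. indicator {a..b} t *\<^sub>R f' t) = f b - f a"
    by (auto simp: has_bochner_integral_iff)
  from integral_norm_bound_ennreal [OF I(1)]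
  have "ennreal \<bar>f b - f a\<bar> \<le> (\<integral>\<^sup>+t. ennreal \<bar>indicator {a..b} t * f' t\<bar> \<partial>lborel)"
    by (simp add: I(2) [simplified])
  also have "\<dots> = (\<integral>\<^sup>+t. indicator {a..b} t * ennreal \<bar>f' t\<bar> \<partial>lborel)"
    by (intro nn_integral_cong) (auto simp: indicator_def)
  finally show ?thesis .
qed

lemma continuous_grad_line:
  assumes "C1c f"
  shows "continuous_on UNIV (\<lambda>t::real. grad f (x + t *\<^sub>R v))" "continuous_on UNIV (\<lambda>t::real. f (x + t *\<^sub>R v))"
  by (rule continuous_on_compose2 [OF continuous_grad [OF assms]], auto intro!: continuous_intros)
     (rule continuous_on_compose2 [OF C1c_continuous [OF assms]], auto intro!: continuous_intros)

text \<open>Dominates the norm of the gradient of f^4, the power to which Gagliardo's argument is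
  applied.\<close>

definition quart :: "(R3 \<Rightarrow> real) \<Rightarrow> R3 \<Rightarrow> real" where
  "quart f x = 4 * \<bar>f x\<bar> ^ 3 * norm (grad f x)"

lemma quart_measurable:
  assumes "C1c f"
  shows "quart f \<in> borel_measurable borel"
  unfolding quart_def
  by (intro borel_measurable_continuous_onI continuous_intros C1c_continuous continuous_grad assms)

text \<open>The line leaves the support of f, so the value of f^4 is the integral of its derivative
  from a point where f is 0.\<close>

lemma power4_le_line_integral:
  assumes f: "C1c f" and e: "norm e = 1"
  shows "ennreal (f (x + a *\<^sub>R e) ^ 4) \<le> (\<integral>\<^sup>+s. ennreal (quart f (x + s *\<^sub>R e)) \<partial>lborel)"
proof -
  obtain R where R: "\<And>x. f x \<noteq> 0 \<Longrightarrow> norm x \<le> R"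
    using f by (auto simp: C1c_def bounded_iff)
  define T where "T = \<bar>a\<bar> + \<bar>R\<bar> + norm x + 1"
  have "norm ((- T) *\<^sub>R e) \<le> norm (x + (- T) *\<^sub>R e) + norm x"
    using norm_triangle_ineq4 [of "x + (- T) *\<^sub>R e" x] by simp
  moreover have "T \<ge> 0" by (simp add: T_def)
  then have "norm ((- T) *\<^sub>R e) = T" using e by simp
  ultimately have "T \<le> norm (x + (- T) *\<^sub>R e) + norm x" by linarith
  then have "norm (x + (- T) *\<^sub>R e) > R"
    using abs_ge_self [of R] abs_ge_zero [of a] unfolding T_def by linarith
  then have 0: "f (x + (- T) *\<^sub>R e) = 0" using R by force
  have "ennreal \<bar>f (x + a *\<^sub>R e) ^ 4 - f (x + (- T) *\<^sub>R e) ^ 4\<bar>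
     \<le> (\<integral>\<^sup>+t. indicator {- T..a} t * ennreal \<bar>4 * f (x + t *\<^sub>R e) ^ 3 * (grad f (x + t *\<^sub>R e) \<bullet> e)\<bar> \<partial>lborel)"
  proof (rule line_increment_le)
    show "((\<lambda>t. f (x + t *\<^sub>R e) ^ 4) has_real_derivative 4 * f (x + t *\<^sub>R e) ^ 3 * (grad f (x + t *\<^sub>R e) \<bullet> e)) (at t)" for t
      using DERIV_power [OF line_derivative [OF f, of x e t], of 4] by (simp add: mult_ac)
    show "continuous_on UNIV (\<lambda>t. 4 * f (x + t *\<^sub>R e) ^ 3 * (grad f (x + t *\<^sub>R e) \<bullet> e))"
      by (intro continuous_intros continuous_grad_line f)
    show "- T \<le> a"
      using abs_ge_minus_self [of a] abs_ge_zero [of R] norm_ge_zero [of x] unfolding T_def by linarith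
  qed
  also have "\<dots> \<le> (\<integral>\<^sup>+s. ennreal (quart f (x + s *\<^sub>R e)) \<partial>lborel)"
  proof (intro nn_integral_mono)
    fix t
    have "\<bar>4 * f (x + t *\<^sub>R e) ^ 3 * (grad f (x + t *\<^sub>R e) \<bullet> e)\<bar> \<le> quart f (x + t *\<^sub>R e)"
      using Cauchy_Schwarz_ineq2 [of "grad f (x + t *\<^sub>R e)" e] e
      by (simp add: quart_def abs_mult power_abs mult_left_mono)
    then show "indicator {- T..a} t * ennreal \<bar>4 * f (x + t *\<^sub>R e) ^ 3 * (grad f (x + t *\<^sub>R e) \<bullet> e)\<bar>
        \<le> ennreal (quart f (x + t *\<^sub>R e))"
      by (auto simp: indicator_def intro!: ennreal_leI)
  qed
  finally show ?thesis using 0 by simp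
qed

text \<open>A square root on the extended nonnegative reals, so that line integrals may be
  infinite.\<close>

definition esqrt :: "ennreal \<Rightarrow> ennreal" where
  "esqrt x = (if x = top then top else ennreal (sqrt (enn2real x)))"

lemma esqrt_measurable [measurable]: "esqrt \<in> borel_measurable borel"
  unfolding esqrt_def by measurable

lemma esqrt_power2: "(esqrt x)\<^sup>2 = x"
  by (cases x) (auto simp: esqrt_def ennreal_power power2_eq_square ennreal_mult [symmetric] ennreal_top_mult)

lemma le_esqrt: "0 \<le> t \<Longrightarrow> ennreal (t\<^sup>2) \<le> x \<Longrightarrow> ennreal t \<le> esqrt x"
  by (cases x) (auto simp: esqrt_def intro!: ennreal_leI real_le_rsqrt)

text \<open>In each coordinate direction f^2 is at most the root of the line integral of
  \<open>quart f\<close>. Hence f^6 is at most a product of three functions of two variables each,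
  which is the situation of \<open>Loomis_Whitney\<close>.\<close>

lemma sobolev_nn:
  assumes f: "C1c f"
  shows "(\<integral>\<^sup>+x. ennreal (f x ^ 6) \<partial>lborel)\<^sup>2 \<le> (\<integral>\<^sup>+x. ennreal (quart f x) \<partial>lborel) ^ 3"
proof -
  let ?h = "\<lambda>x. ennreal (quart f x)"
  have [measurable]: "quart f \<in> borel_measurable borel" "f \<in> borel_measurable borel"
    using quart_measurable C1c_continuous f by (auto intro: borel_measurable_continuous_onI)
  have mh: "(\<lambda>p. ?h (vec3 (fst p) (fst (snd p)) (snd (snd p)))) \<in> borel_measurable (lborel \<Otimes>\<^sub>M (lborel \<Otimes>\<^sub>M lborel))"
    using measurable_compose [OF vec3_measurable, of ?h borel] by (simp add: lborel_prod split_def)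
  have m: "(\<lambda>x. ?h (vec3 (F x) (G x) (H x))) \<in> borel_measurable M"
    if [measurable]: "F \<in> borel_measurable M" "G \<in> borel_measurable M" "H \<in> borel_measurable M" for F G H and M :: "'x measure"
    using measurable_compose [of "\<lambda>x. (F x, G x, H x)" M _ _ borel, OF _ mh] by simp
  define F1 where "F1 b c = (\<integral>\<^sup>+s. ?h (vec3 s b c) \<partial>lborel)" for b c
  define F2 where "F2 a c = (\<integral>\<^sup>+s. ?h (vec3 a s c) \<partial>lborel)" for a c
  define F3 where "F3 a b = (\<integral>\<^sup>+s. ?h (vec3 a b s) \<partial>lborel)" for a b
  have F1m: "(\<lambda>p. F1 (fst p) (snd p)) \<in> borel_measurable (lborel \<Otimes>\<^sub>M lborel)"
    and F2m: "(\<lambda>p. F2 (fst p) (snd p)) \<in> borel_measurable (lborel \<Otimes>\<^sub>M lborel)"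
    and F3m: "(\<lambda>p. F3 (fst p) (snd p)) \<in> borel_measurable (lborel \<Otimes>\<^sub>M lborel)"
    unfolding F1_def F2_def F3_def
    by (intro lborel.borel_measurable_nn_integral; simp add: split_def; intro m; measurable)+
  have I: "(\<integral>\<^sup>+x. ?h x \<partial>lborel) = (\<integral>\<^sup>+a. \<integral>\<^sup>+b. \<integral>\<^sup>+c. ?h (vec3 a b c) \<partial>lborel \<partial>lborel \<partial>lborel)"
    by (rule nn_integral_R3) measurable
  have I3: "(\<integral>\<^sup>+a. \<integral>\<^sup>+b. F3 a b \<partial>lborel \<partial>lborel) = (\<integral>\<^sup>+x. ?h x \<partial>lborel)"
    unfolding I F3_def ..
  have I2: "(\<integral>\<^sup>+a. \<integral>\<^sup>+c. F2 a c \<partial>lborel \<partial>lborel) = (\<integral>\<^sup>+x. ?h x \<partial>lborel)"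
    unfolding I F2_def
    by (intro nn_integral_cong lborel_pair.Fubini') (simp add: split_def, intro m, measurable)
  have I1: "(\<integral>\<^sup>+b. \<integral>\<^sup>+c. F1 b c \<partial>lborel \<partial>lborel) = (\<integral>\<^sup>+x. ?h x \<partial>lborel)"
  proof -
    have "(\<integral>\<^sup>+b. \<integral>\<^sup>+c. F1 b c \<partial>lborel \<partial>lborel) = (\<integral>\<^sup>+b. \<integral>\<^sup>+s. \<integral>\<^sup>+c. ?h (vec3 s b c) \<partial>lborel \<partial>lborel \<partial>lborel)"
      unfolding F1_def
      by (intro nn_integral_cong lborel_pair.Fubini') (simp add: split_def, intro m, measurable)
    also have "\<dots> = (\<integral>\<^sup>+x. ?h x \<partial>lborel)"
      unfolding I
      by (intro lborel_pair.Fubini', simp add: split_def, intro lborel.borel_measurable_nn_integral, simp add: split_def, intro m, measurable)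
    finally show ?thesis .
  qed
  have pt: "ennreal (f (vec3 a b c) ^ 6) \<le> esqrt (F1 b c) * esqrt (F2 a c) * esqrt (F3 a b)" for a b c
  proof -
    have v: "vec3 s b c = vec3 0 b c + s *\<^sub>R axis 1 1" "vec3 a s c = vec3 a 0 c + s *\<^sub>R axis 2 1"
      "vec3 a b s = vec3 a b 0 + s *\<^sub>R axis 3 1" for s
      by (auto simp: vec_eq_iff forall_3 vector_3 axis_def)
    let ?y = "f (vec3 a b c)"
    have "ennreal (?y ^ 4) \<le> F1 b c" "ennreal (?y ^ 4) \<le> F2 a c" "ennreal (?y ^ 4) \<le> F3 a b"
      unfolding F1_def F2_def F3_def
      using power4_le_line_integral [OF f norm_axis_1, of "vec3 0 b c" a 1]
        power4_le_line_integral [OF f norm_axis_1, of "vec3 a 0 c" b 2]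
        power4_le_line_integral [OF f norm_axis_1, of "vec3 a b 0" c 3]
      unfolding v [symmetric] by auto
    then have "ennreal (?y\<^sup>2) \<le> esqrt (F1 b c)" "ennreal (?y\<^sup>2) \<le> esqrt (F2 a c)" "ennreal (?y\<^sup>2) \<le> esqrt (F3 a b)"
      by (intro le_esqrt; simp)+
    then have "ennreal (?y\<^sup>2) * ennreal (?y\<^sup>2) * ennreal (?y\<^sup>2) \<le> esqrt (F1 b c) * esqrt (F2 a c) * esqrt (F3 a b)"
      by (intro mult_mono) auto
    moreover have y6: "?y ^ 6 = ?y\<^sup>2 * ?y\<^sup>2 * ?y\<^sup>2" by (simp add: power2_eq_square eval_nat_numeral)
    ultimately show ?thesis unfolding y6 by (simp only: ennreal_mult'' zero_le_power2)
  qed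
  have "(\<integral>\<^sup>+x. ennreal (f x ^ 6) \<partial>lborel) = (\<integral>\<^sup>+a. \<integral>\<^sup>+b. \<integral>\<^sup>+c. ennreal (f (vec3 a b c) ^ 6) \<partial>lborel \<partial>lborel \<partial>lborel)"
    by (rule nn_integral_R3) measurable
  also have "\<dots> \<le> (\<integral>\<^sup>+a. \<integral>\<^sup>+b. \<integral>\<^sup>+c. esqrt (F1 b c) * esqrt (F2 a c) * esqrt (F3 a b) \<partial>lborel \<partial>lborel \<partial>lborel)"
    by (intro nn_integral_mono pt)
  finally have "(\<integral>\<^sup>+x. ennreal (f x ^ 6) \<partial>lborel)\<^sup>2
      \<le> (\<integral>\<^sup>+a. \<integral>\<^sup>+b. \<integral>\<^sup>+c. esqrt (F1 b c) * esqrt (F2 a c) * esqrt (F3 a b) \<partial>lborel \<partial>lborel \<partial>lborel)\<^sup>2"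
    by (intro power_mono) auto
  also have "\<dots> \<le> (\<integral>\<^sup>+b. \<integral>\<^sup>+c. F1 b c \<partial>lborel \<partial>lborel) * (\<integral>\<^sup>+a. \<integral>\<^sup>+c. F2 a c \<partial>lborel \<partial>lborel) * (\<integral>\<^sup>+a. \<integral>\<^sup>+b. F3 a b \<partial>lborel \<partial>lborel)"
    using Loomis_Whitney [of "\<lambda>p. esqrt (F1 (fst p) (snd p))" "\<lambda>p. esqrt (F2 (fst p) (snd p))" "\<lambda>p. esqrt (F3 (fst p) (snd p))"]
      measurable_compose [OF F1m esqrt_measurable] measurable_compose [OF F2m esqrt_measurable] measurable_compose [OF F3m esqrt_measurable]
    by (simp add: esqrt_power2)
  also have "\<dots> = (\<integral>\<^sup>+x. ?h x \<partial>lborel) ^ 3"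
    unfolding I1 I2 I3 by (simp add: eval_nat_numeral mult.assoc)
  finally show ?thesis .
qed

text \<open>Let S, G, H be the integrals of f^6, of the squared gradient and of
  \<open>quart f\<close>. Then S^2 \<le> H^3, and H^2 \<le> 16 S G by Cauchy--Schwarz, so S^4 \<le>
  16^3 S^3 G^3. The constant 4096 is 16^3; S is finite and can be cancelled unless it is 0.\<close>

theorem sobolev_C1c:
  assumes f: "C1c f"
  shows "(LINT x|lborel. f x ^ 6) \<le> 4096 * (LINT x|lborel. (norm (grad f x))\<^sup>2) ^ 3"
proof -
  have b: "bounded {x. f x \<noteq> 0}" using f by (simp add: C1c_def)
  have b': "bounded {x. grad f x \<noteq> 0}" by (rule bounded_support_grad [OF f])
  have int: "integrable lborel (\<lambda>x. f x ^ 6)" "integrable lborel (\<lambda>x. (norm (grad f x))\<^sup>2)" "integrable lborel (quart f)"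
    unfolding quart_def
    by (rule integrable_bounded_support; (intro continuous_intros C1c_continuous continuous_grad f)?;
        rule bounded_subset [OF b] bounded_subset [OF b']; force)+
  define S G H where "S = (LINT x|lborel. f x ^ 6)" "G = (LINT x|lborel. (norm (grad f x))\<^sup>2)" "H = (LINT x|lborel. quart f x)"
  have nn: "S \<ge> 0" "G \<ge> 0" "H \<ge> 0"
    unfolding S_G_H_def by (auto intro!: Bochner_Integration.integral_nonneg simp: quart_def)
  have S: "(\<integral>\<^sup>+x. ennreal (f x ^ 6) \<partial>lborel) = ennreal S"
    unfolding S_G_H_def using int by (intro nn_integral_eq_integral) auto
  have G: "(\<integral>\<^sup>+x. ennreal ((norm (grad f x))\<^sup>2) \<partial>lborel) = ennreal G"
    unfolding S_G_H_def using int by (intro nn_integral_eq_integral) auto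
  have H: "(\<integral>\<^sup>+x. ennreal (quart f x) \<partial>lborel) = ennreal H"
    unfolding S_G_H_def by (rule nn_integral_eq_integral [OF int(3)]) (simp add: quart_def)
  have SH: "S\<^sup>2 \<le> H ^ 3"
    using sobolev_nn [OF f] nn by (simp add: S H ennreal_power)
  have [measurable]: "f \<in> borel_measurable borel" "grad f \<in> borel_measurable borel"
    by (intro borel_measurable_continuous_onI C1c_continuous continuous_grad f)+
  have "(\<integral>\<^sup>+x. ennreal (4 * \<bar>f x\<bar> ^ 3) * ennreal (norm (grad f x)) \<partial>lborel)\<^sup>2
      \<le> (\<integral>\<^sup>+x. (ennreal (4 * \<bar>f x\<bar> ^ 3))\<^sup>2 \<partial>lborel) * (\<integral>\<^sup>+x. (ennreal (norm (grad f x)))\<^sup>2 \<partial>lborel)"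
    by (rule Cauchy_Schwarz_nn_integral) measurable
  also have "(\<integral>\<^sup>+x. ennreal (4 * \<bar>f x\<bar> ^ 3) * ennreal (norm (grad f x)) \<partial>lborel) = ennreal H"
    unfolding H [symmetric] quart_def by (simp add: ennreal_mult'')
  also have "(\<integral>\<^sup>+x. (ennreal (4 * \<bar>f x\<bar> ^ 3))\<^sup>2 \<partial>lborel) = (\<integral>\<^sup>+x. 16 * ennreal (f x ^ 6) \<partial>lborel)"
  proof (rule nn_integral_cong)
    fix x
    have "(4 * \<bar>f x\<bar> ^ 3)\<^sup>2 = 16 * f x ^ 6"
      by (simp add: power_mult_distrib flip: power_mult power_abs)
    then have "ennreal ((4 * \<bar>f x\<bar> ^ 3)\<^sup>2) = ennreal 16 * ennreal (f x ^ 6)"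
      by (simp only: ennreal_mult' zero_le_numeral)
    then show "(ennreal (4 * \<bar>f x\<bar> ^ 3))\<^sup>2 = 16 * ennreal (f x ^ 6)"
      by (simp add: ennreal_power)
  qed
  also have "\<dots> = ennreal (16 * S)"
    using nn by (subst nn_integral_cmult) (auto simp: S ennreal_mult'')
  also have "(\<integral>\<^sup>+x. (ennreal (norm (grad f x)))\<^sup>2 \<partial>lborel) = ennreal G"
    by (simp add: ennreal_power G)
  finally have HSG: "H\<^sup>2 \<le> 16 * S * G"
    using nn by (simp add: ennreal_power flip: ennreal_mult'')
  have "(S\<^sup>2)\<^sup>2 \<le> (H ^ 3)\<^sup>2" using SH by (intro power_mono) auto
  also have "\<dots> = (H\<^sup>2) ^ 3" by (simp flip: power_mult)
  also have "\<dots> \<le> (16 * S * G) ^ 3" using HSG by (intro power_mono) auto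
  finally have "S ^ 3 * S \<le> S ^ 3 * (4096 * G ^ 3)" by (simp add: power_mult_distrib flip: power_mult) (simp add: eval_nat_numeral)
  then have "S \<le> 4096 * G ^ 3"
    using nn by (cases "S = 0") auto
  then show ?thesis unfolding S_G_H_def .
qed

text \<open>The increment is integrated along the segment from x to x + v; Cauchy--Schwarz over its
  parameter, Fubini and translation invariance give the bound.\<close>

lemma translation_C1c:
  assumes f: "C1c f"
  shows "(\<integral>\<^sup>+x. ennreal ((f (x + v) - f x)\<^sup>2) \<partial>lborel) \<le> ennreal ((norm v)\<^sup>2) * (\<integral>\<^sup>+x. ennreal ((norm (grad f x))\<^sup>2) \<partial>lborel)"
proof -
  have [measurable]: "f \<in> borel_measurable borel" "grad f \<in> borel_measurable borel"
    by (intro borel_measurable_continuous_onI C1c_continuous continuous_grad f)+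
  have pt: "ennreal ((f (x + v) - f x)\<^sup>2) \<le> ennreal ((norm v)\<^sup>2) * (\<integral>\<^sup>+t. indicator {0..1} t * ennreal ((norm (grad f (x + t *\<^sub>R v)))\<^sup>2) \<partial>lborel)" for x
  proof -
    have "ennreal \<bar>f (x + 1 *\<^sub>R v) - f (x + 0 *\<^sub>R v)\<bar> \<le> (\<integral>\<^sup>+t. indicator {0..1} t * ennreal \<bar>grad f (x + t *\<^sub>R v) \<bullet> v\<bar> \<partial>lborel)"
      by (rule line_increment_le, rule line_derivative [OF f])
        (intro continuous_intros continuous_grad_line f, simp)
    then have "(ennreal \<bar>f (x + v) - f x\<bar>)\<^sup>2 \<le> (\<integral>\<^sup>+t. indicator {0..1} t * ennreal \<bar>grad f (x + t *\<^sub>R v) \<bullet> v\<bar> \<partial>lborel)\<^sup>2"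
      by (intro power_mono) auto
    also have "\<dots> = (\<integral>\<^sup>+t. indicator {0..1} t * (indicator {0..1} t * ennreal \<bar>grad f (x + t *\<^sub>R v) \<bullet> v\<bar>) \<partial>lborel)\<^sup>2"
      by (intro arg_cong [of _ _ "\<lambda>y. y\<^sup>2"] nn_integral_cong) (auto simp: indicator_def)
    also have "\<dots> \<le> (\<integral>\<^sup>+t. (indicator {0..1::real} t)\<^sup>2 \<partial>lborel) * (\<integral>\<^sup>+t. (indicator {0..1} t * ennreal \<bar>grad f (x + t *\<^sub>R v) \<bullet> v\<bar>)\<^sup>2 \<partial>lborel)"
      by (rule Cauchy_Schwarz_nn_integral) measurable
    also have "(\<integral>\<^sup>+t. (indicator {0..1::real} t)\<^sup>2 \<partial>lborel) = (\<integral>\<^sup>+t. indicator {0..1::real} t \<partial>lborel)"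
      by (intro nn_integral_cong) (auto simp: indicator_def)
    also have "\<dots> = 1" by simp
    also have "(\<integral>\<^sup>+t. (indicator {0..1} t * ennreal \<bar>grad f (x + t *\<^sub>R v) \<bullet> v\<bar>)\<^sup>2 \<partial>lborel)
        \<le> (\<integral>\<^sup>+t. ennreal ((norm v)\<^sup>2) * (indicator {0..1} t * ennreal ((norm (grad f (x + t *\<^sub>R v)))\<^sup>2)) \<partial>lborel)"
    proof (intro nn_integral_mono)
      fix t
      have "\<bar>grad f (x + t *\<^sub>R v) \<bullet> v\<bar>\<^sup>2 \<le> (norm (grad f (x + t *\<^sub>R v)) * norm v)\<^sup>2"
        by (intro power_mono Cauchy_Schwarz_ineq2) auto
      then have "ennreal (\<bar>grad f (x + t *\<^sub>R v) \<bullet> v\<bar>\<^sup>2) \<le> ennreal ((norm v)\<^sup>2) * ennreal ((norm (grad f (x + t *\<^sub>R v)))\<^sup>2)"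
        by (simp add: power_mult_distrib mult.commute flip: ennreal_mult'')
      then show "(indicator {0..1} t * ennreal \<bar>grad f (x + t *\<^sub>R v) \<bullet> v\<bar>)\<^sup>2
         \<le> ennreal ((norm v)\<^sup>2) * (indicator {0..1} t * ennreal ((norm (grad f (x + t *\<^sub>R v)))\<^sup>2))"
        by (auto simp: indicator_def ennreal_power simp del: power2_abs)
    qed
    also have "\<dots> = ennreal ((norm v)\<^sup>2) * (\<integral>\<^sup>+t. indicator {0..1} t * ennreal ((norm (grad f (x + t *\<^sub>R v)))\<^sup>2) \<partial>lborel)"
      by (rule nn_integral_cmult) measurable
    finally show ?thesis by (simp add: ennreal_power)
  qed
  have "(\<integral>\<^sup>+x. ennreal ((f (x + v) - f x)\<^sup>2) \<partial>lborel)
      \<le> (\<integral>\<^sup>+x. ennreal ((norm v)\<^sup>2) * (\<integral>\<^sup>+t. indicator {0..1} t * ennreal ((norm (grad f (x + t *\<^sub>R v)))\<^sup>2) \<partial>lborel) \<partial>lborel)"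
    by (intro nn_integral_mono pt)
  also have "\<dots> = ennreal ((norm v)\<^sup>2) * (\<integral>\<^sup>+x. \<integral>\<^sup>+t. indicator {0..1::real} t * ennreal ((norm (grad f (x + t *\<^sub>R v)))\<^sup>2) \<partial>lborel \<partial>lborel)"
    by (rule nn_integral_cmult) measurable
  also have "(\<integral>\<^sup>+x. \<integral>\<^sup>+t. indicator {0..1::real} t * ennreal ((norm (grad f (x + t *\<^sub>R v)))\<^sup>2) \<partial>lborel \<partial>lborel)
     = (\<integral>\<^sup>+t. \<integral>\<^sup>+x. indicator {0..1::real} t * ennreal ((norm (grad f (x + t *\<^sub>R v)))\<^sup>2) \<partial>lborel \<partial>lborel)"
    by (rule lborel_pair.Fubini'[symmetric]) measurable
  also have "\<dots> = (\<integral>\<^sup>+t. indicator {0..1::real} t * (\<integral>\<^sup>+x. ennreal ((norm (grad f x))\<^sup>2) \<partial>lborel) \<partial>lborel)"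
  proof (rule nn_integral_cong)
    fix t :: real
    have "(\<integral>\<^sup>+x. ennreal ((norm (grad f (x + t *\<^sub>R v)))\<^sup>2) \<partial>lborel)
        = (\<integral>\<^sup>+x. ennreal ((norm (grad f x))\<^sup>2) \<partial>distr lborel borel ((+) (t *\<^sub>R v)))"
      by (subst nn_integral_distr) (auto simp: add.commute)
    then show "(\<integral>\<^sup>+x. indicator {0..1::real} t * ennreal ((norm (grad f (x + t *\<^sub>R v)))\<^sup>2) \<partial>lborel)
       = indicator {0..1::real} t * (\<integral>\<^sup>+x. ennreal ((norm (grad f x))\<^sup>2) \<partial>lborel)"
      by (simp add: nn_integral_cmult lborel_distr_plus)
  qed
  also have "\<dots> = (\<integral>\<^sup>+x. ennreal ((norm (grad f x))\<^sup>2) \<partial>lborel)"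
    by (subst nn_integral_multc) auto
  finally show ?thesis .
qed

section \<open>The Hilbert space\<close>

definition square_integrable :: "(R3 \<Rightarrow> 'b::euclidean_space) \<Rightarrow> bool" where
  "square_integrable f \<longleftrightarrow> f \<in> borel_measurable lebesgue \<and> integrable lebesgue (\<lambda>x. (norm (f x))\<^sup>2)"

lemma norm_add_square_le: "(norm (a + b))\<^sup>2 \<le> 2 * (norm a)\<^sup>2 + 2 * (norm (b::'b::real_normed_vector))\<^sup>2"
proof -
  have "(norm (a + b))\<^sup>2 \<le> (norm a + norm b)\<^sup>2" by (intro power_mono norm_triangle_ineq) auto
  also have "\<dots> \<le> 2 * (norm a)\<^sup>2 + 2 * (norm b)\<^sup>2"
    using sum_squares_bound [of "norm a" "norm b"] by (simp add: power2_sum)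
  finally show ?thesis .
qed

lemma square_integrable_add:
  assumes "square_integrable f" "square_integrable g"
  shows "square_integrable (\<lambda>x. f x + g x)"
  unfolding square_integrable_def
proof
  show "(\<lambda>x. f x + g x) \<in> borel_measurable lebesgue"
    using assms by (auto simp: square_integrable_def)
  then have [measurable]: "(\<lambda>x. f x + g x) \<in> borel_measurable lebesgue" .
  show "integrable lebesgue (\<lambda>x. (norm (f x + g x))\<^sup>2)"
  proof (rule Bochner_Integration.integrable_bound)
    show "integrable lebesgue (\<lambda>x. 2 * (norm (f x))\<^sup>2 + 2 * (norm (g x))\<^sup>2)"
      using assms by (auto simp: square_integrable_def)
    show "AE x in lebesgue. norm ((norm (f x + g x))\<^sup>2) \<le> norm (2 * (norm (f x))\<^sup>2 + 2 * (norm (g x))\<^sup>2)"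
      by (rule AE_I2) (simp add: norm_add_square_le)
  qed measurable
qed

lemma square_integrable_scaleR:
  "square_integrable f \<Longrightarrow> square_integrable (\<lambda>x. c *\<^sub>R f x)"
  by (auto simp: square_integrable_def power_mult_distrib)

lemma square_integrable_diff:
  "square_integrable f \<Longrightarrow> square_integrable g \<Longrightarrow> square_integrable (\<lambda>x. f x - g x)"
  using square_integrable_add [of f "\<lambda>x. (- 1) *\<^sub>R g x"] square_integrable_scaleR [of g "- 1"] by simp

lemma square_integrable_inner:
  assumes "square_integrable f" "square_integrable g"
  shows "integrable lebesgue (\<lambda>x. f x \<bullet> g x)"
proof (rule Bochner_Integration.integrable_bound [of lebesgue "\<lambda>x. (norm (f x))\<^sup>2 + (norm (g x))\<^sup>2"])
  show "(\<lambda>x. f x \<bullet> g x) \<in> borel_measurable lebesgue"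
    using assms by (auto simp: square_integrable_def)
  show "AE x in lebesgue. norm (f x \<bullet> g x) \<le> norm ((norm (f x))\<^sup>2 + (norm (g x))\<^sup>2)"
  proof (rule AE_I2)
    fix x
    have "\<bar>f x \<bullet> g x\<bar> \<le> norm (f x) * norm (g x)" by (rule Cauchy_Schwarz_ineq2)
    also have "\<dots> \<le> (norm (f x))\<^sup>2 + (norm (g x))\<^sup>2"
      using sum_squares_bound [of "norm (f x)" "norm (g x)"]
        mult_nonneg_nonneg [OF norm_ge_zero norm_ge_zero, of "f x" "g x"] by linarith
    finally show "norm (f x \<bullet> g x) \<le> norm ((norm (f x))\<^sup>2 + (norm (g x))\<^sup>2)" by simp
  qed
qed (use assms in \<open>auto simp: square_integrable_def\<close>)

text \<open>The Sobolev space as a space of pairs, the L2 closure of all (\<phi>, grad \<phi>). With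
  the gradient carried along as a second component the inner product is a plain L2 product; that
  this component is the weak gradient of the first is \<open>has_weak_gradient_val\<close>.\<close>

definition h1set :: "(R3 \<Rightarrow> real \<times> R3) set" where
  "h1set = {f. square_integrable f \<and>
     (\<forall>e>0. \<exists>\<phi>\<in>test_functions. (LINT x|lebesgue. (norm (f x - (\<phi> x, grad \<phi> x)))\<^sup>2) < e)}"

lemma square_integrable_continuous:
  fixes f :: "R3 \<Rightarrow> 'b::euclidean_space"
  assumes "continuous_on UNIV f" "bounded {x. f x \<noteq> 0}"
  shows "square_integrable f"
proof -
  have "integrable lebesgue (\<lambda>x. (norm (f x))\<^sup>2)"
    using assms by (intro integrable_bounded_support continuous_intros bounded_subset [OF assms(2)]) auto
  moreover have "f \<in> borel_measurable lebesgue"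
    using assms(1) by (simp add: measurable_completion borel_measurable_continuous_onI)
  ultimately show ?thesis by (simp add: square_integrable_def)
qed

lemma square_integrable_test:
  assumes "\<phi> \<in> test_functions"
  shows "square_integrable (\<lambda>x. (\<phi> x, grad \<phi> x))"
proof (rule square_integrable_continuous)
  have \<phi>: "C1c \<phi>" by (rule C1c_test [OF assms])
  show "continuous_on UNIV (\<lambda>x. (\<phi> x, grad \<phi> x))"
    by (intro continuous_intros C1c_continuous continuous_grad \<phi>)
  have "bounded ({x. \<phi> x \<noteq> 0} \<union> {x. grad \<phi> x \<noteq> 0})"
    using bounded_support_grad [OF \<phi>] \<phi> by (simp add: C1c_def)
  then show "bounded {x. (\<phi> x, grad \<phi> x) \<noteq> 0}"
    by (rule bounded_subset) (auto simp: zero_prod_def)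
qed

lemma h1set_test: "\<phi> \<in> test_functions \<Longrightarrow> (\<lambda>x. (\<phi> x, grad \<phi> x)) \<in> h1set"
  by (auto simp: h1set_def square_integrable_test intro!: bexI [of _ \<phi>])

lemma h1set_square_integrable: "f \<in> h1set \<Longrightarrow> square_integrable f"
  by (simp add: h1set_def)

lemma h1set_closure:
  assumes f: "square_integrable f"
    and appr: "\<And>e. e > 0 \<Longrightarrow> \<exists>g\<in>h1set. (LINT x|lebesgue. (norm (f x - g x))\<^sup>2) < e"
  shows "f \<in> h1set"
  unfolding h1set_def
proof (intro CollectI conjI f allI impI)
  fix e :: real assume e: "e > 0"
  obtain g where g: "g \<in> h1set" "(LINT x|lebesgue. (norm (f x - g x))\<^sup>2) < e / 4"
    using appr [of "e / 4"] e by auto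
  have "e / 4 > 0" using e by simp
  then obtain \<phi> where \<phi>: "\<phi> \<in> test_functions" "(LINT x|lebesgue. (norm (g x - (\<phi> x, grad \<phi> x)))\<^sup>2) < e / 4"
    using g(1) unfolding h1set_def by blast
  let ?\<phi> = "\<lambda>x. (\<phi> x, grad \<phi> x)"
  have sq: "square_integrable (\<lambda>x. f x - g x)" "square_integrable (\<lambda>x. g x - ?\<phi> x)" "square_integrable (\<lambda>x. f x - ?\<phi> x)"
    by (intro square_integrable_diff f h1set_square_integrable [OF g(1)] square_integrable_test \<phi>)+
  have "(LINT x|lebesgue. (norm (f x - ?\<phi> x))\<^sup>2)
      \<le> (LINT x|lebesgue. 2 * (norm (f x - g x))\<^sup>2 + 2 * (norm (g x - ?\<phi> x))\<^sup>2)"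
  proof (rule integral_mono)
    show "(norm (f x - ?\<phi> x))\<^sup>2 \<le> 2 * (norm (f x - g x))\<^sup>2 + 2 * (norm (g x - ?\<phi> x))\<^sup>2" for x
      using norm_add_square_le [of "f x - g x" "g x - ?\<phi> x"] by (simp only: diff_add_cancel diff_add_eq add_diff_eq)
  qed (use sq in \<open>auto simp: square_integrable_def\<close>)
  also have "\<dots> = 2 * (LINT x|lebesgue. (norm (f x - g x))\<^sup>2) + 2 * (LINT x|lebesgue. (norm (g x - ?\<phi> x))\<^sup>2)"
    using sq by (subst Bochner_Integration.integral_add) (auto simp: square_integrable_def)
  also have "\<dots> < e" using g \<phi> by simp
  finally show "\<exists>\<phi>\<in>test_functions. (LINT x|lebesgue. (norm (f x - (\<phi> x, grad \<phi> x)))\<^sup>2) < e"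
    using \<phi>(1) by blast
qed

lemma grad_add: "C1c f \<Longrightarrow> C1c g \<Longrightarrow> grad (\<lambda>x. f x + g x) = (\<lambda>x. grad f x + grad g x)"
  by (auto simp: grad_def fun_eq_iff vec_eq_iff partial_deriv_add C1c_differentiable)

lemma grad_cmult: "C1c f \<Longrightarrow> grad (\<lambda>x. c * f x) = (\<lambda>x. c *\<^sub>R grad f x)"
  by (auto simp: grad_def fun_eq_iff vec_eq_iff partial_deriv_cmult C1c_differentiable)

lemma h1set_scaleR:
  assumes "f \<in> h1set"
  shows "(\<lambda>x. c *\<^sub>R f x) \<in> h1set"
proof (rule h1set_closure)
  show "square_integrable (\<lambda>x. c *\<^sub>R f x)"
    using assms by (intro square_integrable_scaleR h1set_square_integrable)
  fix e :: real assume e: "e > 0"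
  have e': "e / (c\<^sup>2 + 1) > 0" using e by (simp add: add_nonneg_pos)
  then obtain \<phi> where \<phi>: "\<phi> \<in> test_functions" "(LINT x|lebesgue. (norm (f x - (\<phi> x, grad \<phi> x)))\<^sup>2) < e / (c\<^sup>2 + 1)"
    using assms by (auto simp: h1set_def)
  let ?\<phi> = "\<lambda>x. (c * \<phi> x, grad (\<lambda>x. c * \<phi> x) x)"
  have eq: "?\<phi> x = c *\<^sub>R (\<phi> x, grad \<phi> x)" for x
    using \<phi> by (simp add: grad_cmult C1c_test)
  have "(LINT x|lebesgue. (norm (c *\<^sub>R f x - ?\<phi> x))\<^sup>2) = c\<^sup>2 * (LINT x|lebesgue. (norm (f x - (\<phi> x, grad \<phi> x)))\<^sup>2)"
    unfolding eq scaleR_diff_right [symmetric] by (simp add: power_mult_distrib)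
  also have "\<dots> \<le> (c\<^sup>2 + 1) * (LINT x|lebesgue. (norm (f x - (\<phi> x, grad \<phi> x)))\<^sup>2)"
    by (intro mult_right_mono Bochner_Integration.integral_nonneg) auto
  also have "\<dots> < (c\<^sup>2 + 1) * (e / (c\<^sup>2 + 1))"
    by (intro mult_strict_left_mono \<phi>) (simp add: add_nonneg_pos)
  also have "\<dots> = e" using zero_le_power2 [of c] by (simp add: add_nonneg_eq_0_iff)
  finally show "\<exists>g\<in>h1set. (LINT x|lebesgue. (norm (c *\<^sub>R f x - g x))\<^sup>2) < e"
    by (intro bexI [of _ ?\<phi>] h1set_test [OF test_functions_cmult [OF \<phi>(1), of c]])
qed

lemma h1set_add:
  assumes "f \<in> h1set" "g \<in> h1set"
  shows "(\<lambda>x. f x + g x) \<in> h1set"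
proof (rule h1set_closure)
  show "square_integrable (\<lambda>x. f x + g x)"
    using assms by (intro square_integrable_add h1set_square_integrable)
  fix e :: real assume "e > 0"
  then have "e / 4 > 0" by simp
  then obtain \<phi> \<psi> where \<phi>: "\<phi> \<in> test_functions" "(LINT x|lebesgue. (norm (f x - (\<phi> x, grad \<phi> x)))\<^sup>2) < e / 4"
    and \<psi>: "\<psi> \<in> test_functions" "(LINT x|lebesgue. (norm (g x - (\<psi> x, grad \<psi> x)))\<^sup>2) < e / 4"
    using assms unfolding h1set_def by blast
  let ?\<phi> = "\<lambda>x. (\<phi> x, grad \<phi> x)" and ?\<psi> = "\<lambda>x. (\<psi> x, grad \<psi> x)"
  let ?\<chi> = "\<lambda>x. (\<phi> x + \<psi> x, grad (\<lambda>x. \<phi> x + \<psi> x) x)"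
  have eq: "?\<chi> x = ?\<phi> x + ?\<psi> x" for x
    using \<phi> \<psi> by (simp add: grad_add C1c_test)
  have sq: "square_integrable (\<lambda>x. f x - ?\<phi> x)" "square_integrable (\<lambda>x. g x - ?\<psi> x)"
    by (intro square_integrable_diff square_integrable_test \<phi>(1) \<psi>(1) h1set_square_integrable assms)+
  have sq2: "square_integrable (\<lambda>x. f x + g x - ?\<chi> x)"
    using square_integrable_add [OF sq] by (simp add: eq algebra_simps)
  have "(LINT x|lebesgue. (norm (f x + g x - ?\<chi> x))\<^sup>2)
      \<le> (LINT x|lebesgue. 2 * (norm (f x - ?\<phi> x))\<^sup>2 + 2 * (norm (g x - ?\<psi> x))\<^sup>2)"
  proof (rule integral_mono)
    show "(norm (f x + g x - ?\<chi> x))\<^sup>2 \<le> 2 * (norm (f x - ?\<phi> x))\<^sup>2 + 2 * (norm (g x - ?\<psi> x))\<^sup>2" for x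
      using norm_add_square_le [of "f x - ?\<phi> x" "g x - ?\<psi> x"] by (simp add: eq algebra_simps)
  qed (use sq sq2 in \<open>auto simp: square_integrable_def\<close>)
  also have "\<dots> = 2 * (LINT x|lebesgue. (norm (f x - ?\<phi> x))\<^sup>2) + 2 * (LINT x|lebesgue. (norm (g x - ?\<psi> x))\<^sup>2)"
    using sq by (subst Bochner_Integration.integral_add) (auto simp: square_integrable_def)
  also have "\<dots> < e" using \<phi> \<psi> by simp
  finally show "\<exists>h\<in>h1set. (LINT x|lebesgue. (norm (f x + g x - h x))\<^sup>2) < e"
    by (intro bexI [of _ ?\<chi>] h1set_test [OF test_functions_add [OF \<phi>(1) \<psi>(1)]])
qed

lemma h1set_0: "(\<lambda>x. 0) \<in> h1set"
  using h1set_scaleR [OF h1set_test [OF test_functions_0], of 0] by (simp flip: zero_prod_def)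

text \<open>An element of the space is the canonical representative of a class of functions that agree
  almost everywhere.\<close>

definition canon :: "(R3 \<Rightarrow> real \<times> R3) \<Rightarrow> R3 \<Rightarrow> real \<times> R3" where
  "canon f = (SOME g. g \<in> h1set \<and> (AE x in lebesgue. g x = f x))"

lemma canon:
  assumes "f \<in> h1set"
  shows "canon f \<in> h1set" "AE x in lebesgue. canon f x = f x"
proof -
  have "canon f \<in> h1set \<and> (AE x in lebesgue. canon f x = f x)"
    unfolding canon_def by (rule someI [of _ f]) (use assms in auto)
  then show "canon f \<in> h1set" "AE x in lebesgue. canon f x = f x" by auto
qed

lemma canon_cong:
  assumes "AE x in lebesgue. f x = g x"
  shows "canon f = canon g"
proof -
  have "(AE x in lebesgue. h x = f x) \<longleftrightarrow> (AE x in lebesgue. h x = g x)" for h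
  proof
    assume "AE x in lebesgue. h x = f x"
    with assms show "AE x in lebesgue. h x = g x" by eventually_elim simp
  next
    assume "AE x in lebesgue. h x = g x"
    with assms show "AE x in lebesgue. h x = f x" by eventually_elim simp
  qed
  then show ?thesis by (simp add: canon_def)
qed

typedef h1 = "{f \<in> h1set. canon f = f}"
  morphisms rep mk0
  using canon [OF h1set_0] canon_cong [OF canon(2) [OF h1set_0]] by auto

definition mk :: "(R3 \<Rightarrow> real \<times> R3) \<Rightarrow> h1" where
  "mk f = mk0 (canon f)"

lemma rep_h1set: "rep u \<in> h1set"
  using rep [of u] by simp

lemma rep_square_integrable: "square_integrable (rep u)"
  by (rule h1set_square_integrable [OF rep_h1set])

lemma rep_measurable [measurable]: "rep u \<in> borel_measurable lebesgue"
  using rep_square_integrable by (simp add: square_integrable_def)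

lemma rep_mk:
  assumes "f \<in> h1set"
  shows "AE x in lebesgue. rep (mk f) x = f x"
proof -
  have "rep (mk f) = canon f"
    unfolding mk_def using canon [OF assms] canon_cong [OF canon(2) [OF assms]]
    by (intro mk0_inverse) auto
  then show ?thesis using canon [OF assms] by simp
qed

lemma h1_eqI:
  assumes "AE x in lebesgue. rep u x = rep v x"
  shows "u = v"
  using canon_cong [OF assms] rep [of u] rep [of v] by (simp add: rep_inject)

instantiation h1 :: real_inner
begin

definition "0 = mk (\<lambda>_. 0)"
definition "u + v = mk (\<lambda>x. rep u x + rep v x)"
definition "u - v = mk (\<lambda>x. rep u x - rep v x)"
definition "- u = mk (\<lambda>x. - rep u x)"
definition "c *\<^sub>R u = mk (\<lambda>x. c *\<^sub>R rep u x)"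
definition "u \<bullet> v = (LINT x|lebesgue. rep u x \<bullet> rep v x)"
definition "norm (u::h1) = sqrt (u \<bullet> u)"
definition "sgn (u::h1) = inverse (norm u) *\<^sub>R u"
definition "dist (u::h1) v = norm (u - v)"
definition "uniformity = (INF e\<in>{0 <..}. principal {(x, y). dist (x::h1) y < e})"
definition "open U = (\<forall>x\<in>U. eventually (\<lambda>(x', y). (x'::h1) = x \<longrightarrow> y \<in> U) uniformity)"

lemma rep_0: "AE x in lebesgue. rep 0 x = 0"
  unfolding zero_h1_def by (rule rep_mk [OF h1set_0])

lemma rep_add: "AE x in lebesgue. rep (u + v) x = rep u x + rep v x"
  unfolding plus_h1_def by (intro rep_mk h1set_add rep_h1set)

lemma rep_scaleR: "AE x in lebesgue. rep (c *\<^sub>R u) x = c *\<^sub>R rep u x"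
  unfolding scaleR_h1_def by (intro rep_mk h1set_scaleR rep_h1set)

lemma rep_minus: "AE x in lebesgue. rep (- u) x = - rep u x"
  unfolding uminus_h1_def using h1set_scaleR [OF rep_h1set [of u], of "- 1"] by (intro rep_mk) simp

lemma rep_diff: "AE x in lebesgue. rep (u - v) x = rep u x - rep v x"
  unfolding minus_h1_def using h1set_add [OF rep_h1set [of u] h1set_scaleR [OF rep_h1set [of v], of "- 1"]]
  by (intro rep_mk) simp

lemma integrable_inner_rep: "integrable lebesgue (\<lambda>x. rep u x \<bullet> rep v x)"
  by (intro square_integrable_inner rep_square_integrable)

instance
proof
  fix a b c :: h1 and r s :: real
  show "a + b + c = a + (b + c)"
    by (rule h1_eqI) (use rep_add [of "a + b" c] rep_add [of a b] rep_add [of a "b + c"] rep_add [of b c] in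
      \<open>eventually_elim, simp add: add.assoc\<close>)
  show "a + b = b + a"
    by (rule h1_eqI) (use rep_add [of a b] rep_add [of b a] in \<open>eventually_elim, simp add: add.commute\<close>)
  show "0 + a = a"
    by (rule h1_eqI) (use rep_add [of 0 a] rep_0 in \<open>eventually_elim, simp\<close>)
  show "- a + a = 0"
    by (rule h1_eqI) (use rep_add [of "- a" a] rep_minus [of a] rep_0 in \<open>eventually_elim, simp\<close>)
  show "a - b = a + - b"
    by (rule h1_eqI) (use rep_add [of a "- b"] rep_minus [of b] rep_diff [of a b] in \<open>eventually_elim, simp\<close>)
  show "r *\<^sub>R (a + b) = r *\<^sub>R a + r *\<^sub>R b"
    by (rule h1_eqI) (use rep_scaleR [of r "a + b"] rep_add [of a b] rep_add [of "r *\<^sub>R a" "r *\<^sub>R b"] rep_scaleR [of r a] rep_scaleR [of r b] in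
      \<open>eventually_elim, simp add: scaleR_right_distrib\<close>)
  show "(r + s) *\<^sub>R a = r *\<^sub>R a + s *\<^sub>R a"
    by (rule h1_eqI) (use rep_scaleR [of "r + s" a] rep_add [of "r *\<^sub>R a" "s *\<^sub>R a"] rep_scaleR [of r a] rep_scaleR [of s a] in
      \<open>eventually_elim, simp add: scaleR_left_distrib\<close>)
  show "r *\<^sub>R s *\<^sub>R a = (r * s) *\<^sub>R a"
    by (rule h1_eqI) (use rep_scaleR [of r "s *\<^sub>R a"] rep_scaleR [of s a] rep_scaleR [of "r * s" a] in
      \<open>eventually_elim, simp\<close>)
  show "1 *\<^sub>R a = a"
    by (rule h1_eqI) (use rep_scaleR [of 1 a] in \<open>eventually_elim, simp\<close>)
  show "dist a b = norm (a - b)" by (rule dist_h1_def)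
  show "sgn a = inverse (norm a) *\<^sub>R a" by (rule sgn_h1_def)
  show "norm a = sqrt (a \<bullet> a)" by (rule norm_h1_def)
  show "a \<bullet> b = b \<bullet> a" by (simp add: inner_h1_def inner_commute)
  show "(a + b) \<bullet> c = a \<bullet> c + b \<bullet> c"
  proof -
    have "(a + b) \<bullet> c = (LINT x|lebesgue. rep a x \<bullet> rep c x + rep b x \<bullet> rep c x)"
      unfolding inner_h1_def by (rule integral_cong_AE)
        (measurable, use rep_add [of a b] in \<open>eventually_elim, simp add: inner_add_left\<close>)
    then show ?thesis by (simp add: inner_h1_def integrable_inner_rep)
  qed
  show "r *\<^sub>R a \<bullet> b = r * (a \<bullet> b)"
  proof -
    have "r *\<^sub>R a \<bullet> b = (LINT x|lebesgue. r * (rep a x \<bullet> rep b x))"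
      unfolding inner_h1_def by (rule integral_cong_AE)
        (measurable, use rep_scaleR [of r a] in \<open>eventually_elim, simp\<close>)
    then show ?thesis by (simp add: inner_h1_def)
  qed
  show "0 \<le> a \<bullet> a" by (simp add: inner_h1_def)
  show "(a \<bullet> a = 0) = (a = 0)"
  proof
    assume "a \<bullet> a = 0"
    then have a0: "AE x in lebesgue. rep a x \<bullet> rep a x = 0"
      unfolding inner_h1_def
      using integral_nonneg_eq_0_iff_AE [OF integrable_inner_rep [of a a]] by simp
    show "a = 0"
      by (rule h1_eqI) (use a0 rep_0 in \<open>eventually_elim, simp\<close>)
  next
    assume "a = 0"
    then have "a \<bullet> a = (LINT x|(lebesgue::R3 measure). 0)"
      unfolding inner_h1_def by (intro integral_cong_AE)
        (measurable, use rep_0 in \<open>eventually_elim, simp\<close>)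
    then show "a \<bullet> a = 0" by simp
  qed
qed (simp_all add: uniformity_h1_def open_h1_def)

end

lemma norm_h1_square: "(norm (u::h1))\<^sup>2 = (LINT x|lebesgue. (norm (rep u x))\<^sup>2)"
  by (simp add: norm_eq_sqrt_inner inner_h1_def power2_norm_eq_inner)

lemma norm_diff_mk:
  assumes "f \<in> h1set"
  shows "(norm (u - mk f))\<^sup>2 = (LINT x|lebesgue. (norm (rep u x - f x))\<^sup>2)"
  unfolding norm_h1_square
proof (rule integral_cong_AE)
  show "AE x in lebesgue. (norm (rep (u - mk f) x))\<^sup>2 = (norm (rep u x - f x))\<^sup>2"
    using rep_diff [of u "mk f"] rep_mk [OF assms] by eventually_elim simp
qed (use h1set_square_integrable [OF assms] in \<open>auto simp: square_integrable_def\<close>)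

subsection \<open>Completeness\<close>

text \<open>Even with weights 2^n the squared differences have summable integrals, so at almost
  every x the weighted squares are bounded in n. The differences are then geometrically small and
  the telescoping series converges.\<close>

lemma fast_Cauchy_AE_convergent:
  fixes f :: "nat \<Rightarrow> R3 \<Rightarrow> 'b::euclidean_space"
  assumes sq: "\<And>n. square_integrable (f n)"
    and fast: "\<And>n. (LINT x|lebesgue. (norm (f (Suc n) x - f n x))\<^sup>2) \<le> (1 / 4) ^ n"
  shows "AE x in lebesgue. convergent (\<lambda>n. f n x)"
proof -
  have m [measurable]: "f n \<in> borel_measurable lebesgue" for n
    using sq by (simp add: square_integrable_def)
  let ?g = "\<lambda>n x. 2 ^ n * (norm (f (Suc n) x - f n x))\<^sup>2"
  have "(\<integral>\<^sup>+x. (\<Sum>n. ennreal (?g n x)) \<partial>lebesgue) = (\<Sum>n. \<integral>\<^sup>+x. ennreal (?g n x) \<partial>lebesgue)"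
    by (rule nn_integral_suminf) measurable
  also have "\<dots> \<le> (\<Sum>n. ennreal ((1 / 2) ^ n))"
  proof (rule suminf_le)
    fix n
    have "(\<integral>\<^sup>+x. ennreal (?g n x) \<partial>lebesgue) = ennreal (LINT x|lebesgue. ?g n x)"
      using square_integrable_diff [OF sq sq, of "Suc n" n]
      by (intro nn_integral_eq_integral) (auto simp: square_integrable_def)
    also have "\<dots> \<le> ennreal (2 ^ n * (1 / 4) ^ n)"
      using fast [of n] by (intro ennreal_leI) simp
    also have "2 ^ n * (1 / 4) ^ n = (1 / 2 :: real) ^ n"
      by (simp flip: power_mult_distrib)
    finally show "(\<integral>\<^sup>+x. ennreal (?g n x) \<partial>lebesgue) \<le> ennreal ((1 / 2) ^ n)" .
  qed auto
  also have "\<dots> = ennreal (\<Sum>n. (1 / 2) ^ n)"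
    by (rule suminf_ennreal2) auto
  also have "\<dots> < \<infinity>" by simp
  finally have "AE x in lebesgue. (\<Sum>n. ennreal (?g n x)) \<noteq> \<infinity>"
    by (intro nn_integral_PInf_AE) auto
  then show ?thesis
  proof eventually_elim
    case (elim x)
    define a where "a = (\<lambda>n. ennreal (?g n x))"
    define C where "C = enn2real (suminf a)"
    have fin: "suminf a \<noteq> top" using elim unfolding a_def infinity_ennreal_def .
    have C: "?g n x \<le> C" for n
    proof -
      have "sum a {n} \<le> suminf a" by (rule sum_le_suminf) auto
      then have "a n \<le> ennreal C" using fin by (simp add: C_def less_top)
      moreover have "C \<ge> 0" by (simp add: C_def)
      ultimately show ?thesis unfolding a_def by (simp only: ennreal_le_iff)
    qed
    have "norm (f (Suc n) x - f n x) \<le> sqrt C * (1 / sqrt 2) ^ n" for n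
    proof -
      have "(norm (f (Suc n) x - f n x))\<^sup>2 \<le> C / 2 ^ n" using C [of n] by (simp add: field_simps)
      then have "norm (f (Suc n) x - f n x) \<le> sqrt (C / 2 ^ n)" by (rule real_le_rsqrt)
      also have "\<dots> = sqrt C * (1 / sqrt 2) ^ n"
        by (simp add: real_sqrt_divide real_sqrt_power power_divide)
      finally show ?thesis .
    qed
    moreover have "summable (\<lambda>n. sqrt C * (1 / sqrt 2) ^ n)"
      by (intro summable_mult summable_geometric) simp
    ultimately have "summable (\<lambda>n. f (Suc n) x - f n x)"
      by (rule summable_comparison_test' [of _ 0, rotated])
    then have "(\<lambda>n. f 0 x + (\<Sum>i<n. f (Suc i) x - f i x)) \<longlonglongrightarrow> f 0 x + (\<Sum>n. f (Suc n) x - f n x)"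
      by (intro tendsto_intros summable_LIMSEQ)
    moreover have "f 0 x + (\<Sum>i<n. f (Suc i) x - f i x) = f n x" for n
      using sum_lessThan_telescope [of "\<lambda>i. f i x" n] by simp
    ultimately show ?case
      by (auto simp: convergent_def)
  qed
qed

text \<open>Riesz--Fischer: a fast subsequence converges almost everywhere, Fatou's lemma turns the
  Cauchy bound into a bound on the distance to the pointwise limit, and \<open>h1set\<close> is
  closed in L2.\<close>

instance h1 :: complete_space
proof
  fix X :: "nat \<Rightarrow> h1" assume X: "Cauchy X"
  have "\<exists>N. \<forall>m\<ge>N. \<forall>n\<ge>N. norm (X m - X n) < (1 / 2) ^ k" for k
    using CauchyD [OF X, of "(1 / 2) ^ k"] by simp
  then obtain N where N: "\<And>k m n. N k \<le> m \<Longrightarrow> N k \<le> n \<Longrightarrow> norm (X m - X n) < (1 / 2) ^ k" by metis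
  \<comment> \<open>Summation makes \<open>s k\<close> at least \<open>N k\<close>, and the 1 makes
    the indices strictly increasing.\<close>
  define s where "s k = (\<Sum>i\<le>k. N i + 1)" for k
  have sN: "N k \<le> s k" for k
    unfolding s_def using member_le_sum [of k "{..k}" "\<lambda>i. N i + 1"] by simp
  have s: "strict_mono s" by (intro strict_monoI_Suc) (simp add: s_def)
  define f where "f k = rep (X (s k))" for k
  have sq: "square_integrable (f k)" for k unfolding f_def by (rule rep_square_integrable)
  have nf: "(LINT x|lebesgue. (norm (f k x - f l x))\<^sup>2) = (norm (X (s k) - X (s l)))\<^sup>2" for k l
    unfolding norm_h1_square f_def
    by (rule integral_cong_AE) (measurable, use rep_diff [of "X (s k)" "X (s l)"] in \<open>eventually_elim, simp\<close>)
  have "(LINT x|lebesgue. (norm (f (Suc n) x - f n x))\<^sup>2) \<le> (1 / 4) ^ n" for n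
  proof -
    have "norm (X (s (Suc n)) - X (s n)) < (1 / 2) ^ n"
      using sN [of n] strict_monoD [OF s, of n "Suc n"] by (intro N) auto
    then have "(norm (X (s (Suc n)) - X (s n)))\<^sup>2 \<le> ((1 / 2) ^ n)\<^sup>2" by (intro power_mono) auto
    then show ?thesis by (simp add: nf flip: power_mult) (simp add: power_mult mult.commute [of n] power_divide)
  qed
  then have conv: "AE x in lebesgue. convergent (\<lambda>n. f n x)"
    by (rule fast_Cauchy_AE_convergent [OF sq])
  have m [measurable]: "f n \<in> borel_measurable lebesgue" for n
    using sq by (simp add: square_integrable_def)
  define F where "F x = lim (\<lambda>n. f n x)" for x
  have [measurable]: "F \<in> borel_measurable lebesgue"
    unfolding F_def by measurable
  have lim: "AE x in lebesgue. (\<lambda>n. f n x) \<longlonglongrightarrow> F x"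
    using conv by eventually_elim (simp add: F_def convergent_LIMSEQ_iff)
  have fat: "(\<integral>\<^sup>+x. ennreal ((norm (F x - f k x))\<^sup>2) \<partial>lebesgue) \<le> ennreal ((1 / 4) ^ k)" for k
  proof -
    have "(\<integral>\<^sup>+x. ennreal ((norm (F x - f k x))\<^sup>2) \<partial>lebesgue)
       = (\<integral>\<^sup>+x. liminf (\<lambda>n. ennreal ((norm (f n x - f k x))\<^sup>2)) \<partial>lebesgue)"
    proof (rule nn_integral_cong_AE)
      show "AE x in lebesgue. ennreal ((norm (F x - f k x))\<^sup>2) = liminf (\<lambda>n. ennreal ((norm (f n x - f k x))\<^sup>2))"
        using lim
      proof eventually_elim
        case (elim x)
        then have "(\<lambda>n. ennreal ((norm (f n x - f k x))\<^sup>2)) \<longlonglongrightarrow> ennreal ((norm (F x - f k x))\<^sup>2)"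
          by (intro tendsto_intros)
        from lim_imp_Liminf [OF trivial_limit_sequentially this] show ?case by (rule sym)
      qed
    qed
    also have "\<dots> \<le> liminf (\<lambda>n. \<integral>\<^sup>+x. ennreal ((norm (f n x - f k x))\<^sup>2) \<partial>lebesgue)"
      by (rule nn_integral_liminf) measurable
    also have "\<dots> \<le> ennreal ((1 / 4) ^ k)"
    proof (rule Liminf_le)
      show "\<forall>\<^sub>F n in sequentially. (\<integral>\<^sup>+x. ennreal ((norm (f n x - f k x))\<^sup>2) \<partial>lebesgue) \<le> ennreal ((1 / 4) ^ k)"
        using eventually_ge_at_top [of k]
      proof eventually_elim
        case (elim n)
        have "norm (X (s n) - X (s k)) < (1 / 2) ^ k"
          using sN [of k] strict_mono_mono [OF s] elim by (intro N) (auto dest: monoD intro: order.trans)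
        then have "(norm (X (s n) - X (s k)))\<^sup>2 \<le> ((1 / 2) ^ k)\<^sup>2" by (intro power_mono) auto
        then have "(norm (X (s n) - X (s k)))\<^sup>2 \<le> (1 / 4) ^ k"
          by (simp add: power_mult mult.commute [of k] power_divide flip: power_mult) (simp add: power_mult)
        moreover have "(\<integral>\<^sup>+x. ennreal ((norm (f n x - f k x))\<^sup>2) \<partial>lebesgue) = ennreal ((norm (X (s n) - X (s k)))\<^sup>2)"
          unfolding nf [symmetric] using square_integrable_diff [OF sq sq, of n k]
          by (intro nn_integral_eq_integral) (auto simp: square_integrable_def)
        ultimately show ?case by (simp add: ennreal_leI)
      qed
    qed simp
    finally show ?thesis .
  qed
  have sqd: "square_integrable (\<lambda>x. F x - f k x)" for k
    unfolding square_integrable_def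
  proof
    show "integrable lebesgue (\<lambda>x. (norm (F x - f k x))\<^sup>2)"
      by (rule integrableI_nonneg) (use fat [of k] in \<open>auto intro: le_less_trans\<close>)
  qed measurable
  have fatr: "(LINT x|lebesgue. (norm (F x - f k x))\<^sup>2) \<le> (1 / 4) ^ k" for k
  proof -
    have "ennreal (LINT x|lebesgue. (norm (F x - f k x))\<^sup>2) = (\<integral>\<^sup>+x. ennreal ((norm (F x - f k x))\<^sup>2) \<partial>lebesgue)"
      using sqd [of k] by (intro nn_integral_eq_integral [symmetric]) (auto simp: square_integrable_def)
    also have "\<dots> \<le> ennreal ((1 / 4) ^ k)" by (rule fat)
    finally show ?thesis by (subst (asm) ennreal_le_iff) simp_all
  qed
  have "F \<in> h1set"
  proof (rule h1set_closure)
    show "square_integrable F"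
      using square_integrable_add [OF sqd [of 0] sq [of 0]] by simp
    fix e :: real assume "e > 0"
    then obtain k where "(1 / 4 :: real) ^ k < e"
      using real_arch_pow_inv [of e "1 / 4"] by auto
    then show "\<exists>g\<in>h1set. (LINT x|lebesgue. (norm (F x - g x))\<^sup>2) < e"
      using fatr [of k] rep_h1set by (intro bexI [of _ "f k"]) (auto simp: f_def)
  qed
  note Fh = this
  have "(X \<circ> s) \<longlonglongrightarrow> mk F"
    unfolding lim_sequentially
  proof (intro allI impI)
    fix e :: real assume e: "e > 0"
    then obtain k0 where k0: "(1 / 2 :: real) ^ k0 < e"
      using real_arch_pow_inv [of e "1 / 2"] by auto
    show "\<exists>k0. \<forall>k\<ge>k0. dist ((X \<circ> s) k) (mk F) < e"
    proof (intro exI allI impI)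
      fix k assume k: "k \<ge> k0"
      have "(norm (X (s k) - mk F))\<^sup>2 = (LINT x|lebesgue. (norm (f k x - F x))\<^sup>2)"
        unfolding norm_diff_mk [OF Fh] f_def ..
      also have "\<dots> \<le> ((1 / 2) ^ k)\<^sup>2"
        using fatr [of k] by (simp add: norm_minus_commute power_divide flip: power_mult) (simp add: power_mult mult.commute [of k])
      finally have "norm (X (s k) - mk F) \<le> (1 / 2) ^ k"
        by (simp add: power2_le_iff_abs_le)
      also have "\<dots> \<le> (1 / 2) ^ k0" using k by (intro power_decreasing) auto
      finally show "dist ((X \<circ> s) k) (mk F) < e" using k0 by (simp add: dist_norm)
    qed
  qed
  then have "X \<longlonglongrightarrow> mk F"
    using Cauchy_converges_subseq X s by blast
  then show "convergent X" by (auto simp: convergent_def)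
qed

subsection \<open>Elements as functions with weak gradients\<close>

definition val :: "h1 \<Rightarrow> R3 \<Rightarrow> real" where
  "val u x = fst (rep u x)"

definition gr :: "h1 \<Rightarrow> R3 \<Rightarrow> R3" where
  "gr u x = snd (rep u x)"

lemma rep_eq: "rep u x = (val u x, gr u x)"
  by (simp add: val_def gr_def)

lemma val_measurable [measurable]: "val u \<in> borel_measurable lebesgue"
  using measurable_compose [OF rep_measurable borel_measurable_continuous_onI [OF continuous_on_fst [OF continuous_on_id]], of u]
  by (simp add: val_def [abs_def])

lemma gr_measurable [measurable]: "gr u \<in> borel_measurable lebesgue"
  using measurable_compose [OF rep_measurable borel_measurable_continuous_onI [OF continuous_on_snd [OF continuous_on_id]], of u]
  by (simp add: gr_def [abs_def])

lemma val_add: "AE x in lebesgue. val (u + v) x = val u x + val v x"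
  and gr_add: "AE x in lebesgue. gr (u + v) x = gr u x + gr v x"
  using rep_add [of u v] by (auto simp: rep_eq elim!: eventually_mono)

lemma val_diff: "AE x in lebesgue. val (u - v) x = val u x - val v x"
  using rep_diff [of u v] by (auto simp: rep_eq elim!: eventually_mono)

lemma val_minus: "AE x in lebesgue. val (- u) x = - val u x"
  using rep_minus [of u] by (auto simp: rep_eq elim!: eventually_mono)

lemma val_scaleR: "AE x in lebesgue. val (c *\<^sub>R u) x = c * val u x"
  and gr_scaleR: "AE x in lebesgue. gr (c *\<^sub>R u) x = c *\<^sub>R gr u x"
  using rep_scaleR [of c u] by (auto simp: rep_eq elim!: eventually_mono)

lemma val_0: "AE x in lebesgue. val 0 x = 0"
  using rep_0 by (auto simp: rep_eq zero_prod_def elim!: eventually_mono)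

lemma norm_rep_square: "(norm (rep u x))\<^sup>2 = (val u x)\<^sup>2 + (norm (gr u x))\<^sup>2"
  by (simp add: rep_eq norm_Pair)

lemma integrable_val_square: "integrable lebesgue (\<lambda>x. (val u x)\<^sup>2)"
  and integrable_gr_square: "integrable lebesgue (\<lambda>x. (norm (gr u x))\<^sup>2)"
proof -
  have *: "integrable lebesgue (\<lambda>x. (norm (rep u x))\<^sup>2)"
    using rep_square_integrable [of u] by (simp add: square_integrable_def)
  show "integrable lebesgue (\<lambda>x. (val u x)\<^sup>2)"
    by (rule Bochner_Integration.integrable_bound [OF *]) (auto simp: norm_rep_square)
  show "integrable lebesgue (\<lambda>x. (norm (gr u x))\<^sup>2)"
    by (rule Bochner_Integration.integrable_bound [OF *]) (auto simp: norm_rep_square)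
qed

lemma norm_h1_eq: "(norm u)\<^sup>2 = (LINT x|lebesgue. (val u x)\<^sup>2) + (LINT x|lebesgue. (norm (gr u x))\<^sup>2)"
  unfolding norm_h1_square norm_rep_square
  by (rule Bochner_Integration.integral_add [OF integrable_val_square integrable_gr_square])

lemma square_integrable_val: "square_integrable (val u)"
  using integrable_val_square [of u] by (simp add: square_integrable_def)

lemma square_integrable_gr: "square_integrable (gr u)"
  using integrable_gr_square [of u] by (simp add: square_integrable_def)

lemma integral_val_square_le: "(LINT x|lebesgue. (val u x)\<^sup>2) \<le> (norm u)\<^sup>2"
  using norm_h1_eq [of u] Bochner_Integration.integral_nonneg [of lebesgue "\<lambda>x. (norm (gr u x))\<^sup>2"] by simp

lemma Cauchy_Schwarz_L2:
  fixes f g :: "R3 \<Rightarrow> 'b::euclidean_space"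
  assumes "square_integrable f" "square_integrable g"
  shows "(LINT x|lebesgue. f x \<bullet> g x)\<^sup>2 \<le> (LINT x|lebesgue. (norm (f x))\<^sup>2) * (LINT x|lebesgue. (norm (g x))\<^sup>2)"
proof -
  define a b c where "a = (LINT x|lebesgue. (norm (f x))\<^sup>2)" "b = (LINT x|lebesgue. f x \<bullet> g x)" "c = (LINT x|lebesgue. (norm (g x))\<^sup>2)"
  have int: "integrable lebesgue (\<lambda>x. (norm (f x))\<^sup>2)" "integrable lebesgue (\<lambda>x. f x \<bullet> g x)" "integrable lebesgue (\<lambda>x. (norm (g x))\<^sup>2)"
    using assms square_integrable_inner [OF assms] by (auto simp: square_integrable_def)
  have q: "0 \<le> a * s\<^sup>2 + 2 * b * s * t + c * t\<^sup>2" for s t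
  proof -
    have "0 \<le> (LINT x|lebesgue. (norm (s *\<^sub>R f x + t *\<^sub>R g x))\<^sup>2)"
      by (rule Bochner_Integration.integral_nonneg) simp
    also have "(LINT x|lebesgue. (norm (s *\<^sub>R f x + t *\<^sub>R g x))\<^sup>2)
        = (LINT x|lebesgue. s\<^sup>2 * (norm (f x))\<^sup>2 + (2 * s * t) * (f x \<bullet> g x) + t\<^sup>2 * (norm (g x))\<^sup>2)"
      by (intro Bochner_Integration.integral_cong)
        (auto simp: power2_norm_eq_inner inner_add_left inner_add_right inner_commute algebra_simps power2_eq_square [of s] power2_eq_square [of t])
    also have "\<dots> = s\<^sup>2 * a + (2 * s * t) * b + t\<^sup>2 * c"
      using int by (simp add: a_b_c_def)
    finally show ?thesis by (simp add: mult_ac)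
  qed
  have a0: "a \<ge> 0" unfolding a_b_c_def by (rule Bochner_Integration.integral_nonneg) simp
  have c0: "c \<ge> 0" unfolding a_b_c_def by (rule Bochner_Integration.integral_nonneg) simp
  have "b\<^sup>2 \<le> a * c"
  proof (cases "a = 0")
    case True
    have "b = 0"
    proof (rule ccontr)
      assume "b \<noteq> 0"
      have "0 \<le> 2 * b * (- (c + 1) / (2 * b)) * 1 + c * 1\<^sup>2"
        using q [of "- (c + 1) / (2 * b)" 1] True by simp
      then show False using \<open>b \<noteq> 0\<close> by simp
    qed
    then show ?thesis using True by simp
  next
    case False
    have "0 \<le> a * b\<^sup>2 + 2 * b * b * (- a) + c * (- a)\<^sup>2" using q [of b "- a"] by simp
    then have "0 \<le> a * (a * c - b\<^sup>2)" by (simp add: power2_eq_square algebra_simps)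
    then show ?thesis using False a0 by (simp add: zero_le_mult_iff)
  qed
  then show ?thesis by (simp add: a_b_c_def)
qed

section \<open>Density of test functions and the Sobolev inequality on \<open>h1\<close>\<close>

definition emb :: "(R3 \<Rightarrow> real) \<Rightarrow> h1" where
  "emb \<phi> = mk (\<lambda>x. (\<phi> x, grad \<phi> x))"

lemma rep_emb: "\<phi> \<in> test_functions \<Longrightarrow> AE x in lebesgue. rep (emb \<phi>) x = (\<phi> x, grad \<phi> x)"
  unfolding emb_def by (intro rep_mk h1set_test)

lemma val_emb: "\<phi> \<in> test_functions \<Longrightarrow> AE x in lebesgue. val (emb \<phi>) x = \<phi> x"
  and gr_emb: "\<phi> \<in> test_functions \<Longrightarrow> AE x in lebesgue. gr (emb \<phi>) x = grad \<phi> x"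
  using rep_emb [of \<phi>] by (auto simp: rep_eq elim!: eventually_mono)

lemma emb_dense:
  assumes "e > 0"
  obtains \<phi> where "\<phi> \<in> test_functions" "norm (u - emb \<phi>) < e"
proof -
  have "e\<^sup>2 > 0" using assms by simp
  then obtain \<phi> where \<phi>: "\<phi> \<in> test_functions" "(LINT x|lebesgue. (norm (rep u x - (\<phi> x, grad \<phi> x)))\<^sup>2) < e\<^sup>2"
    using rep_h1set [of u] unfolding h1set_def by blast
  then have "(norm (u - emb \<phi>))\<^sup>2 < e\<^sup>2"
    unfolding emb_def norm_diff_mk [OF h1set_test [OF \<phi>(1)]] by simp
  then have "norm (u - emb \<phi>) < e" using assms by (simp add: power2_less_imp_less)
  then show ?thesis using that \<phi>(1) by blast
qed

lemma emb_sequence: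
  obtains \<phi> where "\<And>n::nat. \<phi> n \<in> test_functions" "(\<lambda>n. emb (\<phi> n)) \<longlonglongrightarrow> u"
proof -
  have "\<exists>\<phi>. \<phi> \<in> test_functions \<and> norm (u - emb \<phi>) < 1 / real (Suc n)" for n
    by (rule emb_dense [of "1 / real (Suc n)" u]) auto
  then obtain \<phi> where \<phi>: "\<And>n. \<phi> n \<in> test_functions" "\<And>n. norm (u - emb (\<phi> n)) < 1 / real (Suc n)"
    by metis
  have "(\<lambda>n. emb (\<phi> n) - u) \<longlonglongrightarrow> 0"
  proof (rule Lim_null_comparison)
    show "\<forall>\<^sub>F n in sequentially. norm (emb (\<phi> n) - u) \<le> 1 / real (Suc n)"
      using \<phi>(2) by (intro always_eventually allI) (metis less_imp_le norm_minus_commute)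
    show "(\<lambda>n. 1 / real (Suc n)) \<longlonglongrightarrow> 0" by (rule LIMSEQ_Suc [OF lim_inverse_n'])
  qed
  then have "(\<lambda>n. emb (\<phi> n)) \<longlonglongrightarrow> u" by (rule LIM_zero_cancel)
  then show ?thesis using that \<phi>(1) by blast
qed

lemma AE_convergent_subsequence:
  assumes "X \<longlonglongrightarrow> (u::h1)"
  obtains k where "strict_mono k" "AE x in lebesgue. (\<lambda>n. rep (X (k n)) x) \<longlonglongrightarrow> rep u x"
proof -
  have "(\<lambda>n. LINT x|lebesgue. norm ((norm (rep (X n - u) x))\<^sup>2)) \<longlonglongrightarrow> 0"
  proof -
    have "(\<lambda>n. (norm (X n - u))\<^sup>2) \<longlonglongrightarrow> 0\<^sup>2"
      using assms by (intro tendsto_power) (simp add: LIM_zero tendsto_norm_zero)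
    then show ?thesis by (simp add: norm_h1_square)
  qed
  moreover have "integrable lebesgue (\<lambda>x. (norm (rep (X n - u) x))\<^sup>2)" for n
    using rep_square_integrable by (simp add: square_integrable_def)
  ultimately obtain k where k: "strict_mono k" "AE x in lebesgue. (\<lambda>n. (norm (rep (X (k n) - u) x))\<^sup>2) \<longlonglongrightarrow> 0"
    using tendsto_L1_AE_subseq [of lebesgue "\<lambda>n x. (norm (rep (X n - u) x))\<^sup>2"] by blast
  have "AE x in lebesgue. \<forall>n. rep (X (k n) - u) x = rep (X (k n)) x - rep u x"
    by (intro AE_all_countable [THEN iffD2] allI rep_diff)
  with k(2) have "AE x in lebesgue. (\<lambda>n. rep (X (k n)) x) \<longlonglongrightarrow> rep u x"
  proof eventually_elim
    case (elim x)
    then have "(\<lambda>n. sqrt ((norm (rep (X (k n)) x - rep u x))\<^sup>2)) \<longlonglongrightarrow> sqrt 0"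
      by (intro tendsto_real_sqrt) simp
    then have "(\<lambda>n. rep (X (k n)) x - rep u x) \<longlonglongrightarrow> 0"
      by (simp add: tendsto_norm_zero_iff)
    then show ?case by (rule LIM_zero_cancel)
  qed
  then show ?thesis using that k(1) by blast
qed

lemma sobolev_emb:
  assumes "\<phi> \<in> test_functions"
  shows "(\<integral>\<^sup>+x. ennreal (\<phi> x ^ 6) \<partial>lebesgue) \<le> ennreal (4096 * norm (emb \<phi>) ^ 6)"
proof -
  have \<phi>: "C1c \<phi>" by (rule C1c_test [OF assms])
  have b: "bounded {x. \<phi> x \<noteq> 0}" using \<phi> by (simp add: C1c_def)
  have "integrable lebesgue (\<lambda>x. \<phi> x ^ 6)" "integrable lborel (\<lambda>x. \<phi> x ^ 6)"
    by (rule integrable_bounded_support; (intro continuous_intros C1c_continuous \<phi>)?; rule bounded_subset [OF b]; force)+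
  then have "(\<integral>\<^sup>+x. ennreal (\<phi> x ^ 6) \<partial>lebesgue) = ennreal (LINT x|lborel. \<phi> x ^ 6)"
    using nn_integral_eq_integral [of lebesgue "\<lambda>x. \<phi> x ^ 6"] integral_completion [of "\<lambda>x. \<phi> x ^ 6" lborel] by simp
  also have "\<dots> \<le> ennreal (4096 * norm (emb \<phi>) ^ 6)"
  proof (rule ennreal_leI)
    have "(LINT x|lborel. (norm (grad \<phi> x))\<^sup>2) = (LINT x|lebesgue. (norm (grad \<phi> x))\<^sup>2)"
      using continuous_grad [OF \<phi>]
      by (intro integral_completion [symmetric]) (auto intro!: borel_measurable_continuous_onI continuous_intros)
    also have "\<dots> = (LINT x|lebesgue. (norm (gr (emb \<phi>) x))\<^sup>2)"
      using continuous_grad [OF \<phi>]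
      by (intro integral_cong_AE)
        (auto intro!: measurable_completion borel_measurable_continuous_onI continuous_intros eventually_mono [OF gr_emb [OF assms]])
    also have "\<dots> \<le> (norm (emb \<phi>))\<^sup>2"
      using norm_h1_eq [of "emb \<phi>"] Bochner_Integration.integral_nonneg [of lebesgue "\<lambda>x. (val (emb \<phi>) x)\<^sup>2"] by simp
    finally have "(LINT x|lborel. (norm (grad \<phi> x))\<^sup>2) ^ 3 \<le> ((norm (emb \<phi>))\<^sup>2) ^ 3"
      by (intro power_mono Bochner_Integration.integral_nonneg) auto
    then show "(LINT x|lborel. \<phi> x ^ 6) \<le> 4096 * norm (emb \<phi>) ^ 6"
      using sobolev_C1c [OF \<phi>] by (simp flip: power_mult)
  qed
  finally show ?thesis .
qed

text \<open>Test functions approximate u, a subsequence converges almost everywhere, and Fatou's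
  lemma carries the inequality over with the same constant.\<close>

lemma sobolev_h1: "(\<integral>\<^sup>+x. ennreal (val u x ^ 6) \<partial>lebesgue) \<le> ennreal (4096 * norm u ^ 6)"
proof -
  obtain \<phi> where \<phi>: "\<And>n::nat. \<phi> n \<in> test_functions" "(\<lambda>n. emb (\<phi> n)) \<longlonglongrightarrow> u"
    by (rule emb_sequence [of u], rule that)
  obtain k where k: "strict_mono k" "AE x in lebesgue. (\<lambda>n. rep (emb (\<phi> (k n))) x) \<longlonglongrightarrow> rep u x"
    using AE_convergent_subsequence [OF \<phi>(2)] by blast
  have "AE x in lebesgue. \<forall>n. val (emb (\<phi> (k n))) x = \<phi> (k n) x"
    by (intro AE_all_countable [THEN iffD2] allI val_emb \<phi>)
  with k(2) have "AE x in lebesgue. ennreal (val u x ^ 6) = liminf (\<lambda>n. ennreal (\<phi> (k n) x ^ 6))"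
  proof eventually_elim
    case (elim x)
    have "(\<lambda>n. val (emb (\<phi> (k n))) x) \<longlonglongrightarrow> val u x"
      unfolding val_def by (intro tendsto_fst elim)
    then have "(\<lambda>n. ennreal (\<phi> (k n) x ^ 6)) \<longlonglongrightarrow> ennreal (val u x ^ 6)"
      using elim by (intro tendsto_intros) simp
    from lim_imp_Liminf [OF trivial_limit_sequentially this] show ?case by (rule sym)
  qed
  then have "(\<integral>\<^sup>+x. ennreal (val u x ^ 6) \<partial>lebesgue) = (\<integral>\<^sup>+x. liminf (\<lambda>n. ennreal (\<phi> (k n) x ^ 6)) \<partial>lebesgue)"
    by (rule nn_integral_cong_AE)
  also have "\<dots> \<le> liminf (\<lambda>n. \<integral>\<^sup>+x. ennreal (\<phi> (k n) x ^ 6) \<partial>lebesgue)"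
    using test_functions_measurable(2) [OF \<phi>(1)] by (intro nn_integral_liminf) auto
  also have "\<dots> \<le> liminf (\<lambda>n. ennreal (4096 * norm (emb (\<phi> (k n))) ^ 6))"
    by (intro Liminf_mono always_eventually allI sobolev_emb \<phi>)
  also have "\<dots> = ennreal (4096 * norm u ^ 6)"
  proof (rule lim_imp_Liminf [OF trivial_limit_sequentially])
    show "(\<lambda>n. ennreal (4096 * norm (emb (\<phi> (k n))) ^ 6)) \<longlonglongrightarrow> ennreal (4096 * norm u ^ 6)"
      using LIMSEQ_subseq_LIMSEQ [OF \<phi>(2) k(1)] by (intro tendsto_intros) (simp add: comp_def)
  qed
  finally show ?thesis .
qed

lemma locally_integrable_square_integrable:
  fixes f :: "R3 \<Rightarrow> 'b::euclidean_space"
  assumes "square_integrable f"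
  shows "locally_integrable f"
  unfolding locally_integrable_def set_integrable_def
proof (intro allI impI)
  fix K :: "R3 set" assume K: "compact K"
  have m [measurable]: "f \<in> borel_measurable lebesgue" "K \<in> sets lebesgue"
    using assms K by (auto simp: square_integrable_def compact_imp_closed)
  have fin: "emeasure lebesgue K < \<infinity>"
    using emeasure_compact_finite [OF K] K by (simp add: compact_imp_closed)
  show "integrable lebesgue (\<lambda>x. indicator K x *\<^sub>R f x)"
  proof (rule Bochner_Integration.integrable_bound)
    show "integrable lebesgue (\<lambda>x. indicator K x + (norm (f x))\<^sup>2)"
      using assms fin by (intro Bochner_Integration.integrable_add integrable_real_indicator m) (auto simp: square_integrable_def)
    show "AE x in lebesgue. norm (indicator K x *\<^sub>R f x) \<le> norm (indicator K x + (norm (f x))\<^sup>2)"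
    proof (rule AE_I2)
      fix x
      have "2 * norm (f x) * 1 \<le> (norm (f x))\<^sup>2 + 1\<^sup>2" by (rule sum_squares_bound)
      then have "norm (f x) \<le> 1 + (norm (f x))\<^sup>2" using norm_ge_zero [of "f x"] by (simp del: norm_ge_zero)
      then show "norm (indicator K x *\<^sub>R f x) \<le> norm (indicator K x + (norm (f x))\<^sup>2)"
        by (auto simp: indicator_def)
    qed
  qed measurable
qed

text \<open>For fixed \<psi> and i the defect in the integration by parts formula is a bounded
  linear functional \<open>L\<close> on \<open>h1\<close>. It vanishes on the dense test functions,
  hence everywhere.\<close>

lemma has_weak_gradient_val: "has_weak_gradient (val u) (gr u)"
  unfolding has_weak_gradient_def
proof (intro conjI ballI allI)
  show "locally_integrable (val u)" "locally_integrable (gr u)"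
    by (intro locally_integrable_square_integrable square_integrable_val square_integrable_gr)+
  fix \<psi> :: "R3 \<Rightarrow> real" and i :: 3 assume \<psi>: "\<psi> \<in> test_functions"
  have p: "partial_deriv i \<psi> \<in> test_functions" by (rule test_functions_partial_deriv [OF \<psi>])
  define g where "g x = (partial_deriv i \<psi> x, \<psi> x *\<^sub>R axis i (1::real) :: R3)" for x
  have sg: "square_integrable g"
  proof (rule square_integrable_continuous)
    show "continuous_on UNIV g"
      unfolding g_def by (intro continuous_intros test_functions_continuous p \<psi>)
    have "bounded ({x. partial_deriv i \<psi> x \<noteq> 0} \<union> {x. \<psi> x \<noteq> 0})"
      using p \<psi> by (simp add: test_functions_def)
    then show "bounded {x. g x \<noteq> 0}"
      by (rule bounded_subset) (auto simp: g_def zero_prod_def)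
  qed
  define L where "L w = (LINT x|lebesgue. rep w x \<bullet> g x)" for w
  have L_bound: "(L w)\<^sup>2 \<le> (norm w)\<^sup>2 * (LINT x|lebesgue. (norm (g x))\<^sup>2)" for w
    unfolding L_def norm_h1_square by (rule Cauchy_Schwarz_L2 [OF rep_square_integrable sg])
  have L_diff: "L (v - w) = L v - L w" for v w
  proof -
    have "L (v - w) = (LINT x|lebesgue. rep v x \<bullet> g x - rep w x \<bullet> g x)"
      unfolding L_def
      by (rule integral_cong_AE)
        (use sg rep_diff [of v w] in \<open>auto simp: square_integrable_def inner_diff_left elim!: eventually_mono\<close>)
    then show ?thesis
      unfolding L_def using square_integrable_inner [OF rep_square_integrable sg] by simp
  qed
  have L_emb: "L (emb \<phi>) = 0" if \<phi>: "\<phi> \<in> test_functions" for \<phi>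
  proof -
    have c: "C1c \<phi>" "C1c \<psi>" "C1c (partial_deriv i \<phi>)" "C1c (partial_deriv i \<psi>)"
      by (intro C1c_test test_functions_partial_deriv \<phi> \<psi>)+
    have "L (emb \<phi>) = (LINT x|lebesgue. \<phi> x * partial_deriv i \<psi> x + partial_deriv i \<phi> x * \<psi> x)"
      unfolding L_def
    proof (rule integral_cong_AE)
      show "AE x in lebesgue. rep (emb \<phi>) x \<bullet> g x = \<phi> x * partial_deriv i \<psi> x + partial_deriv i \<phi> x * \<psi> x"
        using rep_emb [OF \<phi>] by eventually_elim (simp add: g_def inner_axis grad_def)
      show "(\<lambda>x. \<phi> x * partial_deriv i \<psi> x + partial_deriv i \<phi> x * \<psi> x) \<in> borel_measurable lebesgue"
        by (intro borel_measurable_add borel_measurable_times test_functions_measurable \<phi> \<psi> test_functions_partial_deriv)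
    qed (use sg in \<open>auto simp: square_integrable_def\<close>)
    also have "\<dots> = 0"
    proof -
      have "integrable lebesgue (\<lambda>x. \<phi> x * partial_deriv i \<psi> x)" "integrable lebesgue (\<lambda>x. partial_deriv i \<phi> x * \<psi> x)"
        by (intro locally_integrable_times_test locally_integrable_integrable p \<psi>
            integrable_bounded_support C1c_continuous c; use c in \<open>simp add: C1c_def\<close>)+
      then show ?thesis using integration_by_parts [OF c(1,2), of i] by simp
    qed
    finally show ?thesis .
  qed
  have "L u = 0"
  proof (rule ccontr)
    assume "L u \<noteq> 0"
    define G where "G = (LINT x|lebesgue. (norm (g x))\<^sup>2) + 1"
    have G: "G > 0" unfolding G_def by (intro add_nonneg_pos Bochner_Integration.integral_nonneg) auto
    have "\<bar>L u\<bar> / sqrt G > 0" using \<open>L u \<noteq> 0\<close> G by simp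
    then obtain \<phi> where \<phi>: "\<phi> \<in> test_functions" "norm (u - emb \<phi>) < \<bar>L u\<bar> / sqrt G"
      by (rule emb_dense)
    have "(L u)\<^sup>2 \<le> (norm (u - emb \<phi>))\<^sup>2 * (LINT x|lebesgue. (norm (g x))\<^sup>2)"
      using L_bound [of "u - emb \<phi>"] L_emb [OF \<phi>(1)] by (simp add: L_diff)
    also have "\<dots> \<le> (norm (u - emb \<phi>))\<^sup>2 * G" by (intro mult_left_mono) (auto simp: G_def)
    also have "\<dots> < (\<bar>L u\<bar> / sqrt G)\<^sup>2 * G"
      using \<phi>(2) G by (intro mult_strict_right_mono power_strict_mono) auto
    also have "\<dots> = (L u)\<^sup>2" using G by (simp add: power_divide)
    finally show False by simp
  qed
  moreover have "L u = (LINT x|lebesgue. val u x * partial_deriv i \<psi> x) + (LINT x|lebesgue. gr u x $ i * \<psi> x)"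
  proof -
    have "L u = (LINT x|lebesgue. val u x * partial_deriv i \<psi> x + gr u x $ i * \<psi> x)"
      unfolding L_def by (intro Bochner_Integration.integral_cong) (auto simp: rep_eq g_def inner_axis)
    moreover have "integrable lebesgue (\<lambda>x. val u x * partial_deriv i \<psi> x)" "integrable lebesgue (\<lambda>x. gr u x $ i * \<psi> x)"
      by (intro locally_integrable_times_test locally_integrable_nth locally_integrable_square_integrable
          square_integrable_val square_integrable_gr p \<psi>)+
    ultimately show ?thesis by simp
  qed
  ultimately show "(LINT x|lebesgue. val u x * partial_deriv i \<psi> x) = - (LINT x|lebesgue. gr u x $ i * \<psi> x)"
    by linarith
qed

lemma has_weak_gradient_cong:
  assumes "has_weak_gradient u G" "AE x in lebesgue. v x = u x" "v \<in> borel_measurable lebesgue"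
  shows "has_weak_gradient v G"
proof -
  have m: "locally_integrable u" using assms by (simp add: has_weak_gradient_def)
  have "locally_integrable v"
    unfolding locally_integrable_def set_integrable_def
  proof (intro allI impI)
    fix K :: "R3 set" assume K: "compact K"
    then have i: "integrable lebesgue (\<lambda>x. indicator K x *\<^sub>R u x)"
      using m by (simp add: locally_integrable_def set_integrable_def)
    have "(\<lambda>x. indicator K x *\<^sub>R v x) \<in> borel_measurable lebesgue"
      using K assms(3) by (intro borel_measurable_scaleR borel_measurable_indicator) (auto simp: compact_imp_closed)
    then show "integrable lebesgue (\<lambda>x. indicator K x *\<^sub>R v x)"
      using i assms(2) by (subst integrable_cong_AE [of _ _ "\<lambda>x. indicator K x *\<^sub>R u x"]) (auto elim: eventually_mono)
  qed
  note lv = this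
  have "(LINT x|lebesgue. v x * \<psi> x) = (LINT x|lebesgue. u x * \<psi> x)" if "\<psi> \<in> test_functions" for \<psi>
    using locally_integrable_times_test [OF lv that] locally_integrable_times_test [OF m that] assms(2)
    by (intro integral_cong_AE) (auto elim: eventually_mono)
  then show ?thesis
    using assms(1) lv test_functions_partial_deriv by (simp add: has_weak_gradient_def)
qed

lemma weak_grad_AE_val:
  assumes "AE x in lebesgue. v x = val u x" "v \<in> borel_measurable lebesgue"
  shows "AE x in lebesgue. weak_grad v x = gr u x"
  by (rule weak_grad_AE(2) [OF has_weak_gradient_cong [OF has_weak_gradient_val assms]])

text \<open>The second component is the weak gradient of the first and is therefore determined by it
  up to null sets.\<close>

lemma h1_eq_0I:
  assumes "AE x in lebesgue. val u x = 0"
  shows "u = 0"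
proof -
  have "AE x in lebesgue. val 0 x = val u x"
    using assms val_0 by eventually_elim simp
  then have g: "AE x in lebesgue. gr 0 x = gr u x"
    by (intro has_weak_gradient_unique [OF has_weak_gradient_val has_weak_gradient_val])
  show ?thesis
    by (rule h1_eqI) (use g assms val_0 in \<open>eventually_elim, simp add: rep_eq\<close>)
qed

lemma val_in_H1: "val u \<in> H1"
  using has_weak_gradient_val [of u] integrable_val_square [of u] integrable_gr_square [of u]
    val_measurable [of u] gr_measurable [of u]
  unfolding H1_def by (intro CollectI conjI bexI [of _ "gr u"]) (simp_all add: Lp_def)

lemma H1_norm_val:
  assumes "AE x in lebesgue. v x = val u x" "v \<in> borel_measurable lebesgue"
  shows "H1_norm v = norm u"
proof -
  have "(LINT x|lebesgue. (norm (weak_grad v x))\<^sup>2 + (v x)\<^sup>2) = (LINT x|lebesgue. (norm (rep u x))\<^sup>2)"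
  proof (rule integral_cong_AE)
    show "AE x in lebesgue. (norm (weak_grad v x))\<^sup>2 + (v x)\<^sup>2 = (norm (rep u x))\<^sup>2"
      using assms(1) weak_grad_AE_val [OF assms] by eventually_elim (simp add: norm_rep_square)
    have "weak_grad v \<in> borel_measurable lebesgue"
      by (rule borel_measurable_AE [OF gr_measurable [of u]])
        (use weak_grad_AE_val [OF assms] in \<open>auto elim: eventually_mono\<close>)
    then show "(\<lambda>x. (norm (weak_grad v x))\<^sup>2 + (v x)\<^sup>2) \<in> borel_measurable lebesgue"
      using assms(2) by measurable
  qed measurable
  then show ?thesis by (simp add: H1_norm_def norm_h1_square [symmetric])
qed

section \<open>Power nonlinearities\<close>

text \<open>The vector y minimises J v = |v|^2 - 2 f v. The parallelogram identity
  \<open>par\<close> makes a minimising sequence Cauchy, and the vanishing of the first variation at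
  the minimiser is the claim.\<close>

lemma riesz_representation:
  fixes f :: "'a::{real_inner,complete_space} \<Rightarrow> real"
  assumes f: "bounded_linear f"
  shows "\<exists>y. \<forall>v. f v = y \<bullet> v"
proof -
  interpret bounded_linear f by (rule f)
  obtain B where B: "\<And>v. \<bar>f v\<bar> \<le> norm v * B" using bounded by auto
  define J where "J v = (norm v)\<^sup>2 - 2 * f v" for v
  have J_ge: "J v \<ge> - B\<^sup>2" for v
  proof -
    have "2 * f v \<le> 2 * norm v * B" using B [of v] by simp
    also have "\<dots> \<le> (norm v)\<^sup>2 + B\<^sup>2" by (rule sum_squares_bound)
    finally show ?thesis by (simp add: J_def)
  qed
  have bdd: "bdd_below (range J)" using J_ge by (auto intro!: bdd_belowI)
  define I where "I = Inf (range J)"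
  have I_le: "I \<le> J v" for v unfolding I_def using bdd by (intro cInf_lower) auto
  have "\<exists>v. J v < I + 1 / real (Suc n)" for n
    using cInf_lessD [of "range J" "I + 1 / real (Suc n)"] by (auto simp: I_def)
  then obtain X where X: "\<And>n. J (X n) < I + 1 / real (Suc n)" by metis
  have par: "(norm (v - w))\<^sup>2 = 2 * J v + 2 * J w - 4 * J ((1/2) *\<^sub>R (v + w))" for v w
  proof -
    have "f ((1/2) *\<^sub>R (v + w)) = (f v + f w) / 2" by (simp add: scale add)
    then show ?thesis
      by (simp add: J_def power2_norm_eq_inner inner_diff_left inner_diff_right inner_add_left inner_add_right
          inner_commute [of w v] field_simps)
  qed
  have "Cauchy X"
  proof (rule CauchyI)
    fix e :: real assume e: "e > 0"
    obtain N where N: "4 / e\<^sup>2 < real (Suc N)"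
      using reals_Archimedean2 [of "4 / e\<^sup>2"] by (metis less_trans of_nat_less_iff lessI)
    have "norm (X m - X n) < e" if "m \<ge> N" "n \<ge> N" for m n
    proof -
      have "1 / real (Suc m) \<le> 1 / real (Suc N)" "1 / real (Suc n) \<le> 1 / real (Suc N)"
        using that by (intro divide_left_mono; simp)+
      then have "(norm (X m - X n))\<^sup>2 < 4 * (1 / real (Suc N))"
        using par [of "X m" "X n"] X [of m] X [of n] I_le [of "(1/2) *\<^sub>R (X m + X n)"] by linarith
      also have "\<dots> \<le> e\<^sup>2" using N e by (simp add: field_simps)
      finally show ?thesis using e by (simp add: power2_less_imp_less)
    qed
    then show "\<exists>M. \<forall>m\<ge>M. \<forall>n\<ge>M. norm (X m - X n) < e" by blast
  qed
  then obtain y where y: "X \<longlonglongrightarrow> y" by (auto simp: Cauchy_convergent_iff convergent_def)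
  have "(\<lambda>n. J (X n)) \<longlonglongrightarrow> J y"
    unfolding J_def by (intro tendsto_intros tendsto y)
  moreover have "(\<lambda>n. I + 1 / real (Suc n)) \<longlonglongrightarrow> I + 0"
    by (intro tendsto_intros LIMSEQ_Suc [OF lim_inverse_n'])
  ultimately have Jy: "J y \<le> I"
    using X by (intro LIMSEQ_le [of "\<lambda>n. J (X n)" _ "\<lambda>n. I + 1 / real (Suc n)"]) (auto intro: less_imp_le)
  have "f v = y \<bullet> v" for v
  proof -
    have ineq: "0 \<le> 2 * t * (y \<bullet> v - f v) + t\<^sup>2 * (norm v)\<^sup>2" for t
    proof -
      have "(norm (y + t *\<^sub>R v))\<^sup>2 = (norm y)\<^sup>2 + 2 * t * (y \<bullet> v) + t\<^sup>2 * (norm v)\<^sup>2"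
        by (simp only: power2_norm_eq_inner) (simp add: inner_add_left inner_add_right inner_commute [of v y] power2_eq_square [of t] algebra_simps)
      moreover have "f (y + t *\<^sub>R v) = f y + t * f v" by (simp add: add scale)
      ultimately show ?thesis
        using Jy I_le [of "y + t *\<^sub>R v"] unfolding J_def by (simp add: right_diff_distrib)
    qed
    define d where "d = y \<bullet> v - f v"
    have "d = 0"
    proof (rule ccontr)
      assume d: "d \<noteq> 0"
      \<comment> \<open>The 1 keeps the trial step - d / N defined when v = 0.\<close>
      define N where "N = (norm v)\<^sup>2 + 1"
      have N: "N > 0" by (simp add: N_def add_nonneg_pos)
      have "0 \<le> 2 * (- d / N) * d + (- d / N)\<^sup>2 * (norm v)\<^sup>2" using ineq [of "- d / N"] by (simp add: d_def)
      also have "\<dots> \<le> 2 * (- d / N) * d + (- d / N)\<^sup>2 * N" by (intro add_left_mono mult_left_mono) (auto simp: N_def)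
      also have "\<dots> = - d\<^sup>2 / N" using N by (simp add: power2_eq_square field_simps)
      also have "\<dots> < 0" using d N by (simp add: divide_neg_pos)
      finally show False by simp
    qed
    then show ?thesis by (simp add: d_def)
  qed
  then show ?thesis by blast
qed

definition riesz :: "('a::{real_inner,complete_space} \<Rightarrow> real) \<Rightarrow> 'a" where
  "riesz f = (SOME y. \<forall>v. f v = y \<bullet> v)"

lemma riesz: "bounded_linear f \<Longrightarrow> riesz f \<bullet> v = f v"
  unfolding riesz_def using someI_ex [OF riesz_representation] by metis

lemma norm_le_inner:
  fixes y :: "'a::real_inner"
  assumes "\<And>v. y \<bullet> v \<le> B * norm v" "B \<ge> 0"
  shows "norm y \<le> B"
proof (cases "y = 0")
  case False
  have "norm y * norm y \<le> B * norm y" using assms(1) [of y] by (simp add: power2_norm_eq_inner [symmetric] power2_eq_square)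
  then show ?thesis using False by simp
qed (use assms in simp)

subsection \<open>Scalar inequalities\<close>

lemma DERIV_abs_powr_mult:
  fixes r :: real
  assumes "r > 0"
  shows "((\<lambda>x. \<bar>x\<bar> powr r * x) has_real_derivative (r + 1) * \<bar>x\<bar> powr r) (at x)"
proof -
  consider "x > 0" | "x < 0" | "x = 0" by linarith
  then show ?thesis
  proof cases
    case 1
    have "((\<lambda>x. x powr (r + 1)) has_real_derivative (r + 1) * \<bar>x\<bar> powr r) (at x)"
      using 1 by (auto intro!: derivative_eq_intros)
    then show ?thesis
      by (rule has_field_derivative_transform_within_open [of _ _ _ "{0<..}"]) (use 1 in \<open>auto simp: powr_add\<close>)
  next
    case 2
    have "((\<lambda>x. - ((- x) powr (r + 1))) has_real_derivative (r + 1) * \<bar>x\<bar> powr r) (at x)"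
      using 2 by (auto intro!: derivative_eq_intros)
    then show ?thesis
      by (rule has_field_derivative_transform_within_open [of _ _ _ "{..<0}"]) (use 2 in \<open>auto simp: powr_add\<close>)
  next
    case 3
    have "((\<lambda>h. \<bar>h\<bar> powr r) \<longlongrightarrow> \<bar>0\<bar> powr r) (at (0::real))"
      using assms by (intro tendsto_powr' tendsto_intros) auto
    then have "((\<lambda>h. \<bar>h\<bar> powr r) \<longlongrightarrow> 0) (at (0::real))" by simp
    moreover have "\<forall>\<^sub>F h in at (0::real). (\<bar>0 + h\<bar> powr r * (0 + h) - \<bar>0\<bar> powr r * 0) / h = \<bar>h\<bar> powr r"
      by (auto simp: eventually_at intro!: exI [of _ 1])
    ultimately have "((\<lambda>h. (\<bar>0 + h\<bar> powr r * (0 + h) - \<bar>0\<bar> powr r * 0) / h) \<longlongrightarrow> 0) (at (0::real))"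
      by (simp add: tendsto_cong)
    then show ?thesis using 3 assms by (simp add: DERIV_def)
  qed
qed

text \<open>The mean value bound on the symmetric interval of radius |a| + |b|, which contains both
  points; the derivative is largest at its ends.\<close>

lemma abs_powr_mult_lipschitz:
  fixes r a b :: real
  assumes "r > 0"
  shows "\<bar>\<bar>a\<bar> powr r * a - \<bar>b\<bar> powr r * b\<bar> \<le> (r + 1) * (\<bar>a\<bar> + \<bar>b\<bar>) powr r * \<bar>a - b\<bar>"
proof -
  have "norm (\<bar>a\<bar> powr r * a - \<bar>b\<bar> powr r * b) \<le> (r + 1) * (\<bar>a\<bar> + \<bar>b\<bar>) powr r * norm (a - b)"
  proof (rule field_differentiable_bound [of "{- (\<bar>a\<bar> + \<bar>b\<bar>)..\<bar>a\<bar> + \<bar>b\<bar>}" _ "\<lambda>x. (r + 1) * \<bar>x\<bar> powr r"])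
    fix z assume "z \<in> {- (\<bar>a\<bar> + \<bar>b\<bar>)..\<bar>a\<bar> + \<bar>b\<bar>}"
    then have "\<bar>z\<bar> powr r \<le> (\<bar>a\<bar> + \<bar>b\<bar>) powr r"
      using assms by (intro powr_mono2) auto
    then show "norm ((r + 1) * \<bar>z\<bar> powr r) \<le> (r + 1) * (\<bar>a\<bar> + \<bar>b\<bar>) powr r"
      using assms by (simp add: abs_mult)
    show "((\<lambda>x. \<bar>x\<bar> powr r * x) has_field_derivative (r + 1) * \<bar>z\<bar> powr r) (at z within {- (\<bar>a\<bar> + \<bar>b\<bar>)..\<bar>a\<bar> + \<bar>b\<bar>})"
      by (rule has_field_derivative_at_within [OF DERIV_abs_powr_mult [OF assms]])
  qed auto
  then show ?thesis by simp
qed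

text \<open>The tangent inequality of the convex function |t|^s, obtained from Young's inequality
  for |a|^(s-1) |b| with exponents s/(s-1) and s.\<close>

lemma abs_powr_convex:
  fixes s a b :: real
  assumes "s > 2"
  shows "\<bar>a\<bar> powr s + s * (\<bar>a\<bar> powr (s - 2) * a * (b - a)) \<le> \<bar>b\<bar> powr s"
proof -
  have *: "\<bar>a\<bar> powr (s - 2) * \<bar>a\<bar> * \<bar>a\<bar> = \<bar>a\<bar> powr s" for a :: real
  proof (cases "a = 0")
    case False
    have "\<bar>a\<bar> powr s = \<bar>a\<bar> powr (s - 2) * \<bar>a\<bar> powr 2" using powr_add [of "\<bar>a\<bar>" "s - 2" 2] by simp
    then show ?thesis using False by (simp add: power2_eq_square)
  qed simp
  have "\<bar>a\<bar> powr (s - 2) * a * b \<le> \<bar>a\<bar> powr (s - 2) * \<bar>a\<bar> * \<bar>b\<bar>"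
    using mult_left_mono [of "a * b" "\<bar>a\<bar> * \<bar>b\<bar>" "\<bar>a\<bar> powr (s - 2)"] abs_ge_self [of "a * b"] by (simp add: abs_mult mult.assoc)
  also have "\<bar>a\<bar> powr (s - 2) * \<bar>a\<bar> * \<bar>b\<bar> \<le> (1 - 1 / s) * \<bar>a\<bar> powr s + 1 / s * \<bar>b\<bar> powr s"
  proof (cases "a = 0 \<or> b = 0")
    case False
    have "(\<bar>a\<bar> powr s) powr (1 - 1 / s) * (\<bar>b\<bar> powr s) powr (1 / s) \<le> (1 - 1 / s) * \<bar>a\<bar> powr s + 1 / s * \<bar>b\<bar> powr s"
      using assms False by (intro Youngs_inequality_0) auto
    moreover have "(\<bar>a\<bar> powr s) powr (1 - 1 / s) = \<bar>a\<bar> powr (s - 2) * \<bar>a\<bar>"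
    proof -
      have "(\<bar>a\<bar> powr s) powr (1 - 1 / s) = \<bar>a\<bar> powr (s - 2 + 1)"
        using assms by (simp add: powr_powr right_diff_distrib)
      then show ?thesis using False by (simp only: powr_add) simp
    qed
    moreover have "(\<bar>b\<bar> powr s) powr (1 / s) = \<bar>b\<bar>" using assms by (simp add: powr_powr)
    ultimately show ?thesis by simp
  qed (use assms in auto)
  finally have "s * (\<bar>a\<bar> powr (s - 2) * a * b) \<le> (s - 1) * \<bar>a\<bar> powr s + \<bar>b\<bar> powr s"
    using assms by (simp add: field_simps)
  moreover have "\<bar>a\<bar> powr (s - 2) * a * a = \<bar>a\<bar> powr s" using * [of a] by (simp add: mult.assoc)
  ultimately show ?thesis by (simp add: algebra_simps)
qed

lemma powr_mult_mult_le:
  fixes a b c s :: real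
  assumes "a \<ge> 0" "b \<ge> 0" "c \<ge> 0" "s > 2"
  shows "a powr (s - 2) * b * c \<le> a powr s + b powr s + c powr s"
proof -
  define m where "m = max a (max b c)"
  have m: "a \<le> m" "b \<le> m" "c \<le> m" "m \<ge> 0" using assms by (auto simp: m_def)
  have "a powr (s - 2) * b * c \<le> m powr (s - 2) * m * m"
    using assms m by (intro mult_mono powr_mono2) auto
  also have "\<dots> = m powr s"
  proof (cases "m = 0")
    case False
    have "m powr s = m powr (s - 2) * m powr 2" using powr_add [of m "s - 2" 2] by simp
    then show ?thesis using m False by (simp add: power2_eq_square)
  qed simp
  also have "\<dots> \<le> a powr s + b powr s + c powr s"
    by (auto simp: m_def max_def)
  finally show ?thesis .
qed

lemma powr_add_le:
  fixes a b r :: real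
  assumes "a \<ge> 0" "b \<ge> 0" "r \<ge> 0"
  shows "(a + b) powr r \<le> 2 powr r * (a powr r + b powr r)"
proof -
  have "(a + b) powr r \<le> (2 * max a b) powr r" using assms by (intro powr_mono2) auto
  also have "\<dots> = 2 powr r * (max a b) powr r" using assms by (simp add: powr_mult)
  also have "\<dots> \<le> 2 powr r * (a powr r + b powr r)" by (intro mult_left_mono) (auto simp: max_def)
  finally show ?thesis .
qed

subsection \<open>Weighted power terms\<close>

text \<open>Covers both nonlinearities, the weight g with exponent p and the weight 1 with exponent
  q. Integrability is demanded on the unit ball only and extends by homogeneity; the factor 3 in the
  later bounds comes from the three summands of \<open>powr_mult_mult_le\<close>.\<close>

locale power_weight =
  fixes \<omega> :: "R3 \<Rightarrow> real" and s C :: real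
  assumes \<omega>_measurable [measurable]: "\<omega> \<in> borel_measurable lebesgue"
    and \<omega>_nonneg: "\<And>x. \<omega> x \<ge> 0" and s: "s > 2" and C_nonneg: "C \<ge> 0"
    and power_bound: "\<And>u. norm u \<le> 1 \<Longrightarrow> (\<integral>\<^sup>+x. ennreal (\<omega> x * \<bar>val u x\<bar> powr s) \<partial>lebesgue) \<le> ennreal C"
begin

lemma term_bound_unit:
  assumes "norm u \<le> 1" "norm v \<le> 1" "norm w \<le> 1"
  shows "(\<integral>\<^sup>+x. ennreal (\<omega> x * \<bar>val u x\<bar> powr (s - 2) * \<bar>val v x\<bar> * \<bar>val w x\<bar>) \<partial>lebesgue) \<le> ennreal (3 * C)"
proof -
  have "(\<integral>\<^sup>+x. ennreal (\<omega> x * \<bar>val u x\<bar> powr (s - 2) * \<bar>val v x\<bar> * \<bar>val w x\<bar>) \<partial>lebesgue)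
    \<le> (\<integral>\<^sup>+x. ennreal (\<omega> x * \<bar>val u x\<bar> powr s) + ennreal (\<omega> x * \<bar>val v x\<bar> powr s) + ennreal (\<omega> x * \<bar>val w x\<bar> powr s) \<partial>lebesgue)"
  proof (intro nn_integral_mono)
    fix x
    have "\<omega> x * (\<bar>val u x\<bar> powr (s - 2) * \<bar>val v x\<bar> * \<bar>val w x\<bar>) \<le> \<omega> x * (\<bar>val u x\<bar> powr s + \<bar>val v x\<bar> powr s + \<bar>val w x\<bar> powr s)"
      by (intro mult_left_mono powr_mult_mult_le \<omega>_nonneg s) auto
    then show "ennreal (\<omega> x * \<bar>val u x\<bar> powr (s - 2) * \<bar>val v x\<bar> * \<bar>val w x\<bar>)
        \<le> ennreal (\<omega> x * \<bar>val u x\<bar> powr s) + ennreal (\<omega> x * \<bar>val v x\<bar> powr s) + ennreal (\<omega> x * \<bar>val w x\<bar> powr s)"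
      using \<omega>_nonneg [of x] by (simp add: mult.assoc distrib_left flip: ennreal_plus)
  qed
  also have "\<dots> = (\<integral>\<^sup>+x. ennreal (\<omega> x * \<bar>val u x\<bar> powr s) \<partial>lebesgue) + (\<integral>\<^sup>+x. ennreal (\<omega> x * \<bar>val v x\<bar> powr s) \<partial>lebesgue)
      + (\<integral>\<^sup>+x. ennreal (\<omega> x * \<bar>val w x\<bar> powr s) \<partial>lebesgue)"
    by (simp add: nn_integral_add)
  also have "\<dots> \<le> ennreal C + ennreal C + ennreal C"
    by (intro add_mono power_bound assms)
  also have "\<dots> = ennreal (3 * C)" using C_nonneg by (simp flip: ennreal_plus)
  finally show ?thesis .
qed

lemma term_bound:
  "(\<integral>\<^sup>+x. ennreal (\<omega> x * \<bar>val u x\<bar> powr (s - 2) * \<bar>val v x\<bar> * \<bar>val w x\<bar>) \<partial>lebesgue)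
     \<le> ennreal (3 * C * norm u powr (s - 2) * norm v * norm w)"
proof (cases "u = 0 \<or> v = 0 \<or> w = 0")
  case True
  have "AE x in lebesgue. ennreal (\<omega> x * \<bar>val u x\<bar> powr (s - 2) * \<bar>val v x\<bar> * \<bar>val w x\<bar>) = 0"
    using True val_0 by (elim disjE) (auto elim!: eventually_mono)
  then show ?thesis by (subst nn_integral_0_iff_AE [THEN iffD2]) auto
next
  case False
  define u' v' w' where "u' = u /\<^sub>R norm u" "v' = v /\<^sub>R norm v" "w' = w /\<^sub>R norm w"
  have n: "norm u' \<le> 1" "norm v' \<le> 1" "norm w' \<le> 1" using False by (auto simp: u'_v'_w'_def)
  have e: "u = norm u *\<^sub>R u'" "v = norm v *\<^sub>R v'" "w = norm w *\<^sub>R w'" using False by (auto simp: u'_v'_w'_def)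
  let ?c = "norm u powr (s - 2) * norm v * norm w"
  have "AE x in lebesgue. val u x = norm u * val u' x" "AE x in lebesgue. val v x = norm v * val v' x"
    "AE x in lebesgue. val w x = norm w * val w' x"
    using val_scaleR [of "norm u" u'] val_scaleR [of "norm v" v'] val_scaleR [of "norm w" w'] e by auto
  then have "AE x in lebesgue. ennreal (\<omega> x * \<bar>val u x\<bar> powr (s - 2) * \<bar>val v x\<bar> * \<bar>val w x\<bar>)
      = ennreal ?c * ennreal (\<omega> x * \<bar>val u' x\<bar> powr (s - 2) * \<bar>val v' x\<bar> * \<bar>val w' x\<bar>)"
  proof eventually_elim
    case (elim x)
    show ?case unfolding elim
      using \<omega>_nonneg [of x] by (simp add: abs_mult powr_mult mult_ac flip: ennreal_mult)
  qed
  then have "(\<integral>\<^sup>+x. ennreal (\<omega> x * \<bar>val u x\<bar> powr (s - 2) * \<bar>val v x\<bar> * \<bar>val w x\<bar>) \<partial>lebesgue)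
     = (\<integral>\<^sup>+x. ennreal ?c * ennreal (\<omega> x * \<bar>val u' x\<bar> powr (s - 2) * \<bar>val v' x\<bar> * \<bar>val w' x\<bar>) \<partial>lebesgue)"
    by (rule nn_integral_cong_AE)
  also have "\<dots> = ennreal ?c * (\<integral>\<^sup>+x. ennreal (\<omega> x * \<bar>val u' x\<bar> powr (s - 2) * \<bar>val v' x\<bar> * \<bar>val w' x\<bar>) \<partial>lebesgue)"
    by (rule nn_integral_cmult) measurable
  also have "\<dots> \<le> ennreal ?c * ennreal (3 * C)"
    by (intro mult_left_mono term_bound_unit n) auto
  also have "\<dots> = ennreal (3 * C * norm u powr (s - 2) * norm v * norm w)"
    using C_nonneg by (simp add: mult_ac flip: ennreal_mult)
  finally show ?thesis .
qed

lemma term_integrable: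
  "integrable lebesgue (\<lambda>x. \<omega> x * \<bar>val u x\<bar> powr (s - 2) * \<bar>val v x\<bar> * \<bar>val w x\<bar>)"
  and term_integrable': "integrable lebesgue (\<lambda>x. \<omega> x * \<bar>val u x\<bar> powr (s - 2) * val v x * val w x)"
  and term_integral_le: "(LINT x|lebesgue. \<omega> x * \<bar>val u x\<bar> powr (s - 2) * \<bar>val v x\<bar> * \<bar>val w x\<bar>)
     \<le> 3 * C * norm u powr (s - 2) * norm v * norm w"
proof -
  let ?f = "\<lambda>x. \<omega> x * \<bar>val u x\<bar> powr (s - 2) * \<bar>val v x\<bar> * \<bar>val w x\<bar>"
  have nn: "?f x \<ge> 0" for x using \<omega>_nonneg by simp
  show 1: "integrable lebesgue ?f"
    using term_bound [of u v w] nn by (intro integrableI_nonneg) (auto intro: le_less_trans)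
  show "integrable lebesgue (\<lambda>x. \<omega> x * \<bar>val u x\<bar> powr (s - 2) * val v x * val w x)"
    by (rule Bochner_Integration.integrable_bound [OF 1]) (auto simp: abs_mult \<omega>_nonneg)
  have "ennreal (LINT x|lebesgue. ?f x) = (\<integral>\<^sup>+x. ennreal (?f x) \<partial>lebesgue)"
    using 1 nn by (intro nn_integral_eq_integral [symmetric]) auto
  also have "\<dots> \<le> ennreal (3 * C * norm u powr (s - 2) * norm v * norm w)" by (rule term_bound)
  finally show "(LINT x|lebesgue. ?f x) \<le> 3 * C * norm u powr (s - 2) * norm v * norm w"
    using C_nonneg by (subst (asm) ennreal_le_iff) auto
qed

definition pair :: "h1 \<Rightarrow> h1 \<Rightarrow> real" where
  "pair u v = (LINT x|lebesgue. \<omega> x * \<bar>val u x\<bar> powr (s - 2) * val u x * val v x)"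

lemma bounded_linear_pair: "bounded_linear (pair u)"
proof (rule bounded_linear_intro [of _ "3 * C * norm u powr (s - 2) * norm u"])
  fix v w :: h1 and c :: real
  have "pair u (v + w) = (LINT x|lebesgue. \<omega> x * \<bar>val u x\<bar> powr (s - 2) * val u x * val v x + \<omega> x * \<bar>val u x\<bar> powr (s - 2) * val u x * val w x)"
    unfolding pair_def by (rule integral_cong_AE)
      (measurable, use val_add [of v w] in \<open>eventually_elim, simp add: distrib_left\<close>)
  then show "pair u (v + w) = pair u v + pair u w"
    by (simp add: pair_def term_integrable')
  have "pair u (c *\<^sub>R v) = (LINT x|lebesgue. c * (\<omega> x * \<bar>val u x\<bar> powr (s - 2) * val u x * val v x))"
    unfolding pair_def by (rule integral_cong_AE)
      (measurable, use val_scaleR [of c v] in \<open>eventually_elim, simp\<close>)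
  then show "pair u (c *\<^sub>R v) = c *\<^sub>R pair u v" by (simp add: pair_def)
  have "norm (pair u v) \<le> (LINT x|lebesgue. norm (\<omega> x * \<bar>val u x\<bar> powr (s - 2) * val u x * val v x))"
    unfolding pair_def by (rule integral_norm_bound)
  also have "\<dots> = (LINT x|lebesgue. \<omega> x * \<bar>val u x\<bar> powr (s - 2) * \<bar>val u x\<bar> * \<bar>val v x\<bar>)"
    by (simp add: abs_mult \<omega>_nonneg)
  also have "\<dots> \<le> 3 * C * norm u powr (s - 2) * norm u * norm v" by (rule term_integral_le)
  finally show "norm (pair u v) \<le> norm v * (3 * C * norm u powr (s - 2) * norm u)" by (simp add: mult_ac)
qed

text \<open>The gradient of u \<mapsto> (1/s) \<integral> \<omega> |u|^s, as the Riesz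
  representative of its differential \<open>pair u\<close>.\<close>

definition D :: "h1 \<Rightarrow> h1" where
  "D u = riesz (pair u)"

lemma D_inner: "D u \<bullet> v = pair u v"
  unfolding D_def by (rule riesz [OF bounded_linear_pair])

lemma abs_powr_split: "\<bar>a\<bar> powr (s - 2) * a * a = \<bar>a\<bar> powr s"
proof (cases "a = 0")
  case False
  have "\<bar>a\<bar> powr s = \<bar>a\<bar> powr (s - 2) * \<bar>a\<bar> powr 2" using powr_add [of "\<bar>a\<bar>" "s - 2" 2] by simp
  then show ?thesis using False by (simp add: power2_eq_square mult.assoc)
qed simp

lemma D_inner_self: "D u \<bullet> u = (LINT x|lebesgue. \<omega> x * \<bar>val u x\<bar> powr s)"
  unfolding D_inner pair_def by (simp add: abs_powr_split mult.assoc)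
     (simp add: abs_powr_split flip: mult.assoc)

lemma power_integrable: "integrable lebesgue (\<lambda>x. \<omega> x * \<bar>val u x\<bar> powr s)"
proof -
  have "(\<lambda>x. \<omega> x * \<bar>val u x\<bar> powr (s - 2) * val u x * val u x) = (\<lambda>x. \<omega> x * \<bar>val u x\<bar> powr s)"
    by (auto simp: fun_eq_iff mult.assoc abs_powr_split [symmetric])
  then show ?thesis using term_integrable' [of u u u] by simp
qed

lemma D_self_nonneg: "D u \<bullet> u \<ge> 0"
  unfolding D_inner_self by (rule Bochner_Integration.integral_nonneg) (simp add: \<omega>_nonneg)

lemma D_scale_self:
  assumes "t > 0"
  shows "D (t *\<^sub>R u) \<bullet> (t *\<^sub>R u) = t powr s * (D u \<bullet> u)"
proof -
  have "D (t *\<^sub>R u) \<bullet> (t *\<^sub>R u) = (LINT x|lebesgue. t powr s * (\<omega> x * \<bar>val u x\<bar> powr s))"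
    unfolding D_inner_self
  proof (rule integral_cong_AE)
    show "AE x in lebesgue. \<omega> x * \<bar>val (t *\<^sub>R u) x\<bar> powr s = t powr s * (\<omega> x * \<bar>val u x\<bar> powr s)"
      using val_scaleR [of t u] by eventually_elim (use assms in \<open>simp add: abs_mult powr_mult\<close>)
  qed measurable
  then show ?thesis by (simp add: D_inner_self)
qed

lemma D_minus: "D (- u) = - D u"
proof -
  have "D (- u) \<bullet> v = - D u \<bullet> v" for v
  proof -
    have "pair (- u) v = (LINT x|lebesgue. - (\<omega> x * \<bar>val u x\<bar> powr (s - 2) * val u x * val v x))"
      unfolding pair_def by (rule integral_cong_AE)
        (measurable, use val_minus [of u] in \<open>eventually_elim, simp\<close>)
    then show ?thesis by (simp add: D_inner pair_def)
  qed
  then have "\<forall>v. D (- u) \<bullet> v = - D u \<bullet> v" by blast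
  then show ?thesis by (simp only: vector_eq_rdot)
qed

lemma D_self_le: "D u \<bullet> u \<le> 3 * C * norm u powr s"
proof -
  have "D u \<bullet> u \<le> 3 * C * norm u powr (s - 2) * norm u * norm u"
    using term_integral_le [of u u u] unfolding D_inner_self
    by (simp add: mult.assoc abs_powr_split [symmetric])
  also have "\<dots> = 3 * C * (norm u powr (s - 2) * norm u * norm u)" by simp
  also have "norm u powr (s - 2) * norm u * norm u = norm u powr s"
    using abs_powr_split [of "norm u"] by simp
  finally show ?thesis .
qed

text \<open>The pointwise Lipschitz bound for |t|^(s-2) t, with the power of the sum split by
  \<open>powr_add_le\<close>, leaves two integrals of the kind bounded in
  \<open>term_integral_le\<close>. Testing with every z gives the norm.\<close>

lemma D_lipschitz:
  "norm (D u - D v) \<le> (s - 1) * 2 powr (s - 2) * (3 * C) * (norm u powr (s - 2) + norm v powr (s - 2)) * norm (u - v)"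
proof (rule norm_le_inner)
  fix z
  let ?K = "(s - 1) * 2 powr (s - 2)"
  have "(D u - D v) \<bullet> z = (LINT x|lebesgue. \<omega> x * (\<bar>val u x\<bar> powr (s - 2) * val u x - \<bar>val v x\<bar> powr (s - 2) * val v x) * val z x)"
    unfolding inner_diff_left D_inner pair_def
    by (subst Bochner_Integration.integral_diff [symmetric, OF term_integrable' term_integrable'])
      (simp add: algebra_simps)
  also have "\<dots> \<le> (LINT x|lebesgue. ?K * (\<omega> x * \<bar>val u x\<bar> powr (s - 2) * \<bar>val (u - v) x\<bar> * \<bar>val z x\<bar>)
      + ?K * (\<omega> x * \<bar>val v x\<bar> powr (s - 2) * \<bar>val (u - v) x\<bar> * \<bar>val z x\<bar>))"
  proof (rule integral_mono_AE)
    show "integrable lebesgue (\<lambda>x. \<omega> x * (\<bar>val u x\<bar> powr (s - 2) * val u x - \<bar>val v x\<bar> powr (s - 2) * val v x) * val z x)"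
      using Bochner_Integration.integrable_diff [OF term_integrable' [of u u z] term_integrable' [of v v z]]
      by (simp add: algebra_simps)
    show "integrable lebesgue (\<lambda>x. ?K * (\<omega> x * \<bar>val u x\<bar> powr (s - 2) * \<bar>val (u - v) x\<bar> * \<bar>val z x\<bar>)
      + ?K * (\<omega> x * \<bar>val v x\<bar> powr (s - 2) * \<bar>val (u - v) x\<bar> * \<bar>val z x\<bar>))"
      by (intro Bochner_Integration.integrable_add integrable_mult_right term_integrable)
    show "AE x in lebesgue. \<omega> x * (\<bar>val u x\<bar> powr (s - 2) * val u x - \<bar>val v x\<bar> powr (s - 2) * val v x) * val z x
      \<le> ?K * (\<omega> x * \<bar>val u x\<bar> powr (s - 2) * \<bar>val (u - v) x\<bar> * \<bar>val z x\<bar>)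
      + ?K * (\<omega> x * \<bar>val v x\<bar> powr (s - 2) * \<bar>val (u - v) x\<bar> * \<bar>val z x\<bar>)"
      using val_diff [of u v]
    proof eventually_elim
      case (elim x)
      let ?a = "val u x" and ?b = "val v x"
      have "\<bar>\<bar>?a\<bar> powr (s - 2) * ?a - \<bar>?b\<bar> powr (s - 2) * ?b\<bar> \<le> (s - 2 + 1) * (\<bar>?a\<bar> + \<bar>?b\<bar>) powr (s - 2) * \<bar>?a - ?b\<bar>"
        using s by (intro abs_powr_mult_lipschitz) auto
      also have "\<dots> \<le> (s - 2 + 1) * (2 powr (s - 2) * (\<bar>?a\<bar> powr (s - 2) + \<bar>?b\<bar> powr (s - 2))) * \<bar>?a - ?b\<bar>"
        using s by (intro mult_right_mono mult_left_mono powr_add_le) auto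
      finally have 1: "\<bar>\<bar>?a\<bar> powr (s - 2) * ?a - \<bar>?b\<bar> powr (s - 2) * ?b\<bar>
          \<le> ?K * (\<bar>?a\<bar> powr (s - 2) + \<bar>?b\<bar> powr (s - 2)) * \<bar>?a - ?b\<bar>" by (simp add: mult.assoc)
      have "\<omega> x * (\<bar>?a\<bar> powr (s - 2) * ?a - \<bar>?b\<bar> powr (s - 2) * ?b) * val z x
          \<le> \<omega> x * \<bar>\<bar>?a\<bar> powr (s - 2) * ?a - \<bar>?b\<bar> powr (s - 2) * ?b\<bar> * \<bar>val z x\<bar>"
        using abs_ge_self [of "\<omega> x * (\<bar>?a\<bar> powr (s - 2) * ?a - \<bar>?b\<bar> powr (s - 2) * ?b) * val z x"] \<omega>_nonneg [of x]
        by (simp only: abs_mult abs_of_nonneg)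
      also have "\<dots> \<le> \<omega> x * (?K * (\<bar>?a\<bar> powr (s - 2) + \<bar>?b\<bar> powr (s - 2)) * \<bar>?a - ?b\<bar>) * \<bar>val z x\<bar>"
        by (intro mult_right_mono mult_left_mono 1 \<omega>_nonneg) auto
      finally show ?case by (simp add: elim algebra_simps)
    qed
  qed
  also have "\<dots> = ?K * (LINT x|lebesgue. \<omega> x * \<bar>val u x\<bar> powr (s - 2) * \<bar>val (u - v) x\<bar> * \<bar>val z x\<bar>)
      + ?K * (LINT x|lebesgue. \<omega> x * \<bar>val v x\<bar> powr (s - 2) * \<bar>val (u - v) x\<bar> * \<bar>val z x\<bar>)"
    by (subst Bochner_Integration.integral_add) (auto intro!: integrable_mult_right term_integrable)
  also have "\<dots> \<le> ?K * (3 * C * norm u powr (s - 2) * norm (u - v) * norm z) + ?K * (3 * C * norm v powr (s - 2) * norm (u - v) * norm z)"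
    using s by (intro add_mono mult_left_mono term_integral_le) auto
  finally show "(D u - D v) \<bullet> z \<le> (s - 1) * 2 powr (s - 2) * (3 * C) * (norm u powr (s - 2) + norm v powr (s - 2)) * norm (u - v) * norm z"
    by (simp add: algebra_simps)
next
  show "(s - 1) * 2 powr (s - 2) * (3 * C) * (norm u powr (s - 2) + norm v powr (s - 2)) * norm (u - v) \<ge> 0"
    using s C_nonneg by (intro mult_nonneg_nonneg add_nonneg_nonneg) auto
qed

text \<open>The tangent inequality for |t|^s, integrated. These terms enter the energy with a minus
  sign, so convexity bounds the energy from above, the direction that \<open>descent\<close> asks
  for.\<close>

lemma D_convex: "(D u \<bullet> u) / s + D u \<bullet> (v - u) \<le> (D v \<bullet> v) / s"
proof -
  have "(D u \<bullet> u) + s * (D u \<bullet> (v - u)) = (LINT x|lebesgue. \<omega> x * \<bar>val u x\<bar> powr s + s * (\<omega> x * \<bar>val u x\<bar> powr (s - 2) * val u x * val (v - u) x))"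
    unfolding D_inner_self unfolding D_inner pair_def
    by (simp add: power_integrable term_integrable')
  also have "\<dots> \<le> (LINT x|lebesgue. \<omega> x * \<bar>val v x\<bar> powr s)"
  proof (rule integral_mono_AE)
    show "integrable lebesgue (\<lambda>x. \<omega> x * \<bar>val u x\<bar> powr s + s * (\<omega> x * \<bar>val u x\<bar> powr (s - 2) * val u x * val (v - u) x))"
      by (intro Bochner_Integration.integrable_add integrable_mult_right term_integrable' power_integrable)
    show "AE x in lebesgue. \<omega> x * \<bar>val u x\<bar> powr s + s * (\<omega> x * \<bar>val u x\<bar> powr (s - 2) * val u x * val (v - u) x) \<le> \<omega> x * \<bar>val v x\<bar> powr s"
      using val_diff [of v u]
    proof eventually_elim
      case (elim x)
      have "\<omega> x * (\<bar>val u x\<bar> powr s + s * (\<bar>val u x\<bar> powr (s - 2) * val u x * (val v x - val u x))) \<le> \<omega> x * \<bar>val v x\<bar> powr s"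
        by (intro mult_left_mono abs_powr_convex s \<omega>_nonneg)
      then show ?case by (simp add: elim distrib_left mult_ac)
    qed
  qed (rule power_integrable)
  finally have "(D u \<bullet> u) + s * (D u \<bullet> (v - u)) \<le> D v \<bullet> v" by (simp add: D_inner_self)
  then have "((D u \<bullet> u) + s * (D u \<bullet> (v - u))) / s \<le> (D v \<bullet> v) / s"
    using s by (intro divide_right_mono) auto
  then show ?thesis using s by (simp add: add_divide_distrib)
qed

end

section \<open>The Coulomb energy\<close>

lemma sigma_finite_lebesgue: "sigma_finite_measure (lebesgue :: 'a::euclidean_space measure)"
proof -
  from lborel.sigma_finite_countable obtain A :: "'a set set" where
    A: "countable A \<and> A \<subseteq> sets lborel \<and> \<Union>A = space lborel \<and> (\<forall>a\<in>A. emeasure lborel a \<noteq> \<infinity>)" ..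
  show ?thesis
  proof (intro sigma_finite_measure.intro exI [of _ A] conjI ballI)
    show "countable A" using A by (rule conjunct1)
    have sub: "A \<subseteq> sets lborel" using A by (elim conjE)
    show "A \<subseteq> sets lebesgue"
    proof
      fix a assume "a \<in> A"
      then show "a \<in> sets lebesgue" using subsetD [OF sub] by simp
    qed
    show "\<Union>A = space lebesgue" using A by (elim conjE) simp
    show "emeasure lebesgue a \<noteq> \<infinity>" if "a \<in> A" for a
    proof -
      have "emeasure lebesgue a = emeasure lborel a"
        using subsetD [OF sub that] by simp
      moreover have "emeasure lborel a \<noteq> \<infinity>" using A that by (elim conjE) (rule bspec)
      ultimately show ?thesis by simp
    qed
  qed
qed

interpretation lebesgue: sigma_finite_measure "lebesgue :: R3 measure"
  by (rule sigma_finite_lebesgue)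

interpretation lebesgue2: pair_sigma_finite "lebesgue :: R3 measure" "lebesgue :: R3 measure" ..

lemma AE_fst:
  assumes "AE x in M. P x" "sigma_finite_measure N"
  shows "AE p in M \<Otimes>\<^sub>M N. P (fst p)"
proof -
  obtain A where A: "{x \<in> space M. \<not> P x} \<subseteq> A" "emeasure M A = 0" "A \<in> sets M"
    using assms(1) by (rule AE_E)
  have "emeasure (M \<Otimes>\<^sub>M N) (A \<times> space N) = 0"
    using A assms(2) by (simp add: sigma_finite_measure.emeasure_pair_measure_Times)
  then have "A \<times> space N \<in> null_sets (M \<Otimes>\<^sub>M N)" using A by auto
  moreover have "{p \<in> space (M \<Otimes>\<^sub>M N). \<not> P (fst p)} \<subseteq> A \<times> space N"
    using A by (auto simp: space_pair_measure)
  ultimately show ?thesis by (rule AE_I')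
qed

lemma AE_snd:
  assumes "AE x in N. P x" "sigma_finite_measure N"
  shows "AE p in M \<Otimes>\<^sub>M N. P (snd p)"
proof -
  obtain A where A: "{x \<in> space N. \<not> P x} \<subseteq> A" "emeasure N A = 0" "A \<in> sets N"
    using assms(1) by (rule AE_E)
  have "emeasure (M \<Otimes>\<^sub>M N) (space M \<times> A) = 0"
    using A assms(2) by (simp add: sigma_finite_measure.emeasure_pair_measure_Times)
  then have "space M \<times> A \<in> null_sets (M \<Otimes>\<^sub>M N)" using A by auto
  moreover have "{p \<in> space (M \<Otimes>\<^sub>M N). \<not> P (snd p)} \<subseteq> space M \<times> A"
    using A by (auto simp: space_pair_measure)
  ultimately show ?thesis by (rule AE_I')
qed

lemma lebesgue_id_measurable: "(\<lambda>x. x) \<in> borel_measurable (lebesgue :: R3 measure)"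
  by (rule measurable_completion) simp

text \<open>The Newtonian kernel near 0, raised to the power 3/2: this exponent is conjugate to 3,
  the power of u^2 controlled by the Sobolev inequality, and it is below the dimension 3, hence
  integrable.\<close>

definition near_kernel :: "R3 \<Rightarrow> real" where
  "near_kernel y = (if norm y < 1 then (1 / norm y) powr (3 / 2) else 0)"

lemma near_kernel_measurable [measurable]: "near_kernel \<in> borel_measurable borel"
  unfolding near_kernel_def by measurable

text \<open>Dyadic shells: between the radii 2^-(j+1) and 2^-j the kernel is at most c^(j+1) with c
  = 2^(3/2), while the volume is of order 8^-j; as c/8 \<le> 1/2 the series is geometric.\<close>

lemma near_kernel_bound: "\<exists>K\<ge>0. \<forall>x. (\<integral>\<^sup>+y. ennreal (near_kernel (x - y)) \<partial>lebesgue) \<le> ennreal K"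
proof -
  define c :: real where "c = 2 powr (3 / 2)"
  define U where "U = unit_ball_vol (3::real)"
  have U: "U \<ge> 0" by (simp add: U_def)
  have c: "0 < c" "c \<le> 4"
  proof -
    have "(2::real) powr (3 / 2) \<le> 2 powr 2" by (intro powr_mono) auto
    then show "c \<le> 4" by (simp add: c_def)
  qed (simp add: c_def)
  define a where "a x j y = ennreal (c ^ (j + 1)) * indicator (cball x ((1/2) ^ j)) y" for x y :: R3 and j :: nat
  have a_meas [measurable]: "a x j \<in> borel_measurable lebesgue" for x j
  proof -
    have [measurable]: "(indicator (cball x ((1/2) ^ j)) :: R3 \<Rightarrow> ennreal) \<in> borel_measurable lebesgue"
      by (rule borel_measurable_indicator) simp
    show ?thesis unfolding a_def by measurable
  qed
  have le: "ennreal (near_kernel (x - y)) \<le> (\<Sum>j. a x j y)" for x y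
  proof (cases "x = y \<or> norm (x - y) \<ge> 1")
    case True
    then show ?thesis by (auto simp: near_kernel_def)
  next
    case False
    then have n: "0 < norm (x - y)" "norm (x - y) < 1" by auto
    obtain m0 where m0: "(1/2) ^ m0 < norm (x - y)"
      using real_arch_pow_inv [OF n(1), of "1/2"] by auto
    define m where "m = (LEAST m. (1/2) ^ m < norm (x - y))"
    have m: "(1/2) ^ m < norm (x - y)" unfolding m_def by (rule LeastI [of _ m0]) (rule m0)
    have "m \<noteq> 0"
    proof
      assume "m = 0"
      with m n show False by simp
    qed
    then obtain j where j: "m = Suc j" by (cases m) auto
    have "\<not> (1/2) ^ j < norm (x - y)" using not_less_Least [of j "\<lambda>m. (1/2) ^ m < norm (x - y)"] j by (simp add: m_def)
    then have ind: "indicator (cball x ((1/2) ^ j)) y = (1::ennreal)"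
      by (simp add: dist_norm)
    have "1 / norm (x - y) \<le> 1 / (1/2) ^ Suc j"
      using m n j by (intro divide_left_mono) auto
    also have "1 / (1/2) ^ Suc j = (2::real) ^ Suc j" by (simp add: power_one_over divide_simps)
    finally have "(1 / norm (x - y)) powr (3 / 2) \<le> (2 ^ Suc j) powr (3 / 2)"
      using n by (intro powr_mono2) auto
    also have "(2 ^ Suc j) powr (3 / 2) = ((2::real) powr real (Suc j)) powr (3 / 2)"
      by (subst powr_realpow) auto
    also have "\<dots> = c powr real (Suc j)" by (simp add: c_def powr_powr mult.commute)
    also have "\<dots> = c ^ Suc j" using c by (subst powr_realpow) auto
    finally have "near_kernel (x - y) \<le> c ^ (j + 1)"
      using n by (simp add: near_kernel_def)
    then have "ennreal (near_kernel (x - y)) \<le> a x j y"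
      unfolding a_def ind by (simp add: ennreal_leI)
    also have "\<dots> \<le> (\<Sum>j. a x j y)"
      using sum_le_suminf [of "\<lambda>j. a x j y" "{j}"] by (simp add: summableI)
    finally show ?thesis .
  qed
  have int: "(\<integral>\<^sup>+y. a x j y \<partial>lebesgue) \<le> ennreal (c * U * (1/2) ^ j)" for x j
  proof -
    have "(\<integral>\<^sup>+y. a x j y \<partial>lebesgue) = ennreal (c ^ (j + 1)) * emeasure lebesgue (cball x ((1/2) ^ j))"
      unfolding a_def by (rule nn_integral_cmult_indicator) auto
    also have "emeasure lebesgue (cball x ((1/2) ^ j)) = ennreal (U * ((1/2) ^ j) ^ 3)"
      by (simp add: emeasure_cball U_def del: power_one_over)
    also have "ennreal (c ^ (j + 1)) * ennreal (U * ((1/2) ^ j) ^ 3) = ennreal (c ^ (j + 1) * (U * ((1/2) ^ j) ^ 3))"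
      using c by (intro ennreal_mult' [symmetric]) auto
    also have "\<dots> \<le> ennreal (c * U * (1/2) ^ j)"
    proof (rule ennreal_leI)
      have "((1/2 :: real) ^ j) ^ 3 = (1/8) ^ j"
        by (simp add: power3_eq_cube flip: power_mult_distrib)
      then have "c ^ (j + 1) * (U * ((1/2) ^ j) ^ 3) = c * U * (c * (1/8)) ^ j"
        by (simp only: power_mult_distrib) (simp add: power_add)
      also have "\<dots> \<le> c * U * (1/2) ^ j"
        using c U by (intro mult_left_mono power_mono) auto
      finally show "c ^ (j + 1) * (U * ((1/2) ^ j) ^ 3) \<le> c * U * (1/2) ^ j" .
    qed
    finally show ?thesis .
  qed
  have "(\<integral>\<^sup>+y. ennreal (near_kernel (x - y)) \<partial>lebesgue) \<le> ennreal (c * U * 2)" for x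
  proof -
    have "(\<integral>\<^sup>+y. ennreal (near_kernel (x - y)) \<partial>lebesgue) \<le> (\<integral>\<^sup>+y. (\<Sum>j. a x j y) \<partial>lebesgue)"
      by (intro nn_integral_mono le)
    also have "\<dots> = (\<Sum>j. \<integral>\<^sup>+y. a x j y \<partial>lebesgue)"
      by (rule nn_integral_suminf) measurable
    also have "\<dots> \<le> (\<Sum>j. ennreal (c * U * (1/2) ^ j))"
      by (intro suminf_le int) auto
    also have "\<dots> = ennreal (\<Sum>j. c * U * (1/2) ^ j)"
      using c U by (intro suminf_ennreal2 summable_mult) auto
    also have "(\<Sum>j. c * U * (1/2) ^ j) = c * U * 2"
      by (subst suminf_mult) (auto simp: suminf_geometric)
    finally show ?thesis .
  qed
  then show ?thesis using c U by (intro exI [of _ "c * U * 2"]) auto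
qed

text \<open>For r < 1 this is Young's inequality with exponents 3 and 3/2, obtained by comparing 1/r
  with a^4; for r \<ge> 1 the first term suffices. At r = 0 the quotient is 0 by convention.\<close>

lemma square_div_le:
  fixes a r :: real
  assumes "r \<ge> 0"
  shows "a\<^sup>2 / r \<le> a\<^sup>2 + a ^ 6 + (if r < 1 then (1 / r) powr (3 / 2) else 0)"
proof (cases "r < 1 \<and> r > 0")
  case True
  define t where "t = 1 / r"
  have t: "t \<ge> 1" using True by (simp add: t_def)
  show ?thesis
  proof (cases "t \<le> a ^ 4")
    case True
    have "a\<^sup>2 * t \<le> a\<^sup>2 * a ^ 4" using True by (intro mult_left_mono) auto
    also have "\<dots> = a ^ 6" by (simp flip: power_add)
    finally have "a\<^sup>2 / r \<le> a ^ 6" by (simp add: t_def)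
    moreover have "(if r < 1 then (1 / r) powr (3 / 2) else 0) \<ge> 0" by simp
    moreover have "a\<^sup>2 \<ge> 0" by simp
    ultimately show ?thesis by linarith
  next
    case False
    have "(a\<^sup>2)\<^sup>2 \<le> t" using False by simp
    then have "a\<^sup>2 \<le> sqrt t" by (rule real_le_rsqrt)
    then have "a\<^sup>2 * t \<le> sqrt t * t" using t by (intro mult_right_mono) auto
    also have "\<dots> = t powr (1/2) * t powr 1" using t by (simp add: powr_half_sqrt)
    also have "\<dots> = t powr (3/2)" unfolding powr_add [symmetric] by simp
    finally have "a\<^sup>2 / r \<le> (1 / r) powr (3 / 2)" by (simp add: t_def)
    moreover have "a\<^sup>2 \<ge> 0" "a ^ 6 \<ge> 0" by simp_all
    moreover have "(if r < 1 then (1 / r) powr (3 / 2) else 0) = (1 / r) powr (3 / 2)"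
      using \<open>r < 1 \<and> r > 0\<close> by simp
    ultimately show ?thesis by linarith
  qed
next
  case False
  have "a\<^sup>2 / r \<le> a\<^sup>2"
  proof (cases "r = 0")
    case False
    then have "r \<ge> 1" using \<open>\<not> (r < 1 \<and> r > 0)\<close> assms by auto
    then show ?thesis using divide_left_mono [of 1 r "a\<^sup>2"] by simp
  qed simp
  moreover have "a ^ 6 \<ge> 0" "(if r < 1 then (1 / r) powr (3 / 2) else 0) \<ge> 0" by simp_all
  ultimately show ?thesis by linarith
qed

text \<open>The Newtonian potential of the square of w is bounded uniformly in x: the three terms of
  \<open>square_div_le\<close> are controlled by the L2 norm, the Sobolev inequality and the
  integral of the truncated kernel.\<close>

lemma potential_bound:
  "\<exists>P\<ge>0. \<forall>w x. norm w \<le> 1 \<longrightarrow> (\<integral>\<^sup>+y. ennreal ((val w y)\<^sup>2 / norm (x - y)) \<partial>lebesgue) \<le> ennreal P"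
proof -
  obtain K where K: "K \<ge> 0" "\<And>x. (\<integral>\<^sup>+y. ennreal (near_kernel (x - y)) \<partial>lebesgue) \<le> ennreal K"
    using near_kernel_bound by blast
  have "(\<integral>\<^sup>+y. ennreal ((val w y)\<^sup>2 / norm (x - y)) \<partial>lebesgue) \<le> ennreal (1 + 4096 + K)" if w: "norm w \<le> 1" for w x
  proof -
    note lebesgue_id_measurable [measurable]
    have nk: "(\<lambda>y. near_kernel (x - y)) \<in> borel_measurable lebesgue" by measurable
    have "(\<integral>\<^sup>+y. ennreal ((val w y)\<^sup>2 / norm (x - y)) \<partial>lebesgue)
       \<le> (\<integral>\<^sup>+y. ennreal ((val w y)\<^sup>2) + ennreal (val w y ^ 6) + ennreal (near_kernel (x - y)) \<partial>lebesgue)"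
    proof (intro nn_integral_mono)
      fix y
      have "(val w y)\<^sup>2 / norm (x - y) \<le> (val w y)\<^sup>2 + val w y ^ 6 + near_kernel (x - y)"
        unfolding near_kernel_def by (rule square_div_le) simp
      moreover have "near_kernel (x - y) \<ge> 0" by (simp add: near_kernel_def)
      ultimately show "ennreal ((val w y)\<^sup>2 / norm (x - y)) \<le> ennreal ((val w y)\<^sup>2) + ennreal (val w y ^ 6) + ennreal (near_kernel (x - y))"
        by (simp add: ennreal_leI flip: ennreal_plus)
    qed
    also have "\<dots> = (\<integral>\<^sup>+y. ennreal ((val w y)\<^sup>2) \<partial>lebesgue) + (\<integral>\<^sup>+y. ennreal (val w y ^ 6) \<partial>lebesgue) + (\<integral>\<^sup>+y. ennreal (near_kernel (x - y)) \<partial>lebesgue)"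
      using nk by (simp add: nn_integral_add)
    also have "\<dots> \<le> ennreal 1 + ennreal 4096 + ennreal K"
    proof (intro add_mono K(2))
      have "(\<integral>\<^sup>+y. ennreal ((val w y)\<^sup>2) \<partial>lebesgue) = ennreal (LINT y|lebesgue. (val w y)\<^sup>2)"
        by (intro nn_integral_eq_integral integrable_val_square) auto
      also have "\<dots> \<le> ennreal 1"
        using integral_val_square_le [of w] power_le_one [OF norm_ge_zero w, of 2] by (intro ennreal_leI) simp
      finally show "(\<integral>\<^sup>+y. ennreal ((val w y)\<^sup>2) \<partial>lebesgue) \<le> ennreal 1" .
      have "(\<integral>\<^sup>+y. ennreal (val w y ^ 6) \<partial>lebesgue) \<le> ennreal (4096 * norm w ^ 6)" by (rule sobolev_h1)
      also have "\<dots> \<le> ennreal 4096"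
        using power_le_one [OF norm_ge_zero w, of 6] by (intro ennreal_leI) simp
      finally show "(\<integral>\<^sup>+y. ennreal (val w y ^ 6) \<partial>lebesgue) \<le> ennreal 4096" .
    qed
    also have "\<dots> = ennreal (1 + 4096 + K)" using K(1) by (simp only: ennreal_plus [symmetric] add_nonneg_nonneg zero_le_numeral zero_le_one)
    finally show ?thesis .
  qed
  then show ?thesis using K(1) by (intro exI [of _ "1 + 4096 + K"]) auto
qed

definition pot_const :: real where
  "pot_const = (SOME P. P \<ge> 0 \<and> (\<forall>w x. norm w \<le> 1 \<longrightarrow> (\<integral>\<^sup>+y. ennreal ((val w y)\<^sup>2 / norm (x - y)) \<partial>lebesgue) \<le> ennreal P))"

lemma pot_const:
  "pot_const \<ge> 0" "norm w \<le> 1 \<Longrightarrow> (\<integral>\<^sup>+y. ennreal ((val w y)\<^sup>2 / norm (x - y)) \<partial>lebesgue) \<le> ennreal pot_const"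
  using someI_ex [OF potential_bound [unfolded Bex_def]] unfolding pot_const_def [symmetric] by blast+

section \<open>The quadrilinear Coulomb form\<close>

abbreviation LL :: "(R3 \<times> R3) measure" where
  "LL \<equiv> (lebesgue :: R3 measure) \<Otimes>\<^sub>M (lebesgue :: R3 measure)"

text \<open>The Coulomb density polarised in all four slots, so that the energy, its gradient and
  its Taylor terms are values of one quadrilinear form.\<close>

definition cden :: "h1 \<Rightarrow> h1 \<Rightarrow> h1 \<Rightarrow> h1 \<Rightarrow> R3 \<times> R3 \<Rightarrow> real" where
  "cden u v w z p = val u (fst p) * val v (fst p) * (val w (snd p) * val z (snd p)) / norm (fst p - snd p)"

lemma norm_diff_measurable [measurable]: "(\<lambda>p. norm (fst p - snd p)) \<in> borel_measurable LL"
proof -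
  have *: "fst \<in> borel_measurable LL" "snd \<in> borel_measurable LL"
    using measurable_compose [OF measurable_fst lebesgue_id_measurable, of "lebesgue :: R3 measure"]
      measurable_compose [OF measurable_snd lebesgue_id_measurable, of "lebesgue :: R3 measure"] by simp_all
  show ?thesis by (rule measurable_compose [OF borel_measurable_diff [OF *] borel_measurable_norm])
qed

lemma cden_measurable [measurable]: "cden u v w z \<in> borel_measurable LL"
  unfolding cden_def [abs_def] by measurable

lemma abs_mult_le_squares: "\<bar>a * b\<bar> \<le> a\<^sup>2 + (b::real)\<^sup>2"
  using sum_squares_bound [of "\<bar>a\<bar>" "\<bar>b\<bar>"] mult_nonneg_nonneg [OF abs_ge_zero abs_ge_zero, of a b]
  unfolding abs_mult power2_abs by linarith

text \<open>Products are estimated by squares. The inner integral is then a bounded potential, and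
  the outer one is controlled by L2 norms.\<close>

lemma cden_bound_unit:
  assumes "norm u \<le> 1" "norm v \<le> 1" "norm w \<le> 1" "norm z \<le> 1"
  shows "(\<integral>\<^sup>+p. ennreal \<bar>cden u v w z p\<bar> \<partial>LL) \<le> ennreal (4 * pot_const)"
proof -
  let ?f = "\<lambda>p::R3 \<times> R3. ennreal ((val u (fst p))\<^sup>2 + (val v (fst p))\<^sup>2) *
      (ennreal ((val w (snd p))\<^sup>2 / norm (fst p - snd p)) + ennreal ((val z (snd p))\<^sup>2 / norm (fst p - snd p)))"
  have "(\<integral>\<^sup>+p. ennreal \<bar>cden u v w z p\<bar> \<partial>LL) \<le> (\<integral>\<^sup>+p. ?f p \<partial>LL)"
  proof (intro nn_integral_mono)
    fix p :: "R3 \<times> R3"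
    let ?r = "norm (fst p - snd p)"
    have "\<bar>cden u v w z p\<bar> = \<bar>val u (fst p) * val v (fst p)\<bar> * (\<bar>val w (snd p) * val z (snd p)\<bar> / ?r)"
      by (simp add: cden_def abs_mult)
    also have "\<dots> \<le> ((val u (fst p))\<^sup>2 + (val v (fst p))\<^sup>2) * (((val w (snd p))\<^sup>2 + (val z (snd p))\<^sup>2) / ?r)"
      by (intro mult_mono divide_right_mono abs_mult_le_squares) auto
    finally have "ennreal \<bar>cden u v w z p\<bar> \<le> ennreal (((val u (fst p))\<^sup>2 + (val v (fst p))\<^sup>2) * (((val w (snd p))\<^sup>2 + (val z (snd p))\<^sup>2) / ?r))"
      by (rule ennreal_leI)
    also have "\<dots> = ?f p"
      by (simp add: ennreal_mult'' add_divide_distrib)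
    finally show "ennreal \<bar>cden u v w z p\<bar> \<le> ?f p" .
  qed
  also have "\<dots> = (\<integral>\<^sup>+x. \<integral>\<^sup>+y. ?f (x, y) \<partial>lebesgue \<partial>lebesgue)"
    by (rule lebesgue.nn_integral_fst [symmetric]) measurable
  also have "\<dots> \<le> (\<integral>\<^sup>+x. ennreal ((val u x)\<^sup>2 + (val v x)\<^sup>2) * ennreal (2 * pot_const) \<partial>lebesgue)"
  proof (intro nn_integral_mono)
    fix x
    note lebesgue_id_measurable [measurable]
    have m: "(\<lambda>y. ennreal ((val q y)\<^sup>2 / norm (x - y))) \<in> borel_measurable lebesgue" for q
      by measurable
    have "(\<integral>\<^sup>+y. ?f (x, y) \<partial>lebesgue) = ennreal ((val u x)\<^sup>2 + (val v x)\<^sup>2) *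
       ((\<integral>\<^sup>+y. ennreal ((val w y)\<^sup>2 / norm (x - y)) \<partial>lebesgue) + (\<integral>\<^sup>+y. ennreal ((val z y)\<^sup>2 / norm (x - y)) \<partial>lebesgue))"
      using m [of w] m [of z] by (simp add: nn_integral_cmult nn_integral_add)
    also have "\<dots> \<le> ennreal ((val u x)\<^sup>2 + (val v x)\<^sup>2) * (ennreal pot_const + ennreal pot_const)"
      by (intro mult_left_mono add_mono pot_const assms) auto
    also have "ennreal pot_const + ennreal pot_const = ennreal (2 * pot_const)"
      using pot_const(1) by (simp flip: ennreal_plus)
    finally show "(\<integral>\<^sup>+y. ?f (x, y) \<partial>lebesgue) \<le> ennreal ((val u x)\<^sup>2 + (val v x)\<^sup>2) * ennreal (2 * pot_const)" .
  qed
  also have "\<dots> = (\<integral>\<^sup>+x. ennreal ((val u x)\<^sup>2 + (val v x)\<^sup>2) \<partial>lebesgue) * ennreal (2 * pot_const)"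
    by (rule nn_integral_multc) measurable
  also have "\<dots> \<le> ennreal 2 * ennreal (2 * pot_const)"
  proof (intro mult_right_mono)
    have "(\<integral>\<^sup>+x. ennreal ((val u x)\<^sup>2 + (val v x)\<^sup>2) \<partial>lebesgue) = ennreal (LINT x|lebesgue. (val u x)\<^sup>2 + (val v x)\<^sup>2)"
      by (intro nn_integral_eq_integral Bochner_Integration.integrable_add integrable_val_square) auto
    also have "\<dots> \<le> ennreal 2"
      using integral_val_square_le [of u] integral_val_square_le [of v]
        power_le_one [OF norm_ge_zero assms(1), of 2] power_le_one [OF norm_ge_zero assms(2), of 2]
      by (intro ennreal_leI) (simp add: integrable_val_square)
    finally show "(\<integral>\<^sup>+x. ennreal ((val u x)\<^sup>2 + (val v x)\<^sup>2) \<partial>lebesgue) \<le> ennreal 2" .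
  qed auto
  also have "\<dots> = ennreal (2 * (2 * pot_const))"
    by (rule ennreal_mult' [symmetric]) simp
  finally show ?thesis by simp
qed

lemma AE_LL: "AE x in lebesgue. P x \<Longrightarrow> AE p in LL. P (fst p)" "AE x in lebesgue. P x \<Longrightarrow> AE p in LL. P (snd p)"
  by (rule AE_fst [OF _ sigma_finite_lebesgue], assumption) (rule AE_snd [OF _ sigma_finite_lebesgue])

lemma cden_scale: "AE p in LL. cden (a *\<^sub>R u) (b *\<^sub>R v) (c *\<^sub>R w) (d *\<^sub>R z) p = a * b * c * d * cden u v w z p"
  using AE_LL(1) [OF val_scaleR [of a u]] AE_LL(1) [OF val_scaleR [of b v]]
    AE_LL(2) [OF val_scaleR [of c w]] AE_LL(2) [OF val_scaleR [of d z]]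
  by eventually_elim (simp add: cden_def)

lemma cden_bound: "(\<integral>\<^sup>+p. ennreal \<bar>cden u v w z p\<bar> \<partial>LL) \<le> ennreal (4 * pot_const * norm u * norm v * norm w * norm z)"
proof -
  define nm where "nm x = x /\<^sub>R norm x" for x :: h1
  have n: "norm (nm x) \<le> 1" "norm x *\<^sub>R nm x = x" for x by (cases "x = 0"; simp add: nm_def)+
  let ?c = "norm u * norm v * norm w * norm z"
  have "AE p in LL. ennreal \<bar>cden u v w z p\<bar> = ennreal ?c * ennreal \<bar>cden (nm u) (nm v) (nm w) (nm z) p\<bar>"
    using cden_scale [of "norm u" "nm u" "norm v" "nm v" "norm w" "nm w" "norm z" "nm z"]
    unfolding n by eventually_elim (simp add: abs_mult flip: ennreal_mult)
  then have "(\<integral>\<^sup>+p. ennreal \<bar>cden u v w z p\<bar> \<partial>LL) = (\<integral>\<^sup>+p. ennreal ?c * ennreal \<bar>cden (nm u) (nm v) (nm w) (nm z) p\<bar> \<partial>LL)"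
    by (rule nn_integral_cong_AE)
  also have "\<dots> = ennreal ?c * (\<integral>\<^sup>+p. ennreal \<bar>cden (nm u) (nm v) (nm w) (nm z) p\<bar> \<partial>LL)"
    by (rule nn_integral_cmult) measurable
  also have "\<dots> \<le> ennreal ?c * ennreal (4 * pot_const)"
    by (intro mult_left_mono cden_bound_unit n) auto
  also have "\<dots> = ennreal (4 * pot_const * norm u * norm v * norm w * norm z)"
    using pot_const(1) by (simp add: mult_ac flip: ennreal_mult)
  finally show ?thesis .
qed

lemma cden_integrable: "integrable LL (cden u v w z)"
  unfolding integrable_iff_bounded
proof
  show "(\<integral>\<^sup>+p. ennreal (norm (cden u v w z p)) \<partial>LL) < \<infinity>"
    using cden_bound [of u v w z] by (auto intro: le_less_trans)
qed measurable

definition coul :: "h1 \<Rightarrow> h1 \<Rightarrow> h1 \<Rightarrow> h1 \<Rightarrow> real" where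
  "coul u v w z = (LINT p|LL. cden u v w z p)"

lemma coul_abs_le: "\<bar>coul u v w z\<bar> \<le> 4 * pot_const * norm u * norm v * norm w * norm z"
proof -
  have "ennreal \<bar>coul u v w z\<bar> \<le> (\<integral>\<^sup>+p. ennreal \<bar>cden u v w z p\<bar> \<partial>LL)"
    unfolding coul_def using integral_norm_bound_ennreal [OF cden_integrable [of u v w z]] by simp
  also have "\<dots> \<le> ennreal (4 * pot_const * norm u * norm v * norm w * norm z)" by (rule cden_bound)
  finally show ?thesis using pot_const(1) by (subst (asm) ennreal_le_iff) auto
qed

lemma coul_scale: "coul (a *\<^sub>R u) (b *\<^sub>R v) (c *\<^sub>R w) (d *\<^sub>R z) = a * b * c * d * coul u v w z"
proof -
  have "coul (a *\<^sub>R u) (b *\<^sub>R v) (c *\<^sub>R w) (d *\<^sub>R z) = (LINT p|LL. a * b * c * d * cden u v w z p)"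
    unfolding coul_def by (rule integral_cong_AE [OF _ _ cden_scale]) measurable
  then show ?thesis by (simp add: coul_def)
qed

lemma coul_add4: "coul u v w (z + z') = coul u v w z + coul u v w z'"
proof -
  have "coul u v w (z + z') = (LINT p|LL. cden u v w z p + cden u v w z' p)"
    unfolding coul_def
  proof (rule integral_cong_AE)
    show "AE p in LL. cden u v w (z + z') p = cden u v w z p + cden u v w z' p"
      using AE_LL(2) [OF val_add [of z z']]
      by eventually_elim (simp add: cden_def distrib_left add_divide_distrib)
  qed measurable
  then show ?thesis by (simp add: coul_def cden_integrable)
qed

lemma coul_comm12: "coul u v w z = coul v u w z"
  unfolding coul_def cden_def by (simp add: mult_ac)

lemma coul_comm34: "coul u v w z = coul u v z w"
  unfolding coul_def cden_def by (simp add: mult_ac)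

lemma coul_swap: "coul u v w z = coul w z u v"
proof -
  have "coul u v w z = (LINT (x, y)|LL. cden u v w z (y, x))"
    unfolding coul_def by (rule lebesgue2.integral_product_swap [symmetric]) measurable
  also have "\<dots> = coul w z u v"
    unfolding coul_def
    by (intro Bochner_Integration.integral_cong) (auto simp: cden_def norm_minus_commute mult_ac)
  finally show ?thesis .
qed

lemma coul_add3: "coul u v (w + w') z = coul u v w z + coul u v w' z"
  using coul_add4 [of u v z w w'] by (simp add: coul_comm34 [of u v _ z])

lemma coul_add1: "coul (u + u') v w z = coul u v w z + coul u' v w z"
  using coul_add3 [of w z u u' v] by (simp add: coul_swap [of _ v w z])

lemma coul_add2: "coul u (v + v') w z = coul u v w z + coul u v' w z"
  using coul_add1 [of v v' u w z] by (simp add: coul_comm12 [of u])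

lemma coul_scale4: "coul u v w (c *\<^sub>R z) = c * coul u v w z"
  using coul_scale [of 1 u 1 v 1 w c z] by simp

lemma coul_minus: "coul (- u) v w z = - coul u v w z" "coul u (- v) w z = - coul u v w z" "coul u v (- w) z = - coul u v w z"
  "coul u v w (- z) = - coul u v w z"
  using coul_scale [of "- 1" u 1 v 1 w 1 z] coul_scale [of 1 u "- 1" v 1 w 1 z]
    coul_scale [of 1 u 1 v "- 1" w 1 z] coul_scale [of 1 u 1 v 1 w "- 1" z] by simp_all

lemma coul_diff1: "coul (u - u') v w z = coul u v w z - coul u' v w z"
  and coul_diff2: "coul v (u - u') w z = coul v u w z - coul v u' w z"
  and coul_diff3: "coul v w (u - u') z = coul v w u z - coul v w u' z"
  using coul_add1 [of u "- u'" v w z] coul_add2 [of v u "- u'" w z] coul_add3 [of v w u "- u'" z]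
  by (simp_all add: coul_minus)

lemma coul_self_nonneg: "coul u u u u \<ge> 0"
  unfolding coul_def by (rule Bochner_Integration.integral_nonneg) (simp add: cden_def)

text \<open>The gradient of coul u u u u / (16 \<pi>); the four equal slots turn 16 into 4.\<close>

definition B :: "h1 \<Rightarrow> h1" where
  "B u = riesz (\<lambda>v. coul u u u v / (4 * pi))"

lemma B_inner: "B u \<bullet> v = coul u u u v / (4 * pi)"
  unfolding B_def
proof (rule riesz, rule bounded_linear_intro [of _ "4 * pot_const * norm u * norm u * norm u / (4 * pi)"])
  fix v
  show "norm (coul u u u v / (4 * pi)) \<le> norm v * (4 * pot_const * norm u * norm u * norm u / (4 * pi))"
    using divide_right_mono [OF coul_abs_le [of u u u v], of "4 * pi"] by (simp add: mult_ac)
qed (simp_all add: coul_add4 coul_scale4 add_divide_distrib)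

lemma B_self_nonneg: "B u \<bullet> u \<ge> 0"
  by (simp add: B_inner coul_self_nonneg)

lemma B_scale_self: "B (t *\<^sub>R u) \<bullet> (t *\<^sub>R u) = t ^ 4 * (B u \<bullet> u)"
  unfolding B_inner coul_scale by (simp add: power4_eq_xxxx mult_ac)

lemma B_minus: "B (- u) = - B u"
proof -
  have "\<forall>v. B (- u) \<bullet> v = - B u \<bullet> v" by (simp add: B_inner coul_minus)
  then show ?thesis by (simp only: vector_eq_rdot)
qed

lemma B_lipschitz:
  "norm (B u - B v) \<le> pot_const / pi * ((norm u)\<^sup>2 + norm u * norm v + (norm v)\<^sup>2) * norm (u - v)"
proof (rule norm_le_inner)
  fix z
  have "coul u u u z - coul v v v z = coul u u (u - v) z + coul u (u - v) v z + coul (u - v) v v z"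
    by (simp add: coul_diff1 coul_diff2 coul_diff3)
  also have "\<dots> \<le> 4 * pot_const * norm u * norm u * norm (u - v) * norm z + 4 * pot_const * norm u * norm (u - v) * norm v * norm z
      + 4 * pot_const * norm (u - v) * norm v * norm v * norm z"
    using coul_abs_le [of u u "u - v" z] coul_abs_le [of u "u - v" v z] coul_abs_le [of "u - v" v v z] by linarith
  also have "\<dots> = 4 * (pot_const * ((norm u)\<^sup>2 + norm u * norm v + (norm v)\<^sup>2) * norm (u - v) * norm z)"
    by (simp add: power2_eq_square algebra_simps)
  finally have "(coul u u u z - coul v v v z) / (4 * pi) \<le> 4 * (pot_const * ((norm u)\<^sup>2 + norm u * norm v + (norm v)\<^sup>2) * norm (u - v) * norm z) / (4 * pi)"
    by (intro divide_right_mono) auto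
  then show "(B u - B v) \<bullet> z \<le> pot_const / pi * ((norm u)\<^sup>2 + norm u * norm v + (norm v)\<^sup>2) * norm (u - v) * norm z"
    by (simp add: inner_diff_left B_inner diff_divide_distrib)
next
  show "pot_const / pi * ((norm u)\<^sup>2 + norm u * norm v + (norm v)\<^sup>2) * norm (u - v) \<ge> 0"
    using pot_const(1) by (intro mult_nonneg_nonneg add_nonneg_nonneg divide_nonneg_nonneg) auto
qed

text \<open>The quadrilinear form at u + d is expanded exactly. By symmetry the second order part is
  2 coul u u d d + 4 coul u d u d, whence the coefficient 6; the third order part has coefficient
  4.\<close>

lemma B_descent:
  "(B v \<bullet> v) / 4 \<le> (B u \<bullet> u) / 4 + B u \<bullet> (v - u)
     + pot_const / (4 * pi) * (6 * (norm u)\<^sup>2 + 4 * norm u * norm (v - u) + (norm (v - u))\<^sup>2) * (norm (v - u))\<^sup>2"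
proof -
  define d where "d = v - u"
  have v: "v = u + d" by (simp add: d_def)
  have "coul v v v v = coul u u u u + 4 * coul u u u d + (2 * coul u u d d + 4 * coul u d u d + 4 * coul u d d d + coul d d d d)"
    unfolding v coul_add1 coul_add2 coul_add3 coul_add4
    using coul_comm12 [of d u] coul_comm34 [of _ _ d u] coul_swap [of d d u u] coul_swap [of u d u u] coul_swap [of d d u d]
    by simp
  also have "2 * coul u u d d + 4 * coul u d u d + 4 * coul u d d d + coul d d d d
     \<le> 4 * pot_const * (6 * (norm u)\<^sup>2 + 4 * norm u * norm d + (norm d)\<^sup>2) * (norm d)\<^sup>2"
  proof -
    have "2 * coul u u d d + 4 * coul u d u d + 4 * coul u d d d + coul d d d d
      \<le> 2 * (4 * pot_const * norm u * norm u * norm d * norm d) + 4 * (4 * pot_const * norm u * norm d * norm u * norm d)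
        + 4 * (4 * pot_const * norm u * norm d * norm d * norm d) + 4 * pot_const * norm d * norm d * norm d * norm d"
      using coul_abs_le [of u u d d] coul_abs_le [of u d u d] coul_abs_le [of u d d d] coul_abs_le [of d d d d] by linarith
    also have "\<dots> = 4 * pot_const * (6 * (norm u)\<^sup>2 + 4 * norm u * norm d + (norm d)\<^sup>2) * (norm d)\<^sup>2"
      by (simp add: power2_eq_square algebra_simps)
    finally show ?thesis .
  qed
  finally have "coul v v v v / (16 * pi) \<le> (coul u u u u + 4 * coul u u u d + 4 * pot_const * (6 * (norm u)\<^sup>2 + 4 * norm u * norm d + (norm d)\<^sup>2) * (norm d)\<^sup>2) / (16 * pi)"
    by (intro divide_right_mono) auto
  then show ?thesis
    unfolding d_def [symmetric] by (simp add: B_inner add_divide_distrib mult.assoc mult.commute [of "(norm d)\<^sup>2"])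
qed

lemma coulomb_val:
  assumes "AE x in lebesgue. v x = val u x" "v \<in> borel_measurable lebesgue"
  shows "coulomb v = coul u u u u"
proof -
  have [measurable]: "(\<lambda>p. v (fst p)) \<in> borel_measurable LL" "(\<lambda>p. v (snd p)) \<in> borel_measurable LL"
    by (rule measurable_compose [OF measurable_fst assms(2)], rule measurable_compose [OF measurable_snd assms(2)])
  show ?thesis
    unfolding coulomb_def coul_def split_def
  proof (rule integral_cong_AE)
    show "AE p in LL. (v (fst p))\<^sup>2 * (v (snd p))\<^sup>2 / norm (fst p - snd p) = cden u u u u p"
      using AE_LL(1) [OF assms(1)] AE_LL(2) [OF assms(1)]
      by eventually_elim (simp add: cden_def power2_eq_square)
  qed measurable
qed

section \<open>Local compactness\<close>

text \<open>Half-open, so that the cubes of side l indexed by integer vectors partition the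
  space.\<close>

definition cube :: "real \<Rightarrow> int ^ 3 \<Rightarrow> R3 set" where
  "cube l z = {x. \<forall>i. l * of_int (z $ i) \<le> x $ i \<and> x $ i < l * (of_int (z $ i) + 1)}"

lemma cube_measurable [measurable]: "cube l z \<in> sets borel"
proof -
  have "cube l z = (\<Inter>i. {x. l * of_int (z $ i) \<le> x $ i} \<inter> {x. x $ i < l * (of_int (z $ i) + 1)})"
    by (auto simp: cube_def)
  also have "\<dots> \<in> sets borel"
  proof (intro sets.finite_INT)
    fix i :: 3
    have "closed {x::R3. l * of_int (z $ i) \<le> x $ i}" "open {x::R3. x $ i < l * (of_int (z $ i) + 1)}"
      by (intro closed_Collect_le open_Collect_less continuous_intros)+
    then show "{x::R3. l * of_int (z $ i) \<le> x $ i} \<inter> {x. x $ i < l * (of_int (z $ i) + 1)} \<in> sets borel"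
      by auto
  qed auto
  finally show ?thesis .
qed

lemma cube_measurable_lebesgue [measurable]: "cube l z \<in> sets lebesgue"
  by (simp add: sets_completionI_sets)

lemma emeasure_cube:
  assumes "l > 0"
  shows "emeasure lborel (cube l z) = ennreal (l ^ 3)"
proof (rule antisym)
  let ?a = "(\<chi> i. l * of_int (z $ i)) :: R3" and ?b = "(\<chi> i. l * (of_int (z $ i) + 1)) :: R3"
  have le: "?a $ i \<le> ?b $ i" for i using assms by (simp add: algebra_simps)
  have p: "(\<Prod>b\<in>Basis. (?b - ?a) \<bullet> b) = l ^ 3"
  proof -
    have "(\<Prod>b\<in>Basis. (?b - ?a) \<bullet> b) = (\<Prod>i\<in>UNIV. (?b - ?a) $ i)"
      unfolding Basis_vec_def by (subst prod.UNION_disjoint) (auto simp: inner_axis axis_eq_axis prod.reindex inj_on_def)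
    also have "\<dots> = (\<Prod>i\<in>(UNIV::3 set). l)" by (intro prod.cong) (auto simp: algebra_simps)
    finally show ?thesis by simp
  qed
  have lb: "?a \<bullet> b \<le> ?b \<bullet> b" if "b \<in> Basis" for b
    using that le unfolding Basis_vec_def by (auto simp: inner_axis)
  have "emeasure lborel (cube l z) \<le> emeasure lborel (cbox ?a ?b)"
    by (intro emeasure_mono) (auto simp: cube_def mem_box_cart less_imp_le)
  also have "\<dots> = ennreal (l ^ 3)" using lb p by (simp add: emeasure_lborel_cbox)
  finally show "emeasure lborel (cube l z) \<le> ennreal (l ^ 3)" .
  have "ennreal (l ^ 3) = emeasure lborel (box ?a ?b)" using lb p by (simp add: emeasure_lborel_box)
  also have "\<dots> \<le> emeasure lborel (cube l z)"
    by (intro emeasure_mono) (auto simp: cube_def mem_box_cart less_imp_le)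
  finally show "ennreal (l ^ 3) \<le> emeasure lborel (cube l z)" .
qed

lemma cube_unique:
  assumes "l > 0" "x \<in> cube l z" "x \<in> cube l z'"
  shows "z = z'"
proof -
  have "z $ i = z' $ i" for i
  proof -
    have "l * of_int (z $ i) < l * (of_int (z' $ i) + 1)" "l * of_int (z' $ i) < l * (of_int (z $ i) + 1)"
      using assms unfolding cube_def by (blast intro: le_less_trans)+
    then show ?thesis using assms(1) by simp
  qed
  then show ?thesis by (simp add: vec_eq_iff)
qed

lemma cube_floor:
  assumes "l > 0"
  shows "x \<in> cube l (\<chi> i. \<lfloor>x $ i / l\<rfloor>)"
proof -
  have "l * of_int \<lfloor>x $ i / l\<rfloor> \<le> x $ i" "x $ i < l * (of_int \<lfloor>x $ i / l\<rfloor> + 1)" for i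
  proof -
    have "real_of_int \<lfloor>x $ i / l\<rfloor> \<le> x $ i / l" "x $ i / l < real_of_int \<lfloor>x $ i / l\<rfloor> + 1" by linarith+
    then show "l * of_int \<lfloor>x $ i / l\<rfloor> \<le> x $ i" "x $ i < l * (of_int \<lfloor>x $ i / l\<rfloor> + 1)"
      unfolding pos_le_divide_eq [OF assms] pos_divide_less_eq [OF assms] by (simp_all only: mult.commute)
  qed
  then show ?thesis by (simp add: cube_def)
qed

lemma finite_int_vec_bounded: "finite {z :: int ^ 3. \<forall>i. \<bar>z $ i\<bar> \<le> n}"
proof -
  have "{z :: int ^ 3. \<forall>i. \<bar>z $ i\<bar> \<le> n} \<subseteq> vec_lambda ` (PiE UNIV (\<lambda>_. {- n..n}))"
  proof
    fix z :: "int ^ 3" assume "z \<in> {z. \<forall>i. \<bar>z $ i\<bar> \<le> n}"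
    then show "z \<in> vec_lambda ` (PiE UNIV (\<lambda>_. {- n..n}))"
      by (intro image_eqI [of _ _ "vec_nth z"]) (auto simp: abs_le_iff minus_le_iff)
  qed
  then show ?thesis by (rule finite_subset) (intro finite_imageI finite_PiE; simp)
qed

text \<open>At most one cube contains x; if it contains y too, every coordinate of y - x is at most
  l in absolute value.\<close>

lemma sum_indicator_cubes_le:
  assumes l: "l > 0" and Z: "finite Z"
  shows "(\<Sum>z\<in>Z. indicator (cube l z) x * indicator (cube l z) y :: ennreal) \<le> indicator (cbox (\<chi> i. - l) (\<chi> i. l)) (y - x)"
proof (cases "\<exists>z\<in>Z. x \<in> cube l z \<and> y \<in> cube l z")
  case True
  then obtain z where z: "z \<in> Z" "x \<in> cube l z" "y \<in> cube l z" by blast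
  have "(\<Sum>z'\<in>Z - {z}. indicator (cube l z') x * indicator (cube l z') y :: ennreal) = 0"
    using cube_unique [OF l z(2)] by (intro sum.neutral) (auto simp: indicator_def)
  then have "(\<Sum>z\<in>Z. indicator (cube l z) x * indicator (cube l z) y :: ennreal) = indicator (cube l z) x * indicator (cube l z) y"
    using Z z(1) by (subst sum.remove [of _ z]) auto
  moreover have "- l \<le> y $ i - x $ i \<and> y $ i - x $ i \<le> l" for i
  proof -
    have "l * of_int (z $ i) \<le> x $ i" "x $ i < l * (of_int (z $ i) + 1)"
      "l * of_int (z $ i) \<le> y $ i" "y $ i < l * (of_int (z $ i) + 1)"
      using z by (auto simp: cube_def)
    then show ?thesis by (simp add: distrib_left)
  qed
  then have "y - x \<in> cbox (\<chi> i. - l) (\<chi> i. l)" by (auto simp: mem_box_cart)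
  ultimately show ?thesis using z by simp
next
  case False
  then have "(\<Sum>z\<in>Z. indicator (cube l z) x * indicator (cube l z) y :: ennreal) = 0"
    by (intro sum.neutral) (auto simp: indicator_def)
  then show ?thesis by simp
qed

text \<open>Pairs in a common cube are rewritten as (x, x + h) with h in the cube of side 2l, and
  \<open>translation_C1c\<close> applies for each h. The constant is the volume (2l)^3 times the
  bound 3 l^2 for the squared norm of h.\<close>

lemma cube_double_integral:
  assumes f: "C1c f" and l: "l > 0" and Z: "finite Z"
  shows "(\<Sum>z\<in>Z. \<integral>\<^sup>+x. \<integral>\<^sup>+y. indicator (cube l z) x * indicator (cube l z) y * ennreal ((f y - f x)\<^sup>2) \<partial>lborel \<partial>lborel)
    \<le> ennreal (24 * l ^ 5) * (\<integral>\<^sup>+x. ennreal ((norm (grad f x))\<^sup>2) \<partial>lborel)"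
proof -
  let ?C = "cbox (\<chi> i. - l) (\<chi> i. l) :: R3 set"
  have [measurable]: "f \<in> borel_measurable borel"
    by (intro borel_measurable_continuous_onI C1c_continuous f)
  have "(\<Sum>z\<in>Z. \<integral>\<^sup>+x. \<integral>\<^sup>+y. indicator (cube l z) x * indicator (cube l z) y * ennreal ((f y - f x)\<^sup>2) \<partial>lborel \<partial>lborel)
      = (\<integral>\<^sup>+x. \<integral>\<^sup>+y. (\<Sum>z\<in>Z. indicator (cube l z) x * indicator (cube l z) y) * ennreal ((f y - f x)\<^sup>2) \<partial>lborel \<partial>lborel)"
  proof -
    have "(\<Sum>z\<in>Z. \<integral>\<^sup>+x. \<integral>\<^sup>+y. indicator (cube l z) x * indicator (cube l z) y * ennreal ((f y - f x)\<^sup>2) \<partial>lborel \<partial>lborel)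
        = (\<integral>\<^sup>+x. (\<Sum>z\<in>Z. \<integral>\<^sup>+y. indicator (cube l z) x * indicator (cube l z) y * ennreal ((f y - f x)\<^sup>2) \<partial>lborel) \<partial>lborel)"
      by (rule nn_integral_sum [symmetric]) measurable
    also have "\<dots> = (\<integral>\<^sup>+x. \<integral>\<^sup>+y. (\<Sum>z\<in>Z. indicator (cube l z) x * indicator (cube l z) y * ennreal ((f y - f x)\<^sup>2)) \<partial>lborel \<partial>lborel)"
      by (rule nn_integral_cong, rule nn_integral_sum [symmetric]) measurable
    finally show ?thesis by (simp only: sum_distrib_right)
  qed
  also have "\<dots> \<le> (\<integral>\<^sup>+x. \<integral>\<^sup>+y. indicator ?C (y - x) * ennreal ((f y - f x)\<^sup>2) \<partial>lborel \<partial>lborel)"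
    by (intro nn_integral_mono mult_right_mono sum_indicator_cubes_le l Z) auto
  also have "\<dots> = (\<integral>\<^sup>+x. \<integral>\<^sup>+h. indicator ?C h * ennreal ((f (x + h) - f x)\<^sup>2) \<partial>lborel \<partial>lborel)"
  proof (rule nn_integral_cong)
    fix x
    have "(\<integral>\<^sup>+y. indicator ?C (y - x) * ennreal ((f y - f x)\<^sup>2) \<partial>lborel)
        = (\<integral>\<^sup>+y. indicator ?C (y - x) * ennreal ((f y - f x)\<^sup>2) \<partial>distr lborel borel ((+) x))"
      by (simp add: lborel_distr_plus)
    also have "\<dots> = (\<integral>\<^sup>+h. indicator ?C h * ennreal ((f (x + h) - f x)\<^sup>2) \<partial>lborel)"
      by (subst nn_integral_distr) auto
    finally show "(\<integral>\<^sup>+y. indicator ?C (y - x) * ennreal ((f y - f x)\<^sup>2) \<partial>lborel)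
        = (\<integral>\<^sup>+h. indicator ?C h * ennreal ((f (x + h) - f x)\<^sup>2) \<partial>lborel)" .
  qed
  also have "\<dots> = (\<integral>\<^sup>+h. \<integral>\<^sup>+x. indicator ?C h * ennreal ((f (x + h) - f x)\<^sup>2) \<partial>lborel \<partial>lborel)"
    by (rule lborel_pair.Fubini' [symmetric]) measurable
  also have "\<dots> \<le> (\<integral>\<^sup>+h. indicator ?C h * (ennreal (3 * l\<^sup>2) * (\<integral>\<^sup>+x. ennreal ((norm (grad f x))\<^sup>2) \<partial>lborel)) \<partial>lborel)"
  proof (intro nn_integral_mono)
    fix h :: R3
    show "(\<integral>\<^sup>+x. indicator ?C h * ennreal ((f (x + h) - f x)\<^sup>2) \<partial>lborel)
        \<le> indicator ?C h * (ennreal (3 * l\<^sup>2) * (\<integral>\<^sup>+x. ennreal ((norm (grad f x))\<^sup>2) \<partial>lborel))"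
    proof (cases "h \<in> ?C")
      case True
      then have "\<bar>h $ i\<bar> \<le> l" for i by (auto simp: mem_box_cart abs_le_iff minus_le_iff)
      then have "(h $ i)\<^sup>2 \<le> l\<^sup>2" for i using power_mono [of "\<bar>h $ i\<bar>" l 2] by simp
      then have "(\<Sum>i\<in>UNIV. (h $ i)\<^sup>2) \<le> (\<Sum>i\<in>(UNIV::3 set). l\<^sup>2)" by (intro sum_mono)
      then have "(norm h)\<^sup>2 \<le> 3 * l\<^sup>2"
        by (simp add: norm_vec_def L2_set_def sum_nonneg)
      then have "ennreal ((norm h)\<^sup>2) * (\<integral>\<^sup>+x. ennreal ((norm (grad f x))\<^sup>2) \<partial>lborel) \<le> ennreal (3 * l\<^sup>2) * (\<integral>\<^sup>+x. ennreal ((norm (grad f x))\<^sup>2) \<partial>lborel)"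
        by (intro mult_right_mono ennreal_leI) auto
      then show ?thesis using True order.trans [OF translation_C1c [OF f, of h]] by simp
    qed simp
  qed
  also have "\<dots> = emeasure lborel ?C * (ennreal (3 * l\<^sup>2) * (\<integral>\<^sup>+x. ennreal ((norm (grad f x))\<^sup>2) \<partial>lborel))"
    by (subst nn_integral_multc) auto
  also have "emeasure lborel ?C = ennreal ((2 * l) ^ 3)"
  proof -
    have "(\<Prod>b\<in>Basis. ((\<chi> i. l) - (\<chi> i. - l) :: R3) \<bullet> b) = (\<Prod>i\<in>UNIV. ((\<chi> i. l) - (\<chi> i. - l) :: R3) $ i)"
      unfolding Basis_vec_def by (subst prod.UNION_disjoint) (auto simp: inner_axis axis_eq_axis prod.reindex inj_on_def)
    also have "\<dots> = (2 * l) ^ 3" by simp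
    finally have "(\<Prod>b\<in>Basis. ((\<chi> i. l) - (\<chi> i. - l) :: R3) \<bullet> b) = (2 * l) ^ 3" .
    moreover have "(\<chi> i. - l) \<bullet> b \<le> (\<chi> i. l) \<bullet> (b::R3)" if "b \<in> Basis" for b
      using that l unfolding Basis_vec_def by (auto simp: inner_axis)
    ultimately show ?thesis by (simp add: emeasure_lborel_cbox)
  qed
  also have "ennreal ((2 * l) ^ 3) * (ennreal (3 * l\<^sup>2) * (\<integral>\<^sup>+x. ennreal ((norm (grad f x))\<^sup>2) \<partial>lborel))
      = ennreal (24 * l ^ 5) * (\<integral>\<^sup>+x. ennreal ((norm (grad f x))\<^sup>2) \<partial>lborel)"
  proof -
    have "ennreal ((2 * l) ^ 3) * ennreal (3 * l\<^sup>2) = ennreal ((2 * l) ^ 3 * (3 * l\<^sup>2))"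
      using l by (intro ennreal_mult [symmetric]) auto
    also have "(2 * l) ^ 3 * (3 * l\<^sup>2) = 24 * l ^ 5"
      by (simp add: power_mult_distrib flip: power_add)
    finally show ?thesis by (simp add: mult.assoc [symmetric])
  qed
  finally show ?thesis .
qed

text \<open>The variance identity: the mean square equals the squared mean plus half the mean of the
  squared differences. Together with \<open>cube_double_integral\<close> it plays the part of the
  Poincare inequality on cubes.\<close>

lemma cube_variance:
  assumes f: "C1c f" and l: "l > 0"
  shows "(LINT x|lborel. indicator (cube l z) x * (f x)\<^sup>2)
    = 1 / l ^ 3 * (LINT x|lborel. indicator (cube l z) x * f x)\<^sup>2
      + 1 / (2 * l ^ 3) * enn2real (\<integral>\<^sup>+x. \<integral>\<^sup>+y. indicator (cube l z) x * indicator (cube l z) y * ennreal ((f y - f x)\<^sup>2) \<partial>lborel \<partial>lborel)"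
proof -
  let ?I = "indicator (cube l z) :: R3 \<Rightarrow> real"
  define a b where "a = (LINT x|lborel. ?I x * (f x)\<^sup>2)" "b = (LINT x|lborel. ?I x * f x)"
  have [measurable]: "f \<in> borel_measurable borel"
    by (intro borel_measurable_continuous_onI C1c_continuous f)
  have c: "continuous_on UNIV f" "bounded {x. f x \<noteq> 0}" using f by (auto simp: C1c_def intro: C1c_continuous)
  have int1: "integrable lborel (\<lambda>x. f x)"
    using c by (rule integrable_bounded_support)
  have int2: "integrable lborel (\<lambda>x. (f x)\<^sup>2)"
    using c by (intro integrable_bounded_support) (auto intro!: continuous_intros)
  have i0: "integrable lborel ?I" using emeasure_cube [OF l, of z] by (simp add: less_top [symmetric])
  have i1: "integrable lborel (\<lambda>x. ?I x * f x)"
    by (rule Bochner_Integration.integrable_bound [OF int1]) (auto simp: indicator_def)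
  have i2: "integrable lborel (\<lambda>x. ?I x * (f x)\<^sup>2)"
    by (rule Bochner_Integration.integrable_bound [OF int2]) (auto simp: indicator_def)
  have m: "measure lborel (cube l z) = l ^ 3" using emeasure_cube [OF l, of z] l by (simp add: measure_def)
  have inner: "(\<integral>\<^sup>+y. indicator (cube l z) x * indicator (cube l z) y * ennreal ((f y - f x)\<^sup>2) \<partial>lborel)
      = indicator (cube l z) x * ennreal (a - 2 * f x * b + (f x)\<^sup>2 * l ^ 3)" for x
  proof -
    have eq: "?I y * (f y - f x)\<^sup>2 = ?I y * (f y)\<^sup>2 - 2 * f x * (?I y * f y) + (f x)\<^sup>2 * ?I y" for y
      by (simp add: power2_eq_square algebra_simps)
    have "(\<integral>\<^sup>+y. ennreal (?I y * (f y - f x)\<^sup>2) \<partial>lborel) = ennreal (LINT y|lborel. ?I y * (f y - f x)\<^sup>2)"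
    proof (rule nn_integral_eq_integral)
      show "integrable lborel (\<lambda>y. ?I y * (f y - f x)\<^sup>2)" unfolding eq using i0 i1 i2 by simp
    qed simp
    also have "(LINT y|lborel. ?I y * (f y - f x)\<^sup>2) = a - 2 * f x * b + (f x)\<^sup>2 * l ^ 3"
      unfolding eq using i0 i1 i2 by (simp add: a_b_def m)
    finally show ?thesis
      by (simp add: nn_integral_cmult mult.assoc ennreal_mult' indicator_mult_ennreal)
  qed
  have nonneg: "a - 2 * f x * b + (f x)\<^sup>2 * l ^ 3 \<ge> 0" for x
  proof -
    have eq: "?I y * (f y - f x)\<^sup>2 = ?I y * (f y)\<^sup>2 - 2 * f x * (?I y * f y) + (f x)\<^sup>2 * ?I y" for y
      by (simp add: power2_eq_square algebra_simps)
    have "0 \<le> (LINT y|lborel. ?I y * (f y - f x)\<^sup>2)" by simp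
    also have "\<dots> = a - 2 * f x * b + (f x)\<^sup>2 * l ^ 3"
      unfolding eq using i0 i1 i2 by (simp add: a_b_def m)
    finally show ?thesis .
  qed
  have eq: "?I x * (a - 2 * f x * b + (f x)\<^sup>2 * l ^ 3) = a * ?I x - 2 * b * (?I x * f x) + l ^ 3 * (?I x * (f x)\<^sup>2)" for x
    by (simp add: algebra_simps)
  have "(\<integral>\<^sup>+x. \<integral>\<^sup>+y. indicator (cube l z) x * indicator (cube l z) y * ennreal ((f y - f x)\<^sup>2) \<partial>lborel \<partial>lborel)
      = (\<integral>\<^sup>+x. ennreal (?I x * (a - 2 * f x * b + (f x)\<^sup>2 * l ^ 3)) \<partial>lborel)"
    unfolding inner by (simp add: indicator_mult_ennreal)
  also have "\<dots> = ennreal (LINT x|lborel. ?I x * (a - 2 * f x * b + (f x)\<^sup>2 * l ^ 3))"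
  proof (rule nn_integral_eq_integral)
    show "integrable lborel (\<lambda>x. ?I x * (a - 2 * f x * b + (f x)\<^sup>2 * l ^ 3))" unfolding eq using i0 i1 i2 by simp
    show "AE x in lborel. 0 \<le> ?I x * (a - 2 * f x * b + (f x)\<^sup>2 * l ^ 3)" using nonneg by simp
  qed
  also have "(LINT x|lborel. ?I x * (a - 2 * f x * b + (f x)\<^sup>2 * l ^ 3)) = 2 * l ^ 3 * a - 2 * b\<^sup>2"
    unfolding eq using i0 i1 i2 by (simp add: a_b_def m power2_eq_square)
  finally have *: "(\<integral>\<^sup>+x. \<integral>\<^sup>+y. indicator (cube l z) x * indicator (cube l z) y * ennreal ((f y - f x)\<^sup>2) \<partial>lborel \<partial>lborel)
      = ennreal (2 * l ^ 3 * a - 2 * b\<^sup>2)" .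
  have "0 \<le> (LINT x|lborel. ?I x * (a - 2 * f x * b + (f x)\<^sup>2 * l ^ 3))"
    using nonneg by (intro Bochner_Integration.integral_nonneg) simp
  also have "\<dots> = 2 * l ^ 3 * a - 2 * b\<^sup>2"
    unfolding eq using i0 i1 i2 by (simp add: a_b_def m power2_eq_square)
  finally show ?thesis unfolding * a_b_def [symmetric] using l by (simp add: field_simps)
qed

lemma integrable_indicator_square:
  assumes "S \<in> sets borel"
  shows "integrable lebesgue (\<lambda>x. indicator S x * (val u x)\<^sup>2)"
proof (rule Bochner_Integration.integrable_bound [OF integrable_val_square [of u]])
  have [measurable]: "S \<in> sets lebesgue" using assms by (simp add: sets_completionI_sets)
  show "(\<lambda>x. indicator S x * (val u x)\<^sup>2) \<in> borel_measurable lebesgue" by measurable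
qed (auto simp: indicator_def)

text \<open>The variance identity summed over disjoint cubes: up to an error of order l^2, the L2
  norm on a finite union of cubes is seen by the finitely many cube integrals. The factor 12 l^2 is
  24 l^5 divided by 2 l^3.\<close>

lemma local_estimate_test:
  assumes \<phi>: "\<phi> \<in> test_functions" and l: "l > 0" and Z: "finite Z"
  shows "(LINT x|lebesgue. indicator (\<Union>z\<in>Z. cube l z) x * (val (emb \<phi>) x)\<^sup>2)
    \<le> 1 / l ^ 3 * (\<Sum>z\<in>Z. (LINT x|lebesgue. indicator (cube l z) x * val (emb \<phi>) x)\<^sup>2) + 12 * l\<^sup>2 * (norm (emb \<phi>))\<^sup>2"
proof -
  let ?J = "\<lambda>z. \<integral>\<^sup>+x. \<integral>\<^sup>+y. indicator (cube l z) x * indicator (cube l z) y * ennreal ((\<phi> y - \<phi> x)\<^sup>2) \<partial>lborel \<partial>lborel"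
  let ?G = "LINT x|lborel. (norm (grad \<phi> x))\<^sup>2"
  have f: "C1c \<phi>" by (rule C1c_test [OF \<phi>])
  have c: "continuous_on UNIV \<phi>" "bounded {x. \<phi> x \<noteq> 0}" using f by (auto simp: C1c_def intro: C1c_continuous)
  have [measurable]: "\<phi> \<in> borel_measurable borel"
    by (intro borel_measurable_continuous_onI c)
  then have [measurable]: "\<phi> \<in> borel_measurable lebesgue" by (intro measurable_completion) simp
  have intg: "integrable lborel (\<lambda>x. (norm (grad \<phi> x))\<^sup>2)" "integrable lebesgue (\<lambda>x. (norm (grad \<phi> x))\<^sup>2)"
    using continuous_grad [OF f] bounded_support_grad [OF f] by (intro integrable_bounded_support; auto intro!: continuous_intros)+
  have G0: "?G \<ge> 0" by simp
  have G: "?G \<le> (norm (emb \<phi>))\<^sup>2"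
  proof -
    have "?G = (LINT x|lebesgue. (norm (grad \<phi> x))\<^sup>2)"
      using continuous_grad [OF f] by (intro integral_completion [symmetric]) (auto intro!: borel_measurable_continuous_onI continuous_intros)
    also have "\<dots> = (LINT x|lebesgue. (norm (gr (emb \<phi>) x))\<^sup>2)"
      using gr_emb [OF \<phi>] intg by (intro integral_cong_AE) (auto elim!: eventually_mono)
    also have "\<dots> \<le> (norm (emb \<phi>))\<^sup>2" unfolding norm_h1_eq by simp
    finally show ?thesis .
  qed
  have J: "(\<Sum>z\<in>Z. ?J z) \<le> ennreal (24 * l ^ 5 * ?G)"
  proof -
    have "(\<integral>\<^sup>+x. ennreal ((norm (grad \<phi> x))\<^sup>2) \<partial>lborel) = ennreal ?G"
      by (rule nn_integral_eq_integral [OF intg(1)]) simp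
    then show ?thesis using cube_double_integral [OF f l Z] l by (simp add: ennreal_mult)
  qed
  then have fin: "(\<Sum>z\<in>Z. ?J z) < top" by (rule le_less_trans) simp
  have "?J z < top" if "z \<in> Z" for z
    by (rule le_less_trans [OF member_le_sum fin]) (use that Z in auto)
  then have "(\<Sum>z\<in>Z. enn2real (?J z)) = enn2real (\<Sum>z\<in>Z. ?J z)"
    using enn2real_sum [of Z ?J] by (simp add: comp_def)
  also have "\<dots> \<le> 24 * l ^ 5 * ?G" using J G0 l by (intro enn2real_leI) auto
  finally have J': "(\<Sum>z\<in>Z. enn2real (?J z)) \<le> 24 * l ^ 5 * ?G" .
  have sq: "(LINT x|lebesgue. indicator (cube l z) x * (val (emb \<phi>) x)\<^sup>2) = (LINT x|lborel. indicator (cube l z) x * (\<phi> x)\<^sup>2)" for z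
  proof -
    have "(LINT x|lebesgue. indicator (cube l z) x * (val (emb \<phi>) x)\<^sup>2) = (LINT x|lebesgue. indicator (cube l z) x * (\<phi> x)\<^sup>2)"
      using val_emb [OF \<phi>] by (intro integral_cong_AE) (auto elim!: eventually_mono)
    then show ?thesis by (simp add: integral_completion)
  qed
  have li: "(LINT x|lebesgue. indicator (cube l z) x * val (emb \<phi>) x) = (LINT x|lborel. indicator (cube l z) x * \<phi> x)" for z
  proof -
    have "(LINT x|lebesgue. indicator (cube l z) x * val (emb \<phi>) x) = (LINT x|lebesgue. indicator (cube l z) x * \<phi> x)"
      using val_emb [OF \<phi>] by (intro integral_cong_AE) (auto elim!: eventually_mono)
    then show ?thesis by (simp add: integral_completion)
  qed
  have "(LINT x|lebesgue. indicator (\<Union>z\<in>Z. cube l z) x * (val (emb \<phi>) x)\<^sup>2) = (LINT x|lebesgue. (\<Sum>z\<in>Z. indicator (cube l z) x * (val (emb \<phi>) x)\<^sup>2))"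
  proof (intro Bochner_Integration.integral_cong refl)
    fix x
    have "disjoint_family_on (cube l) Z"
      unfolding disjoint_family_on_def using cube_unique [OF l] by blast
    then show "indicator (\<Union>z\<in>Z. cube l z) x * (val (emb \<phi>) x)\<^sup>2 = (\<Sum>z\<in>Z. indicator (cube l z) x * (val (emb \<phi>) x)\<^sup>2)"
      by (simp add: indicator_UN_disjoint [OF Z] sum_distrib_right)
  qed
  also have "\<dots> = (\<Sum>z\<in>Z. (LINT x|lborel. indicator (cube l z) x * (\<phi> x)\<^sup>2))"
    by (subst Bochner_Integration.integral_sum) (auto intro!: integrable_indicator_square simp: sq)
  also have "\<dots> = 1 / l ^ 3 * (\<Sum>z\<in>Z. (LINT x|lborel. indicator (cube l z) x * \<phi> x)\<^sup>2) + 1 / (2 * l ^ 3) * (\<Sum>z\<in>Z. enn2real (?J z))"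
    unfolding cube_variance [OF f l] by (simp add: sum.distrib sum_distrib_left)
  also have "1 / (2 * l ^ 3) * (\<Sum>z\<in>Z. enn2real (?J z)) \<le> 1 / (2 * l ^ 3) * (24 * l ^ 5 * ?G)"
    using J' l by (intro mult_left_mono) auto
  also have "\<dots> = 12 * l\<^sup>2 * ?G" using l by (simp add: field_simps eval_nat_numeral)
  also have "\<dots> \<le> 12 * l\<^sup>2 * (norm (emb \<phi>))\<^sup>2" using G by (intro mult_left_mono) auto
  finally show ?thesis unfolding li by simp
qed

text \<open>Cauchy--Schwarz with the indicator of the cube, whose L2 norm is the root of l^3.
  Boundedness lets Riesz representation write cube integrals as inner products.\<close>

lemma bounded_linear_cube_integral:
  assumes l: "l > 0"
  shows "bounded_linear (\<lambda>u. LINT x|lebesgue. indicator (cube l z) x * val u x)"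
proof (rule bounded_linear_intro [of _ "sqrt (l ^ 3)"])
  have m: "(LINT x|lebesgue. (norm (indicator (cube l z) x :: real))\<^sup>2) = l ^ 3"
  proof -
    have "(LINT x|lebesgue. (norm (indicator (cube l z) x :: real))\<^sup>2) = (LINT x|lebesgue. indicator (cube l z) x)"
      by (intro Bochner_Integration.integral_cong) (auto simp: indicator_def)
    also have "\<dots> = l ^ 3" using emeasure_cube [OF l, of z] l by (simp add: measure_def)
    finally show ?thesis .
  qed
  have s: "square_integrable (indicator (cube l z) :: R3 \<Rightarrow> real)"
  proof -
    have "integrable lebesgue (indicator (cube l z) :: R3 \<Rightarrow> real)"
      using emeasure_cube [OF l, of z] by (simp add: less_top [symmetric])
    then have "integrable lebesgue (\<lambda>x. (norm (indicator (cube l z) x :: real))\<^sup>2)"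
      by (rule back_subst [of "integrable lebesgue"]) (auto simp: indicator_def)
    moreover have "(indicator (cube l z) :: R3 \<Rightarrow> real) \<in> borel_measurable lebesgue"
      by (rule borel_measurable_indicator) (simp add: sets_completionI_sets)
    ultimately show ?thesis by (simp add: square_integrable_def)
  qed
  have int: "integrable lebesgue (\<lambda>x. indicator (cube l z) x * val u x)" for u
    using square_integrable_inner [OF s square_integrable_val] by simp
  fix u v :: h1 and c :: real
  have "(LINT x|lebesgue. indicator (cube l z) x * val (u + v) x) = (LINT x|lebesgue. indicator (cube l z) x * val u x + indicator (cube l z) x * val v x)"
    using val_add [of u v] by (intro integral_cong_AE) (auto elim!: eventually_mono simp: distrib_left)
  then show "(LINT x|lebesgue. indicator (cube l z) x * val (u + v) x) = (LINT x|lebesgue. indicator (cube l z) x * val u x) + (LINT x|lebesgue. indicator (cube l z) x * val v x)"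
    using int by simp
  have "(LINT x|lebesgue. indicator (cube l z) x * val (c *\<^sub>R u) x) = (LINT x|lebesgue. c * (indicator (cube l z) x * val u x))"
    using val_scaleR [of c u] by (intro integral_cong_AE) (auto elim!: eventually_mono)
  then show "(LINT x|lebesgue. indicator (cube l z) x * val (c *\<^sub>R u) x) = c *\<^sub>R (LINT x|lebesgue. indicator (cube l z) x * val u x)"
    by simp
  have "(LINT x|lebesgue. indicator (cube l z) x * val u x)\<^sup>2 \<le> l ^ 3 * (LINT x|lebesgue. (val u x)\<^sup>2)"
    using Cauchy_Schwarz_L2 [OF s square_integrable_val [of u]] by (simp add: m [unfolded real_norm_def power2_abs])
  also have "\<dots> \<le> l ^ 3 * (norm u)\<^sup>2" using integral_val_square_le [of u] l by (intro mult_left_mono) auto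
  also have "\<dots> = (norm u * sqrt (l ^ 3))\<^sup>2" using l by (simp add: power_mult_distrib)
  finally show "norm (LINT x|lebesgue. indicator (cube l z) x * val u x) \<le> norm u * sqrt (l ^ 3)"
    unfolding real_norm_def using l by (subst (asm) abs_le_square_iff [symmetric]) simp
qed

text \<open>A quantitative Rellich theorem. Small cubes make the oscillation part small, and
  finitely many of them cover the ball.\<close>

lemma local_estimate:
  assumes e: "e > 0"
  shows "\<exists>Z (y :: int ^ 3 \<Rightarrow> h1) C. finite Z \<and> C \<ge> 0 \<and>
    (\<forall>u. (LINT x|lebesgue. indicator (cball 0 R) x * (val u x)\<^sup>2) \<le> e * (norm u)\<^sup>2 + C * (\<Sum>z\<in>Z. (y z \<bullet> u)\<^sup>2))"
proof -
  \<comment> \<open>Gives 24 l^2 = e. The 12 l^2 of the estimate for test functions is doubled when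
    u is replaced by an approximating test function.\<close>
  define l where "l = sqrt (e / 24)"
  have l: "l > 0" "24 * l\<^sup>2 = e" using e by (auto simp: l_def)
  define Z :: "(int ^ 3) set" where "Z = {z. \<forall>i. \<bar>z $ i\<bar> \<le> \<lceil>R / l\<rceil> + 1}"
  have Z: "finite Z" unfolding Z_def by (rule finite_int_vec_bounded)
  define S where "S = (\<Union>z\<in>Z. cube l z)"
  have S [measurable]: "S \<in> sets borel" unfolding S_def using Z by (intro sets.finite_UN) auto
  have sub: "cball 0 R \<subseteq> S"
  proof
    fix x :: R3 assume x: "x \<in> cball 0 R"
    have "\<bar>\<lfloor>x $ i / l\<rfloor>\<bar> \<le> \<lceil>R / l\<rceil> + 1" for i
    proof -
      have "\<bar>x $ i\<bar> \<le> R" using x component_le_norm_cart [of x i] by simp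
      then have "\<bar>x $ i / l\<bar> \<le> R / l" using l by (simp add: abs_div divide_right_mono)
      then show ?thesis by linarith
    qed
    then have "(\<chi> i. \<lfloor>x $ i / l\<rfloor>) \<in> Z" by (simp add: Z_def)
    then show "x \<in> S" unfolding S_def using cube_floor [OF l(1), of x] by blast
  qed
  define y where "y z = riesz (\<lambda>u. LINT x|lebesgue. indicator (cube l z) x * val u x)" for z
  have y: "(LINT x|lebesgue. indicator (cube l z) x * val u x) = y z \<bullet> u" for z u
    unfolding y_def by (rule riesz [OF bounded_linear_cube_integral [OF l(1)], symmetric])
  have "(LINT x|lebesgue. indicator (cball 0 R) x * (val u x)\<^sup>2) \<le> e * (norm u)\<^sup>2 + 2 / l ^ 3 * (\<Sum>z\<in>Z. (y z \<bullet> u)\<^sup>2)" for u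
  proof -
    obtain \<phi> where \<phi>: "\<And>n::nat. \<phi> n \<in> test_functions" "(\<lambda>n. emb (\<phi> n)) \<longlonglongrightarrow> u"
      by (rule emb_sequence [of u], rule that)
    have "(LINT x|lebesgue. indicator (cball 0 R) x * (val u x)\<^sup>2) \<le> (LINT x|lebesgue. indicator S x * (val u x)\<^sup>2)"
      using sub by (intro integral_mono integrable_indicator_square S) (auto simp: indicator_def)
    \<comment> \<open>The vanishing first term is written out because it is the limit of the
      approximation error.\<close>
    also have "\<dots> \<le> 2 * (norm (u - u))\<^sup>2 + (2 / l ^ 3 * (\<Sum>z\<in>Z. (y z \<bullet> u)\<^sup>2) + 24 * l\<^sup>2 * (norm u)\<^sup>2)"
    proof (rule LIMSEQ_le_const)
      show "(\<lambda>n. 2 * (norm (u - emb (\<phi> n)))\<^sup>2 + (2 / l ^ 3 * (\<Sum>z\<in>Z. (y z \<bullet> emb (\<phi> n))\<^sup>2) + 24 * l\<^sup>2 * (norm (emb (\<phi> n)))\<^sup>2))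
        \<longlonglongrightarrow> 2 * (norm (u - u))\<^sup>2 + (2 / l ^ 3 * (\<Sum>z\<in>Z. (y z \<bullet> u)\<^sup>2) + 24 * l\<^sup>2 * (norm u)\<^sup>2)"
        by (intro tendsto_intros \<phi>(2))
      show "\<exists>N. \<forall>n\<ge>N. (LINT x|lebesgue. indicator S x * (val u x)\<^sup>2)
        \<le> 2 * (norm (u - emb (\<phi> n)))\<^sup>2 + (2 / l ^ 3 * (\<Sum>z\<in>Z. (y z \<bullet> emb (\<phi> n))\<^sup>2) + 24 * l\<^sup>2 * (norm (emb (\<phi> n)))\<^sup>2)"
      proof (intro exI allI impI)
        fix n :: nat
        let ?w = "emb (\<phi> n)"
        have "(LINT x|lebesgue. indicator S x * (val u x)\<^sup>2) \<le> (LINT x|lebesgue. 2 * (val (u - ?w) x)\<^sup>2 + 2 * (indicator S x * (val ?w x)\<^sup>2))"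
        proof (rule integral_mono_AE)
          show "AE x in lebesgue. indicator S x * (val u x)\<^sup>2 \<le> 2 * (val (u - ?w) x)\<^sup>2 + 2 * (indicator S x * (val ?w x)\<^sup>2)"
            using val_diff [of u ?w]
          proof eventually_elim
            case (elim x)
            have "(val u x)\<^sup>2 \<le> 2 * (val u x - val ?w x)\<^sup>2 + 2 * (val ?w x)\<^sup>2"
              using zero_le_power2 [of "val u x - 2 * val ?w x"] by (simp add: power2_eq_square algebra_simps)
            then show ?case unfolding elim by (auto simp: indicator_def)
          qed
        qed (intro Bochner_Integration.integrable_add integrable_mult_right integrable_indicator_square integrable_val_square S)+
        also have "\<dots> = 2 * (LINT x|lebesgue. (val (u - ?w) x)\<^sup>2) + 2 * (LINT x|lebesgue. indicator S x * (val ?w x)\<^sup>2)"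
          by (simp add: integrable_val_square integrable_indicator_square S)
        also have "\<dots> \<le> 2 * (norm (u - ?w))\<^sup>2 + 2 * (1 / l ^ 3 * (\<Sum>z\<in>Z. (y z \<bullet> ?w)\<^sup>2) + 12 * l\<^sup>2 * (norm ?w)\<^sup>2)"
          using integral_val_square_le [of "u - ?w"] local_estimate_test [OF \<phi>(1) l(1) Z, of n]
          unfolding S_def y by (intro add_mono mult_left_mono) simp_all
        finally show "(LINT x|lebesgue. indicator S x * (val u x)\<^sup>2)
          \<le> 2 * (norm (u - ?w))\<^sup>2 + (2 / l ^ 3 * (\<Sum>z\<in>Z. (y z \<bullet> ?w)\<^sup>2) + 24 * l\<^sup>2 * (norm ?w)\<^sup>2)"
          by simp
      qed
    qed
    finally show ?thesis by (simp add: l)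
  qed
  moreover have "2 / l ^ 3 \<ge> 0" using l by simp
  ultimately show ?thesis using Z by blast
qed

text \<open>Integer radii and errors 1/(k+1) involve only countably many functionals. Their
  normalised values on X n form a point of a countable power of [-1, 1], whose sequential
  compactness does the work of a diagonal argument.\<close>

lemma local_Cauchy_subsequence:
  fixes X :: "nat \<Rightarrow> h1"
  assumes X: "\<And>n. norm (X n) \<le> 1"
  obtains k where "strict_mono (k :: nat \<Rightarrow> nat)"
    "\<And>R e. e > 0 \<Longrightarrow> \<exists>N. \<forall>m\<ge>N. \<forall>n\<ge>N. (LINT x|lebesgue. indicator (cball 0 R) x * (val (X (k m) - X (k n)) x)\<^sup>2) < e"
proof -
  define P where "P j Z y C \<longleftrightarrow> finite Z \<and> C \<ge> 0 \<and>
    (\<forall>u. (LINT x|lebesgue. indicator (cball 0 (real (fst j))) x * (val u x)\<^sup>2) \<le> (1 / real (Suc (snd j))) * (norm u)\<^sup>2 + C * (\<Sum>z\<in>Z. (y z \<bullet> u)\<^sup>2))"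
    for j :: "nat \<times> nat" and Z :: "(int ^ 3) set" and y :: "int ^ 3 \<Rightarrow> h1" and C :: real
  have "\<forall>j. \<exists>Z y C. P j Z y C"
    unfolding P_def by (intro allI local_estimate) simp
  then obtain Z y C where ZyC: "\<And>j. P j (Z j) (y j) (C j)" by metis
  have Z: "finite (Z j)" and C: "C j \<ge> 0" and
    est: "(LINT x|lebesgue. indicator (cball 0 (real (fst j))) x * (val u x)\<^sup>2) \<le> (1 / real (Suc (snd j))) * (norm u)\<^sup>2 + C j * (\<Sum>z\<in>Z j. (y j z \<bullet> u)\<^sup>2)" for j u
    using ZyC [of j] unfolding P_def by blast+
  \<comment> \<open>The added 0 makes S nonempty, so that it is the range of an enumeration.\<close>
  define S where "S = insert 0 (\<Union>j. y j ` Z j)"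
  have S: "countable S" unfolding S_def
    by (intro countable_insert countable_UN [OF countableI_type] countable_image countable_finite [OF Z])
  define \<sigma> where "\<sigma> = from_nat_into S"
  have range: "range \<sigma> = S" unfolding \<sigma>_def by (rule range_from_nat_into [OF _ S]) (simp add: S_def)
  have M: "norm ((w \<bullet> X n) / (1 + norm w)) \<le> 1" for n w
  proof -
    have "\<bar>w \<bullet> X n\<bar> \<le> norm w * norm (X n)" by (rule Cauchy_Schwarz_ineq2)
    also have "\<dots> \<le> norm w * 1" using X by (intro mult_left_mono) auto
    finally have "\<bar>w \<bullet> X n\<bar> \<le> 1 + norm w" by simp
    moreover have "1 + norm w > 0" by (simp add: add_pos_nonneg)
    ultimately show ?thesis by (simp add: divide_le_eq_1_pos)
  qed
  define F :: "nat \<Rightarrow> nat \<Rightarrow> real" where "F n i = (\<sigma> i \<bullet> X n) / (1 + norm (\<sigma> i))" for n i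
  have "compact (PiE UNIV (\<lambda>_. {- 1..1 :: real}) :: (nat \<Rightarrow> real) set)"
    unfolding compactin_euclidean_iff [symmetric] euclidean_product_topology [symmetric] compactin_PiE by simp
  then have "seq_compact (PiE UNIV (\<lambda>_. {- 1..1 :: real}) :: (nat \<Rightarrow> real) set)"
    by (rule compact_imp_seq_compact)
  moreover have "F n \<in> PiE UNIV (\<lambda>_. {- 1..1})" for n
  proof -
    have "\<bar>F n i\<bar> \<le> 1" for i using M [of "\<sigma> i" n] by (simp add: F_def)
    then show ?thesis by (auto simp: abs_le_iff minus_le_iff)
  qed
  ultimately obtain G k where k: "strict_mono (k :: nat \<Rightarrow> nat)" "(F \<circ> k) \<longlonglongrightarrow> G"
    unfolding seq_compact_def by metis
  have k2: "\<exists>l. (\<lambda>n. (w \<bullet> X (k n)) / (1 + norm w)) \<longlonglongrightarrow> l" if "w \<in> S" for w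
  proof -
    have "w \<in> range \<sigma>" using \<open>w \<in> S\<close> range by simp
    then obtain i where i: "w = \<sigma> i" by (rule rangeE)
    have "isCont (\<lambda>h :: nat \<Rightarrow> real. h i) G"
      by (rule continuous_on_interior [OF continuous_on_product_coordinates]) simp
    then have "(\<lambda>n. (F \<circ> k) n i) \<longlonglongrightarrow> G i" using k(2) by (rule isCont_tendsto_compose)
    then show ?thesis by (auto simp: F_def i)
  qed
  have conv: "Cauchy (\<lambda>n. w \<bullet> X (k n))" if "w \<in> S" for w
  proof -
    obtain l where "(\<lambda>n. (w \<bullet> X (k n)) / (1 + norm w)) \<longlonglongrightarrow> l" using k2 [OF \<open>w \<in> S\<close>] by blast
    then have "(\<lambda>n. (1 + norm w) * ((w \<bullet> X (k n)) / (1 + norm w))) \<longlonglongrightarrow> (1 + norm w) * l"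
      by (intro tendsto_intros)
    moreover have "1 + norm w > 0" by (simp add: add_pos_nonneg)
    ultimately have "(\<lambda>n. w \<bullet> X (k n)) \<longlonglongrightarrow> (1 + norm w) * l" by simp
    then show ?thesis by (rule LIMSEQ_imp_Cauchy)
  qed
  have "\<exists>N. \<forall>m\<ge>N. \<forall>n\<ge>N. (LINT x|lebesgue. indicator (cball 0 R) x * (val (X (k m) - X (k n)) x)\<^sup>2) < e" if e: "e > 0" for R e
  proof -
    obtain a where a: "R \<le> real a" using real_arch_simple by blast
    \<comment> \<open>Differences of unit ball elements have squared norm at most 4, and now 4 / (b
      + 1) < e / 2.\<close>
    obtain b where b: "8 / e < real b" using reals_Archimedean2 by blast
    define j where "j = (a, b)"
    define d where "d = e / (2 * (C j + 1) * (real (card (Z j)) + 1))"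
    have Cj: "C j \<ge> 0" by (rule C)
    have d: "d > 0" using e Cj unfolding d_def by (intro divide_pos_pos mult_pos_pos) auto
    have "\<exists>N. \<forall>m\<ge>N. \<forall>n\<ge>N. (w \<bullet> (X (k m) - X (k n)))\<^sup>2 < d" if w: "w \<in> S" for w
    proof -
      obtain N where N: "\<And>m n. m \<ge> N \<Longrightarrow> n \<ge> N \<Longrightarrow> dist (w \<bullet> X (k m)) (w \<bullet> X (k n)) < sqrt d"
        using metric_CauchyD [OF conv [OF w], of "sqrt d"] d by auto
      have "(w \<bullet> (X (k m) - X (k n)))\<^sup>2 < d" if "m \<ge> N" "n \<ge> N" for m n
      proof -
        have "\<bar>w \<bullet> (X (k m) - X (k n))\<bar> < sqrt d" using N [OF that] by (simp add: dist_real_def inner_diff_right)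
        then show ?thesis using d by (metis abs_ge_zero power2_abs power_strict_mono real_sqrt_pow2 zero_less_numeral less_imp_le)
      qed
      then show ?thesis by blast
    qed
    then have "\<forall>z. \<exists>N. z \<in> Z j \<longrightarrow> (\<forall>m\<ge>N. \<forall>n\<ge>N. (y j z \<bullet> (X (k m) - X (k n)))\<^sup>2 < d)"
      unfolding S_def by blast
    then obtain N where N: "\<And>z m n. z \<in> Z j \<Longrightarrow> m \<ge> N z \<Longrightarrow> n \<ge> N z \<Longrightarrow> (y j z \<bullet> (X (k m) - X (k n)))\<^sup>2 < d"
      by metis
    define N0 where "N0 = (\<Sum>z\<in>Z j. N z)"
    have N0: "N z \<le> N0" if "z \<in> Z j" for z
      unfolding N0_def using Z [of j] that by (intro member_le_sum) auto
    show ?thesis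
    proof (intro exI allI impI)
      fix m n assume mn: "m \<ge> N0" "n \<ge> N0"
      let ?u = "X (k m) - X (k n)"
      have "norm ?u \<le> 2" using norm_triangle_ineq4 [of "X (k m)" "X (k n)"] X [of "k m"] X [of "k n"] by linarith
      then have u: "(norm ?u)\<^sup>2 \<le> 4" using power_mono [of "norm ?u" 2 2] by simp
      have "(LINT x|lebesgue. indicator (cball 0 R) x * (val ?u x)\<^sup>2) \<le> (LINT x|lebesgue. indicator (cball 0 (real a)) x * (val ?u x)\<^sup>2)"
        using a by (intro integral_mono integrable_indicator_square) (auto simp: indicator_def)
      also have "\<dots> \<le> (1 / real (Suc b)) * (norm ?u)\<^sup>2 + C j * (\<Sum>z\<in>Z j. (y j z \<bullet> ?u)\<^sup>2)"
        using est [of j ?u] by (simp add: j_def)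
      also have "\<dots> \<le> (1 / real (Suc b)) * 4 + C j * (real (card (Z j)) * d)"
      proof (intro add_mono mult_left_mono u Cj)
        show "(\<Sum>z\<in>Z j. (y j z \<bullet> ?u)\<^sup>2) \<le> real (card (Z j)) * d"
          using N N0 mn by (intro sum_bounded_above) (meson le_trans less_imp_le)
      qed simp
      also have "\<dots> < e"
      proof -
        have "8 < e * real (Suc b)" using b e by (simp add: field_simps)
        then have 1: "(1 / real (Suc b)) * 4 < e / 2" by (simp add: field_simps)
        have "C j * (real (card (Z j)) * d) \<le> (C j + 1) * ((real (card (Z j)) + 1) * d)"
          using Cj d by (intro mult_mono) auto
        also have "\<dots> = e / 2"
        proof -
          have *: "a * (b * (e / (2 * a * b))) = e / 2" if "a \<noteq> 0" "b \<noteq> 0" for a b :: real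
            using that by simp
          show ?thesis unfolding d_def by (rule *) (use Cj in linarith)+
        qed
        finally show ?thesis using 1 by linarith
      qed
      finally show "(LINT x|lebesgue. indicator (cball 0 R) x * (val ?u x)\<^sup>2) < e" .
    qed
  qed
  with k(1) show thesis by (rule that)
qed

text \<open>If the larger of a and c exceeds A, sixth powers dominate with the factor A^(r-6), small
  for large A as r < 6. Otherwise a^(r-2) is at most A^(r-2) and a quadratic expression remains. In
  the application d is a difference of two functions; dividing by \<eta> is harmless because its
  local L2 norm can be made small afterwards.\<close>

lemma young_truncated:
  fixes a d c r A \<eta> :: real
  assumes "0 \<le> d" "d \<le> a" "0 \<le> c" "2 < r" "r < 6" "A > 0" "\<eta> > 0"
  shows "a powr (r - 2) * d * c \<le> A powr (r - 6) * (a ^ 6 + c ^ 6) + A powr (r - 2) * (\<eta> * c\<^sup>2 + d\<^sup>2 / \<eta>)"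
proof -
  define M where "M = max a c"
  have M: "a \<le> M" "c \<le> M" "d \<le> M" "0 \<le> M" using assms by (auto simp: M_def)
  have n1: "0 \<le> A powr (r - 6) * (a ^ 6 + c ^ 6)" by simp
  have n2: "0 \<le> A powr (r - 2) * (\<eta> * c\<^sup>2 + d\<^sup>2 / \<eta>)" using assms by simp
  show ?thesis
  proof (cases "M \<le> A")
    case True
    have dc: "d * c \<le> \<eta> * c\<^sup>2 + d\<^sup>2 / \<eta>"
    proof -
      have "0 \<le> (d / sqrt \<eta> - sqrt \<eta> * c)\<^sup>2" by simp
      also have "\<dots> = \<eta> * c\<^sup>2 + d\<^sup>2 / \<eta> - 2 * (d * c)"
        using assms by (simp add: power2_diff power_mult_distrib power_divide)
      finally show ?thesis using mult_nonneg_nonneg [OF assms(1,3)] by linarith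
    qed
    have "a powr (r - 2) * (d * c) \<le> A powr (r - 2) * (\<eta> * c\<^sup>2 + d\<^sup>2 / \<eta>)"
      using assms M True dc by (intro mult_mono powr_mono2) auto
    then show ?thesis using n1 unfolding mult.assoc by linarith
  next
    case False
    then have M0: "M > A" "M > 0" using assms by auto
    have "a powr (r - 2) * (d * c) \<le> M powr (r - 2) * (M * M)"
      using assms M by (intro mult_mono powr_mono2) auto
    also have "\<dots> = M powr r"
      using M0 powr_add [of M "r - 2" 2] by (simp add: power2_eq_square)
    also have "\<dots> = M powr (r - 6) * M ^ 6"
      using M0 powr_add [of M "r - 6" 6] by simp
    also have "\<dots> \<le> A powr (r - 6) * M ^ 6"
      using M0 assms by (intro mult_right_mono powr_mono2') auto
    also have "\<dots> \<le> A powr (r - 6) * (a ^ 6 + c ^ 6)"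
      unfolding M_def using assms by (intro mult_left_mono) (auto simp: max_def)
    finally show ?thesis using n2 unfolding mult.assoc by linarith
  qed
qed

lemma integrable_val_power6: "integrable lebesgue (\<lambda>x. (val u x) ^ 6)"
  and integral_val_power6_le: "(LINT x|lebesgue. (val u x) ^ 6) \<le> 4096 * norm u ^ 6"
proof -
  show i: "integrable lebesgue (\<lambda>x. (val u x) ^ 6)"
    using sobolev_h1 [of u] by (intro integrableI_bounded) (auto simp: power_even_abs intro: le_less_trans)
  have "ennreal (LINT x|lebesgue. (val u x) ^ 6) = (\<integral>\<^sup>+x. ennreal (val u x ^ 6) \<partial>lebesgue)"
    by (rule nn_integral_eq_integral [symmetric, OF i]) (simp add: zero_le_even_power)
  then show "(LINT x|lebesgue. (val u x) ^ 6) \<le> 4096 * norm u ^ 6"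
    using sobolev_h1 [of u] ennreal_le_iff [of "4096 * norm u ^ 6" "LINT x|lebesgue. (val u x) ^ 6"] by simp
qed

text \<open>Cutting off large values and far points changes the weighted power by a uniformly small
  amount on the unit ball. This and the strict inequality s < 6 make D compact.\<close>

locale tight_weight = power_weight +
  assumes s_less_6: "s < 6"
    and tight: "\<And>e. e > 0 \<Longrightarrow> \<exists>n::nat. \<forall>u. norm u \<le> 1 \<longrightarrow>
      (\<integral>\<^sup>+x. ennreal ((if \<omega> x > real n \<or> norm x > real n then \<omega> x else 0) * \<bar>val u x\<bar> powr s) \<partial>lebesgue) \<le> ennreal e"
begin

text \<open>The tail of the weight is itself a \<open>power_weight\<close> with a tiny constant, so
  \<open>D_lipschitz\<close> bounds its contribution by e / 2. The rest of the weight is bounded and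
  lives on a ball, where \<open>young_truncated\<close> isolates the local L2 distance.\<close>

lemma compact_estimate:
  assumes e: "e > 0"
  shows "\<exists>R M. M \<ge> 0 \<and> (\<forall>u v. norm u \<le> 1 \<longrightarrow> norm v \<le> 1 \<longrightarrow>
    norm (D u - D v) \<le> e + M * (LINT x|lebesgue. indicator (cball 0 R) x * (val (u - v) x)\<^sup>2))"
proof -
  \<comment> \<open>12 = 3 * 2 * 2: the factor 3 of \<open>D_lipschitz\<close>, two powers of norms
    at most 1, and a distance at most 2.\<close>
  define L where "L = (s - 1) * 2 powr (s - 2) * 12"
  have L: "L > 0" using s by (simp add: L_def)
  define e' where "e' = e / (2 * L)"
  have e': "e' > 0" "L * e' = e / 2" using e L by (auto simp: e'_def)
  obtain n :: nat where n: "\<And>u. norm u \<le> 1 \<Longrightarrow>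
      (\<integral>\<^sup>+x. ennreal ((if \<omega> x > real n \<or> norm x > real n then \<omega> x else 0) * \<bar>val u x\<bar> powr s) \<partial>lebesgue) \<le> ennreal e'"
    using tight [OF e'(1)] by blast
  define \<omega>2 where "\<omega>2 x = (if \<omega> x > real n \<or> norm x > real n then \<omega> x else 0)" for x
  have \<omega>2_measurable [measurable]: "\<omega>2 \<in> borel_measurable lebesgue"
  proof -
    have [measurable]: "(\<lambda>x::R3. norm x) \<in> borel_measurable lebesgue"
      by (intro measurable_completion) simp
    show ?thesis unfolding \<omega>2_def [abs_def] by measurable
  qed
  interpret W2: power_weight \<omega>2 s e'
    using n s e' \<omega>_nonneg \<omega>2_measurable by unfold_locales (auto simp: \<omega>2_def)
  define N where "N = real n * (s - 1) + 1"
  have N: "N > 0" using s by (simp add: N_def add_nonneg_pos)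
  \<comment> \<open>129 = 64 + 64 + 1 counts the sixth powers of u, v and the test vector w, each
    with integral at most 4096. A and then \<open>\<eta>\<close> are chosen to make each of the two
    errors e / 8.\<close>
  define A where "A = (e / (8 * N * 4096 * 129)) powr (1 / (s - 6))"
  have A: "A > 0" "A powr (s - 6) = e / (8 * N * 4096 * 129)"
    using e N s_less_6 by (auto simp: A_def powr_powr)
  define \<eta> where "\<eta> = e / (8 * N * A powr (s - 2))"
  have \<eta>: "\<eta> > 0" "N * (A powr (s - 2) * \<eta>) = e / 8"
    using e N A by (auto simp: \<eta>_def)
  define M where "M = N * (A powr (s - 2) / \<eta>)"
  have M: "M \<ge> 0" using N \<eta> by (simp add: M_def)
  have key: "norm (D u - D v) \<le> e + M * (LINT x|lebesgue. indicator (cball 0 (real n)) x * (val (u - v) x)\<^sup>2)"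
    if u: "norm u \<le> 1" and v: "norm v \<le> 1" for u v
  proof -
    let ?I = "LINT x|lebesgue. indicator (cball 0 (real n)) x * (val (u - v) x)\<^sup>2"
    have I: "?I \<ge> 0" by simp
    have *: "(D u - D v) \<bullet> w \<le> e + M * ?I" if w: "norm w \<le> 1" for w
    proof -
      have W2: "(W2.D u - W2.D v) \<bullet> w \<le> e / 2"
      proof -
        have p: "norm u powr (s - 2) \<le> 1" "norm v powr (s - 2) \<le> 1"
          using u v s by (auto intro!: powr_le1)
        have uv: "norm (u - v) \<le> 2" using norm_triangle_ineq4 [of u v] u v by linarith
        have "(W2.D u - W2.D v) \<bullet> w \<le> norm (W2.D u - W2.D v) * norm w" by (rule norm_cauchy_schwarz)
        also have "\<dots> \<le> norm (W2.D u - W2.D v) * 1" using w by (intro mult_left_mono) auto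
        also have "\<dots> \<le> (s - 1) * 2 powr (s - 2) * (3 * e') * (norm u powr (s - 2) + norm v powr (s - 2)) * norm (u - v)"
          using W2.D_lipschitz [of u v] by simp
        also have "\<dots> \<le> (s - 1) * 2 powr (s - 2) * (3 * e') * 2 * 2"
          using p uv s e' by (intro mult_mono mult_left_mono) auto
        also have "\<dots> = e / 2" unfolding e'(2) [symmetric] L_def by simp
        finally show ?thesis .
      qed
      define h where "h x = A powr (s - 6) * ((64 * val u x ^ 6 + 64 * val v x ^ 6) + val w x ^ 6)
          + A powr (s - 2) * (\<eta> * (val w x)\<^sup>2) + A powr (s - 2) / \<eta> * (indicator (cball 0 (real n)) x * (val (u - v) x)\<^sup>2)" for x
      have h_int: "integrable lebesgue h"
        unfolding h_def by (intro Bochner_Integration.integrable_add integrable_mult_right integrable_val_power6 integrable_val_square integrable_indicator_square) simp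
      have h_le: "(LINT x|lebesgue. h x) \<le> A powr (s - 6) * (129 * 4096) + A powr (s - 2) * \<eta> + A powr (s - 2) / \<eta> * ?I"
      proof -
        have p6: "(LINT x|lebesgue. val z x ^ 6) \<le> 4096" if "norm z \<le> 1" for z
          using integral_val_power6_le [of z] power_le_one [of "norm z" 6] that by simp
        have p2: "(LINT x|lebesgue. (val w x)\<^sup>2) \<le> 1"
          using integral_val_square_le [of w] power_le_one [of "norm w" 2] w by simp
        have "(LINT x|lebesgue. h x) = A powr (s - 6) * ((64 * (LINT x|lebesgue. val u x ^ 6) + 64 * (LINT x|lebesgue. val v x ^ 6)) + (LINT x|lebesgue. val w x ^ 6))
          + A powr (s - 2) * (\<eta> * (LINT x|lebesgue. (val w x)\<^sup>2)) + A powr (s - 2) / \<eta> * ?I"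
          unfolding h_def by (simp add: integrable_val_power6 integrable_val_square integrable_indicator_square)
        also have "\<dots> \<le> A powr (s - 6) * ((64 * 4096 + 64 * 4096) + 4096) + A powr (s - 2) * (\<eta> * 1) + A powr (s - 2) / \<eta> * ?I"
          using p6 [OF u] p6 [OF v] p6 [OF w] p2 \<eta> by (intro add_mono mult_left_mono) auto
        finally show ?thesis by simp
      qed
      have "(D u - D v) \<bullet> w - (W2.D u - W2.D v) \<bullet> w
          = (LINT x|lebesgue. (\<omega> x * \<bar>val u x\<bar> powr (s - 2) * val u x * val w x - \<omega> x * \<bar>val v x\<bar> powr (s - 2) * val v x * val w x)
            - (\<omega>2 x * \<bar>val u x\<bar> powr (s - 2) * val u x * val w x - \<omega>2 x * \<bar>val v x\<bar> powr (s - 2) * val v x * val w x))"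
        unfolding inner_diff_left D_inner W2.D_inner pair_def W2.pair_def
        by (simp add: term_integrable' W2.term_integrable')
      also have "\<dots> \<le> (LINT x|lebesgue. N * h x)"
      proof (rule integral_mono_AE)
        show "AE x in lebesgue. (\<omega> x * \<bar>val u x\<bar> powr (s - 2) * val u x * val w x - \<omega> x * \<bar>val v x\<bar> powr (s - 2) * val v x * val w x)
            - (\<omega>2 x * \<bar>val u x\<bar> powr (s - 2) * val u x * val w x - \<omega>2 x * \<bar>val v x\<bar> powr (s - 2) * val v x * val w x) \<le> N * h x"
          using val_diff [of u v]
        proof eventually_elim
          case (elim x)
          define a b c where "a = val u x" "b = val v x" "c = val w x"
          have h0: "h x \<ge> 0" unfolding h_def using \<eta> by (intro add_nonneg_nonneg mult_nonneg_nonneg) (auto simp: zero_le_even_power)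
          show ?case
          proof (cases "\<omega> x > real n \<or> norm x > real n")
            case True
            then show ?thesis using h0 N by (simp add: \<omega>2_def)
          next
            case False
            then have \<omega>x: "\<omega> x \<le> real n" "x \<in> cball 0 (real n)" "\<omega>2 x = 0" by (auto simp: \<omega>2_def)
            have "(\<bar>a\<bar> + \<bar>b\<bar>) ^ 6 \<le> 64 * (a ^ 6 + b ^ 6)"
            proof -
              have "(\<bar>a\<bar> + \<bar>b\<bar>) ^ 6 \<le> (2 * max \<bar>a\<bar> \<bar>b\<bar>) ^ 6" by (intro power_mono) auto
              also have "\<dots> \<le> 64 * (\<bar>a\<bar> ^ 6 + \<bar>b\<bar> ^ 6)" by (auto simp: power_mult_distrib max_def)
              finally show ?thesis by (simp add: power_even_abs)
            qed
            then have p6: "(\<bar>a\<bar> + \<bar>b\<bar>) ^ 6 \<le> 64 * a ^ 6 + 64 * b ^ 6" by simp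
            have "(\<bar>a\<bar> + \<bar>b\<bar>) powr (s - 2) * \<bar>a - b\<bar> * \<bar>c\<bar>
                \<le> A powr (s - 6) * ((\<bar>a\<bar> + \<bar>b\<bar>) ^ 6 + \<bar>c\<bar> ^ 6) + A powr (s - 2) * (\<eta> * \<bar>c\<bar>\<^sup>2 + \<bar>a - b\<bar>\<^sup>2 / \<eta>)"
              using s s_less_6 A(1) \<eta>(1) by (intro young_truncated) auto
            also have "\<dots> \<le> A powr (s - 6) * ((64 * a ^ 6 + 64 * b ^ 6) + c ^ 6) + A powr (s - 2) * (\<eta> * c\<^sup>2 + (a - b)\<^sup>2 / \<eta>)"
              using p6 \<eta>(1) by (intro add_mono mult_left_mono) (auto simp: power_even_abs)
            also have "\<dots> = h x"
              unfolding h_def elim using \<omega>x(2) by (simp add: a_b_c_def algebra_simps)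
            finally have y: "(\<bar>a\<bar> + \<bar>b\<bar>) powr (s - 2) * \<bar>a - b\<bar> * \<bar>c\<bar> \<le> h x" .
            have "\<omega> x * \<bar>a\<bar> powr (s - 2) * a * c - \<omega> x * \<bar>b\<bar> powr (s - 2) * b * c = \<omega> x * ((\<bar>a\<bar> powr (s - 2) * a - \<bar>b\<bar> powr (s - 2) * b) * c)"
              by (simp add: algebra_simps)
            also have "\<dots> \<le> \<omega> x * (\<bar>\<bar>a\<bar> powr (s - 2) * a - \<bar>b\<bar> powr (s - 2) * b\<bar> * \<bar>c\<bar>)"
              unfolding abs_mult [symmetric] using \<omega>_nonneg by (intro mult_left_mono) auto
            also have "\<dots> \<le> \<omega> x * (((s - 1) * (\<bar>a\<bar> + \<bar>b\<bar>) powr (s - 2) * \<bar>a - b\<bar>) * \<bar>c\<bar>)"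
              using abs_powr_mult_lipschitz [of "s - 2" a b] s \<omega>_nonneg by (intro mult_left_mono mult_right_mono) auto
            also have "\<dots> = (\<omega> x * (s - 1)) * ((\<bar>a\<bar> + \<bar>b\<bar>) powr (s - 2) * \<bar>a - b\<bar> * \<bar>c\<bar>)" by simp
            also have "\<dots> \<le> N * h x"
            proof (rule mult_mono [OF _ y])
              have "\<omega> x * (s - 1) \<le> real n * (s - 1)" using \<omega>x(1) s by (intro mult_right_mono) auto
                then show "\<omega> x * (s - 1) \<le> N" unfolding N_def by linarith
            qed (use N in auto)
            finally show ?thesis using \<omega>x(3) by (simp add: a_b_c_def)
          qed
        qed
      qed (use h_int in \<open>simp_all add: term_integrable' W2.term_integrable'\<close>)
      also have "\<dots> \<le> N * (A powr (s - 6) * (129 * 4096) + A powr (s - 2) * \<eta> + A powr (s - 2) / \<eta> * ?I)"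
        using h_le N by simp
      also have "\<dots> = N * (A powr (s - 6) * (129 * 4096)) + N * (A powr (s - 2) * \<eta>) + M * ?I"
        unfolding M_def by (simp add: distrib_left)
      also have "\<dots> = e / 8 + e / 8 + M * ?I"
        unfolding \<eta>(2) A(2) using N by simp
      finally show ?thesis using W2 e by linarith
    qed
    show ?thesis
    proof (rule norm_le_inner)
      show "0 \<le> e + M * ?I" using e M I by simp
      fix w
      show "(D u - D v) \<bullet> w \<le> (e + M * ?I) * norm w"
      proof (cases "w = 0")
        case False
        have "(D u - D v) \<bullet> (w /\<^sub>R norm w) \<le> e + M * ?I" by (rule *) (simp add: False)
        then show ?thesis using False by (simp add: field_simps)
      qed simp
    qed
  qed
  with M show ?thesis by blast
qed

lemma D_Cauchy_subsequence:
  assumes "\<And>n. norm (X n) \<le> 1"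
  obtains k where "strict_mono (k :: nat \<Rightarrow> nat)" "Cauchy (\<lambda>n. D (X (k n)))"
proof -
  obtain k where k: "strict_mono (k :: nat \<Rightarrow> nat)"
    "\<And>R e. e > 0 \<Longrightarrow> \<exists>N. \<forall>m\<ge>N. \<forall>n\<ge>N. (LINT x|lebesgue. indicator (cball 0 R) x * (val (X (k m) - X (k n)) x)\<^sup>2) < e"
    by (rule local_Cauchy_subsequence [OF assms], rule that)
  have "Cauchy (\<lambda>n. D (X (k n)))"
  proof (rule metric_CauchyI)
    fix e :: real assume e: "e > 0"
    then have "e / 2 > 0" by simp
    then obtain R M where M: "M \<ge> 0" and RM: "\<And>u v. norm u \<le> 1 \<Longrightarrow> norm v \<le> 1 \<Longrightarrow>
      norm (D u - D v) \<le> e / 2 + M * (LINT x|lebesgue. indicator (cball 0 R) x * (val (u - v) x)\<^sup>2)"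
      using compact_estimate [of "e / 2"] by blast
    obtain N where N: "\<And>m n. m \<ge> N \<Longrightarrow> n \<ge> N \<Longrightarrow> (LINT x|lebesgue. indicator (cball 0 R) x * (val (X (k m) - X (k n)) x)\<^sup>2) < e / (2 * (M + 1))"
      using k(2) [of "e / (2 * (M + 1))" R] e M by auto
    show "\<exists>N. \<forall>m\<ge>N. \<forall>n\<ge>N. dist (D (X (k m))) (D (X (k n))) < e"
    proof (intro exI allI impI)
      fix m n assume mn: "m \<ge> N" "n \<ge> N"
      let ?I = "LINT x|lebesgue. indicator (cball 0 R) x * (val (X (k m) - X (k n)) x)\<^sup>2"
      have "M * ?I \<le> M * (e / (2 * (M + 1)))" using N [OF mn] M by (intro mult_left_mono) auto
      also have "\<dots> < e / 2" using M e by (simp add: field_simps)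
      finally show "dist (D (X (k m))) (D (X (k n))) < e"
        using RM [OF assms assms, of "k m" "k n"] by (simp add: dist_norm)
    qed
  qed
  with k(1) show thesis by (rule that)
qed

end

section \<open>Functions in \<open>X\<close> and elements of \<open>h1\<close>\<close>

lemma has_weak_gradient_diff:
  assumes "has_weak_gradient u G" "has_weak_gradient v H"
  shows "has_weak_gradient (\<lambda>x. u x - v x) (\<lambda>x. G x - H x)"
  unfolding has_weak_gradient_def
proof (intro conjI ballI allI)
  have u: "locally_integrable u" "locally_integrable G" and v: "locally_integrable v" "locally_integrable H"
    using assms by (auto simp: has_weak_gradient_def)
  show "locally_integrable (\<lambda>x. u x - v x)" "locally_integrable (\<lambda>x. G x - H x)"
    using u v by (auto intro: locally_integrable_diff)
  fix \<psi> :: "R3 \<Rightarrow> real" and i :: 3 assume \<psi>: "\<psi> \<in> test_functions"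
  have p: "partial_deriv i \<psi> \<in> test_functions" by (rule test_functions_partial_deriv [OF \<psi>])
  have "(LINT x|lebesgue. (u x - v x) * partial_deriv i \<psi> x) = (LINT x|lebesgue. u x * partial_deriv i \<psi> x) - (LINT x|lebesgue. v x * partial_deriv i \<psi> x)"
    by (simp add: left_diff_distrib locally_integrable_times_test u v p)
  also have "\<dots> = - (LINT x|lebesgue. G x $ i * \<psi> x) - - (LINT x|lebesgue. H x $ i * \<psi> x)"
    using assms \<psi> by (simp add: has_weak_gradient_def)
  also have "\<dots> = - (LINT x|lebesgue. (G x - H x) $ i * \<psi> x)"
    by (simp add: left_diff_distrib locally_integrable_times_test locally_integrable_nth u v \<psi>)
  finally show "(LINT x|lebesgue. (u x - v x) * partial_deriv i \<psi> x) = - (LINT x|lebesgue. (G x - H x) $ i * \<psi> x)" .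
qed

lemma weak_grad_measurable:
  assumes "has_weak_gradient u G" "G \<in> borel_measurable lebesgue"
  shows "weak_grad u \<in> borel_measurable lebesgue"
  by (rule borel_measurable_AE [OF assms(2)])
    (use weak_grad_AE(2) [OF assms(1)] in \<open>auto elim: eventually_mono\<close>)

text \<open>Convergence in \<open>H1_norm\<close> is L2 convergence of the pairs of function and
  weak gradient, so the limiting pair belongs to \<open>h1set\<close>.\<close>

lemma H1_approximable_val:
  assumes u: "u \<in> H1" and \<phi>: "\<And>n::nat. \<phi> n \<in> test_functions"
    and lim: "(\<lambda>n. H1_norm (\<lambda>x. \<phi> n x - u x)) \<longlonglongrightarrow> 0"
  obtains w where "AE x in lebesgue. u x = val w x"
proof -
  obtain G where G: "has_weak_gradient u G" "G \<in> Lp 2" and u2: "u \<in> Lp 2" using u by (auto simp: H1_def)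
  have [measurable]: "u \<in> borel_measurable lebesgue" "G \<in> borel_measurable lebesgue"
    using u2 G by (auto simp: Lp_def)
  have [measurable]: "(\<lambda>x. (u x, G x)) \<in> borel_measurable lebesgue"
    by (intro borel_measurable_Pair) measurable
  have sq: "square_integrable (\<lambda>x. (u x, G x))"
    using u2 G(2) by (auto simp: square_integrable_def Lp_def norm_Pair)
  have "(\<lambda>x. (u x, G x)) \<in> h1set"
    unfolding h1set_def
  proof (intro CollectI conjI sq allI impI)
    fix e :: real assume e: "e > 0"
    then obtain n where n: "H1_norm (\<lambda>x. \<phi> n x - u x) < sqrt e"
      using order_tendstoD(2) [OF lim, of "sqrt e"] by (auto simp: eventually_sequentially)
    have [measurable]: "\<phi> n \<in> borel_measurable lebesgue" by (rule test_functions_measurable [OF \<phi>])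
    have "grad (\<phi> n) \<in> borel_measurable lborel"
      using borel_measurable_continuous_onI [OF continuous_grad [OF C1c_test [OF \<phi>]], of n] by simp
    then have [measurable]: "grad (\<phi> n) \<in> borel_measurable lebesgue" by (rule measurable_completion)
    have hw: "has_weak_gradient (\<lambda>x. \<phi> n x - u x) (\<lambda>x. grad (\<phi> n) x - G x)"
      by (intro has_weak_gradient_diff has_weak_gradient_test \<phi> G)
    have [measurable]: "weak_grad (\<lambda>x. \<phi> n x - u x) \<in> borel_measurable lebesgue"
      by (rule weak_grad_measurable [OF hw]) measurable
    have "(LINT x|lebesgue. (norm ((u x, G x) - (\<phi> n x, grad (\<phi> n) x)))\<^sup>2)
        = (LINT x|lebesgue. (norm (weak_grad (\<lambda>x. \<phi> n x - u x) x))\<^sup>2 + (\<phi> n x - u x)\<^sup>2)"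
    proof (rule integral_cong_AE)
      show "AE x in lebesgue. (norm ((u x, G x) - (\<phi> n x, grad (\<phi> n) x)))\<^sup>2 = (norm (weak_grad (\<lambda>x. \<phi> n x - u x) x))\<^sup>2 + (\<phi> n x - u x)\<^sup>2"
        using weak_grad_AE(2) [OF hw] by eventually_elim (simp add: norm_Pair norm_minus_commute power2_commute)
      show "(\<lambda>x. (norm ((u x, G x) - (\<phi> n x, grad (\<phi> n) x)))\<^sup>2) \<in> borel_measurable lebesgue"
        by (simp add: norm_Pair)
    qed measurable
    also have "\<dots> = (H1_norm (\<lambda>x. \<phi> n x - u x))\<^sup>2" by (simp add: H1_norm_def)
    also have "\<dots> < (sqrt e)\<^sup>2" using n by (intro power_strict_mono) (auto simp: H1_norm_def)
    finally show "\<exists>\<phi>\<in>test_functions. (LINT x|lebesgue. (norm ((u x, G x) - (\<phi> x, grad \<phi> x)))\<^sup>2) < e"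
      using e \<phi> [of n] by auto
  qed
  from rep_mk [OF this] have "AE x in lebesgue. u x = val (mk (\<lambda>x. (u x, G x))) x"
    by eventually_elim (simp add: val_def)
  then show thesis by (rule that)
qed

lemma H1_cong_val:
  assumes "AE x in lebesgue. v x = val u x" "v \<in> borel_measurable lebesgue"
  shows "v \<in> H1"
proof -
  have "integrable lebesgue (\<lambda>x. (v x)\<^sup>2) \<longleftrightarrow> integrable lebesgue (\<lambda>x. (val u x)\<^sup>2)"
    using assms by (intro integrable_cong_AE) (auto elim!: eventually_mono)
  then have "v \<in> Lp 2" using assms integrable_val_square [of u] by (simp add: Lp_def)
  moreover have "gr u \<in> Lp 2" using integrable_gr_square [of u] by (simp add: Lp_def)
  ultimately show ?thesis
    using has_weak_gradient_cong [OF has_weak_gradient_val assms] by (auto simp: H1_def)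
qed

locale equivalent_potential =
  fixes V :: "R3 \<Rightarrow> real"
  assumes V_measurable [measurable]: "V \<in> borel_measurable lebesgue"
    and V_pos: "V x > 0" and equiv: "V_norm_equivalent V"
begin

lemma potential_integrable: "integrable lebesgue (\<lambda>x. V x * (val u x)\<^sup>2)"
  using equiv val_in_H1 [of u] by (simp add: V_norm_equivalent_def)

lemma potential_pair_integrable: "integrable lebesgue (\<lambda>x. V x * val u x * val v x)"
proof (rule Bochner_Integration.integrable_bound [OF Bochner_Integration.integrable_add [OF potential_integrable [of u] potential_integrable [of v]]])
  show "AE x in lebesgue. norm (V x * val u x * val v x) \<le> norm (V x * (val u x)\<^sup>2 + V x * (val v x)\<^sup>2)"
  proof (rule AE_I2)
    fix x
    have "norm (V x * val u x * val v x) = V x * \<bar>val u x * val v x\<bar>" using V_pos [of x] by (simp add: abs_mult)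
    also have "\<dots> \<le> V x * ((val u x)\<^sup>2 + (val v x)\<^sup>2)"
      using V_pos [of x] by (intro mult_left_mono abs_mult_le_squares) auto
    also have "\<dots> = norm (V x * (val u x)\<^sup>2 + V x * (val v x)\<^sup>2)"
      using V_pos [of x] by (simp add: distrib_left)
    finally show "norm (V x * val u x * val v x) \<le> norm (V x * (val u x)\<^sup>2 + V x * (val v x)\<^sup>2)" .
  qed
qed measurable

definition form :: "h1 \<Rightarrow> h1 \<Rightarrow> real" where
  "form u v = (LINT x|lebesgue. gr u x \<bullet> gr v x + V x * val u x * val v x)"

lemma gr_inner_integrable: "integrable lebesgue (\<lambda>x. gr u x \<bullet> gr v x)"
  by (intro square_integrable_inner square_integrable_gr)

lemma form_integrable: "integrable lebesgue (\<lambda>x. gr u x \<bullet> gr v x + V x * val u x * val v x)"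
  by (intro Bochner_Integration.integrable_add gr_inner_integrable potential_pair_integrable)

lemma form_commute: "form u v = form v u"
  by (simp add: form_def inner_commute mult_ac)

lemma form_add: "form u (v + w) = form u v + form u w"
proof -
  have "form u (v + w) = (LINT x|lebesgue. (gr u x \<bullet> gr v x + V x * val u x * val v x) + (gr u x \<bullet> gr w x + V x * val u x * val w x))"
    unfolding form_def
  proof (rule integral_cong_AE)
    show "AE x in lebesgue. gr u x \<bullet> gr (v + w) x + V x * val u x * val (v + w) x
        = (gr u x \<bullet> gr v x + V x * val u x * val v x) + (gr u x \<bullet> gr w x + V x * val u x * val w x)"
      using val_add [of v w] gr_add [of v w] by eventually_elim (simp add: inner_add_right algebra_simps)
  qed measurable
  then show ?thesis using form_integrable by (simp add: form_def)
qed

lemma form_scaleR: "form u (c *\<^sub>R v) = c * form u v"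
proof -
  have "form u (c *\<^sub>R v) = (LINT x|lebesgue. c * (gr u x \<bullet> gr v x + V x * val u x * val v x))"
    unfolding form_def
  proof (rule integral_cong_AE)
    show "AE x in lebesgue. gr u x \<bullet> gr (c *\<^sub>R v) x + V x * val u x * val (c *\<^sub>R v) x = c * (gr u x \<bullet> gr v x + V x * val u x * val v x)"
      using val_scaleR [of c v] gr_scaleR [of c v] by eventually_elim (simp add: algebra_simps)
  qed measurable
  then show ?thesis by (simp add: form_def)
qed

lemma form_add_left: "form (u + v) w = form u w + form v w"
  by (simp add: form_commute [of _ w] form_add)

lemma form_scaleR_left: "form (c *\<^sub>R u) v = c * form u v"
  by (simp add: form_commute [of _ v] form_scaleR)

lemma form_minus: "form u (- v) = - form u v" "form (- v) u = - form v u"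
  using form_scaleR [of u "- 1" v] form_scaleR_left [of "- 1" v u] by simp_all

lemma form_diff: "form u (v - w) = form u v - form u w" "form (v - w) u = form v u - form w u"
  using form_add [of u v "- w"] form_add_left [of v "- w" u] by (simp_all add: form_minus)

lemma form_self_nonneg: "form u u \<ge> 0"
  unfolding form_def
proof (rule Bochner_Integration.integral_nonneg)
  fix x
  show "gr u x \<bullet> gr u x + V x * val u x * val u x \<ge> 0"
    using V_pos [of x] by (simp add: mult.assoc)
qed

lemma V_norm_val:
  assumes "AE x in lebesgue. v x = val u x" "v \<in> borel_measurable lebesgue"
  shows "(LINT x|lebesgue. (norm (weak_grad v x))\<^sup>2 + V x * (v x)\<^sup>2) = form u u"
  unfolding form_def
proof (rule integral_cong_AE)
  show "AE x in lebesgue. (norm (weak_grad v x))\<^sup>2 + V x * (v x)\<^sup>2 = gr u x \<bullet> gr u x + V x * val u x * val u x"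
    using assms(1) weak_grad_AE_val [OF assms]
    by eventually_elim (simp add: dot_square_norm power2_eq_square [of "val u _"] mult.assoc)
  have [measurable]: "weak_grad v \<in> borel_measurable lebesgue"
    by (rule weak_grad_measurable [OF has_weak_gradient_cong [OF has_weak_gradient_val assms] gr_measurable])
  note assms(2) [measurable]
  show "(\<lambda>x. (norm (weak_grad v x))\<^sup>2 + V x * (v x)\<^sup>2) \<in> borel_measurable lebesgue" by measurable
qed measurable

lemma form_bounds:
  obtains c C where "c > 0" "C > 0" "\<And>u. c * (norm u)\<^sup>2 \<le> form u u" "\<And>u. form u u \<le> C * (norm u)\<^sup>2"
proof -
  obtain c C where cC: "c > 0" "C > 0" "\<And>u. u \<in> H1 \<Longrightarrow> c * H1_norm u \<le> V_norm V u" "\<And>u. u \<in> H1 \<Longrightarrow> V_norm V u \<le> C * H1_norm u"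
    using equiv unfolding V_norm_equivalent_def by blast
  have n: "(V_norm V (val u))\<^sup>2 = form u u" "V_norm V (val u) \<ge> 0" for u
    using V_norm_val [of "val u" u] form_self_nonneg [of u] by (simp_all add: V_norm_def)
  have h: "H1_norm (val u) = norm u" for u by (rule H1_norm_val) auto
  show thesis
  proof (rule that [of "c\<^sup>2" "C\<^sup>2"])
    fix u
    show "c\<^sup>2 * (norm u)\<^sup>2 \<le> form u u"
      using power_mono [OF cC(3) [OF val_in_H1 [of u]], of 2] cC(1) by (simp add: n h power_mult_distrib)
    show "form u u \<le> C\<^sup>2 * (norm u)\<^sup>2"
      using power_mono [OF cC(4) [OF val_in_H1 [of u]] n(2), of 2] by (simp add: n h power_mult_distrib)
  qed (use cC in auto)
qed

text \<open>Nonnegativity of the form at a + b and at a - b bounds it by C on unit vectors; scaling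
  gives the general case.\<close>

lemma form_abs_le:
  assumes C: "\<And>u. form u u \<le> C * (norm u)\<^sup>2"
  shows "\<bar>form u v\<bar> \<le> C * norm u * norm v"
proof (cases "u = 0 \<or> v = 0")
  case True
  have "form u 0 = 0" for u using form_scaleR [of u 0 0] by simp
  then show ?thesis using True form_commute [of u v] by auto
next
  case False
  have unit: "\<bar>form a b\<bar> \<le> C" if "norm a = 1" "norm b = 1" for a b
  proof -
    have "form (a + b) (a + b) = form a a + 2 * form a b + form b b"
      "form (a - b) (a - b) = form a a - 2 * form a b + form b b"
      by (simp_all add: form_add form_add_left form_diff form_commute [of b a])
    then show ?thesis
      using form_self_nonneg [of "a + b"] form_self_nonneg [of "a - b"] C [of a] C [of b] that by simp
  qed
  let ?a = "u /\<^sub>R norm u" and ?b = "v /\<^sub>R norm v"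
  have "form u v = form (norm u *\<^sub>R ?a) (norm v *\<^sub>R ?b)" using False by simp
  also have "\<dots> = norm u * norm v * form ?a ?b"
    using False by (simp add: form_scaleR form_scaleR_left field_simps)
  finally have "\<bar>form u v\<bar> = norm u * norm v * \<bar>form ?a ?b\<bar>" by (simp add: abs_mult)
  also have "\<dots> \<le> norm u * norm v * C" using False by (intro mult_left_mono unit) auto
  finally show ?thesis by (simp add: mult_ac)
qed

definition A :: "h1 \<Rightarrow> h1" where
  "A u = riesz (form u)"

lemma A_inner: "A u \<bullet> v = form u v"
  unfolding A_def
proof (rule riesz)
  obtain C where C: "\<And>u. form u u \<le> C * (norm u)\<^sup>2" by (rule form_bounds, rule that, assumption)
  show "bounded_linear (form u)"
    by (rule bounded_linear_intro [of _ "C * norm u"])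
      (use form_abs_le [OF C, of u] in \<open>auto simp: form_add form_scaleR mult_ac\<close>)
qed

lemma A_diff: "A (u - v) = A u - A v"
proof -
  have "A (u - v) \<bullet> w = (A u - A v) \<bullet> w" for w
    by (simp add: A_inner inner_diff_left form_diff)
  then show ?thesis using vector_eq_rdot by blast
qed

lemma A_minus: "A (- u) = - A u"
  using A_diff [of 0 u] A_diff [of 0 0] by simp

lemma norm_A_le:
  assumes C: "\<And>u. form u u \<le> C * (norm u)\<^sup>2" "C \<ge> 0"
  shows "norm (A u) \<le> C * norm u"
  by (rule norm_le_inner) (use form_abs_le [OF C(1), of u] C(2) in \<open>auto simp: A_inner abs_le_iff\<close>)

text \<open>The root of the quartic Coulomb energy is of second order in the norm of
  \<open>h1\<close>, just like the quadratic form, so \<open>X_norm\<close> is no stronger than the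
  \<open>H1\<close> norm.\<close>

lemma X_norm_le:
  obtains K where "K \<ge> 0" "\<And>v u. AE x in lebesgue. v x = val u x \<Longrightarrow> v \<in> borel_measurable lebesgue \<Longrightarrow> X_norm V v \<le> K * norm u"
proof -
  obtain C where C: "C > 0" "\<And>u. form u u \<le> C * (norm u)\<^sup>2" by (rule form_bounds, rule that, assumption+)
  let ?K = "sqrt (C + sqrt \<bar>4 * pot_const\<bar>)"
  show thesis
  proof (rule that [of ?K])
    fix v u assume v: "AE x in lebesgue. v x = val u x" "v \<in> borel_measurable lebesgue"
    have "coul u u u u \<le> \<bar>4 * pot_const\<bar> * ((norm u)\<^sup>2)\<^sup>2"
    proof -
      have "coul u u u u \<le> 4 * pot_const * ((norm u)\<^sup>2)\<^sup>2"
        using coul_abs_le [of u u u u] by (simp add: power2_eq_square mult.assoc)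
      also have "\<dots> \<le> \<bar>4 * pot_const\<bar> * ((norm u)\<^sup>2)\<^sup>2" by (intro mult_right_mono) auto
      finally show ?thesis .
    qed
    then have "sqrt (coul u u u u) \<le> sqrt (\<bar>4 * pot_const\<bar> * ((norm u)\<^sup>2)\<^sup>2)" by simp
    then have "sqrt (coul u u u u) \<le> sqrt \<bar>4 * pot_const\<bar> * (norm u)\<^sup>2" by (simp only: real_sqrt_mult real_sqrt_pow2_iff real_sqrt_abs abs_power2)
    then have "form u u + sqrt (coul u u u u) \<le> (C + sqrt \<bar>4 * pot_const\<bar>) * (norm u)\<^sup>2"
      using C(2) [of u] by (simp add: distrib_right)
    then have "X_norm V v \<le> sqrt ((C + sqrt \<bar>4 * pot_const\<bar>) * (norm u)\<^sup>2)"
      by (simp add: X_norm_def V_norm_val [OF v] coulomb_val [OF v])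
    then show "X_norm V v \<le> ?K * norm u" by (simp add: real_sqrt_mult)
  qed (use C in simp)
qed

text \<open>Since \<open>X_norm\<close> is dominated by the norm of \<open>h1\<close>, an
  \<open>H1\<close> convergent sequence of test functions is Cauchy for it. Thus
  \<open>X_space V\<close> is the closure of the test functions in \<open>H1\<close>, up to null
  sets.\<close>

lemma X_space_iff: "v \<in> X_space V \<longleftrightarrow> v \<in> borel_measurable lebesgue \<and> (\<exists>u. AE x in lebesgue. v x = val u x)"
proof
  assume v: "v \<in> X_space V"
  then have v1: "v \<in> H1" by (simp add: X_space_def)
  obtain \<phi> where "\<And>n::nat. \<phi> n \<in> test_functions" "(\<lambda>n. H1_norm (\<lambda>x. \<phi> n x - v x)) \<longlonglongrightarrow> 0"
    using v unfolding X_space_def by blast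
  from H1_approximable_val [OF v1 this] have "\<exists>u. AE x in lebesgue. v x = val u x" by blast
  then show "v \<in> borel_measurable lebesgue \<and> (\<exists>u. AE x in lebesgue. v x = val u x)"
    using v1 by (simp add: H1_def Lp_def)
next
  assume "v \<in> borel_measurable lebesgue \<and> (\<exists>u. AE x in lebesgue. v x = val u x)"
  then obtain u where v: "AE x in lebesgue. v x = val u x" "v \<in> borel_measurable lebesgue" by blast
  note v(2) [measurable]
  obtain \<phi> where \<phi>: "\<And>n::nat. \<phi> n \<in> test_functions" "(\<lambda>n. emb (\<phi> n)) \<longlonglongrightarrow> u"
    by (rule emb_sequence [of u], rule that)
  have [measurable]: "\<phi> n \<in> borel_measurable lebesgue" for n by (intro test_functions_measurable \<phi>)
  obtain K where K: "K \<ge> 0" "\<And>v u. AE x in lebesgue. v x = val u x \<Longrightarrow> v \<in> borel_measurable lebesgue \<Longrightarrow> X_norm V v \<le> K * norm u"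
    by (rule X_norm_le, rule that)
  show "v \<in> X_space V"
    unfolding X_space_def
  proof (intro CollectI conjI exI [of _ \<phi>] allI impI H1_cong_val [OF v] \<phi>(1))
    fix e :: real assume e: "e > 0"
    have "Cauchy (\<lambda>n. emb (\<phi> n))" by (rule LIMSEQ_imp_Cauchy [OF \<phi>(2)])
    then obtain N where N: "\<And>m n. m \<ge> N \<Longrightarrow> n \<ge> N \<Longrightarrow> dist (emb (\<phi> m)) (emb (\<phi> n)) < e / (K + 1)"
      using metric_CauchyD [of "\<lambda>n. emb (\<phi> n)" "e / (K + 1)"] e K(1) by auto
    show "\<exists>N. \<forall>m\<ge>N. \<forall>n\<ge>N. X_norm V (\<lambda>x. \<phi> m x - \<phi> n x) < e"
    proof (intro exI allI impI)
      fix m n assume mn: "m \<ge> N" "n \<ge> N"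
      have "X_norm V (\<lambda>x. \<phi> m x - \<phi> n x) \<le> K * norm (emb (\<phi> m) - emb (\<phi> n))"
      proof (rule K(2))
        show "AE x in lebesgue. \<phi> m x - \<phi> n x = val (emb (\<phi> m) - emb (\<phi> n)) x"
          using val_diff [of "emb (\<phi> m)" "emb (\<phi> n)"] val_emb [OF \<phi>(1), of m] val_emb [OF \<phi>(1), of n]
          by eventually_elim simp
      qed measurable
      also have "\<dots> \<le> K * (e / (K + 1))"
        using N [OF mn] K(1) by (intro mult_left_mono) (auto simp: dist_norm)
      also have "\<dots> < e" using K(1) e by (simp add: field_simps)
      finally show "X_norm V (\<lambda>x. \<phi> m x - \<phi> n x) < e" .
    qed
  next
    have "H1_norm (\<lambda>x. \<phi> n x - v x) = norm (emb (\<phi> n) - u)" for n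
    proof (rule H1_norm_val)
      show "AE x in lebesgue. \<phi> n x - v x = val (emb (\<phi> n) - u) x"
        using val_diff [of "emb (\<phi> n)" u] val_emb [OF \<phi>(1), of n] v(1) by eventually_elim simp
    qed measurable
    then show "(\<lambda>n. H1_norm (\<lambda>x. \<phi> n x - v x)) \<longlonglongrightarrow> 0"
      using tendsto_norm_zero [OF LIM_zero [OF \<phi>(2)]] by simp
  qed
qed

end

section \<open>The energy functional\<close>

text \<open>Young's inequality with the conjugate exponents 6/(6-p) and 6/p, with unit constants, by
  comparing x with t^(6-p).\<close>

lemma mult_powr_le:
  fixes x t p :: real
  assumes "x \<ge> 0" "t \<ge> 0" "0 < p" "p < 6"
  shows "x * t powr p \<le> x powr (6 / (6 - p)) + t ^ 6"
proof (cases "t = 0 \<or> x = 0")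
  case True
  then show ?thesis using assms by auto
next
  case False
  then have pos: "x > 0" "t > 0" using assms by auto
  show ?thesis
  proof (cases "x \<le> t powr (6 - p)")
    case True
    have "x * t powr p \<le> t powr (6 - p) * t powr p" using True by (intro mult_right_mono) auto
    also have "\<dots> = t ^ 6" using pos by (simp flip: powr_add)
    finally show ?thesis by (simp add: add_increasing)
  next
    case False
    then have "(t powr (6 - p)) powr (1 / (6 - p)) \<le> x powr (1 / (6 - p))"
      using assms by (intro powr_mono2) auto
    then have "t \<le> x powr (1 / (6 - p))" using pos assms by (simp add: powr_powr)
    then have "t powr p \<le> (x powr (1 / (6 - p))) powr p" using assms by (intro powr_mono2) auto
    then have "x * t powr p \<le> x powr 1 * x powr (p / (6 - p))"
      using pos assms by (simp add: powr_powr)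
    also have "\<dots> = x powr (1 + p / (6 - p))" by (rule powr_add [symmetric])
    also have "1 + p / (6 - p) = 6 / (6 - p)" using assms by (simp add: field_simps)
    finally show ?thesis using assms by (simp add: add_increasing2)
  qed
qed

text \<open>|t|^q \<le> t^2 + t^6 for exponents between 2 and 6; the constant is 1 from the L2 norm
  plus 4096 from the Sobolev inequality.\<close>

lemma power_weight_one:
  assumes "2 < q" "q \<le> 6"
  shows "power_weight (\<lambda>_. 1) q 4097"
proof
  fix u :: h1 assume u: "norm u \<le> 1"
  have le: "\<bar>t\<bar> powr q \<le> t\<^sup>2 + t ^ 6" for t :: real
  proof -
    consider "t = 0" | "0 < \<bar>t\<bar>" "\<bar>t\<bar> \<le> 1" | "\<bar>t\<bar> > 1" by linarith
    then show ?thesis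
    proof cases
      case 2
      then have "\<bar>t\<bar> powr q \<le> \<bar>t\<bar> powr 2" using assms by (intro powr_mono') auto
      moreover have "t ^ 6 \<ge> 0" by (rule zero_le_even_power) simp
      moreover have "\<bar>t\<bar> powr 2 = t\<^sup>2" using 2 by simp
      ultimately show ?thesis by linarith
    next
      case 3
      then have "\<bar>t\<bar> powr q \<le> \<bar>t\<bar> powr 6" using assms by (intro powr_mono) auto
      moreover have "\<bar>t\<bar> powr 6 = t ^ 6" using 3 by (simp add: power_even_abs)
      ultimately show ?thesis using zero_le_power2 [of t] by linarith
    qed simp
  qed
  have "(\<integral>\<^sup>+x. ennreal (1 * \<bar>val u x\<bar> powr q) \<partial>lebesgue) \<le> (\<integral>\<^sup>+x. ennreal ((val u x)\<^sup>2 + val u x ^ 6) \<partial>lebesgue)"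
    by (intro nn_integral_mono ennreal_leI) (simp add: le)
  also have "\<dots> = ennreal (LINT x|lebesgue. (val u x)\<^sup>2 + val u x ^ 6)"
    by (intro nn_integral_eq_integral Bochner_Integration.integrable_add integrable_val_square integrable_val_power6)
      (simp add: zero_le_even_power)
  also have "\<dots> \<le> ennreal 4097"
  proof (rule ennreal_leI)
    have "(LINT x|lebesgue. (val u x)\<^sup>2 + val u x ^ 6) = (LINT x|lebesgue. (val u x)\<^sup>2) + (LINT x|lebesgue. val u x ^ 6)"
      by (rule Bochner_Integration.integral_add [OF integrable_val_square integrable_val_power6])
    also have "\<dots> \<le> (norm u)\<^sup>2 + 4096 * norm u ^ 6"
      by (rule add_mono [OF integral_val_square_le integral_val_power6_le])
    also have "\<dots> \<le> 1 + 4096 * 1" using u by (intro add_mono mult_left_mono power_le_one) auto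
    finally show "(LINT x|lebesgue. (val u x)\<^sup>2 + val u x ^ 6) \<le> 4097" by simp
  qed
  finally show "(\<integral>\<^sup>+x. ennreal (1 * \<bar>val u x\<bar> powr q) \<partial>lebesgue) \<le> ennreal 4097" .
qed (use assms in auto)

text \<open>Applying \<open>mult_powr_le\<close> to \<omega>/\<eta> puts the small factor \<eta> on
  the sixth power, at the price of a large factor on the integral of the weight; for tails of g that
  integral is small.\<close>

lemma weight_bound:
  assumes \<omega> [measurable]: "\<omega> \<in> borel_measurable lebesgue" and nn: "\<And>x. \<omega> x \<ge> 0"
    and p: "0 < p" "p < 6" and \<eta>: "\<eta> > 0" and u: "norm u \<le> 1"
    and I: "(\<integral>\<^sup>+x. ennreal (\<omega> x powr (6 / (6 - p))) \<partial>lebesgue) \<le> ennreal I" "I \<ge> 0"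
  shows "(\<integral>\<^sup>+x. ennreal (\<omega> x * \<bar>val u x\<bar> powr p) \<partial>lebesgue) \<le> ennreal (\<eta> powr (1 - 6 / (6 - p)) * I + 4096 * \<eta>)"
proof -
  let ?a = "6 / (6 - p)" and ?c = "\<eta> powr (1 - 6 / (6 - p))"
  have le: "\<omega> x * \<bar>t\<bar> powr p \<le> ?c * \<omega> x powr ?a + \<eta> * t ^ 6" for x t
  proof -
    have "\<omega> x * \<bar>t\<bar> powr p = \<eta> * ((\<omega> x / \<eta>) * \<bar>t\<bar> powr p)" using \<eta> by simp
    also have "\<dots> \<le> \<eta> * ((\<omega> x / \<eta>) powr ?a + \<bar>t\<bar> ^ 6)"
      using nn \<eta> p by (intro mult_left_mono mult_powr_le) auto
    also have "\<dots> = \<eta> powr 1 * \<omega> x powr ?a / \<eta> powr ?a + \<eta> * t ^ 6"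
      using nn [of x] \<eta> by (simp add: powr_divide distrib_left power_even_abs)
    also have "\<dots> = ?c * \<omega> x powr ?a + \<eta> * t ^ 6" by (simp add: powr_diff)
    finally show ?thesis .
  qed
  have "(\<integral>\<^sup>+x. ennreal (\<omega> x * \<bar>val u x\<bar> powr p) \<partial>lebesgue) \<le> (\<integral>\<^sup>+x. ennreal ?c * ennreal (\<omega> x powr ?a) + ennreal \<eta> * ennreal (val u x ^ 6) \<partial>lebesgue)"
  proof (intro nn_integral_mono)
    fix x
    have "ennreal (\<omega> x * \<bar>val u x\<bar> powr p) \<le> ennreal (?c * \<omega> x powr ?a + \<eta> * val u x ^ 6)"
      by (rule ennreal_leI [OF le])
    also have "\<dots> = ennreal ?c * ennreal (\<omega> x powr ?a) + ennreal \<eta> * ennreal (val u x ^ 6)"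
      using \<eta> by (simp add: ennreal_mult zero_le_even_power)
    finally show "ennreal (\<omega> x * \<bar>val u x\<bar> powr p) \<le> ennreal ?c * ennreal (\<omega> x powr ?a) + ennreal \<eta> * ennreal (val u x ^ 6)" .
  qed
  also have "\<dots> = ennreal ?c * (\<integral>\<^sup>+x. ennreal (\<omega> x powr ?a) \<partial>lebesgue) + ennreal \<eta> * (\<integral>\<^sup>+x. ennreal (val u x ^ 6) \<partial>lebesgue)"
    by (simp add: nn_integral_add nn_integral_cmult)
  also have "\<dots> \<le> ennreal ?c * ennreal I + ennreal \<eta> * ennreal 4096"
  proof (intro add_mono mult_left_mono I)
    have "4096 * norm u ^ 6 \<le> 4096 * 1" using u by (intro mult_left_mono power_le_one) auto
    then show "(\<integral>\<^sup>+x. ennreal (val u x ^ 6) \<partial>lebesgue) \<le> ennreal 4096"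
      by (intro order.trans [OF sobolev_h1 [of u] ennreal_leI]) simp
  qed auto
  also have "\<dots> = ennreal (?c * I + 4096 * \<eta>)"
    using \<eta> I(2) by (simp add: ennreal_mult' ennreal_plus mult.commute flip: ennreal_numeral)
  finally show ?thesis .
qed

text \<open>The tails of g tend to 0 in L^(6/(6-p)) by dominated convergence, and
  \<open>weight_bound\<close> converts this into tightness.\<close>

lemma tight_weight_Lp:
  assumes g: "g \<in> Lp (6 / (6 - p))" and nn: "\<And>x. g x \<ge> 0" and p: "2 < p" "p < 6"
  obtains C where "tight_weight g p C"
proof -
  let ?a = "6 / (6 - p)"
  have [measurable]: "g \<in> borel_measurable lebesgue" using g by (simp add: Lp_def)
  have int: "integrable lebesgue (\<lambda>x. g x powr ?a)" using g nn by (simp add: Lp_def)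
  define I where "I = (LINT x|lebesgue. g x powr ?a)"
  have I: "(\<integral>\<^sup>+x. ennreal (g x powr ?a) \<partial>lebesgue) = ennreal I"
    unfolding I_def by (rule nn_integral_eq_integral [OF int]) simp
  have I0: "I \<ge> 0" unfolding I_def by simp
  have [measurable]: "(\<lambda>x::R3. norm x) \<in> borel_measurable lebesgue"
    by (intro measurable_completion) simp
  define h where "h n x = (if g x > real n \<or> norm x > real n then g x else 0)" for n :: nat and x
  have hm [measurable]: "h n \<in> borel_measurable lebesgue" for n
    unfolding h_def [abs_def] by measurable
  have hn: "h n x \<ge> 0" for n x by (simp add: h_def nn)
  have lim: "(\<lambda>n. LINT x|lebesgue. h n x powr ?a) \<longlonglongrightarrow> (LINT x|(lebesgue :: R3 measure). 0)"
  proof (rule integral_dominated_convergence [OF _ _ int])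
    show "AE x in lebesgue. (\<lambda>n. h n x powr ?a) \<longlonglongrightarrow> 0"
    proof (rule AE_I2)
      fix x :: R3
      obtain N where N: "max (g x) (norm x) \<le> real N" using real_arch_simple by blast
      have "\<forall>\<^sub>F n in sequentially. h n x powr ?a = 0"
        by (rule eventually_sequentiallyI [of N]) (use N in \<open>auto simp: h_def\<close>)
      then show "(\<lambda>n. h n x powr ?a) \<longlonglongrightarrow> 0" by (rule tendsto_eventually)
    qed
  qed (auto simp: h_def)
  have "tight_weight g p (1 powr (1 - ?a) * I + 4096 * 1)"
  proof
    show "(\<integral>\<^sup>+x. ennreal (g x * \<bar>val u x\<bar> powr p) \<partial>lebesgue) \<le> ennreal (1 powr (1 - ?a) * I + 4096 * 1)"
      if "norm u \<le> 1" for u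
      by (rule weight_bound) (use that p nn I I0 in auto)
    fix e :: real assume e: "e > 0"
    \<comment> \<open>Then 4096 \<eta> is half of e, and the other half is left for the integral of
      the tail.\<close>
    define \<eta> where "\<eta> = e / 8192"
    have \<eta>: "\<eta> > 0" using e by (simp add: \<eta>_def)
    define c where "c = \<eta> powr (1 - ?a)"
    have c: "c > 0" using \<eta> by (simp add: c_def)
    obtain n where n: "(LINT x|lebesgue. h n x powr ?a) < e / (2 * c)"
      using order_tendstoD(2) [OF lim, of "e / (2 * c)"] e c by (auto simp: eventually_sequentially)
    have int_h: "integrable lebesgue (\<lambda>x. h n x powr ?a)"
      by (rule Bochner_Integration.integrable_bound [OF int]) (auto simp: h_def)
    have "(\<integral>\<^sup>+x. ennreal (h n x * \<bar>val u x\<bar> powr p) \<partial>lebesgue) \<le> ennreal e" if "norm u \<le> 1" for u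
    proof -
      have "(\<integral>\<^sup>+x. ennreal (h n x powr ?a) \<partial>lebesgue) = ennreal (LINT x|lebesgue. h n x powr ?a)"
        by (rule nn_integral_eq_integral [OF int_h]) simp
      then have "(\<integral>\<^sup>+x. ennreal (h n x powr ?a) \<partial>lebesgue) \<le> ennreal (e / (2 * c))"
        using n by (simp add: ennreal_leI)
      then have "(\<integral>\<^sup>+x. ennreal (h n x * \<bar>val u x\<bar> powr p) \<partial>lebesgue) \<le> ennreal (\<eta> powr (1 - ?a) * (e / (2 * c)) + 4096 * \<eta>)"
        using p e c by (intro weight_bound [OF hm hn _ _ \<eta> that]) auto
      also have "\<eta> powr (1 - ?a) * (e / (2 * c)) + 4096 * \<eta> = e"
        unfolding c_def [symmetric] using c by (simp add: \<eta>_def)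
      finally show ?thesis .
    qed
    then show "\<exists>n::nat. \<forall>u. norm u \<le> 1 \<longrightarrow>
      (\<integral>\<^sup>+x. ennreal ((if g x > real n \<or> norm x > real n then g x else 0) * \<bar>val u x\<bar> powr p) \<partial>lebesgue) \<le> ennreal e"
      unfolding h_def by blast
  qed (use p nn I0 in auto)
  then show thesis by (rule that)
qed

context power_weight begin

lemma D_continuous: "continuous_on S D"
proof -
  have "isCont D u" for u
    unfolding isCont_def
  proof (rule LIM_zero_cancel, rule Lim_null_comparison)
    let ?M = "(s - 1) * 2 powr (s - 2) * (3 * C)"
    show "\<forall>\<^sub>F v in at u. norm (D v - D u) \<le> ?M * (norm v powr (s - 2) + norm u powr (s - 2)) * norm (v - u)"
      by (simp add: D_lipschitz)
    have "((\<lambda>v. norm v powr (s - 2)) \<longlongrightarrow> norm u powr (s - 2)) (at u)"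
      using s by (intro tendsto_powr' tendsto_intros disjI2 conjI always_eventually) auto
    then have "((\<lambda>v. ?M * (norm v powr (s - 2) + norm u powr (s - 2)) * norm (v - u)) \<longlongrightarrow> ?M * (norm u powr (s - 2) + norm u powr (s - 2)) * norm (u - u)) (at u)"
      by (intro tendsto_mult tendsto_add tendsto_const tendsto_norm tendsto_diff tendsto_ident_at)
    then show "((\<lambda>v. ?M * (norm v powr (s - 2) + norm u powr (s - 2)) * norm (v - u)) \<longlongrightarrow> 0) (at u)" by simp
  qed
  then show ?thesis by (simp add: continuous_at_imp_continuous_on)
qed

end

section \<open>Sums of bumps with disjoint supports\<close>

lemma val_sum:
  fixes n :: nat
  shows "AE x in lebesgue. val (\<Sum>i\<le>n. s i *\<^sub>R f i) x = (\<Sum>i\<le>n. s i * val (f i) x)"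
proof (induction n)
  case 0
  then show ?case using val_scaleR [of "s 0" "f 0"] by simp
next
  case (Suc n)
  show ?case
    using Suc val_add [of "\<Sum>i\<le>n. s i *\<^sub>R f i" "s (Suc n) *\<^sub>R f (Suc n)"] val_scaleR [of "s (Suc n)" "f (Suc n)"]
    by (simp, eventually_elim) simp
qed

text \<open>Boxes of width h stand side by side along the first axis. The 4 in \<open>h\<close>
  leaves room for three coordinate deviations of at most (n + 1) h each inside a ball of radius
  e.\<close>

lemma disjoint_boxes:
  fixes n :: nat
  assumes "open S" "S \<noteq> ({} :: R3 set)"
  obtains a b :: "nat \<Rightarrow> R3" where "\<And>i. i \<le> n \<Longrightarrow> box (a i) (b i) \<subseteq> S" "\<And>i. i \<le> n \<Longrightarrow> box (a i) (b i) \<noteq> {}"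
    "\<And>i j. i \<noteq> j \<Longrightarrow> box (a i) (b i) \<inter> box (a j) (b j) = {}"
proof -
  obtain x0 where "x0 \<in> S" using assms by blast
  then obtain e where e: "e > 0" "ball x0 e \<subseteq> S" using assms(1) openE by blast
  define h where "h = e / (4 * (real n + 1))"
  have h: "h > 0" "4 * ((real n + 1) * h) = e" using e by (auto simp: h_def field_simps)
  define a :: "nat \<Rightarrow> R3" where "a i = (\<chi> j. if j = 1 then x0 $ j + real i * h else x0 $ j)" for i
  define b :: "nat \<Rightarrow> R3" where "b i = (\<chi> j. if j = 1 then x0 $ j + real (Suc i) * h else x0 $ j + h)" for i
  show thesis
  proof (rule that [of a b])
    fix i assume i: "i \<le> n"
    show "box (a i) (b i) \<subseteq> S"
    proof
      fix y assume y: "y \<in> box (a i) (b i)"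
      have "\<bar>(y - x0) $ j\<bar> \<le> (real n + 1) * h" for j
      proof -
        have le: "real i * h \<ge> 0" "real (Suc i) * h \<le> (real n + 1) * h" "1 * h \<le> (real n + 1) * h"
          using h i by (auto intro!: mult_right_mono)
        have "x0 $ j \<le> a i $ j" using le(1) by (simp add: a_def)
        moreover have "b i $ j \<le> x0 $ j + (real n + 1) * h" using le(2,3) by (simp add: b_def)
        moreover have "a i $ j < y $ j" "y $ j < b i $ j" using y by (auto simp: mem_box_cart)
        ultimately show ?thesis unfolding vector_minus_component by linarith
      qed
      then have "(\<Sum>j\<in>UNIV. \<bar>(y - x0) $ j\<bar>) \<le> (\<Sum>j\<in>(UNIV :: 3 set). (real n + 1) * h)" by (intro sum_mono)
      then have "norm (y - x0) \<le> 3 * ((real n + 1) * h)" using norm_le_l1_cart [of "y - x0"] by simp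
      also have "\<dots> < e" using h mult_pos_pos [of "real n + 1" h] by linarith
      finally show "y \<in> S" using e(2) by (auto simp: dist_norm norm_minus_commute)
    qed
  next
    fix i
    have "(\<chi> j. a i $ j + h / 2) \<in> box (a i) (b i)" using h by (auto simp: mem_box_cart a_def b_def algebra_simps)
    then show "box (a i) (b i) \<noteq> {}" by blast
  next
    have *: "\<not> (y \<in> box (a i) (b i) \<and> y \<in> box (a j) (b j))" if "i < j" for i j y
    proof
      assume "y \<in> box (a i) (b i) \<and> y \<in> box (a j) (b j)"
      then have "y $ 1 < b i $ 1" "a j $ 1 < y $ 1" by (auto simp: mem_box_cart)
      then have "real j * h < real (Suc i) * h" by (simp add: a_def b_def)
      moreover have "real (Suc i) * h \<le> real j * h" using that h by (intro mult_right_mono) auto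
      ultimately show False by linarith
    qed
    fix i j :: nat assume "i \<noteq> j"
    then show "box (a i) (b i) \<inter> box (a j) (b j) = {}" using *[of i j] *[of j i] by (cases "i < j") auto
  qed
qed

lemma powr_norm_le:
  fixes u :: h1
  assumes "norm u \<le> R" "a \<ge> 0"
  shows "norm u powr a \<le> R powr a"
  using assms by (intro powr_mono2) auto

section \<open>The energy functional and its gradient on \<open>h1\<close>\<close>

locale elliptic_equation = equivalent_potential V + K: tight_weight g p Ck + N: power_weight "\<lambda>_. 1" q Cn
  for V g :: "R3 \<Rightarrow> real" and p q Ck Cn :: real +
  assumes p4: "p > 4" and q4: "q > 4"
begin

definition \<Phi> :: "real \<Rightarrow> h1 \<Rightarrow> real" where
  "\<Phi> lam u = form u u / 2 + (B u \<bullet> u) / 4 - lam * (K.D u \<bullet> u) / p - (N.D u \<bullet> u) / q"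

definition \<Phi>' :: "real \<Rightarrow> h1 \<Rightarrow> h1" where
  "\<Phi>' lam u = A u + B u - lam *\<^sub>R K.D u - N.D u"

lemma energy_val:
  assumes v: "AE x in lebesgue. v x = val u x" and m [measurable]: "v \<in> borel_measurable lebesgue"
  shows "energy V g p q lam v = \<Phi> lam u"
proof -
  have "(LINT x|lebesgue. g x * \<bar>v x\<bar> powr p) = K.D u \<bullet> u"
    unfolding K.D_inner_self using v by (intro integral_cong_AE) (measurable, auto elim: eventually_mono)
  moreover have "(LINT x|lebesgue. \<bar>v x\<bar> powr q) = N.D u \<bullet> u"
    unfolding N.D_inner_self using v by (intro integral_cong_AE) (measurable, auto elim: eventually_mono)
  ultimately show ?thesis
    by (simp add: energy_def \<Phi>_def V_norm_val [OF v m] coulomb_val [OF v m] B_inner)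
qed

lemma weak_solution_val:
  assumes v: "AE x in lebesgue. v x = val u x" and m [measurable]: "v \<in> borel_measurable lebesgue"
    and crit: "\<Phi>' lam u = 0"
  shows "weak_solution V g p q lam v"
  unfolding weak_solution_def
proof (intro conjI ballI)
  show "v \<in> X_space V" using v m by (auto simp: X_space_iff)
  fix w assume "w \<in> X_space V"
  then obtain z where z: "AE x in lebesgue. w x = val z x" and mw [measurable]: "w \<in> borel_measurable lebesgue"
    by (auto simp: X_space_iff)
  have [measurable]: "weak_grad v \<in> borel_measurable lebesgue" "weak_grad w \<in> borel_measurable lebesgue"
    by (rule weak_grad_measurable [OF has_weak_gradient_cong [OF has_weak_gradient_val] gr_measurable]; fact)+
  have 1: "(LINT x|lebesgue. weak_grad v x \<bullet> weak_grad w x + V x * v x * w x) = form u z"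
    unfolding form_def
  proof (rule integral_cong_AE)
    show "AE x in lebesgue. weak_grad v x \<bullet> weak_grad w x + V x * v x * w x = gr u x \<bullet> gr z x + V x * val u x * val z x"
      using v z weak_grad_AE_val [OF v m] weak_grad_AE_val [OF z mw] by eventually_elim simp
  qed measurable
  have [measurable]: "(\<lambda>p. v (fst p)) \<in> borel_measurable LL" "(\<lambda>p. v (snd p)) \<in> borel_measurable LL" "(\<lambda>p. w (snd p)) \<in> borel_measurable LL"
    by (rule measurable_compose [OF measurable_fst m], rule measurable_compose [OF measurable_snd m], rule measurable_compose [OF measurable_snd mw])
  have 2: "(LINT (x, y)|LL. (v x)\<^sup>2 * v y * w y / norm (x - y)) = coul u u u z"
    unfolding coul_def split_def
  proof (rule integral_cong_AE)
    show "AE p in LL. (v (fst p))\<^sup>2 * v (snd p) * w (snd p) / norm (fst p - snd p) = cden u u u z p"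
      using AE_LL(1) [OF v] AE_LL(2) [OF v] AE_LL(2) [OF z]
      by eventually_elim (simp add: cden_def power2_eq_square)
  qed measurable
  have 3: "(LINT x|lebesgue. g x * \<bar>v x\<bar> powr (p - 2) * v x * w x) = K.D u \<bullet> z"
    unfolding K.D_inner K.pair_def
  proof (rule integral_cong_AE)
    show "AE x in lebesgue. g x * \<bar>v x\<bar> powr (p - 2) * v x * w x = g x * \<bar>val u x\<bar> powr (p - 2) * val u x * val z x"
      using v z by eventually_elim simp
  qed measurable
  have 4: "(LINT x|lebesgue. \<bar>v x\<bar> powr (q - 2) * v x * w x) = N.D u \<bullet> z"
    unfolding N.D_inner N.pair_def
  proof (rule integral_cong_AE)
    show "AE x in lebesgue. \<bar>v x\<bar> powr (q - 2) * v x * w x = 1 * \<bar>val u x\<bar> powr (q - 2) * val u x * val z x"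
      using v z by eventually_elim simp
  qed measurable
  have "form u z + B u \<bullet> z - lam * (K.D u \<bullet> z) - N.D u \<bullet> z = \<Phi>' lam u \<bullet> z"
    by (simp add: \<Phi>'_def inner_diff_left inner_add_left A_inner)
  also have "\<dots> = 0" by (simp add: crit)
  finally show "(LINT x|lebesgue. weak_grad v x \<bullet> weak_grad w x + V x * v x * w x)
    + 1 / (4 * pi) * (LINT (x, y)|LL. (v x)\<^sup>2 * v y * w y / norm (x - y))
    - lam * (LINT x|lebesgue. g x * \<bar>v x\<bar> powr (p - 2) * v x * w x)
    - (LINT x|lebesgue. \<bar>v x\<bar> powr (q - 2) * v x * w x) = 0"
    unfolding 1 2 3 4 by (simp add: B_inner)
qed

lemma N_self_pos:
  assumes "u \<noteq> 0"
  shows "N.D u \<bullet> u > 0"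
proof (rule ccontr)
  assume "\<not> N.D u \<bullet> u > 0"
  then have "(LINT x|lebesgue. 1 * \<bar>val u x\<bar> powr q) = 0"
    using N.D_self_nonneg [of u] unfolding N.D_inner_self by linarith
  then have "AE x in lebesgue. 1 * \<bar>val u x\<bar> powr q = 0"
    by (subst (asm) integral_nonneg_eq_0_iff_AE [OF N.power_integrable]) auto
  then have "AE x in lebesgue. val u x = 0" by eventually_elim simp
  from h1_eq_0I [OF this] assms show False by simp
qed

lemma \<Phi>_minus: "\<Phi> lam (- u) = \<Phi> lam u"
  by (simp add: \<Phi>_def form_minus B_minus K.D_minus N.D_minus)

lemma \<Phi>'_minus: "\<Phi>' lam (- u) = - \<Phi>' lam u"
  by (simp add: \<Phi>'_def A_minus B_minus K.D_minus N.D_minus)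

lemma \<Phi>_ray:
  assumes "t > 0"
  shows "\<Phi> lam (t *\<^sub>R u) = form u u * t ^ 2 / 2 + (B u \<bullet> u) * t ^ 4 / 4 - (lam * (K.D u \<bullet> u)) * t powr p / p - (N.D u \<bullet> u) * t powr q / q"
  using assms by (simp only: \<Phi>_def form_scaleR form_scaleR_left B_scale_self K.D_scale_self N.D_scale_self)
    (simp add: power2_eq_square mult_ac)

lemma \<Phi>'_ray:
  assumes "t > 0"
  shows "(\<Phi>' lam (t *\<^sub>R u) \<bullet> u) * t = form u u * t ^ 2 + (B u \<bullet> u) * t ^ 4 - (lam * (K.D u \<bullet> u)) * t powr p - (N.D u \<bullet> u) * t powr q"
proof -
  have "(\<Phi>' lam (t *\<^sub>R u) \<bullet> u) * t = \<Phi>' lam (t *\<^sub>R u) \<bullet> (t *\<^sub>R u)" by simp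
  also have "\<dots> = form (t *\<^sub>R u) (t *\<^sub>R u) + B (t *\<^sub>R u) \<bullet> (t *\<^sub>R u) - lam * (K.D (t *\<^sub>R u) \<bullet> (t *\<^sub>R u)) - N.D (t *\<^sub>R u) \<bullet> (t *\<^sub>R u)"
    by (simp only: \<Phi>'_def inner_diff_left inner_add_left A_inner inner_scaleR_left [of lam])
  finally show ?thesis
    using assms by (simp only: form_scaleR form_scaleR_left B_scale_self K.D_scale_self N.D_scale_self)
      (simp add: power2_eq_square mult_ac)
qed

lemma \<Phi>'_lipschitz:
  assumes lam: "lam > 0"
  shows "\<exists>L. \<forall>u v. norm u \<le> R \<longrightarrow> norm v \<le> R \<longrightarrow> norm (\<Phi>' lam u - \<Phi>' lam v) \<le> L * norm (u - v)"
proof -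
  obtain C where C: "C > 0" "\<And>u. form u u \<le> C * (norm u)\<^sup>2" by (rule form_bounds, rule that, assumption+)
  define L where "L = C + pot_const / pi * (3 * R\<^sup>2) + lam * ((p - 1) * 2 powr (p - 2) * (3 * Ck) * (2 * R powr (p - 2)))
    + (q - 1) * 2 powr (q - 2) * (3 * Cn) * (2 * R powr (q - 2))"
  have "norm (\<Phi>' lam u - \<Phi>' lam v) \<le> L * norm (u - v)" if u: "norm u \<le> R" and v: "norm v \<le> R" for u v
  proof -
    have R: "R \<ge> 0" using u norm_ge_zero [of u] by linarith
    have 1: "norm (A u - A v) \<le> C * norm (u - v)"
      unfolding A_diff [symmetric] using C by (intro norm_A_le) auto
    have "(norm u)\<^sup>2 + norm u * norm v + (norm v)\<^sup>2 \<le> R\<^sup>2 + R * R + R\<^sup>2"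
      using u v R by (intro add_mono mult_mono power_mono) auto
    then have "(norm u)\<^sup>2 + norm u * norm v + (norm v)\<^sup>2 \<le> 3 * R\<^sup>2" by (simp add: power2_eq_square)
    then have 2: "norm (B u - B v) \<le> pot_const / pi * (3 * R\<^sup>2) * norm (u - v)"
      using pot_const(1) by (intro order.trans [OF B_lipschitz [of u v]] mult_right_mono mult_left_mono) auto
    have 3: "norm (K.D u - K.D v) \<le> (p - 1) * 2 powr (p - 2) * (3 * Ck) * (2 * R powr (p - 2)) * norm (u - v)"
      using powr_norm_le [OF u, of "p - 2"] powr_norm_le [OF v, of "p - 2"] p4 K.C_nonneg
      by (intro order.trans [OF K.D_lipschitz [of u v]] mult_right_mono mult_left_mono) auto
    have 4: "norm (N.D u - N.D v) \<le> (q - 1) * 2 powr (q - 2) * (3 * Cn) * (2 * R powr (q - 2)) * norm (u - v)"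
      using powr_norm_le [OF u, of "q - 2"] powr_norm_le [OF v, of "q - 2"] q4 N.C_nonneg
      by (intro order.trans [OF N.D_lipschitz [of u v]] mult_right_mono mult_left_mono) auto
    have "\<Phi>' lam u - \<Phi>' lam v = (A u - A v) + (B u - B v) - lam *\<^sub>R (K.D u - K.D v) - (N.D u - N.D v)"
      by (simp add: \<Phi>'_def algebra_simps)
    also have "norm \<dots> \<le> norm (A u - A v) + norm (B u - B v) + lam * norm (K.D u - K.D v) + norm (N.D u - N.D v)"
      using lam by (intro order.trans [OF norm_triangle_ineq4] add_mono norm_triangle_ineq order_refl) (simp add: norm_triangle_ineq)+
    also have "\<dots> \<le> L * norm (u - v)"
      using 1 2 4 mult_left_mono [OF 3 less_imp_le [OF lam]] unfolding L_def distrib_right mult.assoc by linarith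
    finally show ?thesis .
  qed
  then show ?thesis by blast
qed

text \<open>Both power terms are handled by convexity alone, so the constant depends neither on
  \<lambda> nor on the exponents; it comes from the quadratic form and the Coulomb term.\<close>

lemma \<Phi>_descent:
  assumes lam: "lam > 0"
  shows "\<exists>L. \<forall>u v. norm u \<le> R \<longrightarrow> norm v \<le> R \<longrightarrow> \<Phi> lam v \<le> \<Phi> lam u + \<Phi>' lam u \<bullet> (v - u) + L * (norm (v - u))\<^sup>2"
proof -
  obtain C where C: "C > 0" "\<And>u. form u u \<le> C * (norm u)\<^sup>2" by (rule form_bounds, rule that, assumption+)
  \<comment> \<open>18 = 6 + 8 + 4, from the three terms of \<open>B_descent\<close> with norm u
    \<le> R and norm (v - u) \<le> 2 R.\<close>
  define L where "L = C / 2 + pot_const / (4 * pi) * (18 * R\<^sup>2)"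
  have "\<Phi> lam v \<le> \<Phi> lam u + \<Phi>' lam u \<bullet> (v - u) + L * (norm (v - u))\<^sup>2" if u: "norm u \<le> R" and v: "norm v \<le> R" for u v
  proof -
    have R: "R \<ge> 0" using u norm_ge_zero [of u] by linarith
    have "form v v = form u u + 2 * form u (v - u) + form (v - u) (v - u)"
      by (simp add: form_diff form_commute [of v u])
    then have 1: "form v v / 2 \<le> form u u / 2 + form u (v - u) + C / 2 * (norm (v - u))\<^sup>2"
      using C(2) [of "v - u"] by simp
    have d: "norm (v - u) \<le> 2 * R" using norm_triangle_ineq4 [of v u] u v by linarith
    have "6 * (norm u)\<^sup>2 + 4 * norm u * norm (v - u) + (norm (v - u))\<^sup>2 \<le> 6 * R\<^sup>2 + 4 * R * (2 * R) + (2 * R)\<^sup>2"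
      using u d R by (intro add_mono mult_mono power_mono) auto
    then have "6 * (norm u)\<^sup>2 + 4 * norm u * norm (v - u) + (norm (v - u))\<^sup>2 \<le> 18 * R\<^sup>2"
      by (simp add: power2_eq_square)
    then have "pot_const / (4 * pi) * (6 * (norm u)\<^sup>2 + 4 * norm u * norm (v - u) + (norm (v - u))\<^sup>2) * (norm (v - u))\<^sup>2
        \<le> pot_const / (4 * pi) * (18 * R\<^sup>2) * (norm (v - u))\<^sup>2"
      using pot_const(1) by (intro mult_right_mono mult_left_mono) auto
    then have 2: "(B v \<bullet> v) / 4 \<le> (B u \<bullet> u) / 4 + B u \<bullet> (v - u) + pot_const / (4 * pi) * (18 * R\<^sup>2) * (norm (v - u))\<^sup>2"
      using B_descent [of v u] by linarith
    have "lam * ((K.D u \<bullet> u) / p + K.D u \<bullet> (v - u)) \<le> lam * ((K.D v \<bullet> v) / p)"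
      using lam by (intro mult_left_mono K.D_convex) auto
    then have 3: "lam * (K.D u \<bullet> u) / p + lam * (K.D u \<bullet> (v - u)) \<le> lam * (K.D v \<bullet> v) / p"
      by (simp add: distrib_left)
    show ?thesis
      using 1 2 3 N.D_convex [of u v]
      unfolding \<Phi>_def \<Phi>'_def L_def inner_add_left inner_diff_left A_inner inner_scaleR_left distrib_right by linarith
  qed
  then show ?thesis by blast
qed

text \<open>The q-power takes the place of \<delta>, the coefficient that must be positive, because
  the weighted power vanishes on functions that are 0 wherever g is positive.\<close>

lemma fibered:
  assumes lam: "lam > 0" and a: "a > 0" "\<And>u. a * (norm u)\<^sup>2 \<le> form u u"
  shows "fibered_functional (\<Phi> lam) (\<Phi>' lam) (\<lambda>u. form u u) (\<lambda>u. B u \<bullet> u) (\<lambda>u. lam * (K.D u \<bullet> u)) (\<lambda>u. N.D u \<bullet> u)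
    p q a (lam * (3 * Ck) + 3 * Cn + 1)"
proof (rule fibered_functional.intro)
  show "lam * (3 * Ck) + 3 * Cn + 1 > 0" using lam K.C_nonneg N.C_nonneg by (intro add_nonneg_pos add_nonneg_nonneg) auto
  fix u
  have "lam * (K.D u \<bullet> u) \<le> lam * (3 * Ck * norm u powr p)" using lam K.D_self_le by (intro mult_left_mono) auto
  also have "\<dots> \<le> (lam * (3 * Ck) + 3 * Cn + 1) * norm u powr p" using N.C_nonneg by (simp add: distrib_right)
  finally show "lam * (K.D u \<bullet> u) \<le> (lam * (3 * Ck) + 3 * Cn + 1) * norm u powr p" .
  have "3 * Cn * norm u powr q \<le> (lam * (3 * Ck) + 3 * Cn + 1) * norm u powr q"
    using lam K.C_nonneg by (intro mult_right_mono) auto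
  then show "N.D u \<bullet> u \<le> (lam * (3 * Ck) + 3 * Cn + 1) * norm u powr q" using N.D_self_le [of u] by linarith
qed (use assms p4 q4 K.D_self_nonneg N_self_pos B_self_nonneg \<Phi>_ray \<Phi>'_ray \<Phi>_minus \<Phi>'_minus \<Phi>'_lipschitz \<Phi>_descent in auto)

text \<open>The Coulomb and q-power gradients have order 3 and q - 1 > 3, so on a ball of radius r
  \<le> 1 their Lipschitz constant is at most M r^2. The weighted term is left out, so no \<lambda>
  enters the choice of r.\<close>

lemma small_radius:
  assumes a: "a > 0"
  obtains r where "0 < r" "r \<le> 1"
    "\<And>u v. norm u \<le> r \<Longrightarrow> norm v \<le> r \<Longrightarrow> norm ((B u - N.D u) - (B v - N.D v)) \<le> a / 2 * norm (u - v)"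
proof -
  define M where "M = pot_const / pi * 3 + (q - 1) * 2 powr (q - 2) * (3 * Cn) * 2"
  have M: "M \<ge> 0" unfolding M_def using pot_const(1) N.C_nonneg q4 by (intro add_nonneg_nonneg mult_nonneg_nonneg) auto
  define r where "r = min 1 (sqrt (a / (2 * (M + 1))))"
  have r: "0 < r" "r \<le> 1" using a M by (auto simp: r_def)
  have "r\<^sup>2 \<le> (sqrt (a / (2 * (M + 1))))\<^sup>2" using r by (intro power_mono) (auto simp: r_def)
  also have "\<dots> = a / (2 * (M + 1))" using a M by simp
  finally have "r\<^sup>2 \<le> a / (2 * (M + 1))" .
  then have "M * r\<^sup>2 \<le> M * (a / (2 * (M + 1)))" using M by (intro mult_left_mono) auto
  also have "\<dots> \<le> a / 2" using a M by (simp add: field_simps)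
  finally have Mr: "M * r\<^sup>2 \<le> a / 2" .
  have "norm ((B u - N.D u) - (B v - N.D v)) \<le> a / 2 * norm (u - v)" if u: "norm u \<le> r" and v: "norm v \<le> r" for u v
  proof -
    have p2: "norm w powr (q - 2) \<le> r\<^sup>2" if "norm w \<le> r" for w :: h1
    proof -
      have "norm w powr (q - 2) \<le> r powr (q - 2)" using that q4 by (intro powr_mono2) auto
      also have "\<dots> \<le> r powr 2" using r q4 by (intro powr_mono') auto
      finally show ?thesis using r by simp
    qed
    have "(norm u)\<^sup>2 + norm u * norm v + (norm v)\<^sup>2 \<le> r\<^sup>2 + r * r + r\<^sup>2"
      using u v r by (intro add_mono mult_mono power_mono) auto
    then have "(norm u)\<^sup>2 + norm u * norm v + (norm v)\<^sup>2 \<le> 3 * r\<^sup>2" by (simp add: power2_eq_square)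
    then have 1: "norm (B u - B v) \<le> pot_const / pi * (3 * r\<^sup>2) * norm (u - v)"
      using pot_const(1) by (intro order.trans [OF B_lipschitz [of u v]] mult_right_mono mult_left_mono) auto
    have 2: "norm (N.D u - N.D v) \<le> (q - 1) * 2 powr (q - 2) * (3 * Cn) * (2 * r\<^sup>2) * norm (u - v)"
      using p2 [OF u] p2 [OF v] q4 N.C_nonneg
      by (intro order.trans [OF N.D_lipschitz [of u v]] mult_right_mono mult_left_mono) auto
    have "norm ((B u - N.D u) - (B v - N.D v)) = norm ((B u - B v) - (N.D u - N.D v))" by (simp add: algebra_simps)
    also have "\<dots> \<le> norm (B u - B v) + norm (N.D u - N.D v)" by (rule norm_triangle_ineq4)
    also have "\<dots> \<le> (M * r\<^sup>2) * norm (u - v)"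
      using 1 2 unfolding M_def by (simp add: algebra_simps)
    also have "\<dots> \<le> a / 2 * norm (u - v)" using Mr by (intro mult_right_mono) auto
    finally show ?thesis .
  qed
  with r show thesis by (rule that)
qed

text \<open>Coercivity of A beats the perturbation B - N.D by a / 2, so the distance of two points
  is controlled by the distances of their gradients and of their images under \<open>K.D\<close>.
  The gradients converge, and the images have a Cauchy subsequence.\<close>

lemma palais_smale:
  assumes lam: "lam > 0" and a: "a > 0" "\<And>u. a * (norm u)\<^sup>2 \<le> form u u" and r1: "r \<le> 1"
    and r: "\<And>u v. norm u \<le> r \<Longrightarrow> norm v \<le> r \<Longrightarrow> norm ((B u - N.D u) - (B v - N.D v)) \<le> a / 2 * norm (u - v)"
    and X: "\<And>n. norm (X n) \<le> r" and lim: "(\<lambda>n. \<Phi>' lam (X n)) \<longlonglongrightarrow> 0"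
  shows "\<exists>l k. strict_mono (k::nat\<Rightarrow>nat) \<and> (X \<circ> k) \<longlonglongrightarrow> l"
proof -
  have X1: "norm (X n) \<le> 1" for n using X [of n] r1 by linarith
  obtain k where k: "strict_mono (k :: nat \<Rightarrow> nat)" "Cauchy (\<lambda>n. K.D (X (k n)))"
    by (rule K.D_Cauchy_subsequence [OF X1], rule that)
  have cD: "Cauchy (\<lambda>n. \<Phi>' lam (X (k n)))"
    using LIMSEQ_imp_Cauchy [OF LIMSEQ_subseq_LIMSEQ [OF lim k(1)]] by (simp add: comp_def)
  have key: "a / 2 * norm (u - v) \<le> norm (\<Phi>' lam u - \<Phi>' lam v) + lam * norm (K.D u - K.D v)"
    if u: "norm u \<le> r" and v: "norm v \<le> r" for u v
  proof (cases "u = v")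
    case False
    let ?w = "u - v"
    have eq: "A ?w = (\<Phi>' lam u - \<Phi>' lam v) + lam *\<^sub>R (K.D u - K.D v) - ((B u - N.D u) - (B v - N.D v))"
      by (simp add: \<Phi>'_def A_diff algebra_simps)
    have "a * (norm ?w)\<^sup>2 \<le> A ?w \<bullet> ?w" using a(2) [of ?w] by (simp add: A_inner)
    also have "\<dots> \<le> norm (A ?w) * norm ?w" by (rule norm_cauchy_schwarz)
    finally have "a * norm ?w \<le> norm (A ?w)" using False by (simp add: power2_eq_square)
    also have "\<dots> \<le> norm (\<Phi>' lam u - \<Phi>' lam v) + norm (lam *\<^sub>R (K.D u - K.D v)) + norm ((B u - N.D u) - (B v - N.D v))"
      unfolding eq by (intro order.trans [OF norm_triangle_ineq4] add_mono norm_triangle_ineq order_refl)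
    also have "\<dots> \<le> norm (\<Phi>' lam u - \<Phi>' lam v) + lam * norm (K.D u - K.D v) + a / 2 * norm ?w"
      using r [OF u v] lam by simp
    finally show ?thesis by simp
  qed (use lam in simp)
  have "Cauchy (\<lambda>n. X (k n))"
  proof (rule metric_CauchyI)
    fix e :: real assume e: "e > 0"
    have e1: "a * e / 4 > 0" "a * e / (4 * lam) > 0" using a e lam by auto
    obtain M where M: "\<And>m n. m \<ge> M \<Longrightarrow> n \<ge> M \<Longrightarrow> dist (\<Phi>' lam (X (k m))) (\<Phi>' lam (X (k n))) < a * e / 4"
      using metric_CauchyD [OF cD e1(1)] by blast
    obtain N where N: "\<And>m n. m \<ge> N \<Longrightarrow> n \<ge> N \<Longrightarrow> dist (K.D (X (k m))) (K.D (X (k n))) < a * e / (4 * lam)"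
      using metric_CauchyD [OF k(2) e1(2)] by blast
    show "\<exists>N. \<forall>m\<ge>N. \<forall>n\<ge>N. dist (X (k m)) (X (k n)) < e"
    proof (intro exI allI impI)
      fix m n assume mn: "m \<ge> max M N" "n \<ge> max M N"
      have "lam * dist (K.D (X (k m))) (K.D (X (k n))) < lam * (a * e / (4 * lam))"
        using N [of m n] mn lam by (intro mult_strict_left_mono) auto
      also have "\<dots> = a * e / 4" using lam by simp
      finally have "a / 2 * dist (X (k m)) (X (k n)) < a / 2 * e"
        using key [OF X X, of "k m" "k n"] M [of m n] mn by (simp add: dist_norm)
      then show "dist (X (k m)) (X (k n)) < e" using a by simp
    qed
  qed
  then have "convergent (X \<circ> k)" by (simp add: Cauchy_convergent comp_def)
  then show ?thesis using k(1) by (auto simp: convergent_def)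
qed

text \<open>On a box with nonzero coefficient only its own bump survives, so u and g are nonzero
  there; a nonempty open box is not a null set.\<close>

lemma octa_bumps_pos:
  assumes sub: "\<And>i. i \<le> n \<Longrightarrow> box (a i) (b i) \<subseteq> {x. g x > 0}"
    and ne: "\<And>i. i \<le> n \<Longrightarrow> box (a i) (b i) \<noteq> {}"
    and disj: "\<And>i j. i \<noteq> j \<Longrightarrow> box (a i) (b i) \<inter> box (a j) (b j) = {}"
    and u: "u \<in> octa (\<lambda>i. emb (bump 1 (a i) (b i))) n"
  shows "K.D u \<bullet> u > 0"
proof (rule ccontr)
  assume "\<not> K.D u \<bullet> u > 0"
  then have "(LINT x|lebesgue. g x * \<bar>val u x\<bar> powr p) = 0"
    using K.D_self_nonneg [of u] unfolding K.D_inner_self by linarith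
  then have 0: "AE x in lebesgue. g x * \<bar>val u x\<bar> powr p = 0"
    by (subst (asm) integral_nonneg_eq_0_iff_AE [OF K.power_integrable]) (auto simp: K.\<omega>_nonneg)
  obtain s where s: "u = (\<Sum>i\<le>n. s i *\<^sub>R emb (bump 1 (a i) (b i)))" "(\<Sum>i\<le>n. \<bar>s i\<bar>) = 1"
    using u by (auto simp: octa_def)
  obtain j where j: "j \<le> n" "s j \<noteq> 0"
  proof -
    have "\<exists>j\<in>{..n}. s j \<noteq> 0"
    proof (rule ccontr)
      assume "\<not> ?thesis"
      then have "(\<Sum>i\<le>n. \<bar>s i\<bar>) = 0" by (intro sum.neutral) auto
      then show False using s(2) by simp
    qed
    then show thesis using that by blast
  qed
  have "AE x in lebesgue. \<forall>i. val (emb (bump 1 (a i) (b i))) x = bump 1 (a i) (b i) x"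
    unfolding AE_all_countable by (intro allI val_emb bump_test_function) simp
  then have "AE x in lebesgue. x \<notin> box (a j) (b j)"
    using 0 val_sum [of s "\<lambda>i. emb (bump 1 (a i) (b i))" n] unfolding s(1) [symmetric]
  proof eventually_elim
    case (elim x)
    show ?case
    proof
      assume x: "x \<in> box (a j) (b j)"
      have "x \<notin> box (a i) (b i)" if "i \<noteq> j" for i using disj [OF that] x by blast
      then have "(\<Sum>i\<le>n. s i * bump 1 (a i) (b i) x) = (\<Sum>i\<le>n. if i = j then s j * bump 1 (a j) (b j) x else 0)"
        by (intro sum.cong) (auto simp: bump_outside)
      also have "\<dots> = s j * bump 1 (a j) (b j) x" using j(1) by simp
      finally have "val u x = s j * bump 1 (a j) (b j) x" using elim by simp
      then have "val u x \<noteq> 0" using j(2) bump_pos [OF _ x, of 1] by simp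
      moreover have "g x > 0" using sub [OF j(1)] x by blast
      ultimately show False using elim(2) by simp
    qed
  qed
  then have "emeasure lebesgue (box (a j) (b j)) = 0"
    using AE_iff_measurable [of "box (a j) (b j)" lebesgue "\<lambda>x. x \<notin> box (a j) (b j)"] by (simp add: sets_completionI_sets)
  then show False
    using ne [OF j(1)] open_not_negligible [OF open_box, of "a j" "b j"] by (simp add: negligible_iff_emeasure0 sets_completionI_sets)
qed

text \<open>By compactness the weighted term has a positive minimum over the sphere. For small t the
  positive terms alone stay below c; beyond t0 both t^2 and t^4 are at most a constant times t^p, as
  p > 4, and a large \<lambda> outweighs them.\<close>

lemma octa_subset_sublevel:
  assumes pos: "\<And>u. u \<in> octa \<phi> n \<Longrightarrow> K.D u \<bullet> u > 0" and c: "c > 0"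
  obtains lam0 where "lam0 > 0" "\<And>lam u t. lam \<ge> lam0 \<Longrightarrow> u \<in> octa \<phi> n \<Longrightarrow> t > 0 \<Longrightarrow> \<Phi> lam (t *\<^sub>R u) \<le> c"
proof (cases "octa \<phi> n = {}")
  case True
  then show thesis using that [of 1] by simp
next
  case False
  have "continuous_on (octa \<phi> n) (\<lambda>u. K.D u \<bullet> u)"
    by (intro continuous_intros K.D_continuous)
  then obtain u0 where u0: "u0 \<in> octa \<phi> n" "\<And>u. u \<in> octa \<phi> n \<Longrightarrow> K.D u0 \<bullet> u0 \<le> K.D u \<bullet> u"
    using continuous_attains_inf [OF compact_octa False] by blast
  define \<gamma> where "\<gamma> = K.D u0 \<bullet> u0"
  have \<gamma>: "\<gamma> > 0" unfolding \<gamma>_def by (rule pos [OF u0(1)])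
  obtain C where C: "C > 0" "\<And>u. form u u \<le> C * (norm u)\<^sup>2" by (rule form_bounds, rule that, assumption+)
  define \<rho> where "\<rho> = (\<Sum>i\<le>n. norm (\<phi> i))"
  have \<rho>: "\<rho> \<ge> 0" unfolding \<rho>_def by (intro sum_nonneg) auto
  define M where "M = C * \<rho>\<^sup>2 + pot_const / pi * \<rho> ^ 4 + 1"
  have M: "M > 0" unfolding M_def using C \<rho> pot_const(1) by (intro add_nonneg_pos add_nonneg_nonneg mult_nonneg_nonneg) auto
  have bnd: "form u u \<le> M" "B u \<bullet> u \<le> M" if "u \<in> octa \<phi> n" for u
  proof -
    have n: "norm u \<le> \<rho>" unfolding \<rho>_def by (rule octa_norm [OF that])
    have "form u u \<le> C * \<rho>\<^sup>2" using C n by (intro order.trans [OF C(2)] mult_left_mono power_mono) auto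
    moreover have "pot_const / pi * \<rho> ^ 4 \<ge> 0" using pot_const(1) \<rho> by simp
    ultimately show "form u u \<le> M" unfolding M_def by linarith
    have "coul u u u u \<le> 4 * pot_const * norm u ^ 4"
      using coul_abs_le [of u u u u] by (simp add: power4_eq_xxxx mult.assoc)
    also have "\<dots> \<le> 4 * pot_const * \<rho> ^ 4" using n pot_const(1) by (intro mult_left_mono power_mono) auto
    finally have "B u \<bullet> u \<le> pot_const / pi * \<rho> ^ 4" by (simp add: B_inner field_simps)
    moreover have "C * \<rho>\<^sup>2 \<ge> 0" using C by simp
    ultimately show "B u \<bullet> u \<le> M" unfolding M_def by linarith
  qed
  define t0 where "t0 = min 1 (sqrt (c / M))"
  have t0: "0 < t0" "t0 \<le> 1" using c M by (auto simp: t0_def)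
  have t0c: "M * t0\<^sup>2 \<le> c"
  proof -
    have "t0\<^sup>2 \<le> (sqrt (c / M))\<^sup>2" using t0 by (intro power_mono) (auto simp: t0_def)
    also have "\<dots> = c / M" using c M by simp
    finally show ?thesis using M by (simp add: field_simps)
  qed
  \<comment> \<open>Makes lam0 \<gamma> t^p / p equal to the bound for the two positive terms beyond
    t0.\<close>
  define lam0 where "lam0 = p * (M * t0 powr (2 - p) + M * t0 powr (4 - p)) / \<gamma>"
  have lam0: "lam0 > 0" unfolding lam0_def using p4 M t0 \<gamma> by (intro divide_pos_pos mult_pos_pos add_pos_pos) auto
  show thesis
  proof (rule that [OF lam0])
    fix lam t :: real and u assume lam: "lam \<ge> lam0" and u: "u \<in> octa \<phi> n" and t: "t > 0"
    have le: "\<Phi> lam (t *\<^sub>R u) \<le> M * t\<^sup>2 / 2 + M * t ^ 4 / 4 - (lam * \<gamma>) * t powr p / p"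
    proof -
      have "form u u * t\<^sup>2 / 2 \<le> M * t\<^sup>2 / 2" "(B u \<bullet> u) * t ^ 4 / 4 \<le> M * t ^ 4 / 4"
        using bnd [OF u] t by (auto intro!: divide_right_mono mult_right_mono)
      moreover have "(lam * \<gamma>) * t powr p / p \<le> (lam * (K.D u \<bullet> u)) * t powr p / p"
        using u0(2) [OF u] lam lam0 p4 by (intro divide_right_mono mult_right_mono mult_left_mono) (auto simp: \<gamma>_def)
      moreover have "(N.D u \<bullet> u) * t powr q / q \<ge> 0"
        using N.D_self_nonneg [of u] q4 by simp
      ultimately show ?thesis unfolding \<Phi>_ray [OF t] by linarith
    qed
    show "\<Phi> lam (t *\<^sub>R u) \<le> c"
    proof (cases "t \<le> t0")
      case True
      have "t ^ 4 \<le> t\<^sup>2" using t True t0 by (intro power_decreasing) auto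
      then have 1: "M * t ^ 4 \<le> M * t\<^sup>2" using M by (intro mult_left_mono) auto
      have "t\<^sup>2 \<le> t0\<^sup>2" using t True by (intro power_mono) auto
      then have 2: "M * t\<^sup>2 \<le> M * t0\<^sup>2" using M by (intro mult_left_mono) auto
      have "(lam * \<gamma>) * t powr p / p \<ge> 0" "M * t\<^sup>2 \<ge> 0" using lam lam0 \<gamma> p4 M by auto
      with 1 2 t0c le show ?thesis by linarith
    next
      case False
      have pw: "t ^ k \<le> t0 powr (real k - p) * t powr p" if "real k \<le> p" for k
      proof -
        have "t powr (real k - p) \<le> t0 powr (real k - p)" using False t0 that by (intro powr_mono2') auto
        then have "t powr (real k - p) * t powr p \<le> t0 powr (real k - p) * t powr p" by (intro mult_right_mono) auto
        then show ?thesis using t by (simp add: powr_realpow flip: powr_add)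
      qed
      have "M * t\<^sup>2 \<le> M * (t0 powr (2 - p) * t powr p)" "M * t ^ 4 \<le> M * (t0 powr (4 - p) * t powr p)"
        using pw [of 2] pw [of 4] p4 M by (auto intro!: mult_left_mono)
      moreover have "M * t\<^sup>2 \<ge> 0" "M * t ^ 4 \<ge> 0" using M by auto
      ultimately have "M * t\<^sup>2 / 2 + M * t ^ 4 / 4 \<le> (M * t0 powr (2 - p) + M * t0 powr (4 - p)) * t powr p"
        by (simp add: distrib_right mult.assoc)
      also have "\<dots> = (lam0 * \<gamma>) * t powr p / p" unfolding lam0_def using \<gamma> p4 by simp
      also have "\<dots> \<le> (lam * \<gamma>) * t powr p / p"
        using lam \<gamma> p4 by (intro divide_right_mono mult_right_mono) auto
      finally show ?thesis using le c by linarith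
    qed
  qed
qed

text \<open>A sphere of dimension 2m is used because critical points are counted singly. The
  alternative of an infinite set is carried along since \<open>octa_le_card_critical\<close>
  presupposes finiteness.\<close>

lemma many_critical_points:
  assumes ob: "open {x. g x > 0}" "{x. g x > 0} \<noteq> {}"
  shows "\<exists>lam0>0. \<forall>lam\<ge>lam0. \<exists>S. (infinite S \<or> 2 * m < card S) \<and> (\<forall>w\<in>S. w \<noteq> 0 \<and> \<Phi>' lam w = 0 \<and> \<Phi> lam w > 0)"
proof -
  obtain a where a: "a > 0" "\<And>u. a * (norm u)\<^sup>2 \<le> form u u" by (rule form_bounds, rule that, assumption+)
  obtain r where r: "0 < r" "r \<le> 1"
    "\<And>u v. norm u \<le> r \<Longrightarrow> norm v \<le> r \<Longrightarrow> norm ((B u - N.D u) - (B v - N.D v)) \<le> a / 2 * norm (u - v)"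
    by (rule small_radius [OF a(1)], rule that)
  \<comment> \<open>The largest level at which \<open>nehari_Phi_ge\<close> confines Nehari points
    to the ball of radius r.\<close>
  define c where "c = a * r\<^sup>2 / 4"
  have c: "c > 0" using a r by (simp add: c_def)
  obtain x y where xy: "\<And>i. i \<le> 2 * m \<Longrightarrow> box (x i) (y i) \<subseteq> {x. g x > 0}" "\<And>i. i \<le> 2 * m \<Longrightarrow> box (x i) (y i) \<noteq> {}"
    "\<And>i j. i \<noteq> j \<Longrightarrow> box (x i) (y i) \<inter> box (x j) (y j) = {}"
    by (rule disjoint_boxes [OF ob, of "2 * m"], rule that)
  define \<phi> where "\<phi> i = emb (bump 1 (x i) (y i))" for i
  have pos: "K.D u \<bullet> u > 0" if "u \<in> octa \<phi> (2 * m)" for u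
    by (rule octa_bumps_pos [OF xy _]; (assumption | rule that [unfolded \<phi>_def]))
  obtain lam0 where lam0: "lam0 > 0" "\<And>lam u t. lam \<ge> lam0 \<Longrightarrow> u \<in> octa \<phi> (2 * m) \<Longrightarrow> t > 0 \<Longrightarrow> \<Phi> lam (t *\<^sub>R u) \<le> c"
    by (rule octa_subset_sublevel [OF pos c], assumption, rule that)
  have "\<exists>S. (infinite S \<or> 2 * m < card S) \<and> (\<forall>w\<in>S. w \<noteq> 0 \<and> \<Phi>' lam w = 0 \<and> \<Phi> lam w > 0)" if lam: "lam \<ge> lam0" for lam
  proof -
    have lp: "lam > 0" using lam lam0 by linarith
    interpret F: fibered_functional "\<Phi> lam" "\<Phi>' lam" "\<lambda>u. form u u" "\<lambda>u. B u \<bullet> u" "\<lambda>u. lam * (K.D u \<bullet> u)" "\<lambda>u. N.D u \<bullet> u"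
      p q a "lam * (3 * Ck) + 3 * Cn + 1"
      by (rule fibered [OF lp a])
    define S where "S = {w. w \<noteq> 0 \<and> \<Phi>' lam w = 0 \<and> \<Phi> lam w \<le> c}"
    have "2 * m < card S" if "finite S"
      unfolding S_def
    proof (rule F.octa_le_card_critical [OF r(1)])
      show "4 * c \<le> a * r\<^sup>2" by (simp add: c_def)
      show "octa \<phi> (2 * m) \<subseteq> F.sublevel c"
      proof
        fix u assume u: "u \<in> octa \<phi> (2 * m)"
        have "u \<noteq> 0" using pos [OF u] by auto
        then show "u \<in> F.sublevel c" unfolding F.sublevel_def using lam0(2) [OF lam u] by simp
      qed
      show "finite {w. w \<noteq> 0 \<and> \<Phi>' lam w = 0 \<and> \<Phi> lam w \<le> c}" using that by (simp add: S_def)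
    qed (rule palais_smale [OF lp a r(2) r(3)])
    moreover have "\<Phi> lam w > 0" if "w \<in> S" for w
      using that by (intro F.nehari_Phi_pos) (simp add: S_def F.nehari_def)
    ultimately show ?thesis by (intro exI [of _ S]) (auto simp: S_def)
  qed
  with lam0(1) show ?thesis by blast
qed

end

text \<open>Greedy choice: m chosen points and their negatives exclude at most 2m elements, so the
  set still offers a new one.\<close>

lemma choose_pairs:
  fixes S :: "'a::ab_group_add set"
  assumes S: "infinite S \<or> 2 * m \<le> card S"
  shows "\<exists>f. (\<forall>j\<in>{1..m}. f j \<in> S) \<and> (\<forall>i\<in>{1..m}. \<forall>j\<in>{1..m}. i \<noteq> j \<longrightarrow> f i \<noteq> f j \<and> f i \<noteq> - f j)"
  using S
proof (induction m)
  case (Suc m)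
  have "infinite S \<or> 2 * m \<le> card S" using Suc.prems by auto
  from Suc.IH [OF this] obtain f where f: "\<And>j. j \<in> {1..m} \<Longrightarrow> f j \<in> S"
    "\<And>i j. i \<in> {1..m} \<Longrightarrow> j \<in> {1..m} \<Longrightarrow> i \<noteq> j \<Longrightarrow> f i \<noteq> f j \<and> f i \<noteq> - f j"
    by blast
  let ?T = "f ` {1..m} \<union> (\<lambda>j. - f j) ` {1..m}"
  have "card ?T \<le> card (f ` {1..m}) + card ((\<lambda>j. - f j) ` {1..m})" by (rule card_Un_le)
  also have "\<dots> \<le> m + m" using card_image_le [of "{1..m}" f] card_image_le [of "{1..m}" "\<lambda>j. - f j"] by simp
  finally have T: "card ?T \<le> 2 * m" "finite ?T" by auto
  have "\<not> S \<subseteq> ?T"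
  proof
    assume sub: "S \<subseteq> ?T"
    then have "finite S" using T(2) by (rule finite_subset)
    moreover have "card S \<le> card ?T" using T(2) sub by (rule card_mono)
    ultimately show False using T(1) Suc.prems by auto
  qed
  then obtain w where w: "w \<in> S" "w \<notin> ?T" by blast
  have w1: "w \<noteq> f j" "w \<noteq> - f j" "f j \<noteq> - w" if "j \<in> {1..m}" for j
    using w(2) that by (auto simp: equation_minus_iff)
  show ?case
  proof (intro exI [of _ "f(Suc m := w)"] conjI ballI impI)
    fix j assume "j \<in> {1..Suc m}"
    then show "(f(Suc m := w)) j \<in> S" using f(1) w(1) by (cases "j = Suc m") auto
  next
    fix i j assume ij: "i \<in> {1..Suc m}" "j \<in> {1..Suc m}" "i \<noteq> j"
    have "i \<in> {1..m} \<or> i = Suc m" "j \<in> {1..m} \<or> j = Suc m" using ij by auto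
    then show "(f(Suc m := w)) i \<noteq> (f(Suc m := w)) j" "(f(Suc m := w)) i \<noteq> - (f(Suc m := w)) j"
      using f(2) [of i j] w1 [of i] w1 [of j] ij by auto
  qed
qed simp

lemma h1_eq_if_val_AE_eq: "(AE x in lebesgue. val u x = val v x) \<Longrightarrow> u = v"
proof -
  assume "AE x in lebesgue. val u x = val v x"
  then have "AE x in lebesgue. val (u - v) x = 0" using val_diff [of u v] by eventually_elim simp
  from h1_eq_0I [OF this] show "u = v" by simp
qed

theorem theorem4p1:
  fixes p q :: real and V g :: "real ^ 3 \<Rightarrow> real"
  assumes "4 < p" and "p < q" and "q \<le> 6"
    and "V \<in> borel_measurable lebesgue" and "\<And>x. V x > 0"
    and "V_norm_equivalent V"
    and "g \<in> Lp (6 / (6 - p))" and "\<And>x. g x \<ge> 0"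
    and "open {x. g x > 0}" and "{x. g x > 0} \<noteq> {}"
  shows "\<forall>m::nat. \<exists>lam_m>0. \<forall>lam\<ge>lam_m. \<exists>u :: nat \<Rightarrow> real ^ 3 \<Rightarrow> real.
    (\<forall>j\<in>{1..m}. weak_solution V g p q lam (u j) \<and>
                weak_solution V g p q lam (\<lambda>x. - u j x) \<and>
                energy V g p q lam (u j) > 0) \<and>
    (\<forall>i\<in>{1..m}. \<forall>j\<in>{1..m}. i \<noteq> j \<longrightarrow>
       \<not> (AE x in lebesgue. u i x = u j x) \<and> \<not> (AE x in lebesgue. u i x = - u j x))"
proof
  fix m :: nat
  obtain C where "tight_weight g p C"
    using assms by (auto intro: tight_weight_Lp [of g p])
  then interpret K: tight_weight g p C .
  interpret N: power_weight "\<lambda>_. 1" q 4097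
    using assms by (intro power_weight_one) auto
  interpret elliptic_equation V g p q C 4097
    using assms by unfold_locales auto
  obtain lam0 where lam0: "lam0 > 0" "\<And>lam. lam \<ge> lam0 \<Longrightarrow>
    \<exists>S. (infinite S \<or> 2 * m < card S) \<and> (\<forall>w\<in>S. w \<noteq> 0 \<and> \<Phi>' lam w = 0 \<and> \<Phi> lam w > 0)"
    using many_critical_points [OF assms(9,10), of m] by blast
  show "\<exists>lam_m>0. \<forall>lam\<ge>lam_m. \<exists>u :: nat \<Rightarrow> real ^ 3 \<Rightarrow> real.
    (\<forall>j\<in>{1..m}. weak_solution V g p q lam (u j) \<and>
                weak_solution V g p q lam (\<lambda>x. - u j x) \<and>
                energy V g p q lam (u j) > 0) \<and>
    (\<forall>i\<in>{1..m}. \<forall>j\<in>{1..m}. i \<noteq> j \<longrightarrow>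
       \<not> (AE x in lebesgue. u i x = u j x) \<and> \<not> (AE x in lebesgue. u i x = - u j x))"
  proof (intro exI [of _ lam0] conjI lam0(1) allI impI)
    fix lam assume "lam \<ge> lam0"
    then obtain S where S: "infinite S \<or> 2 * m < card S" "\<And>w. w \<in> S \<Longrightarrow> \<Phi>' lam w = 0" "\<And>w. w \<in> S \<Longrightarrow> \<Phi> lam w > 0"
      using lam0(2) by blast
    have "infinite S \<or> 2 * m \<le> card S" using S(1) by auto
    then obtain f where f: "\<And>j. j \<in> {1..m} \<Longrightarrow> f j \<in> S"
      "\<And>i j. i \<in> {1..m} \<Longrightarrow> j \<in> {1..m} \<Longrightarrow> i \<noteq> j \<Longrightarrow> f i \<noteq> f j" "\<And>i j. i \<in> {1..m} \<Longrightarrow> j \<in> {1..m} \<Longrightarrow> i \<noteq> j \<Longrightarrow> f i \<noteq> - f j"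
      using choose_pairs [of S m] by blast
    show "\<exists>u :: nat \<Rightarrow> real ^ 3 \<Rightarrow> real.
    (\<forall>j\<in>{1..m}. weak_solution V g p q lam (u j) \<and>
                weak_solution V g p q lam (\<lambda>x. - u j x) \<and>
                energy V g p q lam (u j) > 0) \<and>
    (\<forall>i\<in>{1..m}. \<forall>j\<in>{1..m}. i \<noteq> j \<longrightarrow>
       \<not> (AE x in lebesgue. u i x = u j x) \<and> \<not> (AE x in lebesgue. u i x = - u j x))"
    proof (intro exI [of _ "\<lambda>j. val (f j)"] conjI ballI impI)
      fix j assume j: "j \<in> {1..m}"
      have crit: "\<Phi>' lam (f j) = 0" by (rule S(2) [OF f(1) [OF j]])
      show "weak_solution V g p q lam (val (f j))"
        by (rule weak_solution_val [OF _ _ crit]) auto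
      show "weak_solution V g p q lam (\<lambda>x. - val (f j) x)"
      proof (rule weak_solution_val)
        show "AE x in lebesgue. - val (f j) x = val (- f j) x"
          using val_minus [of "f j"] by eventually_elim simp
        show "\<Phi>' lam (- f j) = 0" by (simp add: \<Phi>'_minus crit)
      qed measurable
      show "energy V g p q lam (val (f j)) > 0"
        using S(3) [OF f(1) [OF j]] energy_val [of "val (f j)" "f j" lam] by simp
    next
      fix i j assume ij: "i \<in> {1..m}" "j \<in> {1..m}" "i \<noteq> j"
      show "\<not> (AE x in lebesgue. val (f i) x = val (f j) x)"
        using f(2) [OF ij] h1_eq_if_val_AE_eq by blast
      show "\<not> (AE x in lebesgue. val (f i) x = - val (f j) x)"
      proof
        assume "AE x in lebesgue. val (f i) x = - val (f j) x"
        then have "AE x in lebesgue. val (f i) x = val (- f j) x"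
          using val_minus [of "f j"] by eventually_elim simp
        then show False using f(3) [OF ij] h1_eq_if_val_AE_eq by blast
      qed
    qed
  qed
qed

end
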